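(* Let $X_1,\dots,X_n$ be i.i.d. random vectors in $\mathbb{R}^p$ with mean $\mu$ and covariance matrix $\Sigma\ne0$, in the regime $n\to\infty$, $p=p_n$. Let $0<\delta\le1$, $q=2+\delta$, and assume $K_\delta,D_\delta<\infty$ (computed for $X_i-\mu$). Let $m=m_n\to\infty$ with $m=o(n)$ and assume $$\frac{\tilde K_0^2}{m}+\frac{\tilde K_\delta^q}{m^{q-1}}+\frac{\mathbb{E}((X_1-\mu)^T\Sigma (X_1-\mu))^{q/2}}{m^{\delta/2}f^q}+\frac{\tilde D_\delta^q}{m^\delta}\to0.$$ Let $L=\lfloor n/m\rfloor$, $B_j=\{l\in\mathbb Z:(j-1)m<l\le jm\}$ for $j=1,\dots,L$, $\bar X=n^{-1}\sum_{i=1}^nX_i$, $\bar X_B=|B|^{-1}\sum_{b\in B}X_b$, and $$\hat F(t)=\frac1L\sum_{j=1}^L\mathbf 1\{m|\bar X_{B_j}-\bar X|_2^2\le t(1-m/n)\}.$$ (i) Then $\sup_t|\hat F(t)-\mathbb{P}(n|\bar X-\mu|_2^2\le t)|\to0$ in probability. (ii) Let $A_1,\dots,A_J$ be i.i.d. uniformly distributed on $\{A\subset\{1,\dots,n\}:|A|=m\}$, independent of $(X_i)$, and $\check F(t)=\frac1J\sum_{j=1}^J\mathbf 1\{m|\bar X_{A_j}-\bar X|_2^2\le t(1-m/n)\}$. If $J=J_n\to\infty$, then $\sup_t|\check F(t)-\mathbb{P}(n|\bar X-\mu|_2^2\le t)|\to0$ in probability.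
   Context: $f_k=[\mathrm{tr}(\Sigma^k)]^{1/k}$, $f=f_2$. With $X=X_1-\mu$, $X'=X_2-\mu$: $K_\delta^{2+\delta}=\mathbb{E}|(X^TX-f_1)/f|^{2+\delta}$, $D_\delta^{2+\delta}=\mathbb{E}|X^TX'/f|^{2+\delta}$. $\tilde K_\delta=K_\delta+c_\delta$, $\tilde D_\delta=D_\delta+d_\delta$ with $c_\delta=(1+\delta)^{1/2}\|\xi^2-1\|_{2+\delta}$, $d_\delta=(1+\delta)^{1/2}\|\xi\|^2_{2+\delta}$, $\xi\sim N(0,1)$, $\|Z\|_q=(\mathbb{E}|Z|^q)^{1/q}$. *)

theory Defs
  imports "HOL-Probability.Probability"
begin

text \<open>Vectors in R^p are represented as functions nat => real; only coordinates k < p matter.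
  Random vectors take values in the measurable space vec_space p = PiM {..<p} (%_. borel).\<close>

definition vec_space :: "nat \<Rightarrow> (nat \<Rightarrow> real) measure" where
  "vec_space p = PiM {..<p} (\<lambda>_. borel)"

definition dotp :: "nat \<Rightarrow> (nat \<Rightarrow> real) \<Rightarrow> (nat \<Rightarrow> real) \<Rightarrow> real" where
  "dotp p x y = (\<Sum>k<p. x k * y k)"

definition sqnorm :: "nat \<Rightarrow> (nat \<Rightarrow> real) \<Rightarrow> real" where
  "sqnorm p x = dotp p x x"

definition mean_vec :: "'a measure \<Rightarrow> ('a \<Rightarrow> nat \<Rightarrow> real) \<Rightarrow> nat \<Rightarrow> real" where
  "mean_vec M X = (\<lambda>k. integral\<^sup>L M (\<lambda>\<omega>. X \<omega> k))"

definition cov_mat :: "'a measure \<Rightarrow> ('a \<Rightarrow> nat \<Rightarrow> real) \<Rightarrow> nat \<Rightarrow> nat \<Rightarrow> real" where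
  "cov_mat M X = (\<lambda>k l. integral\<^sup>L M
      (\<lambda>\<omega>. (X \<omega> k - mean_vec M X k) * (X \<omega> l - mean_vec M X l)))"

definition f1 :: "nat \<Rightarrow> (nat \<Rightarrow> nat \<Rightarrow> real) \<Rightarrow> real" where
  "f1 p S = (\<Sum>k<p. S k k)"

definition f2 :: "nat \<Rightarrow> (nat \<Rightarrow> nat \<Rightarrow> real) \<Rightarrow> real" where
  "f2 p S = sqrt (\<Sum>k<p. \<Sum>l<p. S k l * S l k)"

definition centered :: "'a measure \<Rightarrow> ('a \<Rightarrow> nat \<Rightarrow> real) \<Rightarrow> 'a \<Rightarrow> nat \<Rightarrow> real" where
  "centered M X = (\<lambda>\<omega> k. X \<omega> k - mean_vec M X k)"

definition K_integrand :: "'a measure \<Rightarrow> nat \<Rightarrow> ('a \<Rightarrow> nat \<Rightarrow> real) \<Rightarrow> real \<Rightarrow> 'a \<Rightarrow> real" where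
  "K_integrand M p X \<delta> = (\<lambda>\<omega>.
     \<bar>(sqnorm p (centered M X \<omega>) - f1 p (cov_mat M X)) / f2 p (cov_mat M X)\<bar> powr (2 + \<delta>))"

definition D_integrand :: "'a measure \<Rightarrow> nat \<Rightarrow> ('a \<Rightarrow> nat \<Rightarrow> real) \<Rightarrow> ('a \<Rightarrow> nat \<Rightarrow> real) \<Rightarrow> real \<Rightarrow> 'a \<Rightarrow> real" where
  "D_integrand M p X X' \<delta> = (\<lambda>\<omega>.
     \<bar>dotp p (centered M X \<omega>) (centered M X' \<omega>) / f2 p (cov_mat M X)\<bar> powr (2 + \<delta>))"

definition K_delta :: "'a measure \<Rightarrow> nat \<Rightarrow> ('a \<Rightarrow> nat \<Rightarrow> real) \<Rightarrow> real \<Rightarrow> real" where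
  "K_delta M p X \<delta> = (integral\<^sup>L M (K_integrand M p X \<delta>)) powr (1 / (2 + \<delta>))"

definition D_delta :: "'a measure \<Rightarrow> nat \<Rightarrow> ('a \<Rightarrow> nat \<Rightarrow> real) \<Rightarrow> ('a \<Rightarrow> nat \<Rightarrow> real) \<Rightarrow> real \<Rightarrow> real" where
  "D_delta M p X X' \<delta> = (integral\<^sup>L M (D_integrand M p X X' \<delta>)) powr (1 / (2 + \<delta>))"

definition gauss_Lq_norm :: "(real \<Rightarrow> real) \<Rightarrow> real \<Rightarrow> real" where
  "gauss_Lq_norm g q = (integral\<^sup>L lborel (\<lambda>x. \<bar>g x\<bar> powr q * std_normal_density x)) powr (1 / q)"

definition c_delta :: "real \<Rightarrow> real" where
  "c_delta \<delta> = sqrt (1 + \<delta>) * gauss_Lq_norm (\<lambda>x. x\<^sup>2 - 1) (2 + \<delta>)"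

definition d_delta :: "real \<Rightarrow> real" where
  "d_delta \<delta> = sqrt (1 + \<delta>) * (gauss_Lq_norm (\<lambda>x. x) (2 + \<delta>))\<^sup>2"

definition Kt_delta :: "'a measure \<Rightarrow> nat \<Rightarrow> ('a \<Rightarrow> nat \<Rightarrow> real) \<Rightarrow> real \<Rightarrow> real" where
  "Kt_delta M p X \<delta> = K_delta M p X \<delta> + c_delta \<delta>"

definition Dt_delta :: "'a measure \<Rightarrow> nat \<Rightarrow> ('a \<Rightarrow> nat \<Rightarrow> real) \<Rightarrow> ('a \<Rightarrow> nat \<Rightarrow> real) \<Rightarrow> real \<Rightarrow> real" where
  "Dt_delta M p X X' \<delta> = D_delta M p X X' \<delta> + d_delta \<delta>"

definition quad_moment :: "'a measure \<Rightarrow> nat \<Rightarrow> ('a \<Rightarrow> nat \<Rightarrow> real) \<Rightarrow> real \<Rightarrow> real" where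
  "quad_moment M p X q = integral\<^sup>L M (\<lambda>\<omega>.
     (\<Sum>k<p. \<Sum>l<p. centered M X \<omega> k * cov_mat M X k l * centered M X \<omega> l) powr (q / 2))"

definition set_mean :: "nat set \<Rightarrow> (nat \<Rightarrow> nat \<Rightarrow> real) \<Rightarrow> nat \<Rightarrow> real" where
  "set_mean B x = (\<lambda>k. (\<Sum>b\<in>B. x b k) / real (card B))"

definition block :: "nat \<Rightarrow> nat \<Rightarrow> nat set" where
  "block m j = {(j - 1) * m <.. j * m}"

definition Fhat :: "nat \<Rightarrow> nat \<Rightarrow> nat \<Rightarrow> (nat \<Rightarrow> nat \<Rightarrow> real) \<Rightarrow> real \<Rightarrow> real" where
  "Fhat n p m x t = (let L = n div m in
     (1 / real L) * (\<Sum>j\<in>{1..L}.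
        (if real m * sqnorm p (\<lambda>k. set_mean (block m j) x k - set_mean {1..n} x k)
             \<le> t * (1 - real m / real n) then 1 else 0)))"

definition Fcheck :: "nat \<Rightarrow> nat \<Rightarrow> nat \<Rightarrow> nat \<Rightarrow> (nat \<Rightarrow> nat set) \<Rightarrow> (nat \<Rightarrow> nat \<Rightarrow> real) \<Rightarrow> real \<Rightarrow> real" where
  "Fcheck n p m J A x t =
     (1 / real J) * (\<Sum>j\<in>{1..J}.
        (if real m * sqnorm p (\<lambda>k. set_mean (A j) x k - set_mean {1..n} x k)
             \<le> t * (1 - real m / real n) then 1 else 0))"

definition target_cdf :: "'a measure \<Rightarrow> nat \<Rightarrow> nat \<Rightarrow> (nat \<Rightarrow> 'a \<Rightarrow> nat \<Rightarrow> real) \<Rightarrow> (nat \<Rightarrow> real) \<Rightarrow> real \<Rightarrow> real" where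
  "target_cdf M n p X mu t =
     prob_space.prob M {\<omega> \<in> space M.
        real n * sqnorm p (\<lambda>k. set_mean {1..n} (\<lambda>i. X i \<omega>) k - mu k) \<le> t}"

definition tendsto_in_prob_zero :: "(nat \<Rightarrow> 'a measure) \<Rightarrow> (nat \<Rightarrow> 'a \<Rightarrow> real) \<Rightarrow> bool" where
  "tendsto_in_prob_zero M Z \<longleftrightarrow>
     (\<forall>\<epsilon>>0. (\<lambda>n. measure (M n) {\<omega> \<in> space (M n). \<bar>Z n \<omega>\<bar> > \<epsilon>}) \<longlonglongrightarrow> 0)"

end

(*
  Write f1 and f2 for the trace and the Frobenius norm of the covariance matrix S, and R_B for the statistic
  (|sum of the centred X_b, b in B|^2 / card B - f1) / f2 of a block B.

  Replacing the summands one at a time by Gaussian vectors (Lindeberg's method, with smooth test functions)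
  shows that R_B has nearly the same law as V = (|Y|^2 - f1) / f2, with Y Gaussian with covariance S, as soon as
  card B >= m. This covers the blocks of size m as well as the full sample of size n.

  The distribution function of V is equicontinuous uniformly in p and S: for an independent copy V', a rotation
  turns V - V' into a multiple of an inner product of two independent Gaussian vectors, which given the first
  vector is a centred normal variable; its variance is a convex combination of squared standard normals and is
  therefore rarely small.

  The statistics of blocks with small overlap are nearly uncorrelated, so averages of a test function over the
  blocks concentrate at their mean; centring at the sample mean instead of the true mean is negligible since
  m / n tends to 0. The mean overlap of two random subsets is m^2 / n, and consecutive blocks are disjoint.
  Convergence at each point is uniform because the limiting distribution functions are monotone, tight and
  equicontinuous.
*)

theory Submission
  imports Defs
begin

text \<open>All error bounds must be free of the dimension and of the ratio f1 / f2, which may grow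
  without bound. This is why the trace is subtracted exactly everywhere: a block reduced by an
  overlap is recentred at its own trace, and the factor 1 - m / n makes the trace cancel when the
  sample mean replaces the true mean. No eigenvalues occur: the Gaussian vector is the image of a
  standard one under an arbitrary factor of S, and the rows of the factor supply weights with sum
  f2^2 that play the part of squared eigenvalues. Only moments of order q in (2, 3] are at hand, so
  the Taylor remainder is interpolated between a square and a cube. In each replacement the product
  of the inner product and the centred squared norm is split by a weighted inequality with a free
  parameter tau. The squared inner products, summed over all replacements, stay of constant order,
  so an error of order tau survives as n grows; it is removed by letting tau tend to 0
  afterwards.\<close>

section \<open>Elementary power inequalities\<close>

text \<open>The tangent line at 1 of a concave power, from weighted AM-GM with second factor 1.
  Integrated, it serves as Jensen's inequality in \<open>abs_moment_walk\<close>.\<close>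

lemma powr_le_affine:
  fixes y d :: real
  assumes "0 \<le> y" "0 \<le> d" "d \<le> 1"
  shows "y powr d \<le> 1 + d * (y - 1)"
proof (cases "y = 0")
  case False
  have "y powr d * 1 powr (1 - d) \<le> d * y + (1 - d) * 1"
    using assms False by (intro Youngs_inequality_0) auto
  then show ?thesis by (simp add: algebra_simps)
qed (use assms in auto)

text \<open>The linear term is kept exactly because it integrates to zero when \<open>b\<close> is
  centred and independent of \<open>a\<close>; what remains costs a variance and a q-th moment of
  \<open>b\<close>. This drives the induction for moments of sums.\<close>

lemma abs_add_powr_le:
  fixes a b q :: real
  assumes q: "2 \<le> q" "q \<le> 3"
  shows "\<bar>a + b\<bar> powr q \<le> \<bar>a\<bar> powr q + q * (sgn a * \<bar>a\<bar> powr (q - 1)) * b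
           + 16 * (\<bar>a\<bar> powr (q - 2) * b\<^sup>2 + \<bar>b\<bar> powr q)"
proof (cases "a = 0")
  case True
  then show ?thesis by simp
next
  case False
  define x where "x = b / a"
  have b: "b = a * x" using False by (simp add: x_def)
  \<comment> \<open>By homogeneity only \<open>a = 1\<close> has to be treated.\<close>
  have key: "\<bar>1 + x\<bar> powr q \<le> 1 + q * x + 16 * (x\<^sup>2 + \<bar>x\<bar> powr q)"
  proof (cases "\<bar>x\<bar> \<le> 1")
    case True
    \<comment> \<open>Splitting off the exponent 2 leaves an exponent in [0, 1], to which the
      tangent line applies; the product is then a cubic polynomial with exact linear coefficient
      \<open>q\<close>.\<close>
    have "\<bar>1 + x\<bar> powr q = (1 + x) powr (2 + (q - 2))" using True by simp
    also have "\<dots> = (1 + x) powr 2 * (1 + x) powr (q - 2)" by (rule powr_add)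
    also have "\<dots> \<le> (1 + x)\<^sup>2 * (1 + (q - 2) * x)"
    proof (rule mult_mono)
      show "(1 + x) powr 2 \<le> (1 + x)\<^sup>2" using True by (cases "x = -1") (auto simp: powr_numeral)
      show "(1 + x) powr (q - 2) \<le> 1 + (q - 2) * x" using powr_le_affine[of "1 + x" "q - 2"] True q by auto
    qed auto
    also have "\<dots> = 1 + q * x + (1 + 2 * (q - 2)) * x\<^sup>2 + (q - 2) * x * x\<^sup>2"
      by (simp add: algebra_simps power2_eq_square)
    also have "(1 + 2 * (q - 2)) * x\<^sup>2 \<le> 3 * x\<^sup>2" using q by (intro mult_right_mono) auto
    also have "(q - 2) * x * x\<^sup>2 \<le> 1 * x\<^sup>2"
    proof (intro mult_right_mono)
      have "(q - 2) * x \<le> (q - 2) * 1" using True q by (intro mult_left_mono) auto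
      also have "\<dots> \<le> 1" using q by simp
      finally show "(q - 2) * x \<le> 1" .
    qed auto
    finally have "\<bar>1 + x\<bar> powr q \<le> 1 + q * x + 4 * x\<^sup>2" by simp
    also have "4 * x\<^sup>2 \<le> 16 * (x\<^sup>2 + \<bar>x\<bar> powr q)" by (simp add: distrib_left add_increasing2)
    finally show ?thesis by simp
  next
    case False
    \<comment> \<open>For large \<open>x\<close> the power term dominates. The linear term may be
      negative and is absorbed by the quadratic one.\<close>
    have "\<bar>1 + x\<bar> powr q \<le> (2 * \<bar>x\<bar>) powr q" using False q by (intro powr_mono2) auto
    also have "\<dots> = 2 powr q * \<bar>x\<bar> powr q" by (simp add: powr_mult)
    also have "\<dots> \<le> 2 powr 3 * \<bar>x\<bar> powr q" using q by (intro mult_right_mono powr_mono) auto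
    finally have 1: "\<bar>1 + x\<bar> powr q \<le> 8 * \<bar>x\<bar> powr q" by simp
    have "q * \<bar>x\<bar> \<le> 3 * \<bar>x\<bar>" using q by (intro mult_right_mono) auto
    also have "\<bar>x\<bar> * 1 \<le> \<bar>x\<bar> * \<bar>x\<bar>" using False by (intro mult_left_mono) auto
    then have "3 * \<bar>x\<bar> \<le> 3 * x\<^sup>2" by (simp add: power2_eq_square flip: abs_mult)
    finally have "- (q * x) \<le> 3 * x\<^sup>2" using q by (smt (verit) mult_minus_right mult_left_mono)
    moreover have gen: "P \<le> 8 * Q \<Longrightarrow> - r \<le> 3 * s \<Longrightarrow> 0 \<le> Q \<Longrightarrow> 0 \<le> s \<Longrightarrow> P \<le> 1 + r + 16 * (s + Q)"
      for P Q r s :: real by (simp add: distrib_left)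
    ultimately show ?thesis by (intro gen[OF 1]) auto
  qed
  have p1: "\<bar>a\<bar> powr q = \<bar>a\<bar> * \<bar>a\<bar> powr (q - 1)" using False powr_add[of "\<bar>a\<bar>" 1 "q - 1"] by simp
  have p2: "\<bar>a\<bar> powr q = a\<^sup>2 * \<bar>a\<bar> powr (q - 2)" using False powr_add[of "\<bar>a\<bar>" 2 "q - 2"] by (simp add: powr_numeral)
  have "\<bar>a + b\<bar> powr q = \<bar>a\<bar> powr q * \<bar>1 + x\<bar> powr q"
    by (simp add: b powr_mult[symmetric] abs_mult[symmetric] algebra_simps)
  also have "\<dots> \<le> \<bar>a\<bar> powr q * (1 + q * x + 16 * (x\<^sup>2 + \<bar>x\<bar> powr q))"
    using key by (intro mult_left_mono) auto
  also have "\<dots> = \<bar>a\<bar> powr q + q * (\<bar>a\<bar> powr q * x) + 16 * (\<bar>a\<bar> powr q * x\<^sup>2 + \<bar>a\<bar> powr q * \<bar>x\<bar> powr q)"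
    by (simp add: algebra_simps)
  also have "\<bar>a\<bar> powr q * x = sgn a * \<bar>a\<bar> powr (q - 1) * b"
    unfolding p1 b by (simp add: mult.commute mult.left_commute mult.assoc flip: mult_sgn_abs)
       (metis mult.commute mult.left_commute mult_sgn_abs sgn_mult_abs abs_sgn)
  also have "\<bar>a\<bar> powr q * x\<^sup>2 = \<bar>a\<bar> powr (q - 2) * b\<^sup>2"
    unfolding p2 b by (simp add: power_mult_distrib mult_ac)
  also have "\<bar>a\<bar> powr q * \<bar>x\<bar> powr q = \<bar>b\<bar> powr q"
    by (simp add: b powr_mult[symmetric] abs_mult)
  finally show ?thesis by (simp add: mult.assoc)
qed

lemma abs_add_powr_le_8:
  fixes a b q :: real
  assumes q: "0 \<le> q" "q \<le> 3"
  shows "\<bar>a + b\<bar> powr q \<le> 8 * (\<bar>a\<bar> powr q + \<bar>b\<bar> powr q)"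
proof -
  have "\<bar>a + b\<bar> powr q \<le> (2 * max \<bar>a\<bar> \<bar>b\<bar>) powr q" using q by (intro powr_mono2) auto
  also have "\<dots> = 2 powr q * max \<bar>a\<bar> \<bar>b\<bar> powr q" by (simp add: powr_mult)
  also have "\<dots> \<le> 2 powr 3 * max \<bar>a\<bar> \<bar>b\<bar> powr q" using q by (intro mult_right_mono powr_mono) auto
  also have "\<dots> \<le> 8 * (\<bar>a\<bar> powr q + \<bar>b\<bar> powr q)" by (auto simp: max_def)
  finally show ?thesis .
qed

text \<open>A second order Taylor remainder is bounded by a square (bounded second derivative) and
  by a cube (Lipschitz second derivative). The smaller of the two is below every power in between,
  so a q-th moment suffices.\<close>

lemma min_square_cube_le_powr:
  fixes u q :: real
  assumes "2 \<le> q" "q \<le> 3"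
  shows "min (u\<^sup>2) (\<bar>u\<bar> ^ 3) \<le> \<bar>u\<bar> powr q"
proof (cases "u = 0")
  case False
  show ?thesis
  proof (cases "\<bar>u\<bar> \<le> 1")
    case True
    have "\<bar>u\<bar> powr 3 \<le> \<bar>u\<bar> powr q" using assms True by (intro powr_mono') auto
    then show ?thesis using False by (simp add: powr_numeral min.coboundedI2)
  next
    case F: False
    have "\<bar>u\<bar> powr 2 \<le> \<bar>u\<bar> powr q" using assms F by (intro powr_mono) auto
    then show ?thesis using False by (simp add: powr_numeral min.coboundedI1)
  qed
qed auto

section \<open>Smooth test functions\<close>

text \<open>The derivatives are carried as explicit functions. A Lipschitz second derivative is
  asked for instead of a third derivative because the step function built below has jumps in the
  third. The range [0, 1] makes centred values bounded by 1 in covariances.\<close>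

definition test_fun :: "real \<Rightarrow> (real \<Rightarrow> real) \<Rightarrow> (real \<Rightarrow> real) \<Rightarrow> (real \<Rightarrow> real) \<Rightarrow> bool" where
  "test_fun C \<phi> \<phi>1 \<phi>2 \<longleftrightarrow> 0 \<le> C \<and>
     (\<forall>x. 0 \<le> \<phi> x \<and> \<phi> x \<le> 1 \<and> \<bar>\<phi>1 x\<bar> \<le> C \<and> \<bar>\<phi>2 x\<bar> \<le> C
        \<and> (\<phi> has_real_derivative \<phi>1 x) (at x) \<and> (\<phi>1 has_real_derivative \<phi>2 x) (at x)) \<and>
     (\<forall>x y. \<bar>\<phi>2 x - \<phi>2 y\<bar> \<le> C * \<bar>x - y\<bar>)"

lemma deriv_bound_imp_Lipschitz:
  fixes f f' :: "real \<Rightarrow> real"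
  assumes "\<And>x. (f has_real_derivative f' x) (at x)" "\<And>x. \<bar>f' x\<bar> \<le> C"
  shows "\<bar>f x - f y\<bar> \<le> C * \<bar>x - y\<bar>"
  using field_differentiable_bound[of UNIV f f' C x y] assms by simp

lemma test_fun_Lipschitz:
  assumes "test_fun C \<phi> \<phi>1 \<phi>2"
  shows "\<bar>\<phi> x - \<phi> y\<bar> \<le> C * \<bar>x - y\<bar>" "\<bar>\<phi>1 x - \<phi>1 y\<bar> \<le> C * \<bar>x - y\<bar>"
  using assms unfolding test_fun_def
  by (intro deriv_bound_imp_Lipschitz[of _ \<phi>1] deriv_bound_imp_Lipschitz[of _ \<phi>2]; blast)+

lemma test_fun_Taylor2:
  assumes t: "test_fun C \<phi> \<phi>1 \<phi>2" and q: "2 \<le> q" "q \<le> 3"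
  shows "\<bar>\<phi> (x + a) - \<phi> x - \<phi>1 x * a - \<phi>2 x * a\<^sup>2 / 2\<bar> \<le> C * \<bar>a\<bar> powr q"
    and "\<bar>\<phi> (x + a) - \<phi> x - \<phi>1 x * a\<bar> \<le> C * a\<^sup>2"
proof -
  have C: "0 \<le> C" using t by (simp add: test_fun_def)
  \<comment> \<open>Lagrange form of the remainder; the case distinction lets the increment have
    either sign.\<close>
  have "\<exists>\<theta>. \<bar>\<theta> - x\<bar> \<le> \<bar>a\<bar> \<and> \<phi> (x + a) = \<phi> x + \<phi>1 x * a + \<phi>2 \<theta> * a\<^sup>2 / 2"
  proof (cases "a = 0")
    case False
    define D where "D = (\<lambda>m::nat. if m = 0 then \<phi> else if m = 1 then \<phi>1 else \<phi>2)"
    have "\<exists>\<theta>. (if x + a < x then x + a < \<theta> \<and> \<theta> < x else x < \<theta> \<and> \<theta> < x + a) \<and>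
         \<phi> (x + a) = (\<Sum>m<2. D m x / fact m * (x + a - x) ^ m) + D 2 \<theta> / fact 2 * (x + a - x) ^ 2"
    proof (rule Taylor[where a = "min x (x + a)" and b = "max x (x + a)"])
      show "\<forall>m t. m < 2 \<and> min x (x + a) \<le> t \<and> t \<le> max x (x + a) \<longrightarrow> (D m has_real_derivative D (Suc m) t) (at t)"
        using t by (auto simp: D_def test_fun_def less_2_cases_iff)
    qed (use False in \<open>auto simp: D_def\<close>)
    then obtain \<theta> where "(if x + a < x then x + a < \<theta> \<and> \<theta> < x else x < \<theta> \<and> \<theta> < x + a)"
      "\<phi> (x + a) = (\<Sum>m<2. D m x / fact m * (x + a - x) ^ m) + D 2 \<theta> / fact 2 * (x + a - x) ^ 2" by blast
    then show ?thesis by (intro exI[of _ \<theta>]) (auto simp: D_def numeral_2_eq_2 split: if_splits)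
  qed auto
  then obtain \<theta> where \<theta>: "\<bar>\<theta> - x\<bar> \<le> \<bar>a\<bar>" "\<phi> (x + a) = \<phi> x + \<phi>1 x * a + \<phi>2 \<theta> * a\<^sup>2 / 2" by blast
  have b: "\<bar>\<phi>2 \<theta>\<bar> \<le> C" "\<bar>\<phi>2 x\<bar> \<le> C" using t by (auto simp: test_fun_def)
  have "\<bar>\<phi>2 \<theta>\<bar> * a\<^sup>2 \<le> C * a\<^sup>2" using b by (intro mult_right_mono) auto
  moreover have "0 \<le> C * a\<^sup>2" using C by simp
  ultimately show "\<bar>\<phi> (x + a) - \<phi> x - \<phi>1 x * a\<bar> \<le> C * a\<^sup>2"
    using \<theta>(2) by (simp add: abs_mult)
  have e: "\<phi> (x + a) - \<phi> x - \<phi>1 x * a - \<phi>2 x * a\<^sup>2 / 2 = (\<phi>2 \<theta> - \<phi>2 x) * a\<^sup>2 / 2"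
    using \<theta>(2) by (simp add: algebra_simps diff_divide_distrib)
  \<comment> \<open>The same difference is estimated twice, by boundedness here and by the Lipschitz
    property below; the minimum of both is interpolated.\<close>
  have "\<bar>\<phi>2 \<theta> - \<phi>2 x\<bar> \<le> 2 * C" using b by linarith
  then have 1: "\<bar>\<phi>2 \<theta> - \<phi>2 x\<bar> * a\<^sup>2 / 2 \<le> C * a\<^sup>2"
    using mult_right_mono[of "\<bar>\<phi>2 \<theta> - \<phi>2 x\<bar>" "2 * C" "a\<^sup>2"] by simp
  have "\<bar>\<phi>2 \<theta> - \<phi>2 x\<bar> \<le> C * \<bar>\<theta> - x\<bar>" using t by (auto simp: test_fun_def)
  also have "\<dots> \<le> C * \<bar>a\<bar>" using \<theta> C by (intro mult_left_mono) auto
  finally have "\<bar>\<phi>2 \<theta> - \<phi>2 x\<bar> * a\<^sup>2 \<le> C * \<bar>a\<bar> * a\<^sup>2" by (intro mult_right_mono) auto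
  also have "C * \<bar>a\<bar> * a\<^sup>2 = C * \<bar>a\<bar> ^ 3" by (simp add: power3_eq_cube power2_eq_square flip: abs_mult)
  finally have "\<bar>\<phi>2 \<theta> - \<phi>2 x\<bar> * a\<^sup>2 / 2 \<le> C * \<bar>a\<bar> ^ 3"
    using C by (smt (verit) zero_le_mult_iff zero_le_power abs_ge_zero field_sum_of_halves)
  with 1 have "\<bar>\<phi>2 \<theta> - \<phi>2 x\<bar> * a\<^sup>2 / 2 \<le> C * min (a\<^sup>2) (\<bar>a\<bar> ^ 3)" by (simp add: min_def)
  also have "\<dots> \<le> C * \<bar>a\<bar> powr q" using min_square_cube_le_powr[OF q] C by (intro mult_left_mono) auto
  finally show "\<bar>\<phi> (x + a) - \<phi> x - \<phi>1 x * a - \<phi>2 x * a\<^sup>2 / 2\<bar> \<le> C * \<bar>a\<bar> powr q"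
    unfolding e by (simp add: abs_mult)
qed

text \<open>In a replacement step \<open>a\<close> is the scaled inner product of the new vector
  with the rest and \<open>b\<close> its centred squared norm. The square of \<open>b\<close> is
  already negligible after summation, so only \<open>a\<close> is expanded to second order.\<close>

lemma test_fun_Taylor:
  assumes t: "test_fun C \<phi> \<phi>1 \<phi>2" and q: "2 \<le> q" "q \<le> 3"
  shows "\<bar>\<phi> (x + a + b) - \<phi> x - \<phi>1 x * (a + b) - \<phi>2 x * a\<^sup>2 / 2\<bar>
           \<le> C * (\<bar>a\<bar> powr q + b\<^sup>2 + \<bar>a * b\<bar>)"
proof -
  \<comment> \<open>Second order in \<open>a\<close> at \<open>x\<close>, first order in
    \<open>b\<close> at \<open>x + a\<close>, and a correction that moves the slope from
    \<open>x + a\<close> back to \<open>x\<close>.\<close>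
  let ?P = "\<phi> (x + a) - \<phi> x - \<phi>1 x * a - \<phi>2 x * a\<^sup>2 / 2"
  let ?Q = "\<phi> (x + a + b) - \<phi> (x + a) - \<phi>1 (x + a) * b" and ?R = "(\<phi>1 (x + a) - \<phi>1 x) * b"
  have "\<bar>?R\<bar> \<le> C * \<bar>a\<bar> * \<bar>b\<bar>"
    unfolding abs_mult using test_fun_Lipschitz(2)[OF t, of "x + a" x] by (intro mult_right_mono) auto
  also have "\<dots> = C * \<bar>a * b\<bar>" by (simp add: abs_mult)
  finally have "\<bar>?P + ?Q + ?R\<bar> \<le> C * \<bar>a\<bar> powr q + C * b\<^sup>2 + C * \<bar>a * b\<bar>"
    using test_fun_Taylor2(1)[OF t q, of x a] test_fun_Taylor2(2)[OF t q, of "x + a" b] by linarith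
  moreover have "\<phi> (x + a + b) - \<phi> x - \<phi>1 x * (a + b) - \<phi>2 x * a\<^sup>2 / 2 = ?P + ?Q + ?R"
    by (simp add: algebra_simps)
  ultimately show ?thesis by (simp add: distrib_left)
qed

lemma test_fun_affine:
  assumes "test_fun C \<phi> \<phi>1 \<phi>2" "0 < h"
  shows "\<exists>C'. test_fun C' (\<lambda>x. \<phi> ((x - u) / h)) (\<lambda>x. \<phi>1 ((x - u) / h) / h) (\<lambda>x. \<phi>2 ((x - u) / h) / h / h)"
proof -
  have C: "0 \<le> C" and b: "\<And>x. \<bar>\<phi>1 x\<bar> \<le> C" "\<And>x. \<bar>\<phi>2 x\<bar> \<le> C"
    and d: "\<And>x. (\<phi> has_real_derivative \<phi>1 x) (at x)" "\<And>x. (\<phi>1 has_real_derivative \<phi>2 x) (at x)"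
    and l: "\<And>x y. \<bar>\<phi>2 x - \<phi>2 y\<bar> \<le> C * \<bar>x - y\<bar>"
    using assms by (auto simp: test_fun_def)
  let ?C = "C / h + C / h / h + C / h / h / h"
  have "test_fun ?C (\<lambda>x. \<phi> ((x - u) / h)) (\<lambda>x. \<phi>1 ((x - u) / h) / h) (\<lambda>x. \<phi>2 ((x - u) / h) / h / h)"
    unfolding test_fun_def
  proof (intro conjI allI)
    fix x y
    have p: "0 \<le> C / h" "0 \<le> C / h / h" "0 \<le> C / h / h / h" using C assms by auto
    then show "0 \<le> ?C" by linarith
    show "0 \<le> \<phi> ((x - u) / h)" "\<phi> ((x - u) / h) \<le> 1" using assms by (auto simp: test_fun_def)
    have "\<bar>\<phi>1 ((x - u) / h) / h\<bar> \<le> C / h" using b assms by (simp add: divide_right_mono)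
    then show "\<bar>\<phi>1 ((x - u) / h) / h\<bar> \<le> ?C" using p by linarith
    have "\<bar>\<phi>2 ((x - u) / h) / h / h\<bar> \<le> C / h / h" using b assms by (simp add: divide_right_mono)
    then show "\<bar>\<phi>2 ((x - u) / h) / h / h\<bar> \<le> ?C" using p by linarith
    show "((\<lambda>x. \<phi> ((x - u) / h)) has_real_derivative \<phi>1 ((x - u) / h) / h) (at x)"
      using assms by (auto intro!: DERIV_chain'[OF _ d(1), THEN DERIV_cong] derivative_eq_intros)
    show "((\<lambda>x. \<phi>1 ((x - u) / h) / h) has_real_derivative \<phi>2 ((x - u) / h) / h / h) (at x)"
      using assms by (auto intro!: DERIV_cdivide DERIV_chain'[OF _ d(2), THEN DERIV_cong] derivative_eq_intros)
    have "\<bar>\<phi>2 ((x - u) / h) / h / h - \<phi>2 ((y - u) / h) / h / h\<bar> = \<bar>\<phi>2 ((x - u) / h) - \<phi>2 ((y - u) / h)\<bar> / h / h"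
      using assms by (simp add: diff_divide_distrib[symmetric])
    also have "\<dots> \<le> C * \<bar>(x - u) / h - (y - u) / h\<bar> / h / h" using l assms by (intro divide_right_mono) auto
    also have "(x - u) / h - (y - u) / h = (x - y) / h" by (simp add: diff_divide_distrib)
    also have "C * \<bar>(x - y) / h\<bar> / h / h = C / h / h / h * \<bar>x - y\<bar>" using assms by simp
    also have "\<dots> \<le> ?C * \<bar>x - y\<bar>" using p by (intro mult_right_mono) auto
    finally show "\<bar>\<phi>2 ((x - u) / h) / h / h - \<phi>2 ((y - u) / h) / h / h\<bar> \<le> ?C * \<bar>x - y\<bar>" .
  qed
  then show ?thesis by blast
qed

text \<open>Gluing constants to both ends keeps differentiability when the derivative vanishes
  there. Applied to a function and again to its derivative it yields two derivatives.\<close>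

lemma has_real_derivative_clamp:
  fixes f f' :: "real \<Rightarrow> real"
  assumes f: "\<And>x. (f has_real_derivative f' x) (at x)" and z: "f' a = 0" "f' b = 0" and ab: "a < b"
  shows "((\<lambda>x. f (max a (min b x))) has_real_derivative f' (max a (min b x))) (at x)"
proof -
  let ?g = "\<lambda>x. f (max a (min b x))"
  \<comment> \<open>At an end point the clamped difference quotient is either 0 or the original one,
    and the original one tends to 0.\<close>
  have flat: "(?g has_real_derivative 0) (at c)" if c: "f' c = 0" "c = a \<or> c = b" for c
  proof -
    have 1: "(\<lambda>h. (f (c + h) - f c) / h) \<midarrow>0\<rightarrow> 0" using f[of c] c by (simp add: DERIV_def)
    have 2: "\<forall>\<^sub>F h in at 0. \<bar>(?g (c + h) - ?g c) / h\<bar> \<le> \<bar>(f (c + h) - f c) / h\<bar>"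
      unfolding eventually_at
      by (rule exI[of _ "b - a"]) (use ab c in \<open>auto simp: dist_real_def max_def min_def divide_le_0_iff split: if_splits\<close>)
    have "(\<lambda>h. (?g (c + h) - ?g c) / h) \<midarrow>0\<rightarrow> 0"
      by (rule Lim_null_comparison[OF 2[folded real_norm_def] tendsto_norm_zero[OF 1]])
    then show ?thesis by (simp add: DERIV_def)
  qed
  consider "x < a" | "b < x" | "x = a" | "x = b" | "a < x" "x < b" by linarith
  then show ?thesis
  proof cases
    case 1
    have "((\<lambda>x. f a) has_real_derivative 0) (at x)" by simp
    then have "(?g has_real_derivative 0) (at x)"
      by (rule has_field_derivative_transform_within_open[of _ _ _ "{..<a}"]) (use 1 ab in auto)
    then show ?thesis using 1 ab z by (simp add: max_def min_def)
  next
    case 2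
    have "((\<lambda>x. f b) has_real_derivative 0) (at x)" by simp
    then have "(?g has_real_derivative 0) (at x)"
      by (rule has_field_derivative_transform_within_open[of _ _ _ "{b<..}"]) (use 2 ab in auto)
    then show ?thesis using 2 ab z by (simp add: max_def min_def)
  next
    case 5
    have "(?g has_real_derivative f' x) (at x)"
      by (rule has_field_derivative_transform_within_open[OF f[of x], of "{a<..<b}"]) (use 5 in auto)
    then show ?thesis using 5 by (simp add: max_def min_def)
  qed (use flat[of a] flat[of b] z ab in \<open>auto simp: max_def min_def\<close>)
qed

lemma test_fun_unit_step:
  "\<exists>C \<phi> \<phi>1 \<phi>2. test_fun C \<phi> \<phi>1 \<phi>2 \<and> (\<forall>x\<le>0. \<phi> x = 1) \<and> (\<forall>x\<ge>pi. \<phi> x = 0)"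
proof -
  define c where "c = (\<lambda>x::real. max 0 (min pi x))"
  have c: "0 \<le> c x" "c x \<le> pi" for x by (auto simp: c_def)
  \<comment> \<open>On \<open>[0, pi]\<close> this is one minus the normalised integral of the
    squared sine. The squared sine and its derivative both vanish at 0 and \<open>pi\<close>, so
    clamping is harmless twice.\<close>
  define \<phi> where "\<phi> = (\<lambda>x. 1 - (c x - sin (c x) * cos (c x)) / pi)"
  define \<phi>1 where "\<phi>1 = (\<lambda>x. - (2 / pi) * (sin (c x))\<^sup>2)"
  define \<phi>2 where "\<phi>2 = (\<lambda>x. - (4 / pi) * (sin (c x) * cos (c x)))"
  have p2: "2 / pi \<le> 1" "4 / pi \<le> 2" using pi_ge_two by (auto simp: divide_simps)
  have d1: "((\<lambda>y. 1 - (y - sin y * cos y) / pi) has_real_derivative - (2 / pi) * (sin y)\<^sup>2) (at y)" for y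
  proof -
    have "((\<lambda>y. 1 - (y - sin y * cos y) / pi) has_real_derivative - ((1 - (cos y * cos y - sin y * sin y)) / pi)) (at y)"
      by (auto intro!: derivative_eq_intros)
    moreover have "1 - (cos y * cos y - sin y * sin y) = 2 * (sin y)\<^sup>2"
      using sin_cos_squared_add[of y] by (simp add: power2_eq_square)
    ultimately show ?thesis by simp
  qed
  have d2: "((\<lambda>y. - (2 / pi) * (sin y)\<^sup>2) has_real_derivative - (4 / pi) * (sin y * cos y)) (at y)" for y
    by (auto intro!: derivative_eq_intros)
  have d3: "((\<lambda>y. - (4 / pi) * (sin y * cos y)) has_real_derivative - (4 / pi) * (cos y * cos y - sin y * sin y)) (at y)" for y
    by (auto intro!: derivative_eq_intros)
  have D1: "(\<phi> has_real_derivative \<phi>1 x) (at x)" for x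
    unfolding \<phi>_def \<phi>1_def c_def by (rule has_real_derivative_clamp[OF d1]) auto
  have D2: "(\<phi>1 has_real_derivative \<phi>2 x) (at x)" for x
    unfolding \<phi>1_def \<phi>2_def c_def by (rule has_real_derivative_clamp[OF d2]) auto
  have "\<bar>\<phi>1 x\<bar> \<le> 1" for x
    using p2 power_mono[OF abs_sin_le_one[of "c x"], of 2] mult_mono[of "2/pi" 1 "(sin (c x))\<^sup>2" 1]
    by (simp add: \<phi>1_def abs_mult)
  moreover have "\<bar>\<phi>2 x\<bar> \<le> 2" for x
    using mult_mono[OF p2(2) mult_mono[OF abs_sin_le_one[of "c x"] abs_cos_le_one[of "c x"]]]
    by (simp add: \<phi>2_def abs_mult)
  \<comment> \<open>The clamped second derivative has corners, so the Lipschitz bound is taken from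
    the unclamped formula; clamping is a contraction.\<close>
  moreover have "\<bar>\<phi>2 x - \<phi>2 y\<bar> \<le> 4 * \<bar>x - y\<bar>" for x y
  proof -
    have b: "\<bar>- (4 / pi) * (cos y * cos y - sin y * sin y)\<bar> \<le> 4" for y
    proof -
      have "\<bar>cos (2 * y)\<bar> \<le> 1" by (rule abs_cos_le_one)
      then have "\<bar>cos y * cos y - sin y * sin y\<bar> \<le> 1" by (simp add: cos_double power2_eq_square)
      then have "(4/pi) * \<bar>cos y * cos y - sin y * sin y\<bar> \<le> 4 * 1"
        by (rule mult_mono[rotated]) (use p2 in auto)
      then show ?thesis by (simp only: abs_mult) simp
    qed
    have "\<bar>\<phi>2 x - \<phi>2 y\<bar> \<le> 4 * \<bar>c x - c y\<bar>"
      unfolding \<phi>2_def by (rule deriv_bound_imp_Lipschitz[OF d3 b])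
    also have "\<bar>c x - c y\<bar> \<le> \<bar>x - y\<bar>" by (auto simp: c_def max_def min_def)
    finally show ?thesis by simp
  qed
  moreover have "0 \<le> \<phi> x \<and> \<phi> x \<le> 1" for x
  proof -
    have anti: "1 - (z - sin z * cos z) / pi \<le> 1 - (y - sin y * cos y) / pi" if "y \<le> z" for y z
      by (rule DERIV_nonpos_imp_nonincreasing[OF that]) (use d1 in \<open>fastforce\<close>)
    show ?thesis using anti[OF c(1)[of x]] anti[OF c(2)[of x]] by (simp add: \<phi>_def)
  qed
  ultimately have "test_fun 4 \<phi> \<phi>1 \<phi>2"
    using D1 D2 unfolding test_fun_def by (smt (verit))
  moreover have "x \<le> 0 \<Longrightarrow> \<phi> x = 1" "pi \<le> x \<Longrightarrow> \<phi> x = 0" for x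
    by (auto simp: \<phi>_def c_def max_def min_def) (use pi_gt_zero in linarith)
  ultimately show ?thesis by blast
qed

lemma test_fun_step:
  fixes u h :: real
  assumes "0 < h"
  obtains C \<phi> \<phi>1 \<phi>2 where "test_fun C \<phi> \<phi>1 \<phi>2"
    "\<And>x. x \<le> u \<Longrightarrow> \<phi> x = 1" "\<And>x. u + h \<le> x \<Longrightarrow> \<phi> x = 0"
proof -
  obtain C \<phi> \<phi>1 \<phi>2 where t: "test_fun C \<phi> \<phi>1 \<phi>2"
    "\<forall>x\<le>0. \<phi> x = 1" "\<forall>x\<ge>pi. \<phi> x = 0" using test_fun_unit_step by blast
  obtain C' where "test_fun C' (\<lambda>x. \<phi> ((x - u) / (h / pi))) (\<lambda>x. \<phi>1 ((x - u) / (h / pi)) / (h / pi))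
      (\<lambda>x. \<phi>2 ((x - u) / (h / pi)) / (h / pi) / (h / pi))"
    using test_fun_affine[OF t(1), of "h / pi" u] assms by auto
  then show ?thesis
    by (rule that) (use assms in \<open>auto intro!: t(2,3)[rule_format] simp: divide_simps mult_nonpos_nonneg\<close>)
qed

section \<open>Gaussian vectors\<close>

text \<open>Cholesky factorisation by induction on the dimension: the Schur complement of the last
  diagonal entry is again positive semidefinite.\<close>

lemma psd_sum_of_squares:
  fixes S :: "nat \<Rightarrow> nat \<Rightarrow> real"
  assumes "\<And>k l. k < p \<Longrightarrow> l < p \<Longrightarrow> S k l = S l k"
    and "\<And>x. 0 \<le> (\<Sum>k<p. \<Sum>l<p. x k * S k l * x l)"
  shows "\<exists>a. \<forall>k<p. \<forall>l<p. S k l = (\<Sum>r<p. a r k * a r l)"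
  using assms
proof (induction p arbitrary: S)
  case 0
  then show ?case by simp
next
  case (Suc p)
  define d where "d = S p p"
  define b where "b = (\<lambda>x. \<Sum>k<p. x k * S k p)"
  define Q where "Q = (\<lambda>x. \<Sum>k<p. \<Sum>l<p. x k * S k l * x l)"
  have Q: "0 \<le> Q x + 2 * t * b x + t\<^sup>2 * d" for x t
  proof -
    define y where "y = (\<lambda>k. if k = p then t else x k)"
    have "0 \<le> (\<Sum>k<Suc p. \<Sum>l<Suc p. y k * S k l * y l)" by (rule Suc.prems)
    also have "\<dots> = (\<Sum>k<p. \<Sum>l<p. y k * S k l * y l) + (\<Sum>k<p. y k * S k p * y p)
        + (\<Sum>l<p. y p * S p l * y l) + y p * S p p * y p"
      by (simp add: sum.distrib)
    also have "(\<Sum>k<p. \<Sum>l<p. y k * S k l * y l) = Q x" unfolding Q_def by (intro sum.cong) (auto simp: y_def)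
    also have "(\<Sum>k<p. y k * S k p * y p) = t * b x"
      by (simp add: b_def sum_distrib_left y_def mult_ac)
    also have "(\<Sum>l<p. y p * S p l * y l) = t * b x"
      unfolding b_def sum_distrib_left using Suc.prems(1)[of p] by (intro sum.cong) (auto simp: y_def)
    finally show ?thesis by (simp add: y_def d_def power2_eq_square algebra_simps)
  qed
  have d0: "0 \<le> d" using Q[of "\<lambda>_. 0" 1] by (simp add: Q_def b_def)
  \<comment> \<open>A vanishing diagonal entry kills its column: the form is then affine in
    \<open>t\<close>, and the chosen \<open>t\<close> would give it the value -1.\<close>
  have b0: "b x = 0" if "d = 0" for x
  proof (rule ccontr)
    assume "b x \<noteq> 0"
    then show False using Q[of x "- (Q x + 1) / (2 * b x)"] that by (simp add: field_simps)
  qed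
  \<comment> \<open>For \<open>d = 0\<close> the quotient is 0 by convention, so the degenerate case
    needs no separate definition.\<close>
  define S' where "S' = (\<lambda>k l. S k l - S k p * S l p / d)"
  have "\<exists>a. \<forall>k<p. \<forall>l<p. S' k l = (\<Sum>r<p. a r k * a r l)"
  proof (rule Suc.IH)
    show "S' k l = S' l k" if "k < p" "l < p" for k l using Suc.prems(1)[of k l] that by (simp add: S'_def)
    show "0 \<le> (\<Sum>k<p. \<Sum>l<p. x k * S' k l * x l)" for x
    proof -
      have "(\<Sum>k<p. \<Sum>l<p. x k * S' k l * x l) = Q x - (\<Sum>k<p. \<Sum>l<p. (x k * S k p) * (x l * S l p)) / d"
        unfolding Q_def S'_def sum_divide_distrib sum_subtractf[symmetric]
        by (intro sum.cong) (auto simp: algebra_simps)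
      also have "(\<Sum>k<p. \<Sum>l<p. (x k * S k p) * (x l * S l p)) = (b x)\<^sup>2"
        by (simp add: b_def power2_eq_square sum_product)
      finally have e: "(\<Sum>k<p. \<Sum>l<p. x k * S' k l * x l) = Q x - (b x)\<^sup>2 / d" .
      show ?thesis
      proof (cases "d = 0")
        case True then show ?thesis unfolding e using Q[of x 0] by simp
      next
        case False
        \<comment> \<open>This \<open>t\<close> minimises the quadratic polynomial in
          \<open>t\<close>.\<close>
        then show ?thesis unfolding e using Q[of x "- b x / d"] by (simp add: power2_eq_square field_simps)
      qed
    qed
  qed
  then obtain a where a: "\<And>k l. k < p \<Longrightarrow> l < p \<Longrightarrow> S' k l = (\<Sum>r<p. a r k * a r l)" by blast
  \<comment> \<open>The new row is the last column over the root of the pivot; the old rows are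
    extended by 0. For \<open>d = 0\<close> the new row vanishes, in accordance with
    \<open>b0\<close>.\<close>
  define a' where "a' = (\<lambda>r k. if r = p then S k p / sqrt d else if k = p then 0 else a r k)"
  have z: "S k p = 0" if "k < p" "d = 0" for k
    using b0[OF that(2), of "\<lambda>j. if j = k then 1 else 0"] that by (simp add: b_def if_distrib if_distribR sum.If_cases cong: if_cong)
  have "S k l = (\<Sum>r<Suc p. a' r k * a' r l)" if "k < Suc p" "l < Suc p" for k l
  proof -
    have "(\<Sum>r<p. a' r k * a' r l) = (if k = p \<or> l = p then 0 else S' k l)"
      using that a[of k l] by (auto simp: a'_def)
    then show ?thesis
      using that z[of k] z[of l] d0 Suc.prems(1)[of k l] by (cases "d = 0") (auto simp: a'_def S'_def d_def less_Suc_eq)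
  qed
  then show ?case by blast
qed

section \<open>Standard normal variables: rotations, stability, small balls\<close>

abbreviation "std_gauss I \<equiv> PiM I (\<lambda>_. std_normal_distribution)"

interpretation N1: prob_space std_normal_distribution
  by (simp add: prob_space_normal_density)

interpretation NN: product_prob_space "\<lambda>_::nat. std_normal_distribution" UNIV
  by unfold_locales

lemma std_normal_UNIV [simp]:
  "emeasure std_normal_distribution UNIV = 1" "measure std_normal_distribution UNIV = 1"
  using N1.emeasure_space_1 N1.prob_space by simp_all

lemma prob_space_std_gauss: "prob_space (std_gauss I)"
  by (intro prob_space_PiM) (simp add: prob_space_normal_density)

lemma nn_integral_std_normal:
  "f \<in> borel_measurable borel \<Longrightarrow>
    (\<integral>\<^sup>+x. f x \<partial>std_normal_distribution) = (\<integral>\<^sup>+x. ennreal (std_normal_density x) * f x \<partial>lborel)"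
  by (simp add: nn_integral_density)

text \<open>The joint density of a pair depends on its Euclidean norm only; this is the rotation
  invariance in pointwise form.\<close>

lemma std_normal_density_mult_cong:
  assumes "x\<^sup>2 + y\<^sup>2 = u\<^sup>2 + v\<^sup>2"
  shows "std_normal_density x * std_normal_density y = std_normal_density u * std_normal_density v"
proof -
  have "- x\<^sup>2 / 2 + - y\<^sup>2 / 2 = - u\<^sup>2 / 2 + - v\<^sup>2 / 2" using assms by (simp add: field_simps)
  then have "exp (- x\<^sup>2 / 2) * exp (- y\<^sup>2 / 2) = exp (- u\<^sup>2 / 2) * exp (- v\<^sup>2 / 2)"
    by (simp only: mult_exp_exp)
  then show ?thesis by (simp add: std_normal_density_def)
qed

text \<open>The rotation is performed as two one-dimensional affine substitutions, one per variable,
  whose factors 1 / c and c cancel. This is where \<open>c \<noteq> 0\<close> enters.\<close>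

lemma std_normal_rotation:
  fixes c s :: real and F :: "real \<times> real \<Rightarrow> ennreal"
  assumes cs: "c\<^sup>2 + s\<^sup>2 = 1" "c \<noteq> 0"
    and [measurable]: "F \<in> borel_measurable (borel \<Otimes>\<^sub>M borel)"
  shows "(\<integral>\<^sup>+x. \<integral>\<^sup>+y. F (c * x + s * y, c * y - s * x) \<partial>std_normal_distribution \<partial>std_normal_distribution)
       = (\<integral>\<^sup>+x. \<integral>\<^sup>+y. F (x, y) \<partial>std_normal_distribution \<partial>std_normal_distribution)"
proof -
  let ?d = "\<lambda>x y. ennreal (std_normal_density x * std_normal_density y)"
  have u: "(\<integral>\<^sup>+x. \<integral>\<^sup>+y. G x y \<partial>std_normal_distribution \<partial>std_normal_distribution)
       = (\<integral>\<^sup>+x. \<integral>\<^sup>+y. ?d x y * G x y \<partial>lborel \<partial>lborel)"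
    if [measurable]: "(\<lambda>(x, y). G x y) \<in> borel_measurable (borel \<Otimes>\<^sub>M borel)" for G
    by (simp add: nn_integral_std_normal ennreal_mult' nn_integral_cmult[symmetric] mult.assoc)
  have c2: "1 - s\<^sup>2 = c\<^sup>2" using cs by simp
  have "(\<integral>\<^sup>+x. \<integral>\<^sup>+y. ?d x y * F (c * x + s * y, c * y - s * x) \<partial>lborel \<partial>lborel)
      = (\<integral>\<^sup>+y. \<integral>\<^sup>+x. ?d x y * F (c * x + s * y, c * y - s * x) \<partial>lborel \<partial>lborel)"
    by (rule lborel_pair.Fubini'[symmetric]) measurable
  \<comment> \<open>For fixed \<open>y\<close> the first rotated coordinate becomes the new
    \<open>x\<close>; the second one is then \<open>(y - s * x) / c\<close>.\<close>
  also have "\<dots> = (\<integral>\<^sup>+y. \<bar>1 / c\<bar> * (\<integral>\<^sup>+x. ?d (- (s / c) * y + (1 / c) * x) y * F (x, (y - s * x) / c) \<partial>lborel) \<partial>lborel)"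
  proof (rule nn_integral_cong)
    fix y :: real
    have e1: "c * (- (s / c) * y + (1 / c) * x) + s * y = x" for x using cs by (simp add: field_simps)
    have e2: "c * y - s * (- (s / c) * y + (1 / c) * x) = (y - s * x) / c" for x
    proof -
      have "c * y - s * (- (s / c) * y + (1 / c) * x) = ((c\<^sup>2 + s\<^sup>2) * y - s * x) / c"
        using cs(2) by (simp add: field_simps power2_eq_square)
      then show ?thesis using cs by simp
    qed
    show "(\<integral>\<^sup>+x. ?d x y * F (c * x + s * y, c * y - s * x) \<partial>lborel) =
      \<bar>1 / c\<bar> * (\<integral>\<^sup>+x. ?d (- (s / c) * y + (1 / c) * x) y * F (x, (y - s * x) / c) \<partial>lborel)"
      using cs(2) by (subst nn_integral_real_affine[of _ "1 / c" "- (s / c) * y"]) (simp_all only: e1 e2, auto)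
  qed
  also have "\<dots> = (\<integral>\<^sup>+y. \<integral>\<^sup>+x. \<bar>1 / c\<bar> * (?d (- (s / c) * y + (1 / c) * x) y * F (x, (y - s * x) / c)) \<partial>lborel \<partial>lborel)"
    by (simp add: nn_integral_cmult)
  also have "\<dots> = (\<integral>\<^sup>+x. \<integral>\<^sup>+y. \<bar>1 / c\<bar> * (?d (- (s / c) * y + (1 / c) * x) y * F (x, (y - s * x) / c)) \<partial>lborel \<partial>lborel)"
    by (rule lborel_pair.Fubini') measurable
  \<comment> \<open>For fixed \<open>x\<close> the second rotated coordinate becomes the new
    \<open>y\<close>. The product of densities at the original point equals that at the rotated
    one.\<close>
  also have "\<dots> = (\<integral>\<^sup>+x. \<integral>\<^sup>+y. ?d x y * F (x, y) \<partial>lborel \<partial>lborel)"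
  proof (rule nn_integral_cong)
    fix x :: real
    have e1: "(s * x + c * y - s * x) / c = y" for y using cs by simp
    have e2: "- (s / c) * (s * x + c * y) + (1 / c) * x = c * x - s * y" for y
    proof -
      have "- (s / c) * (s * x + c * y) + (1 / c) * x = ((1 - s\<^sup>2) * x - s * c * y) / c"
        using cs(2) by (simp add: field_simps power2_eq_square)
      also have "\<dots> = c * x - s * y" unfolding c2 using cs(2) by (simp add: field_simps power2_eq_square)
      finally show ?thesis .
    qed
    have "(c * x - s * y)\<^sup>2 + (s * x + c * y)\<^sup>2 = (c\<^sup>2 + s\<^sup>2) * (x\<^sup>2 + y\<^sup>2)" for y
      by (simp add: power2_eq_square algebra_simps)
    then have e3: "std_normal_density (c * x - s * y) * std_normal_density (s * x + c * y)
        = std_normal_density x * std_normal_density y" for y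
      using cs by (intro std_normal_density_mult_cong) simp
    have "(\<integral>\<^sup>+y. \<bar>1 / c\<bar> * (?d (- (s / c) * y + (1 / c) * x) y * F (x, (y - s * x) / c)) \<partial>lborel)
       = \<bar>c\<bar> * (\<integral>\<^sup>+y. \<bar>1 / c\<bar> * (?d x y * F (x, y)) \<partial>lborel)"
      using cs(2) by (subst nn_integral_real_affine[of _ c "s * x"]) (simp_all only: e1 e2 e3, auto)
    also have "\<dots> = (ennreal \<bar>c\<bar> * ennreal \<bar>1 / c\<bar>) * (\<integral>\<^sup>+y. ?d x y * F (x, y) \<partial>lborel)"
      by (simp add: nn_integral_cmult mult.assoc)
    also have "ennreal \<bar>c\<bar> * ennreal \<bar>1 / c\<bar> = 1" using cs(2) by (simp add: ennreal_mult'[symmetric])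
    finally show "(\<integral>\<^sup>+y. \<bar>1 / c\<bar> * (?d (- (s / c) * y + (1 / c) * x) y * F (x, (y - s * x) / c)) \<partial>lborel)
       = (\<integral>\<^sup>+y. ?d x y * F (x, y) \<partial>lborel)" by simp
  qed
  finally show ?thesis by (subst (1 2) u) (auto simp: case_prod_beta)
qed

lemma std_normal_stable:
  fixes \<alpha> \<beta> :: real and f :: "real \<Rightarrow> ennreal"
  assumes [measurable]: "f \<in> borel_measurable borel"
  shows "(\<integral>\<^sup>+x. \<integral>\<^sup>+y. f (\<alpha> * x + \<beta> * y) \<partial>std_normal_distribution \<partial>std_normal_distribution)
     = (\<integral>\<^sup>+x. f (sqrt (\<alpha>\<^sup>2 + \<beta>\<^sup>2) * x) \<partial>std_normal_distribution)"
\<comment> \<open>The rotation needs a nonzero cosine. Without the first summand only the symmetry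
  of the normal law is used, to replace \<open>\<beta>\<close> by its absolute value.\<close>
proof (cases "\<alpha> = 0")
  case True
  have "(\<integral>\<^sup>+x. f (\<bar>\<beta>\<bar> * x) \<partial>std_normal_distribution) = (\<integral>\<^sup>+x. f (\<beta> * x) \<partial>std_normal_distribution)"
  proof (cases "0 \<le> \<beta>")
    case False
    have "(\<integral>\<^sup>+x. f (\<bar>\<beta>\<bar> * x) \<partial>std_normal_distribution) = (\<integral>\<^sup>+x. ennreal (std_normal_density x) * f (- \<beta> * x) \<partial>lborel)"
      using False by (simp add: nn_integral_std_normal)
    also have "\<dots> = (\<integral>\<^sup>+x. ennreal (std_normal_density x) * f (\<beta> * x) \<partial>lborel)"
      by (subst nn_integral_real_affine[of _ "-1" 0]) (auto simp: std_normal_density_def)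
    finally show ?thesis by (simp add: nn_integral_std_normal)
  qed simp
  then show ?thesis using True by simp
next
  case False
  define \<tau> where "\<tau> = sqrt (\<alpha>\<^sup>2 + \<beta>\<^sup>2)"
  have \<tau>: "0 < \<tau>" "\<tau>\<^sup>2 = \<alpha>\<^sup>2 + \<beta>\<^sup>2" using False by (auto simp: \<tau>_def add_pos_nonneg)
  have cs: "(\<alpha> / \<tau>)\<^sup>2 + (\<beta> / \<tau>)\<^sup>2 = 1" "\<alpha> / \<tau> \<noteq> 0"
    using \<tau> False by (auto simp: power_divide add_divide_distrib[symmetric])
  have e: "\<tau> * (\<alpha> * x / \<tau> + \<beta> * y / \<tau>) = \<alpha> * x + \<beta> * y" for x y using \<tau>(1) by (simp add: field_simps)
  show ?thesis
    using std_normal_rotation[OF cs, of "\<lambda>(u, v). f (\<tau> * u)"]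
    by (simp add: e \<tau>_def[symmetric])
qed

text \<open>Induction on the coordinates, each one merged with the rest by stability. All laws of
  Gaussian inner products are reduced to this identity.\<close>

lemma nn_integral_std_gauss_linear:
  fixes c :: "nat \<Rightarrow> real" and f :: "real \<Rightarrow> ennreal"
  assumes "finite I" and f: "f \<in> borel_measurable borel"
  shows "(\<integral>\<^sup>+x. f (\<Sum>i\<in>I. c i * x i) \<partial>std_gauss I)
     = (\<integral>\<^sup>+t. f (sqrt (\<Sum>i\<in>I. (c i)\<^sup>2) * t) \<partial>std_normal_distribution)"
  using assms
proof (induction I arbitrary: f rule: finite_induct)
  case empty
  then show ?case by (simp add: NN.nn_integral_empty prob_space.emeasure_space_1[OF prob_space_std_gauss])
next
  case (insert i I)
  note [measurable] = \<open>f \<in> borel_measurable borel\<close>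
  let ?\<sigma> = "sqrt (\<Sum>i\<in>I. (c i)\<^sup>2)"
  have "(\<integral>\<^sup>+x. f (\<Sum>i\<in>insert i I. c i * x i) \<partial>std_gauss (insert i I))
    = (\<integral>\<^sup>+a. \<integral>\<^sup>+x. f (\<Sum>j\<in>insert i I. c j * (x(i := a)) j) \<partial>std_gauss I \<partial>std_normal_distribution)"
    using insert by (intro NN.product_nn_integral_insert_rev) auto
  also have "\<dots> = (\<integral>\<^sup>+a. \<integral>\<^sup>+x. f (c i * a + (\<Sum>j\<in>I. c j * x j)) \<partial>std_gauss I \<partial>std_normal_distribution)"
  proof -
    have "(\<Sum>j\<in>insert i I. c j * (x(i := a)) j) = c i * a + (\<Sum>j\<in>I. c j * x j)" for x a
      using insert.hyps by (auto intro!: sum.cong)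
    then show ?thesis by simp
  qed
  also have "\<dots> = (\<integral>\<^sup>+a. \<integral>\<^sup>+t. f (c i * a + ?\<sigma> * t) \<partial>std_normal_distribution \<partial>std_normal_distribution)"
    by (intro nn_integral_cong insert.IH[where f = "\<lambda>t. f (c i * _ + t)"]) auto
  also have "\<dots> = (\<integral>\<^sup>+t. f (sqrt ((c i)\<^sup>2 + ?\<sigma>\<^sup>2) * t) \<partial>std_normal_distribution)"
    by (rule std_normal_stable) simp
  finally show ?case using insert.hyps by (simp add: sum_nonneg)
qed

text \<open>The rotation acts on each pair of equal coordinates separately, so the plane rotation
  and an induction on the coordinates suffice.\<close>

lemma nn_integral_std_gauss_rotation:
  fixes c s :: real and F :: "(nat \<Rightarrow> real) \<times> (nat \<Rightarrow> real) \<Rightarrow> ennreal"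
  assumes "finite I" and cs: "c\<^sup>2 + s\<^sup>2 = 1" "c \<noteq> 0"
    and "F \<in> borel_measurable (PiM I (\<lambda>_. borel) \<Otimes>\<^sub>M PiM I (\<lambda>_. borel))"
  shows "(\<integral>\<^sup>+x. \<integral>\<^sup>+y. F (\<lambda>i\<in>I. c * x i + s * y i, \<lambda>i\<in>I. c * y i - s * x i) \<partial>std_gauss I \<partial>std_gauss I)
       = (\<integral>\<^sup>+x. \<integral>\<^sup>+y. F (x, y) \<partial>std_gauss I \<partial>std_gauss I)"
  using assms(1,4)
proof (induction I arbitrary: F rule: finite_induct)
  case empty
  then show ?case by (simp add: NN.nn_integral_empty prob_space.emeasure_space_1[OF prob_space_std_gauss])
next
  case (insert i I)
  let ?B = "\<lambda>I. PiM I (\<lambda>_::nat. borel :: real measure)"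
  note F[measurable] = \<open>F \<in> borel_measurable (?B (insert i I) \<Otimes>\<^sub>M ?B (insert i I))\<close>
  have setsG[measurable_cong]: "sets (std_gauss I) = sets (?B I)" for I by (intro sets_PiM_cong) auto
  interpret G: prob_space "std_gauss I" by (rule prob_space_std_gauss)
  interpret GN: pair_sigma_finite "std_normal_distribution" "std_gauss I" ..
  have [measurable]: "(\<lambda>(x, a, y, b). F (x(i := a), y(i := b))) \<in> borel_measurable (?B I \<Otimes>\<^sub>M borel \<Otimes>\<^sub>M ?B I \<Otimes>\<^sub>M borel)"
    unfolding case_prod_beta by measurable
  \<comment> \<open>Fubini brings coordinate \<open>i\<close> of both vectors to the innermost
    position, where the plane rotation can act on it.\<close>
  have ins: "(\<integral>\<^sup>+x. \<integral>\<^sup>+y. K x y \<partial>std_gauss (insert i I) \<partial>std_gauss (insert i I)) =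
     (\<integral>\<^sup>+x. \<integral>\<^sup>+y. \<integral>\<^sup>+a. \<integral>\<^sup>+b. K (x(i := a)) (y(i := b)) \<partial>std_normal_distribution \<partial>std_normal_distribution \<partial>std_gauss I \<partial>std_gauss I)"
    if [measurable]: "(\<lambda>(x, y). K x y) \<in> borel_measurable (?B (insert i I) \<Otimes>\<^sub>M ?B (insert i I))" for K
  proof -
    interpret G': prob_space "std_gauss (insert i I)" by (rule prob_space_std_gauss)
    have "(\<integral>\<^sup>+x. \<integral>\<^sup>+y. K x y \<partial>std_gauss (insert i I) \<partial>std_gauss (insert i I)) =
      (\<integral>\<^sup>+x. \<integral>\<^sup>+a. \<integral>\<^sup>+y. K (x(i := a)) y \<partial>std_gauss (insert i I) \<partial>std_normal_distribution \<partial>std_gauss I)"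
      using insert.hyps by (intro NN.product_nn_integral_insert) measurable
    also have "\<dots> = (\<integral>\<^sup>+x. \<integral>\<^sup>+a. \<integral>\<^sup>+y. \<integral>\<^sup>+b. K (x(i := a)) (y(i := b)) \<partial>std_normal_distribution \<partial>std_gauss I \<partial>std_normal_distribution \<partial>std_gauss I)"
    proof (intro nn_integral_cong NN.product_nn_integral_insert insert.hyps)
      fix x a assume "x \<in> space (std_gauss I)"
      then have "x(i := a) \<in> space (?B (insert i I))" by (auto simp: space_PiM PiE_def extensional_def)
      from measurable_Pair2[OF that this] show "K (x(i := a)) \<in> borel_measurable (std_gauss (insert i I))"
        by (simp cong: measurable_cong_sets add: setsG)
    qed
    also have "\<dots> = (\<integral>\<^sup>+x. \<integral>\<^sup>+y. \<integral>\<^sup>+a. \<integral>\<^sup>+b. K (x(i := a)) (y(i := b)) \<partial>std_normal_distribution \<partial>std_normal_distribution \<partial>std_gauss I \<partial>std_gauss I)"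
    proof (intro nn_integral_cong GN.Fubini'[symmetric])
      fix x assume "x \<in> space (std_gauss I)"
      then have [measurable]: "x \<in> space (?B I)" by (simp add: space_PiM)
      have "(\<lambda>((a, y), b). K (x(i := a)) (y(i := b))) \<in> borel_measurable ((borel \<Otimes>\<^sub>M ?B I) \<Otimes>\<^sub>M borel)"
      proof -
        have "(\<lambda>p. (x(i := fst (fst p)), (snd (fst p))(i := snd p)))
          \<in> measurable ((borel \<Otimes>\<^sub>M ?B I) \<Otimes>\<^sub>M borel) (?B (insert i I) \<Otimes>\<^sub>M ?B (insert i I))" by measurable
        from measurable_compose[OF this that] show ?thesis by (simp add: case_prod_unfold)
      qed
      then have [measurable]: "(\<lambda>((a, y), b). K (x(i := a)) (y(i := b))) \<in> borel_measurable ((std_normal_distribution \<Otimes>\<^sub>M std_gauss I) \<Otimes>\<^sub>M std_normal_distribution)"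
        by (simp cong: measurable_cong_sets sets_pair_measure_cong add: setsG)
      show "(\<lambda>(a, y). \<integral>\<^sup>+b. K (x(i := a)) (y(i := b)) \<partial>std_normal_distribution) \<in> borel_measurable (std_normal_distribution \<Otimes>\<^sub>M std_gauss I)"
        unfolding case_prod_beta by (rule N1.borel_measurable_nn_integral_fst[where f = "\<lambda>((a, y), b). K (x(i := a)) (y(i := b))", simplified case_prod_beta fst_conv snd_conv]) measurable
    qed
    finally show ?thesis .
  qed
  have r: "(\<lambda>j\<in>insert i I. c * (x(i := a)) j + s * (y(i := b)) j) = (\<lambda>j\<in>I. c * x j + s * y j)(i := c * a + s * b)"
    "(\<lambda>j\<in>insert i I. c * (y(i := b)) j - s * (x(i := a)) j) = (\<lambda>j\<in>I. c * y j - s * x j)(i := c * b - s * a)" for x y a b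
    using insert.hyps by (auto simp: fun_eq_iff)
  have "(\<integral>\<^sup>+x. \<integral>\<^sup>+y. F (\<lambda>i\<in>insert i I. c * x i + s * y i, \<lambda>i\<in>insert i I. c * y i - s * x i) \<partial>std_gauss (insert i I) \<partial>std_gauss (insert i I))
    = (\<integral>\<^sup>+x. \<integral>\<^sup>+y. \<integral>\<^sup>+a. \<integral>\<^sup>+b. F ((\<lambda>j\<in>I. c * x j + s * y j)(i := c * a + s * b), (\<lambda>j\<in>I. c * y j - s * x j)(i := c * b - s * a))
        \<partial>std_normal_distribution \<partial>std_normal_distribution \<partial>std_gauss I \<partial>std_gauss I)"
    by (subst ins) (simp_all only: r, measurable)
  \<comment> \<open>The innermost pair is rotated with all other coordinates fixed; afterwards the
    induction hypothesis is applied to the function in which this pair has been integrated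
    out.\<close>
  also have "\<dots> = (\<integral>\<^sup>+x. \<integral>\<^sup>+y. \<integral>\<^sup>+a. \<integral>\<^sup>+b. F ((\<lambda>j\<in>I. c * x j + s * y j)(i := a), (\<lambda>j\<in>I. c * y j - s * x j)(i := b))
        \<partial>std_normal_distribution \<partial>std_normal_distribution \<partial>std_gauss I \<partial>std_gauss I)"
    by (intro nn_integral_cong std_normal_rotation[OF cs, where F = "\<lambda>(a, b). F ((\<lambda>j\<in>I. c * _ j + s * _ j)(i := a), (\<lambda>j\<in>I. c * _ j - s * _ j)(i := b))", simplified]) measurable
  also have "\<dots> = (\<integral>\<^sup>+x. \<integral>\<^sup>+y. \<integral>\<^sup>+a. \<integral>\<^sup>+b. F (x(i := a), y(i := b))
        \<partial>std_normal_distribution \<partial>std_normal_distribution \<partial>std_gauss I \<partial>std_gauss I)"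
    by (rule insert.IH[where F = "\<lambda>z. \<integral>\<^sup>+a. \<integral>\<^sup>+b. F ((fst z)(i := a), (snd z)(i := b)) \<partial>std_normal_distribution \<partial>std_normal_distribution", unfolded fst_conv snd_conv]) measurable
  also have "\<dots> = (\<integral>\<^sup>+x. \<integral>\<^sup>+y. F (x, y) \<partial>std_gauss (insert i I) \<partial>std_gauss (insert i I))"
    by (subst ins) simp_all
  finally show ?case .
qed

text \<open>The density is at most 1 / 2, since \<open>sqrt (2 * pi)\<close> is at least 2, and the
  interval has length \<open>2 * \<epsilon>\<close>.\<close>

lemma std_normal_small_ball:
  assumes "0 \<le> \<epsilon>"
  shows "measure std_normal_distribution {x. \<bar>x\<bar> \<le> \<epsilon>} \<le> \<epsilon>"
proof -
  have d: "std_normal_density x \<le> 1 / 2" for x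
  proof -
    have "2 * 1 \<le> sqrt (2 * pi)" using pi_gt3 by (intro real_le_rsqrt) auto
    then have "1 / sqrt (2 * pi) \<le> 1 / 2" by (intro divide_left_mono) auto
    moreover have "exp (- x\<^sup>2 / 2) \<le> 1" by simp
    ultimately have "1 / sqrt (2 * pi) * exp (- x\<^sup>2 / 2) \<le> 1 / 2 * 1" by (intro mult_mono) auto
    then show ?thesis by (simp add: std_normal_density_def)
  qed
  have s: "{x. \<bar>x\<bar> \<le> \<epsilon>} = {-\<epsilon>..\<epsilon>}" by auto
  have "emeasure std_normal_distribution {-\<epsilon>..\<epsilon>} = (\<integral>\<^sup>+x. ennreal (std_normal_density x) * indicator {-\<epsilon>..\<epsilon>} x \<partial>lborel)"
    by (simp add: emeasure_density)
  also have "\<dots> \<le> (\<integral>\<^sup>+x. ennreal (1 / 2) * indicator {-\<epsilon>..\<epsilon>} x \<partial>lborel)"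
    by (intro nn_integral_mono mult_right_mono ennreal_leI d) auto
  also have "\<dots> = ennreal (1 / 2) * ennreal (2 * \<epsilon>)" using assms by (simp add: nn_integral_cmult)
  also have "\<dots> = ennreal \<epsilon>" using assms by (subst ennreal_mult[symmetric]) auto
  finally show ?thesis unfolding s measure_def using assms by (simp add: enn2real_leI)
qed

lemma abs_powr_le_1_plus_pow4: "\<bar>x::real\<bar> powr q \<le> 1 + x ^ 4" if "0 \<le> q" "q \<le> 4"
proof (cases "\<bar>x\<bar> \<le> 1")
  case True
  then have "\<bar>x\<bar> powr q \<le> 1" using that by (simp add: powr_le1)
  moreover have "0 \<le> x ^ 4" by simp
  ultimately show ?thesis by linarith
next
  case False
  then have "\<bar>x\<bar> powr q \<le> \<bar>x\<bar> powr 4" using that by (intro powr_mono) auto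
  also have "\<dots> = x ^ 4" using False by (simp add: powr_numeral)
  finally show ?thesis by simp
qed

lemma std_normal_moment4:
  "integrable std_normal_distribution (\<lambda>x. x ^ 4)" "(\<integral>x. x ^ 4 \<partial>std_normal_distribution) = 3"
  using std_normal_moment_even[of 2]
  by (auto simp: integrable_density integral_density has_bochner_integral_iff integrable_std_normal_distribution_moment fact_numeral)

text \<open>The bound 4 is \<open>1 + 3\<close>, with 3 the fourth moment, and does not depend on
  \<open>q\<close>.\<close>

lemma std_normal_abs_powr:
  assumes "0 \<le> q" "q \<le> 4"
  shows "integrable std_normal_distribution (\<lambda>x. \<bar>x\<bar> powr q)"
    and "(\<integral>x. \<bar>x\<bar> powr q \<partial>std_normal_distribution) \<le> 4"
proof -
  show i: "integrable std_normal_distribution (\<lambda>x. \<bar>x\<bar> powr q)"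
    by (rule Bochner_Integration.integrable_bound[of _ "\<lambda>x. 1 + x ^ 4"])
       (use abs_powr_le_1_plus_pow4[OF assms] std_normal_moment4 in auto)
  have "(\<integral>x. \<bar>x\<bar> powr q \<partial>std_normal_distribution) \<le> (\<integral>x. 1 + x ^ 4 \<partial>std_normal_distribution)"
    using i std_normal_moment4 abs_powr_le_1_plus_pow4[OF assms] by (intro integral_mono) auto
  also have "\<dots> = 4" using std_normal_moment4 by (simp add: N1.prob_space)
  finally show "(\<integral>x. \<bar>x\<bar> powr q \<partial>std_normal_distribution) \<le> 4" .
qed

section \<open>Laws of random vectors\<close>

text \<open>Points of \<open>vec_space p\<close> are extensional functions, so every vector
  operation is restricted to the coordinates below \<open>p\<close> in order to land in that space
  again.\<close>

definition vadd :: "nat \<Rightarrow> (nat \<Rightarrow> real) \<Rightarrow> (nat \<Rightarrow> real) \<Rightarrow> nat \<Rightarrow> real" where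
  "vadd p x y = (\<lambda>k\<in>{..<p}. x k + y k)"

definition vscale :: "nat \<Rightarrow> real \<Rightarrow> (nat \<Rightarrow> real) \<Rightarrow> nat \<Rightarrow> real" where
  "vscale p c x = (\<lambda>k\<in>{..<p}. c * x k)"

definition vzero :: "nat \<Rightarrow> nat \<Rightarrow> real" where
  "vzero p = (\<lambda>k\<in>{..<p}. 0)"

definition qform :: "nat \<Rightarrow> (nat \<Rightarrow> nat \<Rightarrow> real) \<Rightarrow> (nat \<Rightarrow> real) \<Rightarrow> real" where
  "qform p S x = (\<Sum>k<p. \<Sum>l<p. x k * S k l * x l)"

lemma space_vec_space: "space (vec_space p) = extensional {..<p}"
  by (auto simp: vec_space_def space_PiM PiE_def)

lemma vec_component_measurable:
  "f \<in> measurable M (vec_space p) \<Longrightarrow> k < p \<Longrightarrow> (\<lambda>x. f x k) \<in> borel_measurable M"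
  unfolding vec_space_def by (rule measurable_compose[OF _ measurable_component_singleton]) auto

lemma vec_component_measurable_self: "k < p \<Longrightarrow> (\<lambda>z. z k) \<in> borel_measurable (vec_space p)"
  by (rule vec_component_measurable) auto

lemma dotp_const_measurable [measurable (raw)]:
  assumes [measurable]: "g \<in> measurable M (vec_space p)"
  shows "(\<lambda>x. dotp p a (g x)) \<in> borel_measurable M"
  unfolding dotp_def
  by (intro borel_measurable_sum borel_measurable_times borel_measurable_const vec_component_measurable[OF assms]) auto

lemma dotp_measurable [measurable (raw)]:
  assumes [measurable]: "f \<in> measurable M (vec_space p)" "g \<in> measurable M (vec_space p)"
  shows "(\<lambda>x. dotp p (f x) (g x)) \<in> borel_measurable M"
  unfolding dotp_def by (intro borel_measurable_sum borel_measurable_times vec_component_measurable assms) auto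

lemma sqnorm_measurable [measurable (raw)]:
  assumes [measurable]: "f \<in> measurable M (vec_space p)"
  shows "(\<lambda>x. sqnorm p (f x)) \<in> borel_measurable M"
  unfolding sqnorm_def by measurable

lemma qform_measurable [measurable (raw)]:
  assumes [measurable]: "f \<in> measurable M (vec_space p)"
  shows "(\<lambda>x. qform p S (f x)) \<in> borel_measurable M"
  unfolding qform_def
  by (intro borel_measurable_sum borel_measurable_times borel_measurable_const vec_component_measurable[OF assms]) auto

lemma vadd_measurable [measurable (raw)]:
  assumes "f \<in> measurable M (vec_space p)" "g \<in> measurable M (vec_space p)"
  shows "(\<lambda>x. vadd p (f x) (g x)) \<in> measurable M (vec_space p)"
  unfolding vadd_def by (subst vec_space_def, rule measurable_restrict)
    (intro borel_measurable_add vec_component_measurable[OF assms(1)] vec_component_measurable[OF assms(2)], auto)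

lemma vscale_measurable [measurable (raw)]:
  assumes "f \<in> measurable M (vec_space p)"
  shows "(\<lambda>x. vscale p c (f x)) \<in> measurable M (vec_space p)"
  unfolding vscale_def by (subst vec_space_def, rule measurable_restrict)
    (intro borel_measurable_times borel_measurable_const vec_component_measurable[OF assms(1)], auto)

lemma vscale_measurable_self [measurable]: "vscale p c \<in> measurable (vec_space p) (vec_space p)"
  using vscale_measurable[OF measurable_ident, of p c] by simp

lemma vadd_const_measurable [measurable (raw)]:
  assumes "g \<in> measurable M (vec_space p)"
  shows "(\<lambda>x. vadd p a (g x)) \<in> measurable M (vec_space p)"
  unfolding vadd_def by (subst vec_space_def, rule measurable_restrict)
    (intro borel_measurable_add borel_measurable_const vec_component_measurable[OF assms(1)], auto)

lemma vzero_in_space [simp]: "vzero p \<in> space (vec_space p)"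
  by (simp add: vzero_def space_vec_space)

lemma dotp_vadd_left: "dotp p (vadd p x y) z = dotp p x z + dotp p y z"
  by (simp add: dotp_def vadd_def sum.distrib algebra_simps)

lemma dotp_commute: "dotp p x y = dotp p y x"
  by (simp add: dotp_def mult.commute)

lemma dotp_vadd_right: "dotp p z (vadd p x y) = dotp p z x + dotp p z y"
  by (metis dotp_commute dotp_vadd_left)

lemma dotp_vscale_left: "dotp p (vscale p c x) z = c * dotp p x z"
  by (simp add: dotp_def vscale_def sum_distrib_left mult_ac)

lemma sqnorm_vadd: "sqnorm p (vadd p x y) = sqnorm p x + 2 * dotp p x y + sqnorm p y"
  by (simp add: sqnorm_def dotp_vadd_left dotp_vadd_right dotp_commute[of p y x])

lemma sqnorm_vscale: "sqnorm p (vscale p c x) = c\<^sup>2 * sqnorm p x"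
  by (simp add: sqnorm_def dotp_def vscale_def sum_distrib_left power2_eq_square mult_ac)

lemma sqnorm_nonneg [simp]: "0 \<le> sqnorm p x"
  by (simp add: sqnorm_def dotp_def sum_nonneg)

lemma dotp_Cauchy_Schwarz: "(dotp p x y)\<^sup>2 \<le> sqnorm p x * sqnorm p y"
  using Cauchy_Schwarz_ineq_sum[of x y "{..<p}"] by (simp add: sqnorm_def dotp_def power2_eq_square)

lemma sq_component_le_sqnorm: "k < p \<Longrightarrow> (x k)\<^sup>2 \<le> sqnorm p x"
  unfolding sqnorm_def dotp_def power2_eq_square by (rule member_le_sum) auto

lemma vadd_assoc: "vadd p (vadd p x y) z = vadd p x (vadd p y z)"
  by (auto simp: vadd_def fun_eq_iff)

lemma vadd_commute: "vadd p x y = vadd p y x"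
  by (auto simp: vadd_def fun_eq_iff)

lemma vadd_vzero: "x \<in> space (vec_space p) \<Longrightarrow> vadd p x (vzero p) = x"
  by (auto simp: vadd_def vzero_def fun_eq_iff space_vec_space extensional_def)

lemma dotp_vzero [simp]: "dotp p (vzero p) x = 0" "dotp p x (vzero p) = 0"
  by (simp_all add: vzero_def dotp_def)

lemma sqnorm_vzero [simp]: "sqnorm p (vzero p) = 0"
  by (simp add: sqnorm_def)

lemma sqnorm_vadd_le: "sqnorm p (vadd p x y) \<le> 2 * (sqnorm p x + sqnorm p y)"
proof -
  have "2 * dotp p x y \<le> sqnorm p x + sqnorm p y"
    unfolding sqnorm_def dotp_def sum.distrib[symmetric] sum_distrib_left
    by (intro sum_mono) (use sum_squares_bound in \<open>simp add: power2_eq_square mult.assoc\<close>)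
  then show ?thesis by (simp add: sqnorm_vadd)
qed

text \<open>Cauchy-Schwarz. The bound is a product of one weight per vector, so integrability over a
  product measure follows from that of the single weights.\<close>

lemma abs_dotp_powr_le:
  assumes "0 \<le> q"
  shows "\<bar>dotp p x y\<bar> powr q \<le> (1 + sqnorm p x powr q) * (1 + sqnorm p y powr q)"
proof -
  have h: "a powr (q / 2) \<le> 1 + a powr q" if "0 \<le> a" for a :: real
  proof (cases "a \<le> 1")
    case True
    then have "a powr (q / 2) \<le> 1" using that assms by (simp add: powr_le1)
    then show ?thesis by (simp add: add_increasing2)
  next
    case False
    then have "a powr (q / 2) \<le> a powr q" using assms by (intro powr_mono) auto
    then show ?thesis by simp
  qed
  have "\<bar>dotp p x y\<bar> powr q = ((dotp p x y)\<^sup>2) powr (q / 2)"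
    using powr_powr[of "\<bar>dotp p x y\<bar>" 2 "q / 2"] by (cases "dotp p x y = 0") (auto simp: powr_numeral)
  also have "\<dots> \<le> (sqnorm p x * sqnorm p y) powr (q / 2)"
    using assms dotp_Cauchy_Schwarz by (intro powr_mono2) auto
  also have "\<dots> = sqnorm p x powr (q / 2) * sqnorm p y powr (q / 2)"
    by (simp add: powr_mult)
  also have "\<dots> \<le> (1 + sqnorm p x powr q) * (1 + sqnorm p y powr q)"
    by (intro mult_mono h) auto
  finally show ?thesis .
qed

subsection \<open>Convolution and scaling\<close>

definition conv :: "nat \<Rightarrow> (nat \<Rightarrow> real) measure \<Rightarrow> (nat \<Rightarrow> real) measure \<Rightarrow> (nat \<Rightarrow> real) measure" where
  "conv p P Q = distr (P \<Otimes>\<^sub>M Q) (vec_space p) (\<lambda>(x, y). vadd p x y)"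

definition scale_law :: "nat \<Rightarrow> real \<Rightarrow> (nat \<Rightarrow> real) measure \<Rightarrow> (nat \<Rightarrow> real) measure" where
  "scale_law p c P = distr P (vec_space p) (vscale p c)"

text \<open>The law of a sum of \<open>n\<close> independent vectors. Working with laws instead of
  random variables makes the exchange of a summand an identity between convolutions.\<close>

fun walk :: "nat \<Rightarrow> (nat \<Rightarrow> real) measure \<Rightarrow> nat \<Rightarrow> (nat \<Rightarrow> real) measure" where
  "walk p P 0 = return (vec_space p) (vzero p)"
| "walk p P (Suc n) = conv p (walk p P n) P"

definition vec_law :: "nat \<Rightarrow> (nat \<Rightarrow> real) measure \<Rightarrow> bool" where
  "vec_law p P \<longleftrightarrow> prob_space P \<and> sets P = sets (vec_space p)"

lemma vec_lawD: "vec_law p P \<Longrightarrow> prob_space P" "vec_law p P \<Longrightarrow> sets P = sets (vec_space p)"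
  "vec_law p P \<Longrightarrow> space P = space (vec_space p)"
  by (auto simp: vec_law_def dest: sets_eq_imp_space_eq)

lemma vec_law_pair_measurable:
  assumes "vec_law p P" "vec_law p Q"
  shows "measurable (P \<Otimes>\<^sub>M Q) N = measurable (vec_space p \<Otimes>\<^sub>M vec_space p) N"
  using vec_lawD(2)[OF assms(1)] vec_lawD(2)[OF assms(2)] by (simp cong: measurable_cong_sets sets_pair_measure_cong)

lemma vec_law_conv:
  assumes "vec_law p P" "vec_law p Q"
  shows "vec_law p (conv p P Q)"
proof -
  interpret P: prob_space P using assms vec_lawD by auto
  interpret Q: prob_space Q using assms vec_lawD by auto
  interpret PQ: pair_prob_space P Q ..
  note [simp] = vec_law_pair_measurable[OF assms(1,2)]
  show ?thesis unfolding vec_law_def conv_def case_prod_beta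
    by (intro conjI PQ.prob_space_distr) simp_all
qed

lemma vec_law_scale:
  assumes "vec_law p P"
  shows "vec_law p (scale_law p c P)"
proof -
  interpret P: prob_space P using assms vec_lawD by auto
  have "vscale p c \<in> measurable P (vec_space p)"
    using vscale_measurable_self vec_lawD(2)[OF assms] by (simp cong: measurable_cong_sets)
  then show ?thesis unfolding vec_law_def scale_law_def by (intro conjI P.prob_space_distr) simp_all
qed

lemma vec_law_return: "x \<in> space (vec_space p) \<Longrightarrow> vec_law p (return (vec_space p) x)"
  by (simp add: vec_law_def prob_space_return)

lemma vec_law_walk: "vec_law p P \<Longrightarrow> vec_law p (walk p P n)"
  by (induction n) (auto intro: vec_law_conv vec_law_return)

lemma nn_integral_conv:
  assumes "vec_law p P" "vec_law p Q" and [measurable]: "F \<in> borel_measurable (vec_space p)"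
  shows "(\<integral>\<^sup>+x. F x \<partial>conv p P Q) = (\<integral>\<^sup>+x. \<integral>\<^sup>+y. F (vadd p x y) \<partial>Q \<partial>P)"
proof -
  interpret Q: prob_space Q using assms vec_lawD by auto
  note [simp] = vec_law_pair_measurable[OF assms(1,2)]
  have "(\<integral>\<^sup>+x. F x \<partial>conv p P Q) = (\<integral>\<^sup>+z. F (vadd p (fst z) (snd z)) \<partial>(P \<Otimes>\<^sub>M Q))"
    unfolding conv_def case_prod_beta by (subst nn_integral_distr) simp_all
  also have "\<dots> = (\<integral>\<^sup>+x. \<integral>\<^sup>+y. F (vadd p x y) \<partial>Q \<partial>P)"
    by (subst Q.nn_integral_fst[symmetric]) simp_all
  finally show ?thesis .
qed

text \<open>Nonnegative integrands need no integrability, so identities between laws are all checked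
  in this form.\<close>

lemma vec_law_eqI:
  assumes "vec_law p P" "vec_law p Q"
    "\<And>F :: (nat \<Rightarrow> real) \<Rightarrow> ennreal. F \<in> borel_measurable (vec_space p) \<Longrightarrow> (\<integral>\<^sup>+x. F x \<partial>P) = (\<integral>\<^sup>+x. F x \<partial>Q)"
  shows "P = Q"
proof (rule measure_eqI)
  show "sets P = sets Q" using assms vec_lawD by auto
  fix A assume "A \<in> sets P"
  then have A: "A \<in> sets (vec_space p)" "A \<in> sets P" "A \<in> sets Q" using assms vec_lawD by auto
  then show "emeasure P A = emeasure Q A"
    using assms(3)[of "indicator A"] by simp
qed

lemma conv_assoc:
  assumes "vec_law p P" "vec_law p Q" "vec_law p R"
  shows "conv p (conv p P Q) R = conv p P (conv p Q R)"
proof (rule vec_law_eqI[of p])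
  fix F :: "(nat \<Rightarrow> real) \<Rightarrow> ennreal" assume [measurable]: "F \<in> borel_measurable (vec_space p)"
  interpret R: prob_space R using assms vec_lawD by auto
  note [simp] = assms vec_law_conv
  note [measurable_cong] = vec_lawD(2)[OF assms(3)]
  have [measurable]: "(\<lambda>x. \<integral>\<^sup>+y. F (vadd p x y) \<partial>R) \<in> borel_measurable (vec_space p)"
    by (rule R.borel_measurable_nn_integral) measurable
  have m: "(\<lambda>y. F (vadd p x y)) \<in> borel_measurable (vec_space p)" if "x \<in> space P" for x
  proof -
    have [measurable]: "x \<in> space (vec_space p)" using that vec_lawD(3)[OF assms(1)] by simp
    show ?thesis by measurable
  qed
  show "(\<integral>\<^sup>+x. F x \<partial>conv p (conv p P Q) R) = (\<integral>\<^sup>+x. F x \<partial>conv p P (conv p Q R))"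
    by (simp add: nn_integral_conv m vadd_assoc cong: nn_integral_cong)
qed (auto intro: vec_law_conv assms)

lemma conv_commute:
  assumes "vec_law p P" "vec_law p Q"
  shows "conv p P Q = conv p Q P"
proof (rule vec_law_eqI[of p])
  fix F :: "(nat \<Rightarrow> real) \<Rightarrow> ennreal" assume [measurable]: "F \<in> borel_measurable (vec_space p)"
  interpret P: prob_space P using assms vec_lawD by auto
  interpret Q: prob_space Q using assms vec_lawD by auto
  interpret PQ: pair_prob_space P Q ..
  note [simp] = vec_law_pair_measurable[OF assms(1,2)]
  have "(\<integral>\<^sup>+x. \<integral>\<^sup>+y. F (vadd p x y) \<partial>Q \<partial>P) = (\<integral>\<^sup>+y. \<integral>\<^sup>+x. F (vadd p x y) \<partial>P \<partial>Q)"
    unfolding case_prod_beta by (rule PQ.Fubini'[symmetric]) (simp add: case_prod_beta)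
  then show "(\<integral>\<^sup>+x. F x \<partial>conv p P Q) = (\<integral>\<^sup>+x. F x \<partial>conv p Q P)"
    by (simp add: nn_integral_conv assms vadd_commute[of p _ "_::nat\<Rightarrow>real"] cong: nn_integral_cong)
qed (auto intro: vec_law_conv assms)

subsection \<open>Centred laws with given covariance\<close>

lemma integral_double_sum:
  fixes f :: "nat \<Rightarrow> nat \<Rightarrow> 'a \<Rightarrow> real"
  assumes "\<And>k l. k < p \<Longrightarrow> l < p \<Longrightarrow> integrable M (f k l)"
  shows "(\<integral>z. (\<Sum>k<p. \<Sum>l<p. f k l z) \<partial>M) = (\<Sum>k<p. \<Sum>l<p. \<integral>z. f k l z \<partial>M)"
proof -
  have "(\<integral>z. (\<Sum>k<p. \<Sum>l<p. f k l z) \<partial>M) = (\<Sum>k<p. \<integral>z. (\<Sum>l<p. f k l z) \<partial>M)"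
    using assms by (intro Bochner_Integration.integral_sum Bochner_Integration.integrable_sum) auto
  also have "\<dots> = (\<Sum>k<p. \<Sum>l<p. \<integral>z. f k l z \<partial>M)"
    using assms by (intro sum.cong Bochner_Integration.integral_sum) auto
  finally show ?thesis .
qed

text \<open>The integrability of \<open>sqnorm p z powr q\<close> is qualitative: it makes every
  integral below meaningful, but its size enters no error bound.\<close>

locale cov_law =
  fixes p :: nat and S :: "nat \<Rightarrow> nat \<Rightarrow> real" and q :: real and P :: "(nat \<Rightarrow> real) measure"
  assumes law: "vec_law p P"
    and q: "2 \<le> q" "q \<le> 3"
    and integrable_powr: "integrable P (\<lambda>z. sqnorm p z powr q)"
    and mean: "k < p \<Longrightarrow> (\<integral>z. z k \<partial>P) = 0"
    and cov: "k < p \<Longrightarrow> l < p \<Longrightarrow> (\<integral>z. z k * z l \<partial>P) = S k l"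
begin

sublocale prob_space P using law vec_lawD by auto

lemma measP [simp]: "measurable P N = measurable (vec_space p) N"
  using vec_lawD(2)[OF law] by (simp cong: measurable_cong_sets)

lemma integrable_weight: "integrable P (\<lambda>z. 1 + sqnorm p z powr q)"
  using integrable_powr by simp

lemma integrable_weight_bound:
  fixes g :: "(nat \<Rightarrow> real) \<Rightarrow> real"
  assumes [measurable]: "g \<in> borel_measurable (vec_space p)"
    and "\<And>z. \<bar>g z\<bar> \<le> C * (1 + sqnorm p z powr q)"
  shows "integrable P g"
proof (rule Bochner_Integration.integrable_bound[of P "\<lambda>z. C * (1 + sqnorm p z powr q)"])
  show "AE z in P. norm (g z) \<le> norm (C * (1 + sqnorm p z powr q))"
    using assms(2) by (intro AE_I2) (metis abs_ge_self order_trans real_norm_def)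
qed (use integrable_weight in auto)

end

lemma powr_le_weight:
  fixes t :: real
  assumes "0 \<le> t" "0 \<le> r" "r \<le> q"
  shows "t powr r \<le> 1 + t powr q"
proof (cases "t \<le> 1")
  case True
  then have "t powr r \<le> 1" using assms by (simp add: powr_le1)
  then show ?thesis by (simp add: add_increasing2)
next
  case False
  then have "t powr r \<le> t powr q" using assms by (intro powr_mono) auto
  then show ?thesis by simp
qed

lemma le_weight:
  fixes t :: real
  assumes "0 \<le> t" "2 \<le> q"
  shows "t \<le> 1 + t powr q" "t\<^sup>2 \<le> 1 + t powr q"
  using powr_le_weight[of t 1 q] powr_le_weight[of t 2 q] assms
  by (auto simp: powr_numeral split: if_splits)

context cov_law
begin

lemma integrable_component_mult:
  assumes "k < p" "l < p"
  shows "integrable P (\<lambda>z. z k * z l)"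
proof (rule integrable_weight_bound[of _ 1])
  fix z :: "nat \<Rightarrow> real"
  have "\<bar>z k * z l\<bar> \<le> ((z k)\<^sup>2 + (z l)\<^sup>2) / 2"
    using sum_squares_bound[of "\<bar>z k\<bar>" "\<bar>z l\<bar>"] by (simp add: abs_mult)
  also have "\<dots> \<le> sqnorm p z" using sq_component_le_sqnorm[OF assms(1), of z] sq_component_le_sqnorm[OF assms(2), of z] by simp
  also have "\<dots> \<le> 1 + sqnorm p z powr q" using q by (intro le_weight) auto
  finally show "\<bar>z k * z l\<bar> \<le> 1 * (1 + sqnorm p z powr q)" by simp
qed (use assms in \<open>auto intro!: borel_measurable_times vec_component_measurable_self\<close>)

lemma integrable_component:
  assumes "k < p"
  shows "integrable P (\<lambda>z. z k)"
proof (rule integrable_weight_bound[of _ 2])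
  fix z :: "nat \<Rightarrow> real"
  have "\<bar>z k\<bar> \<le> 1 + (z k)\<^sup>2" using sum_squares_bound[of "\<bar>z k\<bar>" 1] by simp
  also have "\<dots> \<le> 1 + sqnorm p z" using sq_component_le_sqnorm[OF assms, of z] by simp
  also have "\<dots> \<le> 2 * (1 + sqnorm p z powr q)" using le_weight(1)[of "sqnorm p z" q] q
    by simp (smt (verit) powr_ge_zero)
  finally show "\<bar>z k\<bar> \<le> 2 * (1 + sqnorm p z powr q)" .
qed (use assms in \<open>auto intro!: borel_measurable_times vec_component_measurable_self\<close>)

lemma integrable_dotp: "integrable P (\<lambda>z. dotp p x z)"
  unfolding dotp_def using integrable_component by (intro Bochner_Integration.integrable_sum integrable_mult_right) auto

lemma integral_dotp: "(\<integral>z. dotp p x z \<partial>P) = 0"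
  unfolding dotp_def using integrable_component mean by (subst Bochner_Integration.integral_sum) auto

lemma dotp_sq: "(dotp p x z)\<^sup>2 = (\<Sum>k<p. \<Sum>l<p. x k * x l * (z k * z l))"
  unfolding dotp_def power2_eq_square sum_product by (simp add: mult_ac)

lemma integrable_dotp_sq: "integrable P (\<lambda>z. (dotp p x z)\<^sup>2)"
  unfolding dotp_sq using integrable_component_mult
  by (intro Bochner_Integration.integrable_sum integrable_mult_right) auto

lemma integral_dotp_sq: "(\<integral>z. (dotp p x z)\<^sup>2 \<partial>P) = qform p S x"
proof -
  have "(\<integral>z. (dotp p x z)\<^sup>2 \<partial>P) = (\<Sum>k<p. \<Sum>l<p. \<integral>z. x k * x l * (z k * z l) \<partial>P)"
    unfolding dotp_sq using integrable_component_mult by (intro integral_double_sum) simp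
  also have "\<dots> = (\<Sum>k<p. \<Sum>l<p. x k * x l * S k l)"
    by (intro sum.cong) (auto simp: cov)
  finally show ?thesis by (simp add: qform_def mult_ac)
qed

lemma qform_nonneg: "0 \<le> qform p S x"
  unfolding integral_dotp_sq[symmetric] by simp

lemma S_sym: "k < p \<Longrightarrow> l < p \<Longrightarrow> S k l = S l k"
  using cov[of k l] cov[of l k] by (simp add: mult.commute)

lemma integrable_sqnorm: "integrable P (sqnorm p)"
  unfolding sqnorm_def dotp_def using integrable_component_mult by (intro Bochner_Integration.integrable_sum) auto

lemma integral_sqnorm: "(\<integral>z. sqnorm p z \<partial>P) = f1 p S"
  unfolding sqnorm_def dotp_def f1_def using integrable_component_mult cov
  by (subst Bochner_Integration.integral_sum) auto

lemma integrable_qform: "integrable P (qform p A)"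
proof -
  have "integrable P (\<lambda>z. A k l * (z k * z l))" if "k < p" "l < p" for k l
    using integrable_component_mult that by auto
  then show ?thesis unfolding qform_def
    by (intro Bochner_Integration.integrable_sum) (auto simp: mult_ac)
qed

lemma integral_qform: "(\<integral>z. qform p A z \<partial>P) = (\<Sum>k<p. \<Sum>l<p. A k l * S l k)"
proof -
  have i: "integrable P (\<lambda>z. A k l * (z k * z l))" if "k < p" "l < p" for k l
    using integrable_component_mult that by auto
  have "(\<integral>z. qform p A z \<partial>P) = (\<integral>z. (\<Sum>k<p. \<Sum>l<p. A k l * (z k * z l)) \<partial>P)"
    by (simp add: qform_def mult_ac)
  also have "\<dots> = (\<Sum>k<p. \<Sum>l<p. \<integral>z. A k l * (z k * z l) \<partial>P)"
    using i by (rule integral_double_sum)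
  also have "\<dots> = (\<Sum>k<p. \<Sum>l<p. A k l * S l k)"
    by (intro sum.cong) (auto simp: cov S_sym)
  finally show ?thesis .
qed

lemma f2_sq: "(f2 p S)\<^sup>2 = (\<Sum>k<p. \<Sum>l<p. S k l * S l k)"
proof -
  have "0 \<le> (\<Sum>k<p. \<Sum>l<p. S k l * S l k)"
  proof (intro sum_nonneg)
    fix k l assume "k \<in> {..<p}" "l \<in> {..<p}"
    then show "0 \<le> S k l * S l k" using S_sym[of k l] by simp
  qed
  then show ?thesis by (simp add: f2_def)
qed

lemma integral_qform_self: "(\<integral>z. qform p S z \<partial>P) = (f2 p S)\<^sup>2"
  by (simp add: integral_qform f2_sq)

lemma integrable_sqnorm_sq: "integrable P (\<lambda>z. (sqnorm p z - c)\<^sup>2)"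
proof (rule integrable_weight_bound[of _ "2 * (1 + c\<^sup>2)"])
  fix z :: "nat \<Rightarrow> real"
  have "(sqnorm p z - c)\<^sup>2 \<le> 2 * ((sqnorm p z)\<^sup>2 + c\<^sup>2)"
    using sum_squares_bound[of "sqnorm p z" "-c"] by (simp add: power2_eq_square algebra_simps)
  also have "\<dots> \<le> 2 * ((1 + sqnorm p z powr q) + c\<^sup>2 * (1 + sqnorm p z powr q))"
    using le_weight(2)[of "sqnorm p z" q] q mult_left_mono[of 1 "1 + sqnorm p z powr q" "c\<^sup>2"] by simp
  finally show "\<bar>(sqnorm p z - c)\<^sup>2\<bar> \<le> 2 * (1 + c\<^sup>2) * (1 + sqnorm p z powr q)"
    by (simp add: algebra_simps)
qed measurable

lemma integrable_dotp_powr: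
  assumes "0 \<le> r" "r \<le> q"
  shows "integrable P (\<lambda>z. \<bar>dotp p x z\<bar> powr r)"
proof (rule integrable_weight_bound[of _ "1 + (1 + sqnorm p x powr q)"])
  fix z :: "nat \<Rightarrow> real"
  let ?w = "1 + sqnorm p z powr q" and ?v = "1 + sqnorm p x powr q"
  have "\<bar>dotp p x z\<bar> powr r \<le> 1 + \<bar>dotp p x z\<bar> powr q" using assms by (intro powr_le_weight) auto
  also have "\<bar>dotp p x z\<bar> powr q \<le> ?v * ?w" using q by (intro abs_dotp_powr_le) auto
  also have "1 + ?v * ?w \<le> ?w + ?v * ?w" by simp
  finally show "\<bar>\<bar>dotp p x z\<bar> powr r\<bar> \<le> (1 + ?v) * ?w" by (simp add: distrib_right)
qed measurable

end

lemma square_powr_half: "(x\<^sup>2) powr (r / 2) = \<bar>x::real\<bar> powr r"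
proof (cases "x = 0")
  case False
  then have "x\<^sup>2 = \<bar>x\<bar> powr 2" by (simp add: powr_numeral)
  then show ?thesis by (simp only: powr_powr) simp
qed simp

locale cov_law_pair = P: cov_law p S q P + Q: cov_law p T q Q for p S T q P Q
begin

sublocale PQ: pair_prob_space P Q ..

lemma measPQ [simp]: "measurable (P \<Otimes>\<^sub>M Q) N = measurable (vec_space p \<Otimes>\<^sub>M vec_space p) N"
  by (rule vec_law_pair_measurable[OF P.law Q.law])

lemma
  fixes g h :: "(nat \<Rightarrow> real) \<Rightarrow> real"
  assumes g: "integrable P g" and h: "integrable Q h"
  shows integrable_pair_mult: "integrable (P \<Otimes>\<^sub>M Q) (\<lambda>z. g (fst z) * h (snd z))"
    and integral_pair_mult: "(\<integral>z. g (fst z) * h (snd z) \<partial>(P \<Otimes>\<^sub>M Q)) = (\<integral>x. g x \<partial>P) * (\<integral>y. h y \<partial>Q)"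
proof -
  have [measurable]: "g \<in> borel_measurable (vec_space p)" "h \<in> borel_measurable (vec_space p)"
    using borel_measurable_integrable[OF g] borel_measurable_integrable[OF h] by simp_all
  show i: "integrable (P \<Otimes>\<^sub>M Q) (\<lambda>z. g (fst z) * h (snd z))"
    by (rule PQ.Fubini_integrable) (use g h in \<open>auto simp: abs_mult\<close>)
  have "(\<integral>z. g (fst z) * h (snd z) \<partial>(P \<Otimes>\<^sub>M Q)) = (\<integral>x. \<integral>y. g x * h y \<partial>Q \<partial>P)"
    using PQ.integral_fst'[OF i] by simp
  then show "(\<integral>z. g (fst z) * h (snd z) \<partial>(P \<Otimes>\<^sub>M Q)) = (\<integral>x. g x \<partial>P) * (\<integral>y. h y \<partial>Q)"
    by simp
qed

lemma
  fixes g :: "(nat \<Rightarrow> real) \<Rightarrow> real"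
  assumes "integrable P g"
  shows integrable_pair_fst: "integrable (P \<Otimes>\<^sub>M Q) (\<lambda>z. g (fst z))"
    and integral_pair_fst: "(\<integral>z. g (fst z) \<partial>(P \<Otimes>\<^sub>M Q)) = (\<integral>x. g x \<partial>P)"
  using integrable_pair_mult[OF assms, of "\<lambda>_. 1"] integral_pair_mult[OF assms, of "\<lambda>_. 1"]
  by (simp_all add: Q.prob_space)

lemma
  fixes g :: "(nat \<Rightarrow> real) \<Rightarrow> real"
  assumes "integrable Q g"
  shows integrable_pair_snd: "integrable (P \<Otimes>\<^sub>M Q) (\<lambda>z. g (snd z))"
    and integral_pair_snd: "(\<integral>z. g (snd z) \<partial>(P \<Otimes>\<^sub>M Q)) = (\<integral>x. g x \<partial>Q)"
  using integrable_pair_mult[of "\<lambda>_. 1", OF _ assms] integral_pair_mult[of "\<lambda>_. 1", OF _ assms]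
  by (simp_all add: P.prob_space)

lemma integrable_pair_bound:
  fixes F :: "(nat \<Rightarrow> real) \<times> (nat \<Rightarrow> real) \<Rightarrow> real"
  assumes [measurable]: "F \<in> borel_measurable (vec_space p \<Otimes>\<^sub>M vec_space p)"
    and "\<And>x y. \<bar>F (x, y)\<bar> \<le> C * ((1 + sqnorm p x powr q) * (1 + sqnorm p y powr q))"
  shows "integrable (P \<Otimes>\<^sub>M Q) F"
proof (rule Bochner_Integration.integrable_bound)
  show "integrable (P \<Otimes>\<^sub>M Q) (\<lambda>z. C * ((1 + sqnorm p (fst z) powr q) * (1 + sqnorm p (snd z) powr q)))"
    by (intro integrable_mult_right integrable_pair_mult P.integrable_weight Q.integrable_weight)
  show "AE z in P \<Otimes>\<^sub>M Q. norm (F z) \<le> norm (C * ((1 + sqnorm p (fst z) powr q) * (1 + sqnorm p (snd z) powr q)))"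
    using assms(2) by (intro AE_I2) (metis abs_ge_self order_trans real_norm_def prod.collapse)
qed simp

lemma integral_conv:
  fixes F :: "(nat \<Rightarrow> real) \<Rightarrow> real"
  assumes "F \<in> borel_measurable (vec_space p)"
  shows "(\<integral>z. F z \<partial>conv p P Q) = (\<integral>z. F (vadd p (fst z) (snd z)) \<partial>(P \<Otimes>\<^sub>M Q))"
  unfolding conv_def case_prod_beta using assms by (intro integral_distr) simp_all

lemma integrable_conv:
  fixes F :: "(nat \<Rightarrow> real) \<Rightarrow> real"
  assumes "F \<in> borel_measurable (vec_space p)"
  shows "integrable (conv p P Q) F = integrable (P \<Otimes>\<^sub>M Q) (\<lambda>z. F (vadd p (fst z) (snd z)))"
  unfolding conv_def case_prod_beta using assms by (intro integrable_distr_eq) simp_all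

lemma integrable_pair_dotp_powr: "integrable (P \<Otimes>\<^sub>M Q) (\<lambda>z. \<bar>dotp p (fst z) (snd z)\<bar> powr q)"
  using P.q by (intro integrable_pair_bound[of _ 1]) (auto intro!: abs_dotp_powr_le)

lemma integrable_pair_dotp_sq: "integrable (P \<Otimes>\<^sub>M Q) (\<lambda>z. (dotp p (fst z) (snd z))\<^sup>2)"
proof (rule integrable_pair_bound[of _ 1])
  fix x y
  have "(dotp p x y)\<^sup>2 \<le> sqnorm p x * sqnorm p y" by (rule dotp_Cauchy_Schwarz)
  also have "\<dots> \<le> (1 + sqnorm p x powr q) * (1 + sqnorm p y powr q)"
    using P.q by (intro mult_mono le_weight) auto
  finally show "\<bar>(dotp p (fst (x, y)) (snd (x, y)))\<^sup>2\<bar> \<le> 1 * ((1 + sqnorm p x powr q) * (1 + sqnorm p y powr q))" by simp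
qed simp

lemma integral_pair_dotp_sq:
  "(\<integral>z. (dotp p (fst z) (snd z))\<^sup>2 \<partial>(P \<Otimes>\<^sub>M Q)) = (\<Sum>k<p. \<Sum>l<p. T k l * S l k)"
proof -
  have "(\<integral>z. (dotp p (fst z) (snd z))\<^sup>2 \<partial>(P \<Otimes>\<^sub>M Q)) = (\<integral>x. \<integral>y. (dotp p x y)\<^sup>2 \<partial>Q \<partial>P)"
    using PQ.integral_fst'[OF integrable_pair_dotp_sq] by simp
  then show ?thesis by (simp add: Q.integral_dotp_sq P.integral_qform)
qed

lemma cov_law_conv: "cov_law p (\<lambda>k l. S k l + T k l) q (conv p P Q)"
proof (unfold_locales)
  show "vec_law p (conv p P Q)" by (intro vec_law_conv P.law Q.law)
  show "2 \<le> q" "q \<le> 3" by (rule P.q)+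
  have "integrable (P \<Otimes>\<^sub>M Q) (\<lambda>z. sqnorm p (vadd p (fst z) (snd z)) powr q)"
  proof (rule integrable_pair_bound[of _ 64])
    fix x y
    have "sqnorm p (vadd p x y) powr q \<le> (2 * (sqnorm p x + sqnorm p y)) powr q"
      using P.q sqnorm_vadd_le by (intro powr_mono2) auto
    also have "\<dots> = 2 powr q * \<bar>sqnorm p x + sqnorm p y\<bar> powr q" by (subst powr_mult) simp_all
    also have "\<dots> \<le> 2 powr 3 * (8 * (\<bar>sqnorm p x\<bar> powr q + \<bar>sqnorm p y\<bar> powr q))"
      using P.q by (intro mult_mono powr_mono abs_add_powr_le_8) auto
    also have "\<dots> \<le> 64 * ((1 + sqnorm p x powr q) * (1 + sqnorm p y powr q))"
      by (simp add: algebra_simps)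
    finally show "\<bar>sqnorm p (vadd p (fst (x, y)) (snd (x, y))) powr q\<bar>
      \<le> 64 * ((1 + sqnorm p x powr q) * (1 + sqnorm p y powr q))" by simp
  qed simp
  then show "integrable (conv p P Q) (\<lambda>z. sqnorm p z powr q)" by (subst integrable_conv) auto
  fix k assume k: "k < p"
  have a: "vadd p x y k = x k + y k" for x y using k by (simp add: vadd_def)
  show "(\<integral>z. z k \<partial>conv p P Q) = 0"
    using k integrable_pair_fst[OF P.integrable_component[OF k]] integral_pair_fst[OF P.integrable_component[OF k]]
      integrable_pair_snd[OF Q.integrable_component[OF k]] integral_pair_snd[OF Q.integrable_component[OF k]]
    by (subst integral_conv) (auto simp: a P.mean Q.mean intro: vec_component_measurable_self)
  fix l assume l: "l < p"
  have b: "vadd p x y l = x l + y l" for x y using l by (simp add: vadd_def)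
  have "(\<integral>z. z k * z l \<partial>conv p P Q) = (\<integral>z. fst z k * fst z l + fst z k * snd z l + (fst z l * snd z k + snd z k * snd z l) \<partial>(P \<Otimes>\<^sub>M Q))"
    using k l by (subst integral_conv) (auto simp: a b algebra_simps intro!: borel_measurable_times vec_component_measurable_self)
  also have "\<dots> = S k l + 0 + (0 + T k l)"
    using k l integrable_pair_fst[OF P.integrable_component_mult[OF k l]] integral_pair_fst[OF P.integrable_component_mult[OF k l]]
      integrable_pair_snd[OF Q.integrable_component_mult[OF k l]] integral_pair_snd[OF Q.integrable_component_mult[OF k l]]
      integrable_pair_mult[OF P.integrable_component[OF k] Q.integrable_component[OF l]]
      integral_pair_mult[OF P.integrable_component[OF k] Q.integrable_component[OF l]]
      integrable_pair_mult[OF P.integrable_component[OF l] Q.integrable_component[OF k]]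
      integral_pair_mult[OF P.integrable_component[OF l] Q.integrable_component[OF k]]
    by (simp add: P.cov Q.cov P.mean Q.mean)
  finally show "(\<integral>z. z k * z l \<partial>conv p P Q) = S k l + T k l" by simp
qed

text \<open>The squared norm of \<open>x + y\<close> splits into two centred squared norms and twice
  an inner product. These three are orthogonal in L2, so their second moments add up.\<close>

lemma variance_conv:
  "(\<integral>z. (sqnorm p z - (f1 p S + f1 p T))\<^sup>2 \<partial>conv p P Q) =
     (\<integral>z. (sqnorm p z - f1 p S)\<^sup>2 \<partial>P) + (\<integral>z. (sqnorm p z - f1 p T)\<^sup>2 \<partial>Q) + 4 * (\<Sum>k<p. \<Sum>l<p. T k l * S l k)"
proof -
  define a where "a = (\<lambda>z::(nat \<Rightarrow> real) \<times> (nat \<Rightarrow> real). sqnorm p (fst z) - f1 p S)"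
  define b where "b = (\<lambda>z::(nat \<Rightarrow> real) \<times> (nat \<Rightarrow> real). 2 * dotp p (fst z) (snd z))"
  define c where "c = (\<lambda>z::(nat \<Rightarrow> real) \<times> (nat \<Rightarrow> real). sqnorm p (snd z) - f1 p T)"
  have m [measurable]: "a \<in> borel_measurable (P \<Otimes>\<^sub>M Q)" "b \<in> borel_measurable (P \<Otimes>\<^sub>M Q)" "c \<in> borel_measurable (P \<Otimes>\<^sub>M Q)"
    by (simp_all add: a_def b_def c_def)
  have ia: "integrable (P \<Otimes>\<^sub>M Q) (\<lambda>z. (a z)\<^sup>2)"
    unfolding a_def using integrable_pair_fst[OF P.integrable_sqnorm_sq] by simp
  have ic: "integrable (P \<Otimes>\<^sub>M Q) (\<lambda>z. (c z)\<^sup>2)"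
    unfolding c_def using integrable_pair_snd[OF Q.integrable_sqnorm_sq] by simp
  have ib: "integrable (P \<Otimes>\<^sub>M Q) (\<lambda>z. (b z)\<^sup>2)"
    unfolding b_def power_mult_distrib using integrable_pair_dotp_sq by simp
  have cross: "integrable (P \<Otimes>\<^sub>M Q) (\<lambda>z. u z * v z)"
    if "integrable (P \<Otimes>\<^sub>M Q) (\<lambda>z. (u z)\<^sup>2)" "integrable (P \<Otimes>\<^sub>M Q) (\<lambda>z. (v z)\<^sup>2)"
      and [measurable]: "u \<in> borel_measurable (P \<Otimes>\<^sub>M Q)" "v \<in> borel_measurable (P \<Otimes>\<^sub>M Q)" for u v :: "_ \<Rightarrow> real"
  proof (rule Bochner_Integration.integrable_bound)
    show "integrable (P \<Otimes>\<^sub>M Q) (\<lambda>z. (u z)\<^sup>2 + (v z)\<^sup>2)" using that by simp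
    show "AE z in P \<Otimes>\<^sub>M Q. norm (u z * v z) \<le> norm ((u z)\<^sup>2 + (v z)\<^sup>2)"
    proof (rule AE_I2)
      fix z
      have "2 * (\<bar>u z\<bar> * \<bar>v z\<bar>) \<le> (u z)\<^sup>2 + (v z)\<^sup>2" using sum_squares_bound[of "\<bar>u z\<bar>" "\<bar>v z\<bar>"] by simp
      then show "norm (u z * v z) \<le> norm ((u z)\<^sup>2 + (v z)\<^sup>2)"
        using mult_nonneg_nonneg[of "\<bar>u z\<bar>" "\<bar>v z\<bar>"] by (simp add: abs_mult del: zero_le_mult_iff mult_nonneg_nonneg)
    qed
    show "(\<lambda>z. u z * v z) \<in> borel_measurable (P \<Otimes>\<^sub>M Q)" by (rule borel_measurable_times that(3,4))+
  qed
  note iab = cross[OF ia ib m(1,2)] and iac = cross[OF ia ic m(1,3)] and ibc = cross[OF ib ic m(2,3)]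
  \<comment> \<open>The inner product is linear in \<open>y\<close>, which is centred, so
    \<open>y\<close> is integrated first.\<close>
  have "(\<integral>z. a z * b z \<partial>(P \<Otimes>\<^sub>M Q)) = (\<integral>x. \<integral>y. a (x, y) * b (x, y) \<partial>Q \<partial>P)"
    using PQ.integral_fst'[OF iab] by simp
  also have "\<dots> = 0" by (simp add: a_def b_def Q.integral_dotp)
  finally have eab: "(\<integral>z. a z * b z \<partial>(P \<Otimes>\<^sub>M Q)) = 0" .
  \<comment> \<open>Here the other factor depends on \<open>y\<close>, so the order is reversed and
    the centring of \<open>x\<close> is used.\<close>
  have "(\<integral>z. b z * c z \<partial>(P \<Otimes>\<^sub>M Q)) = (\<integral>y. \<integral>x. b (x, y) * c (x, y) \<partial>P \<partial>Q)"
    using PQ.integral_snd[of "\<lambda>x y. b (x, y) * c (x, y)"] ibc unfolding split_def prod.collapse by simp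
  also have "\<dots> = 0" by (simp add: c_def b_def dotp_commute[of p _ "_::nat\<Rightarrow>real"] P.integral_dotp)
  finally have ebc: "(\<integral>z. b z * c z \<partial>(P \<Otimes>\<^sub>M Q)) = 0" .
  have eac: "(\<integral>z. a z * c z \<partial>(P \<Otimes>\<^sub>M Q)) = 0"
    unfolding a_def c_def using P.integrable_sqnorm Q.integrable_sqnorm
    by (subst integral_pair_mult[of "\<lambda>x. sqnorm p x - f1 p S" "\<lambda>x. sqnorm p x - f1 p T"])
       (auto simp: P.integral_sqnorm P.prob_space)
  have "(\<integral>z. (sqnorm p z - (f1 p S + f1 p T))\<^sup>2 \<partial>conv p P Q)
    = (\<integral>z. (a z)\<^sup>2 + (c z)\<^sup>2 + (b z)\<^sup>2 + 2 * (a z * b z) + 2 * (b z * c z) + 2 * (a z * c z) \<partial>(P \<Otimes>\<^sub>M Q))"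
    by (subst integral_conv)
       (auto simp: a_def b_def c_def sqnorm_vadd power2_eq_square algebra_simps intro!: Bochner_Integration.integral_cong)
  also have "\<dots> = (\<integral>z. (a z)\<^sup>2 \<partial>(P \<Otimes>\<^sub>M Q)) + (\<integral>z. (c z)\<^sup>2 \<partial>(P \<Otimes>\<^sub>M Q)) + (\<integral>z. (b z)\<^sup>2 \<partial>(P \<Otimes>\<^sub>M Q))"
    using ia ib ic iab iac ibc by (simp add: eab ebc eac)
  also have "(\<integral>z. (a z)\<^sup>2 \<partial>(P \<Otimes>\<^sub>M Q)) = (\<integral>z. (sqnorm p z - f1 p S)\<^sup>2 \<partial>P)"
    unfolding a_def by (rule integral_pair_fst[OF P.integrable_sqnorm_sq])
  also have "(\<integral>z. (c z)\<^sup>2 \<partial>(P \<Otimes>\<^sub>M Q)) = (\<integral>z. (sqnorm p z - f1 p T)\<^sup>2 \<partial>Q)"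
    unfolding c_def by (rule integral_pair_snd[OF Q.integrable_sqnorm_sq])
  also have "(\<integral>z. (b z)\<^sup>2 \<partial>(P \<Otimes>\<^sub>M Q)) = 4 * (\<Sum>k<p. \<Sum>l<p. T k l * S l k)"
    unfolding b_def power_mult_distrib by (simp add: integral_pair_dotp_sq)
  finally show ?thesis .
qed

end

lemma cov_law_cong: "cov_law p S q P \<Longrightarrow> (\<And>k l. k < p \<Longrightarrow> l < p \<Longrightarrow> S k l = T k l) \<Longrightarrow> cov_law p T q P"
  by (simp add: cov_law_def)

lemma (in cov_law) cov_law_scale: "cov_law p (\<lambda>k l. c\<^sup>2 * S k l) q (scale_law p c P)"
proof (unfold_locales)
  have m: "vscale p c \<in> measurable P (vec_space p)" by simp
  show "vec_law p (scale_law p c P)" by (rule vec_law_scale[OF law])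
  show "2 \<le> q" "q \<le> 3" by (rule q)+
  show "integrable (scale_law p c P) (\<lambda>z. sqnorm p z powr q)"
    unfolding scale_law_def using integrable_powr
    by (subst integrable_distr_eq[OF m]) (auto simp: sqnorm_vscale powr_mult)
  fix k assume k: "k < p"
  show "(\<integral>z. z k \<partial>scale_law p c P) = 0"
    unfolding scale_law_def using mean[OF k] k
    by (subst integral_distr[OF m vec_component_measurable_self[OF k]]) (simp add: vscale_def)
  fix l assume l: "l < p"
  have "(\<integral>z. z k * z l \<partial>scale_law p c P) = (\<integral>z. c\<^sup>2 * (z k * z l) \<partial>P)"
    unfolding scale_law_def using k l
    by (subst integral_distr[OF m borel_measurable_times[OF vec_component_measurable_self[OF k] vec_component_measurable_self[OF l]]])
       (simp add: vscale_def power2_eq_square mult_ac)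
  then show "(\<integral>z. z k * z l \<partial>scale_law p c P) = c\<^sup>2 * S k l" using k l by (simp add: cov)
qed

lemma cov_law_return:
  assumes "2 \<le> q" "q \<le> 3"
  shows "cov_law p (\<lambda>k l. 0) q (return (vec_space p) (vzero p))"
proof (unfold_locales)
  show "vec_law p (return (vec_space p) (vzero p))" by (simp add: vec_law_return)
  have "integrable (return (vec_space p) (vzero p)) (\<lambda>z. sqnorm p z powr q)"
    by (simp add: integrable_iff_bounded nn_integral_return)
  then show "integrable (return (vec_space p) (vzero p)) (\<lambda>z. sqnorm p z powr q)" .
  fix k assume k: "k < p"
  then show "(\<integral>z. z k \<partial>return (vec_space p) (vzero p)) = 0"
    by (subst integral_return) (auto simp: vec_component_measurable_self, simp add: vzero_def)
  fix l assume l: "l < p"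
  show "(\<integral>z. z k * z l \<partial>return (vec_space p) (vzero p)) = 0"
    using k l by (subst integral_return) (auto intro!: borel_measurable_times vec_component_measurable_self, simp add: vzero_def)
qed (rule assms)+

context cov_law
begin

lemma cov_law_walk: "cov_law p (\<lambda>k l. real n * S k l) q (walk p P n)"
proof (induction n)
  case 0
  then show ?case using cov_law_return[OF q] by simp
next
  case (Suc n)
  interpret W: cov_law_pair p "\<lambda>k l. real n * S k l" S q "walk p P n" P
    using Suc cov_law_axioms by (simp add: cov_law_pair_def)
  show ?case unfolding walk.simps by (rule cov_law_cong[OF W.cov_law_conv]) (simp add: algebra_simps)
qed

lemma f1_scale: "f1 p (\<lambda>k l. c * S k l) = c * f1 p S"
  by (simp add: f1_def sum_distrib_left)

text \<open>Each of the \<open>n * (n - 1)\<close> ordered pairs of distinct summands contributes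
  \<open>2 * (f2 p S)^2\<close> through its inner product, and each single summand its own
  variance.\<close>

lemma variance_walk:
  "(\<integral>z. (sqnorm p z - real n * f1 p S)\<^sup>2 \<partial>walk p P n) =
     real n * (\<integral>z. (sqnorm p z - f1 p S)\<^sup>2 \<partial>P) + 2 * real n * (real n - 1) * (f2 p S)\<^sup>2"
proof (induction n)
  case 0
  then show ?case by (simp add: integral_return)
next
  case (Suc n)
  interpret W: cov_law_pair p "\<lambda>k l. real n * S k l" S q "walk p P n" P
    using cov_law_walk cov_law_axioms by (simp add: cov_law_pair_def)
  have "(\<Sum>k<p. \<Sum>l<p. S k l * (real n * S l k)) = real n * (f2 p S)\<^sup>2"
    by (simp add: f2_sq sum_distrib_left mult_ac)
  then show ?case using W.variance_conv Suc by (simp add: f1_scale algebra_simps)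
qed

text \<open>A Rosenthal type inequality for the centred sum of the inner products with
  \<open>x\<close>, by induction on the number of summands: the linear term of
  \<open>abs_add_powr_le\<close> integrates to zero. The constant 16 of the expansion is reproduced
  by the induction.\<close>

lemma abs_moment_walk:
  "(\<integral>s. \<bar>dotp p x s\<bar> powr q \<partial>walk p P n) \<le>
     16 * (real n powr (q / 2) * qform p S x powr (q / 2) + real n * (\<integral>z. \<bar>dotp p x z\<bar> powr q \<partial>P))"
proof (induction n)
  case 0
  then show ?case by (simp add: integral_return)
next
  case (Suc n)
  interpret W: cov_law_pair p "\<lambda>k l. real n * S k l" S q "walk p P n" P
    using cov_law_walk cov_law_axioms by (simp add: cov_law_pair_def)
  let ?v = "qform p S x" and ?m = "\<integral>z. \<bar>dotp p x z\<bar> powr q \<partial>P"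
  let ?s = "\<lambda>s. sgn (dotp p x s) * \<bar>dotp p x s\<bar> powr (q - 1)"
  have qs: "qform p (\<lambda>k l. real n * S k l) x = real n * ?v"
    by (simp add: qform_def sum_distrib_left mult_ac)
  have i0: "integrable (walk p P n) ?s"
    by (rule Bochner_Integration.integrable_bound[OF W.P.integrable_dotp_powr[of "q - 1" x]])
       (use q in \<open>auto simp: abs_mult abs_sgn_eq\<close>)
  have i1: "integrable (walk p P n) (\<lambda>s. \<bar>dotp p x s\<bar> powr r)" if "0 \<le> r" "r \<le> q" for r
    using W.P.integrable_dotp_powr that by blast
  have i2: "integrable P (\<lambda>z. \<bar>dotp p x z\<bar> powr q)" using integrable_dotp_powr[of q x] q by simp
  have "(\<integral>s. \<bar>dotp p x s\<bar> powr q \<partial>walk p P (Suc n)) =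
      (\<integral>z. \<bar>dotp p x (fst z) + dotp p x (snd z)\<bar> powr q \<partial>(walk p P n \<Otimes>\<^sub>M P))"
    unfolding walk.simps by (subst W.integral_conv) (simp_all add: dotp_vadd_right)
  also have "\<dots> \<le> (\<integral>z. \<bar>dotp p x (fst z)\<bar> powr q + q * (?s (fst z) * dotp p x (snd z))
     + 16 * (\<bar>dotp p x (fst z)\<bar> powr (q - 2) * (dotp p x (snd z))\<^sup>2 + \<bar>dotp p x (snd z)\<bar> powr q) \<partial>(walk p P n \<Otimes>\<^sub>M P))"
  proof (rule integral_mono)
    have "cov_law p (\<lambda>k l. real (Suc n) * S k l) q (walk p P (Suc n))" by (rule cov_law_walk)
    then have "integrable (conv p (walk p P n) P) (\<lambda>z. \<bar>dotp p x z\<bar> powr q)"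
      using cov_law.integrable_dotp_powr[of p _ q _ q x] q by fastforce
    then show "integrable (walk p P n \<Otimes>\<^sub>M P) (\<lambda>z. \<bar>dotp p x (fst z) + dotp p x (snd z)\<bar> powr q)"
      by (subst (asm) W.integrable_conv) (simp_all add: dotp_vadd_right)
    show "integrable (walk p P n \<Otimes>\<^sub>M P) (\<lambda>z. \<bar>dotp p x (fst z)\<bar> powr q + q * (?s (fst z) * dotp p x (snd z))
     + 16 * (\<bar>dotp p x (fst z)\<bar> powr (q - 2) * (dotp p x (snd z))\<^sup>2 + \<bar>dotp p x (snd z)\<bar> powr q))"
      using q W.integrable_pair_fst[OF i1[of q]] W.integrable_pair_mult[OF i0 integrable_dotp[of x]]
        W.integrable_pair_mult[OF i1[of "q - 2"] integrable_dotp_sq[of x]] W.integrable_pair_snd[OF i2]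
      by (intro Bochner_Integration.integrable_add integrable_mult_right) auto
    show "\<bar>dotp p x (fst z) + dotp p x (snd z)\<bar> powr q \<le> \<bar>dotp p x (fst z)\<bar> powr q + q * (?s (fst z) * dotp p x (snd z))
     + 16 * (\<bar>dotp p x (fst z)\<bar> powr (q - 2) * (dotp p x (snd z))\<^sup>2 + \<bar>dotp p x (snd z)\<bar> powr q)" for z
      using abs_add_powr_le[OF q, of "dotp p x (fst z)" "dotp p x (snd z)"] by (simp add: mult.assoc)
  qed
  also have "\<dots> = (\<integral>s. \<bar>dotp p x s\<bar> powr q \<partial>walk p P n) + 16 * ((\<integral>s. \<bar>dotp p x s\<bar> powr (q - 2) \<partial>walk p P n) * ?v + ?m)"
    using q W.integrable_pair_fst[OF i1[of q]] W.integral_pair_fst[OF i1[of q]]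
      W.integrable_pair_mult[OF i0 integrable_dotp[of x]] W.integral_pair_mult[OF i0 integrable_dotp[of x]]
      W.integrable_pair_mult[OF i1[of "q - 2"] integrable_dotp_sq[of x]] W.integral_pair_mult[OF i1[of "q - 2"] integrable_dotp_sq[of x]]
      W.integrable_pair_snd[OF i2] W.integral_pair_snd[OF i2]
    by (simp add: integral_dotp integral_dotp_sq)
  also have "(\<integral>s. \<bar>dotp p x s\<bar> powr (q - 2) \<partial>walk p P n) * ?v \<le> real n powr ((q - 2) / 2) * ?v powr (q / 2)"
  \<comment> \<open>The tangent line below is scaled by this variance. If it vanishes, either
    \<open>?v\<close> is 0 or the walk has no step and sits at the origin, where
    \<open>0 powr (q - 2)\<close> is 0.\<close>
  proof (cases "real n * ?v = 0")
    case True
    show ?thesis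
    proof (cases "?v = 0")
      case False
      then have "n = 0" using True by simp
      then show ?thesis by (simp add: integral_return)
    qed simp
  next
    case False
    define \<sigma> where "\<sigma> = real n * ?v"
    have v: "0 < ?v" using False qform_nonneg[of x] by (cases "?v = 0") simp_all
    have \<sigma>: "0 < \<sigma>" using False v by (simp add: \<sigma>_def)
    \<comment> \<open>Jensen's inequality for the concave power \<open>(q - 2) / 2\<close> of the
      squared inner product, through the tangent line at its mean \<open>\<sigma>\<close>.\<close>
    have "(\<integral>s. \<bar>dotp p x s\<bar> powr (q - 2) \<partial>walk p P n) \<le>
       (\<integral>s. \<sigma> powr ((q - 2) / 2) * (1 + (q - 2) / 2 * ((dotp p x s)\<^sup>2 / \<sigma> - 1)) \<partial>walk p P n)"
    proof (rule integral_mono)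
      fix s
      have "\<bar>dotp p x s\<bar> powr (q - 2) = (\<sigma> * ((dotp p x s)\<^sup>2 / \<sigma>)) powr ((q - 2) / 2)"
      proof -
        have "\<sigma> * ((dotp p x s)\<^sup>2 / \<sigma>) = (dotp p x s)\<^sup>2" using \<sigma> by simp
        then show ?thesis by (simp only: square_powr_half)
      qed
      also have "\<dots> = \<sigma> powr ((q - 2) / 2) * ((dotp p x s)\<^sup>2 / \<sigma>) powr ((q - 2) / 2)"
        by (rule powr_mult)
      also have "\<dots> \<le> \<sigma> powr ((q - 2) / 2) * (1 + (q - 2) / 2 * ((dotp p x s)\<^sup>2 / \<sigma> - 1))"
        using q \<sigma> by (intro mult_left_mono powr_le_affine) auto
      finally show "\<bar>dotp p x s\<bar> powr (q - 2) \<le> \<sigma> powr ((q - 2) / 2) * (1 + (q - 2) / 2 * ((dotp p x s)\<^sup>2 / \<sigma> - 1))" .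
    next
      show "integrable (walk p P n) (\<lambda>s. \<bar>dotp p x s\<bar> powr (q - 2))" using i1[of "q - 2"] q by simp
      show "integrable (walk p P n) (\<lambda>s. \<sigma> powr ((q - 2) / 2) * (1 + (q - 2) / 2 * ((dotp p x s)\<^sup>2 / \<sigma> - 1)))"
        using W.P.integrable_dotp_sq[of x]
        by (intro integrable_mult_right Bochner_Integration.integrable_add Bochner_Integration.integrable_diff integrable_divide_zero W.P.integrable_const)
    qed
    also have "\<dots> = \<sigma> powr ((q - 2) / 2)"
      using W.P.integrable_dotp_sq[of x] \<sigma> by (simp add: W.P.integral_dotp_sq qs \<sigma>_def[symmetric] W.P.prob_space)
    finally have "(\<integral>s. \<bar>dotp p x s\<bar> powr (q - 2) \<partial>walk p P n) * ?v \<le> \<sigma> powr ((q - 2) / 2) * ?v"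
      using v by (intro mult_right_mono) auto
    also have "\<dots> = real n powr ((q - 2) / 2) * (?v powr ((q - 2) / 2) * ?v powr 1)"
      using v by (simp add: \<sigma>_def powr_mult)
    also have "?v powr ((q - 2) / 2) * ?v powr 1 = ?v powr (q / 2)"
      by (subst powr_add[symmetric]) (simp add: field_simps)
    finally show ?thesis .
  qed
  finally have *: "(\<integral>s. \<bar>dotp p x s\<bar> powr q \<partial>walk p P (Suc n)) \<le>
     16 * (real n powr (q / 2) * ?v powr (q / 2) + real n * ?m) + 16 * (real n powr ((q - 2) / 2) * ?v powr (q / 2) + ?m)"
    using Suc by simp
  \<comment> \<open>The left side equals \<open>n + 1\<close> times the power
    \<open>(q - 2) / 2\<close> of \<open>n\<close>; this closes the induction without increasing the
    constant.\<close>
  have "real n powr (q / 2) + real n powr ((q - 2) / 2) \<le> real (Suc n) powr (q / 2)"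
  proof -
    have e: "t powr (q / 2) = t * t powr ((q - 2) / 2)" if "0 \<le> t" for t :: real
      using that powr_add[of t 1 "(q - 2) / 2"] by (simp add: field_simps)
    have "real n powr (q / 2) + real n powr ((q - 2) / 2) = real (Suc n) * real n powr ((q - 2) / 2)"
      by (simp add: e algebra_simps)
    also have "\<dots> \<le> real (Suc n) * real (Suc n) powr ((q - 2) / 2)"
      using q by (intro mult_left_mono powr_mono2) auto
    finally show ?thesis by (simp add: e)
  qed
  then have "(real n powr (q / 2) + real n powr ((q - 2) / 2)) * ?v powr (q / 2) \<le> real (Suc n) powr (q / 2) * ?v powr (q / 2)"
    by (intro mult_right_mono) auto
  then show ?case using * by (simp add: algebra_simps)
qed

end

subsection \<open>The Gaussian law\<close>

text \<open>\<open>a r\<close> is the r-th row of a square factor of \<open>S\<close>. Any factor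
  will do, so neither eigenvectors nor invertibility are required, and degenerate \<open>S\<close>
  is included.\<close>

locale gauss_factor =
  fixes p :: nat and S a :: "nat \<Rightarrow> nat \<Rightarrow> real" and q :: real
  assumes S_eq: "k < p \<Longrightarrow> l < p \<Longrightarrow> S k l = (\<Sum>r<p. a r k * a r l)"
    and q_range: "2 \<le> q" "q \<le> 3"
begin

definition lin :: "(nat \<Rightarrow> real) \<Rightarrow> nat \<Rightarrow> real" where
  "lin \<xi> = (\<lambda>k\<in>{..<p}. \<Sum>r<p. a r k * \<xi> r)"

definition G :: "(nat \<Rightarrow> real) measure" where
  "G = distr (std_gauss {..<p}) (vec_space p) lin"

lemma measurable_std_gauss: "measurable (std_gauss I) N = measurable (PiM I (\<lambda>_. borel)) N"
proof -
  have "sets (std_gauss I) = sets (PiM I (\<lambda>_. borel :: real measure))" by (intro sets_PiM_cong) auto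
  then show ?thesis by (simp cong: measurable_cong_sets)
qed

lemma lin_measurable [measurable]: "lin \<in> measurable (PiM {..<p} (\<lambda>_. borel)) (vec_space p)"
  unfolding lin_def by (subst vec_space_def, rule measurable_restrict) measurable

lemma law_G: "vec_law p G"
  unfolding vec_law_def G_def
  by (intro conjI prob_space.prob_space_distr prob_space_std_gauss) (simp_all add: measurable_std_gauss)

sublocale G: prob_space G using law_G vec_lawD by auto

lemma measG [simp]: "measurable G N = measurable (vec_space p) N"
  using vec_lawD(2)[OF law_G] by (simp cong: measurable_cong_sets)

lemma nn_integral_G:
  assumes "F \<in> borel_measurable (vec_space p)"
  shows "(\<integral>\<^sup>+z. F z \<partial>G) = (\<integral>\<^sup>+\<xi>. F (lin \<xi>) \<partial>std_gauss {..<p})"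
  unfolding G_def using assms by (intro nn_integral_distr) (simp_all add: measurable_std_gauss)

lemma sum_dotp_factor_sq: "(\<Sum>r<p. (dotp p (a r) x)\<^sup>2) = qform p S x"
proof -
  have "(\<Sum>r<p. (dotp p (a r) x)\<^sup>2) = (\<Sum>r<p. \<Sum>k<p. \<Sum>l<p. x k * (a r k * a r l) * x l)"
    by (simp add: dotp_def power2_eq_square sum_product mult_ac)
  also have "\<dots> = (\<Sum>k<p. \<Sum>l<p. \<Sum>r<p. x k * (a r k * a r l) * x l)"
    by (subst sum.swap, intro sum.cong refl sum.swap)
  also have "\<dots> = qform p S x"
    unfolding qform_def by (intro sum.cong refl) (simp add: S_eq sum_distrib_left sum_distrib_right)
  finally show ?thesis .
qed

lemma qform_S_nonneg: "0 \<le> qform p S x"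
  unfolding sum_dotp_factor_sq[symmetric] by (simp add: sum_nonneg)

lemma nn_integral_G_dotp:
  assumes "f \<in> borel_measurable borel"
  shows "(\<integral>\<^sup>+z. f (dotp p x z) \<partial>G) = (\<integral>\<^sup>+t. f (sqrt (qform p S x) * t) \<partial>std_normal_distribution)"
proof -
  have "dotp p x (lin \<xi>) = (\<Sum>r<p. dotp p (a r) x * \<xi> r)" for \<xi>
    unfolding dotp_def lin_def sum_distrib_right
    by (subst sum.swap) (simp add: sum_distrib_left mult_ac)
  moreover have "(\<lambda>z. f (dotp p x z)) \<in> borel_measurable (vec_space p)" using assms by simp
  ultimately show ?thesis
    using nn_integral_std_gauss_linear[OF _ assms, of "{..<p}" "\<lambda>r. dotp p (a r) x"]
    by (simp add: nn_integral_G sum_dotp_factor_sq)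
qed

lemma distr_G_dotp:
  "distr G borel (dotp p x) = distr std_normal_distribution borel (\<lambda>t. sqrt (qform p S x) * t)"
proof (rule measure_eqI)
  fix A assume "A \<in> sets (distr G borel (dotp p x))"
  then have A[measurable]: "A \<in> sets borel" by simp
  have [measurable]: "dotp p x \<in> borel_measurable (vec_space p)" by measurable
  have "emeasure (distr G borel (dotp p x)) A = (\<integral>\<^sup>+y. indicator A y \<partial>distr G borel (dotp p x))" by simp
  also have "\<dots> = (\<integral>\<^sup>+z. indicator A (dotp p x z) \<partial>G)" by (subst nn_integral_distr) auto
  also have "\<dots> = (\<integral>\<^sup>+t. indicator A (sqrt (qform p S x) * t) \<partial>std_normal_distribution)"
    by (rule nn_integral_G_dotp) simp
  also have "\<dots> = (\<integral>\<^sup>+y. indicator A y \<partial>distr std_normal_distribution borel (\<lambda>t. sqrt (qform p S x) * t))"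
    by (subst nn_integral_distr) auto
  finally show "emeasure (distr G borel (dotp p x)) A
      = emeasure (distr std_normal_distribution borel (\<lambda>t. sqrt (qform p S x) * t)) A" by simp
qed simp

lemma
  fixes f :: "real \<Rightarrow> real"
  assumes [measurable]: "f \<in> borel_measurable borel"
  shows integrable_G_dotp: "integrable G (\<lambda>z. f (dotp p x z)) \<longleftrightarrow>
      integrable std_normal_distribution (\<lambda>t. f (sqrt (qform p S x) * t))"
    and integral_G_dotp: "(\<integral>z. f (dotp p x z) \<partial>G) = (\<integral>t. f (sqrt (qform p S x) * t) \<partial>std_normal_distribution)"
proof -
  have [measurable]: "dotp p x \<in> borel_measurable (vec_space p)" by measurable
  show "integrable G (\<lambda>z. f (dotp p x z)) \<longleftrightarrow> integrable std_normal_distribution (\<lambda>t. f (sqrt (qform p S x) * t))"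
    using integrable_distr_eq[of "dotp p x" G borel f]
      integrable_distr_eq[of "\<lambda>t. sqrt (qform p S x) * t" std_normal_distribution borel f]
    by (simp add: distr_G_dotp)
  show "(\<integral>z. f (dotp p x z) \<partial>G) = (\<integral>t. f (sqrt (qform p S x) * t) \<partial>std_normal_distribution)"
    using integral_distr[of "dotp p x" G borel f]
      integral_distr[of "\<lambda>t. sqrt (qform p S x) * t" std_normal_distribution borel f]
    by (simp add: distr_G_dotp)
qed

lemma integrable_G_dotp_pow: "integrable G (\<lambda>z. dotp p x z ^ j)"
  using integrable_std_normal_distribution_moment[of j]
  by (subst integrable_G_dotp[of "\<lambda>t. t ^ j"]) (auto simp: power_mult_distrib)

lemma integral_G_dotp_pow:
  "(\<integral>z. dotp p x z ^ j \<partial>G) = sqrt (qform p S x) ^ j * (\<integral>t. t ^ j \<partial>std_normal_distribution)"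
  by (subst integral_G_dotp[of "\<lambda>t. t ^ j"]) (auto simp: power_mult_distrib)

lemma integral_G_dotp_sq: "(\<integral>z. (dotp p x z)\<^sup>2 \<partial>G) = qform p S x"
  using std_normal_moment_even[of 1]
  by (simp add: integral_G_dotp_pow qform_S_nonneg integral_density has_bochner_integral_iff)

lemma integrable_sum_abs_powr:
  fixes f :: "'i \<Rightarrow> 'x \<Rightarrow> real"
  assumes "finite A" "\<And>i. i \<in> A \<Longrightarrow> f i \<in> borel_measurable M" "\<And>i. i \<in> A \<Longrightarrow> integrable M (\<lambda>x. \<bar>f i x\<bar> powr q)"
  shows "integrable M (\<lambda>x. \<bar>\<Sum>i\<in>A. f i x\<bar> powr q)"
  using assms
proof (induction A rule: finite_induct)
  case (insert i A)
  have [measurable]: "f i \<in> borel_measurable M" "(\<lambda>x. \<Sum>i\<in>A. f i x) \<in> borel_measurable M"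
    using insert.prems by (auto intro: borel_measurable_sum)
  have "integrable M (\<lambda>x. \<bar>f i x + (\<Sum>i\<in>A. f i x)\<bar> powr q)"
  proof (rule Bochner_Integration.integrable_bound)
    show "integrable M (\<lambda>x. 8 * (\<bar>f i x\<bar> powr q + \<bar>\<Sum>i\<in>A. f i x\<bar> powr q))" using insert by auto
    show "AE x in M. norm (\<bar>f i x + (\<Sum>i\<in>A. f i x)\<bar> powr q) \<le> norm (8 * (\<bar>f i x\<bar> powr q + \<bar>\<Sum>i\<in>A. f i x\<bar> powr q))"
      using q_range by (intro AE_I2) (simp del: distrib_left_numeral add: abs_add_powr_le_8)
  qed measurable
  then show ?case using insert.hyps by simp
qed simp

definition unit :: "nat \<Rightarrow> nat \<Rightarrow> real" where "unit k j = (if j = k then 1 else 0)"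

lemma dotp_unit: "k < p \<Longrightarrow> dotp p (unit k) z = z k"
  by (simp add: dotp_def unit_def if_distrib if_distribR cong: if_cong)

lemma sum_unit_unit:
  assumes "k < p" "l < p"
  shows "(\<Sum>i<p. unit k i * (\<Sum>j<p. A i j * unit l j)) = A k l"
proof -
  have "unit k i * (\<Sum>j<p. A i j * unit l j) = (if i = k then A k l else 0)" for i
    using assms by (auto simp: unit_def if_distrib cong: if_cong)
  then show ?thesis using assms by simp
qed

lemma qform_units:
  assumes "k < p" "l < p"
  shows "qform p S (\<lambda>j. unit k j + c * unit l j) = S k k + 2 * c * S k l + c\<^sup>2 * S l l"
proof -
  have "qform p S (\<lambda>j. unit k j + c * unit l j) =
      (\<Sum>i<p. \<Sum>j<p. unit k i * (S i j * unit k j) + c * (unit k i * (S i j * unit l j))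
        + c * (unit l i * (S i j * unit k j)) + c\<^sup>2 * (unit l i * (S i j * unit l j)))"
    unfolding qform_def by (intro sum.cong refl) (simp add: algebra_simps power2_eq_square)
  also have "\<dots> = S k k + c * S k l + c * S l k + c\<^sup>2 * S l l"
    using assms by (simp add: sum.distrib sum_distrib_left[symmetric] sum_unit_unit)
  also have "S l k = S k l" using assms by (simp add: S_eq mult.commute)
  finally show ?thesis by simp
qed

lemma dotp_units: "k < p \<Longrightarrow> l < p \<Longrightarrow> dotp p (\<lambda>j. unit k j + c * unit l j) z = z k + c * z l"
  using dotp_unit[of k z] dotp_unit[of l z]
  by (simp add: dotp_def distrib_right sum.distrib sum_distrib_left[symmetric] mult.assoc)

sublocale G: cov_law p S q G
proof
  show "vec_law p G" by (rule law_G)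
  show "2 \<le> q" "q \<le> 3" by (rule q_range)+
  have "integrable G (\<lambda>z. \<bar>\<Sum>k<p. z k * z k\<bar> powr q)"
  proof (rule integrable_sum_abs_powr)
    fix k assume "k \<in> {..<p}"
    then have k: "k < p" by simp
    show [measurable]: "(\<lambda>z. z k * z k) \<in> borel_measurable G"
      using k by (simp add: vec_component_measurable_self borel_measurable_times)
    show "integrable G (\<lambda>z. \<bar>z k * z k\<bar> powr q)"
    proof (rule Bochner_Integration.integrable_bound)
      show "integrable G (\<lambda>z. 1 + z k ^ 8)" using integrable_G_dotp_pow[of "unit k" 8] k by (simp add: dotp_unit)
      show "AE z in G. norm (\<bar>z k * z k\<bar> powr q) \<le> norm (1 + z k ^ 8)"
      proof (rule AE_I2)
        fix z :: "nat \<Rightarrow> real"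
        \<comment> \<open>Since \<open>q\<close> is at most 4, the power of the square is controlled
          by the eighth moment of a normal variable.\<close>
        have "(z k * z k) ^ 4 = z k ^ 8" by (simp add: power_mult_distrib flip: power_add)
        then show "norm (\<bar>z k * z k\<bar> powr q) \<le> norm (1 + z k ^ 8)"
          using abs_powr_le_1_plus_pow4[of q "z k * z k"] q_range by simp
      qed
    qed measurable
  qed simp
  then show "integrable G (\<lambda>z. sqnorm p z powr q)"
    by (simp add: sqnorm_def dotp_def sum_nonneg)
  fix k assume k: "k < p"
  show "(\<integral>z. z k \<partial>G) = 0"
    using integral_G_dotp_pow[of "unit k" 1] integral_std_normal_distribution_moment_odd[of 1] k
    by (simp add: dotp_unit)
  fix l assume l: "l < p"
  have i: "integrable G (\<lambda>z. (z k + c * z l)\<^sup>2)" for c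
    using integrable_G_dotp_pow[of "\<lambda>j. unit k j + c * unit l j" 2] k l by (simp add: dotp_units)
  have e: "(\<integral>z. (z k + c * z l)\<^sup>2 \<partial>G) = S k k + 2 * c * S k l + c\<^sup>2 * S l l" for c
    using integral_G_dotp_sq[of "\<lambda>j. unit k j + c * unit l j"] k l by (simp add: dotp_units qform_units)
  \<comment> \<open>Polarisation: the covariance is recovered from the variances along the sum and
    the difference of two unit vectors.\<close>
  have "(\<integral>z. z k * z l \<partial>G) = (\<integral>z. ((z k + 1 * z l)\<^sup>2 - (z k + (-1) * z l)\<^sup>2) / 4 \<partial>G)"
    by (intro Bochner_Integration.integral_cong) (auto simp: power2_eq_square algebra_simps)
  also have "\<dots> = ((\<integral>z. (z k + 1 * z l)\<^sup>2 \<partial>G) - (\<integral>z. (z k + (-1) * z l)\<^sup>2 \<partial>G)) / 4"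
    using i[of 1] i[of "-1"] by simp
  also have "\<dots> = S k l" unfolding e by simp
  finally show "(\<integral>z. z k * z l \<partial>G) = S k l" .
qed

lemma lin_rotate:
  "vadd p (vscale p c (lin \<xi>)) (vscale p s (lin \<eta>)) = lin (\<lambda>i\<in>{..<p}. c * \<xi> i + s * \<eta> i)"
  by (auto simp: vadd_def vscale_def lin_def fun_eq_iff sum.distrib algebra_simps sum_distrib_left)

lemma nn_integral_G_G:
  fixes F :: "(nat \<Rightarrow> real) \<times> (nat \<Rightarrow> real) \<Rightarrow> ennreal"
  assumes [measurable]: "F \<in> borel_measurable (vec_space p \<Otimes>\<^sub>M vec_space p)"
  shows "(\<integral>\<^sup>+x. \<integral>\<^sup>+y. F (x, y) \<partial>G \<partial>G) = (\<integral>\<^sup>+\<xi>. \<integral>\<^sup>+\<eta>. F (lin \<xi>, lin \<eta>) \<partial>std_gauss {..<p} \<partial>std_gauss {..<p})"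
proof -
  note [measurable_cong] = vec_lawD(2)[OF law_G]
  have "(\<integral>\<^sup>+x. \<integral>\<^sup>+y. F (x, y) \<partial>G \<partial>G) = (\<integral>\<^sup>+\<xi>. \<integral>\<^sup>+y. F (lin \<xi>, y) \<partial>G \<partial>std_gauss {..<p})"
    by (rule nn_integral_G) measurable
  also have "\<dots> = (\<integral>\<^sup>+\<xi>. \<integral>\<^sup>+\<eta>. F (lin \<xi>, lin \<eta>) \<partial>std_gauss {..<p} \<partial>std_gauss {..<p})"
  proof (intro nn_integral_cong nn_integral_G)
    fix \<xi> :: "nat \<Rightarrow> real"
    have "lin \<xi> \<in> space (vec_space p)" by (simp add: lin_def space_vec_space)
    then show "(\<lambda>y. F (lin \<xi>, y)) \<in> borel_measurable (vec_space p)" by measurable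
  qed
  finally show ?thesis .
qed

text \<open>A linear map commutes with the rotation of a pair of vectors, so the invariance is
  inherited from the standard Gaussian pair.\<close>

lemma nn_integral_G_rotation:
  fixes F :: "(nat \<Rightarrow> real) \<times> (nat \<Rightarrow> real) \<Rightarrow> ennreal"
  assumes cs: "c\<^sup>2 + s\<^sup>2 = 1" "c \<noteq> 0"
    and [measurable]: "F \<in> borel_measurable (vec_space p \<Otimes>\<^sub>M vec_space p)"
  shows "(\<integral>\<^sup>+x. \<integral>\<^sup>+y. F (vadd p (vscale p c x) (vscale p s y), vadd p (vscale p c y) (vscale p (- s) x)) \<partial>G \<partial>G)
       = (\<integral>\<^sup>+x. \<integral>\<^sup>+y. F (x, y) \<partial>G \<partial>G)"
proof -
  have "(\<integral>\<^sup>+x. \<integral>\<^sup>+y. F (vadd p (vscale p c x) (vscale p s y), vadd p (vscale p c y) (vscale p (- s) x)) \<partial>G \<partial>G)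
    = (\<integral>\<^sup>+\<xi>. \<integral>\<^sup>+\<eta>. F (lin (\<lambda>i\<in>{..<p}. c * \<xi> i + s * \<eta> i), lin (\<lambda>i\<in>{..<p}. c * \<eta> i - s * \<xi> i)) \<partial>std_gauss {..<p} \<partial>std_gauss {..<p})"
    using nn_integral_G_G[of "\<lambda>z. F (vadd p (vscale p c (fst z)) (vscale p s (snd z)), vadd p (vscale p c (snd z)) (vscale p (- s) (fst z)))"]
    by (simp add: lin_rotate)
  also have "\<dots> = (\<integral>\<^sup>+\<xi>. \<integral>\<^sup>+\<eta>. F (lin \<xi>, lin \<eta>) \<partial>std_gauss {..<p} \<partial>std_gauss {..<p})"
    using nn_integral_std_gauss_rotation[OF _ cs, of "{..<p}" "\<lambda>z. F (lin (fst z), lin (snd z))"] by simp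
  finally show ?thesis by (simp add: nn_integral_G_G)
qed

lemma nn_integral_scale_G:
  assumes "F \<in> borel_measurable (vec_space p)"
  shows "(\<integral>\<^sup>+z. F z \<partial>scale_law p c G) = (\<integral>\<^sup>+z. F (vscale p c z) \<partial>G)"
  unfolding scale_law_def using assms by (intro nn_integral_distr) simp_all

text \<open>The weighted sum is the first component of a rotated pair, up to the factor
  \<open>sqrt (\<alpha>\<^sup>2 + \<beta>\<^sup>2)\<close>. Positivity of \<open>\<alpha>\<close>
  keeps the cosine nonzero; \<open>\<beta> = 0\<close> is allowed and is used later.\<close>

lemma conv_scale_G:
  assumes "0 < \<alpha>"
  shows "conv p (scale_law p \<alpha> G) (scale_law p \<beta> G) = scale_law p (sqrt (\<alpha>\<^sup>2 + \<beta>\<^sup>2)) G"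
proof (rule vec_law_eqI[of p])
  let ?\<tau> = "sqrt (\<alpha>\<^sup>2 + \<beta>\<^sup>2)"
  have \<tau>: "0 < ?\<tau>" using assms by (simp add: add_pos_nonneg)
  have cs: "(\<alpha> / ?\<tau>)\<^sup>2 + (\<beta> / ?\<tau>)\<^sup>2 = 1" "\<alpha> / ?\<tau> \<noteq> 0"
    using \<tau> assms by (auto simp: power_divide add_divide_distrib[symmetric])
  fix F :: "(nat \<Rightarrow> real) \<Rightarrow> ennreal" assume [measurable]: "F \<in> borel_measurable (vec_space p)"
  note [measurable_cong] = vec_lawD(2)[OF law_G]
  have sp: "x \<in> space (vec_space p)" if "x \<in> space G" for x using that vec_lawD(3)[OF law_G] by simp
  have "(\<integral>\<^sup>+z. F z \<partial>conv p (scale_law p \<alpha> G) (scale_law p \<beta> G))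
     = (\<integral>\<^sup>+x. \<integral>\<^sup>+y. F (vadd p x y) \<partial>scale_law p \<beta> G \<partial>scale_law p \<alpha> G)"
    by (intro nn_integral_conv vec_law_scale law_G) simp
  also have "\<dots> = (\<integral>\<^sup>+x. \<integral>\<^sup>+y. F (vadd p x (vscale p \<beta> y)) \<partial>G \<partial>scale_law p \<alpha> G)"
    by (intro nn_integral_cong nn_integral_scale_G) measurable
  also have "\<dots> = (\<integral>\<^sup>+x. \<integral>\<^sup>+y. F (vadd p (vscale p \<alpha> x) (vscale p \<beta> y)) \<partial>G \<partial>G)"
    by (intro nn_integral_scale_G) measurable
  also have "\<dots> = (\<integral>\<^sup>+x. \<integral>\<^sup>+y. F (vscale p ?\<tau> (vadd p (vscale p (\<alpha> / ?\<tau>) x) (vscale p (\<beta> / ?\<tau>) y))) \<partial>G \<partial>G)"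
  proof -
    have "vadd p (vscale p \<alpha> x) (vscale p \<beta> y) = vscale p ?\<tau> (vadd p (vscale p (\<alpha> / ?\<tau>) x) (vscale p (\<beta> / ?\<tau>) y))" for x y
      using \<tau> by (auto simp: vadd_def vscale_def fun_eq_iff field_simps)
    then show ?thesis by simp
  qed
  \<comment> \<open>After the rotation the integrand depends on the first component alone.\<close>
  also have "\<dots> = (\<integral>\<^sup>+x. \<integral>\<^sup>+y. F (vscale p ?\<tau> x) \<partial>G \<partial>G)"
    using nn_integral_G_rotation[OF cs, of "\<lambda>z. F (vscale p ?\<tau> (fst z))"] by simp
  also have "\<dots> = (\<integral>\<^sup>+z. F z \<partial>scale_law p ?\<tau> G)" by (simp add: nn_integral_scale_G G.emeasure_space_1)
  finally show "(\<integral>\<^sup>+z. F z \<partial>conv p (scale_law p \<alpha> G) (scale_law p \<beta> G)) = (\<integral>\<^sup>+z. F z \<partial>scale_law p ?\<tau> G)" .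
qed (intro vec_law_conv vec_law_scale law_G)+

lemma scale_G_1: "scale_law p 1 G = G"
proof (rule vec_law_eqI[of p])
  fix F :: "(nat \<Rightarrow> real) \<Rightarrow> ennreal" assume [measurable]: "F \<in> borel_measurable (vec_space p)"
  have "vscale p 1 z = z" if "z \<in> space G" for z
    using that vec_lawD(3)[OF law_G] by (auto simp: vscale_def fun_eq_iff space_vec_space extensional_def)
  then show "(\<integral>\<^sup>+z. F z \<partial>scale_law p 1 G) = (\<integral>\<^sup>+z. F z \<partial>G)"
    by (simp add: nn_integral_scale_G cong: nn_integral_cong)
qed (intro vec_law_scale law_G)+

lemma scale_G_0: "scale_law p 0 G = return (vec_space p) (vzero p)"
proof (rule vec_law_eqI[of p])
  fix F :: "(nat \<Rightarrow> real) \<Rightarrow> ennreal" assume [measurable]: "F \<in> borel_measurable (vec_space p)"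
  have "vscale p 0 z = vzero p" for z by (simp add: vscale_def vzero_def)
  then show "(\<integral>\<^sup>+z. F z \<partial>scale_law p 0 G) = (\<integral>\<^sup>+z. F z \<partial>return (vec_space p) (vzero p))"
    by (simp add: nn_integral_scale_G nn_integral_return G.emeasure_space_1)
qed (intro vec_law_scale law_G vec_law_return vzero_in_space)+

text \<open>The variance of the squared norm follows from stability: twice the squared norm and the squared
  norm of a sum of two independent copies have the same law.\<close>

lemma variance_G: "(\<integral>z. (sqnorm p z - f1 p S)\<^sup>2 \<partial>G) = 2 * (f2 p S)\<^sup>2"
proof -
  let ?v = "\<integral>z. (sqnorm p z - f1 p S)\<^sup>2 \<partial>G"
  have w2: "walk p G 2 = scale_law p (sqrt 2) G"
  proof -
    have "walk p G 2 = conv p (conv p (return (vec_space p) (vzero p)) G) G" by (simp add: numeral_2_eq_2)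
    also have "return (vec_space p) (vzero p) = scale_law p 0 G" by (rule scale_G_0[symmetric])
    also have "conv p (scale_law p 0 G) G = conv p (scale_law p 1 G) (scale_law p 0 G)"
      by (simp add: scale_G_1 conv_commute law_G vec_law_scale)
    also have "\<dots> = scale_law p 1 G" by (subst conv_scale_G) simp_all
    also have "conv p (scale_law p 1 G) G = conv p (scale_law p 1 G) (scale_law p 1 G)" by (simp add: scale_G_1)
    also have "\<dots> = scale_law p (sqrt 2) G" by (subst conv_scale_G) simp_all
    finally show ?thesis .
  qed
  have "(\<integral>z. (sqnorm p z - real 2 * f1 p S)\<^sup>2 \<partial>walk p G 2) = (\<integral>z. (sqnorm p (vscale p (sqrt 2) z) - 2 * f1 p S)\<^sup>2 \<partial>G)"
    unfolding w2 scale_law_def by (subst integral_distr) simp_all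
  also have "\<dots> = (\<integral>z. 4 * (sqnorm p z - f1 p S)\<^sup>2 \<partial>G)"
    by (intro Bochner_Integration.integral_cong) (auto simp: sqnorm_vscale power2_eq_square algebra_simps)
  finally have "4 * ?v = real 2 * ?v + 2 * real 2 * (real 2 - 1) * (f2 p S)\<^sup>2"
    unfolding G.variance_walk by simp
  then show ?thesis by simp
qed

lemma abs_moment_G: "(\<integral>z. \<bar>dotp p x z\<bar> powr q \<partial>G) \<le> 4 * qform p S x powr (q / 2)"
proof -
  have "(\<integral>z. \<bar>dotp p x z\<bar> powr q \<partial>G) = (\<integral>t. \<bar>sqrt (qform p S x) * t\<bar> powr q \<partial>std_normal_distribution)"
    by (rule integral_G_dotp) measurable
  also have "\<dots> = sqrt (qform p S x) powr q * (\<integral>t. \<bar>t\<bar> powr q \<partial>std_normal_distribution)"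
    by (simp add: abs_mult powr_mult qform_S_nonneg)
  also have "\<dots> \<le> sqrt (qform p S x) powr q * 4"
    using q_range by (intro mult_left_mono std_normal_abs_powr) auto
  also have "sqrt (qform p S x) powr q = qform p S x powr (q / 2)"
    using square_powr_half[of "sqrt (qform p S x)" q] qform_S_nonneg[of x] by simp
  finally show ?thesis by simp
qed

text \<open>Both sides are the mean of the quadratic form under \<open>G\<close>. Divided by
  \<open>f2^2\<close>, these variances are the weights of the convex combination used against small
  values of the form.\<close>

lemma sum_qform_factor: "(\<Sum>r<p. qform p S (a r)) = (f2 p S)\<^sup>2"
proof -
  have "(\<Sum>r<p. qform p S (a r)) = (\<integral>z. (\<Sum>r<p. (dotp p (a r) z)\<^sup>2) \<partial>G)"
    using G.integrable_dotp_sq by (subst Bochner_Integration.integral_sum) (auto simp: integral_G_dotp_sq)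
  also have "\<dots> = (f2 p S)\<^sup>2"
    by (simp add: sum_dotp_factor_sq G.integral_qform_self)
  finally show ?thesis .
qed

text \<open>The form is a sum of squares of normal variables with variances \<open>w r\<close>.
  Cauchy-Schwarz with these weights needs only the one-dimensional marginals, however correlated
  they are; 3 is the standard normal fourth moment.\<close>

lemma integral_G_qform_sq: 
  "integrable G (\<lambda>z. (qform p S z)\<^sup>2)" "(\<integral>z. (qform p S z)\<^sup>2 \<partial>G) \<le> 3 * (f2 p S) ^ 4"
proof -
  define w where "w = (\<lambda>r. qform p S (a r))"
  have w0: "0 \<le> w r" for r by (simp add: w_def qform_S_nonneg)
  \<comment> \<open>A row of weight zero has an inner product that vanishes almost surely, so the
    division by its weight does no harm.\<close>
  have "AE z in G. \<forall>r\<in>{..<p}. (dotp p (a r) z)\<^sup>2 = w r * ((dotp p (a r) z)\<^sup>2 / w r)"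
  proof (rule AE_finite_allI)
    fix r
    show "AE z in G. (dotp p (a r) z)\<^sup>2 = w r * ((dotp p (a r) z)\<^sup>2 / w r)"
    proof (cases "w r = 0")
      case True
      then have "(\<integral>z. (dotp p (a r) z)\<^sup>2 \<partial>G) = 0" by (simp add: integral_G_dotp_sq w_def)
      then have "AE z in G. (dotp p (a r) z)\<^sup>2 = 0"
        using G.integrable_dotp_sq by (subst (asm) integral_nonneg_eq_0_iff_AE) auto
      then show ?thesis by eventually_elim (simp add: True)
    qed simp
  qed simp
  then have AE: "AE z in G. (qform p S z)\<^sup>2 \<le> (f2 p S)\<^sup>2 * (\<Sum>r<p. (dotp p (a r) z) ^ 4 / w r)"
  proof eventually_elim
    case (elim z)
    define c where "c = (\<lambda>r. (dotp p (a r) z)\<^sup>2 / w r)"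
    have "qform p S z = (\<Sum>r<p. sqrt (w r) * (sqrt (w r) * c r))"
      unfolding sum_dotp_factor_sq[symmetric] using elim w0 by (intro sum.cong) (auto simp: c_def mult.assoc[symmetric])
    then have "(qform p S z)\<^sup>2 \<le> (\<Sum>r<p. (sqrt (w r))\<^sup>2) * (\<Sum>r<p. (sqrt (w r) * c r)\<^sup>2)"
      using Cauchy_Schwarz_ineq_sum[of "\<lambda>r. sqrt (w r)" "\<lambda>r. sqrt (w r) * c r" "{..<p}"] by simp
    also have "(\<Sum>r<p. (sqrt (w r))\<^sup>2) = (f2 p S)\<^sup>2"
      using w0 sum_qform_factor by (simp add: w_def)
    also have "(\<Sum>r<p. (sqrt (w r) * c r)\<^sup>2) = (\<Sum>r<p. (dotp p (a r) z) ^ 4 / w r)"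
    proof (rule sum.cong)
      fix r
      have "(sqrt (w r) * c r)\<^sup>2 = w r * (c r)\<^sup>2" using w0[of r] by (simp add: power_mult_distrib)
      also have "\<dots> = (dotp p (a r) z) ^ 4 / w r"
        by (cases "w r = 0") (simp_all add: c_def power_divide power2_eq_square power4_eq_xxxx)
      finally show "(sqrt (w r) * c r)\<^sup>2 = (dotp p (a r) z) ^ 4 / w r" .
    qed simp
    finally show ?case .
  qed
  have ir: "integrable G (\<lambda>z. (f2 p S)\<^sup>2 * (\<Sum>r<p. (dotp p (a r) z) ^ 4 / w r))"
    by (intro integrable_mult_right Bochner_Integration.integrable_sum integrable_divide_zero integrable_G_dotp_pow)
  show i: "integrable G (\<lambda>z. (qform p S z)\<^sup>2)"
  proof (rule Bochner_Integration.integrable_bound[OF ir])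
    show "AE z in G. norm ((qform p S z)\<^sup>2) \<le> norm ((f2 p S)\<^sup>2 * (\<Sum>r<p. (dotp p (a r) z) ^ 4 / w r))"
      using AE by eventually_elim auto
  qed simp
  have "(\<integral>z. (qform p S z)\<^sup>2 \<partial>G) \<le> (\<integral>z. (f2 p S)\<^sup>2 * (\<Sum>r<p. (dotp p (a r) z) ^ 4 / w r) \<partial>G)"
    using AE i ir by (intro integral_mono_AE)
  also have "\<dots> = (f2 p S)\<^sup>2 * (\<Sum>r<p. (\<integral>z. (dotp p (a r) z) ^ 4 / w r \<partial>G))"
    by (subst integral_mult_right_zero, subst Bochner_Integration.integral_sum) (auto intro: integrable_G_dotp_pow)
  also have "(\<Sum>r<p. (\<integral>z. (dotp p (a r) z) ^ 4 / w r \<partial>G)) = (\<Sum>r<p. 3 * w r)"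
  proof (rule sum.cong)
    fix r
    have "sqrt (w r) ^ 4 = w r * w r"
      using w0[of r] power_mult[of "sqrt (w r)" 2 2] by (simp add: power2_eq_square)
    then show "(\<integral>z. (dotp p (a r) z) ^ 4 / w r \<partial>G) = 3 * w r"
      by (cases "w r = 0") (simp_all add: integral_G_dotp_pow std_normal_moment4 w_def)
  qed simp
  also have "\<dots> = 3 * (f2 p S)\<^sup>2"
    using sum_qform_factor by (simp add: w_def sum_distrib_left[symmetric])
  also have "(f2 p S)\<^sup>2 * (3 * (f2 p S)\<^sup>2) = 3 * (f2 p S) ^ 4"
    using power_add[of "f2 p S" 2 2] by simp
  finally show "(\<integral>z. (qform p S z)\<^sup>2 \<partial>G) \<le> 3 * (f2 p S) ^ 4" .
qed

text \<open>\<open>q / 2\<close> is below 2, so after scaling by \<open>f2^2\<close> the power is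
  bounded by 1 plus the square; the 4 is \<open>1 + 3\<close>.\<close>

lemma qform_moment_G:
  assumes f: "0 < f2 p S"
  shows "integrable G (\<lambda>z. qform p S z powr (q / 2))"
    and "(\<integral>z. qform p S z powr (q / 2) \<partial>G) \<le> 4 * f2 p S powr q"
proof -
  let ?f = "f2 p S"
  have b: "qform p S z powr (q / 2) \<le> ?f powr q * (1 + (qform p S z)\<^sup>2 / ?f ^ 4)" for z
  proof -
    have "qform p S z = ?f\<^sup>2 * (qform p S z / ?f\<^sup>2)" using f by simp
    then have "qform p S z powr (q / 2) = (?f\<^sup>2) powr (q / 2) * (qform p S z / ?f\<^sup>2) powr (q / 2)"
      by (metis powr_mult)
    also have "(?f\<^sup>2) powr (q / 2) = ?f powr q" using f by (simp add: square_powr_half)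
    also have "?f powr q * (qform p S z / ?f\<^sup>2) powr (q / 2) \<le> ?f powr q * (1 + (qform p S z / ?f\<^sup>2) powr 2)"
      using q_range qform_S_nonneg by (intro mult_left_mono powr_le_weight) auto
    also have "(qform p S z / ?f\<^sup>2) powr 2 = (qform p S z)\<^sup>2 / ?f ^ 4"
    proof (cases "qform p S z = 0")
      case False
      then have "0 < qform p S z" using qform_S_nonneg[of z] by simp
      then have "(qform p S z / ?f\<^sup>2) powr 2 = (qform p S z / ?f\<^sup>2)\<^sup>2" using f by (simp add: powr_numeral)
      then show ?thesis by (simp add: power_divide flip: power_mult)
    qed simp
    finally show ?thesis .
  qed
  have ib: "integrable G (\<lambda>z. ?f powr q * (1 + (qform p S z)\<^sup>2 / ?f ^ 4))"
    using integral_G_qform_sq(1) by (intro integrable_mult_right Bochner_Integration.integrable_add integrable_divide_zero) auto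
  show i: "integrable G (\<lambda>z. qform p S z powr (q / 2))"
  proof (rule Bochner_Integration.integrable_bound[OF ib])
    show "AE z in G. norm (qform p S z powr (q / 2)) \<le> norm (?f powr q * (1 + (qform p S z)\<^sup>2 / ?f ^ 4))"
      using b by (intro AE_I2) (smt (verit) powr_ge_zero real_norm_def)
  qed simp
  have "(\<integral>z. qform p S z powr (q / 2) \<partial>G) \<le> (\<integral>z. ?f powr q * (1 + (qform p S z)\<^sup>2 / ?f ^ 4) \<partial>G)"
    using i ib b by (rule integral_mono)
  also have "\<dots> = ?f powr q * (1 + (\<integral>z. (qform p S z)\<^sup>2 \<partial>G) / ?f ^ 4)"
    using integral_G_qform_sq(1) by (simp add: G.prob_space)
  also have "\<dots> \<le> ?f powr q * (1 + 3)"
    using integral_G_qform_sq(2) f by (intro mult_left_mono add_left_mono) (simp_all add: divide_le_eq)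
  finally show "(\<integral>z. qform p S z powr (q / 2) \<partial>G) \<le> 4 * f2 p S powr q" by simp
qed

subsection \<open>Anti-concentration\<close>

text \<open>The quadratic form is a convex combination of variables with the law of a squared standard normal;
  a Markov bound on the weights transfers the small-ball estimate to the combination.\<close>

lemma qform_small_ball:
  assumes f: "0 < f2 p S" and e: "0 < e"
  shows "measure G {z \<in> space G. qform p S z \<le> e * (f2 p S)\<^sup>2} \<le> 2 * sqrt (2 * e)"
proof -
  let ?f = "f2 p S"
  define w where "w = (\<lambda>r. qform p S (a r))"
  define B where "B = (\<lambda>r. {z \<in> space G. (dotp p (a r) z)\<^sup>2 \<le> 2 * e * w r})"
  have w0: "0 \<le> w r" for r by (simp add: w_def qform_S_nonneg)
  have sw: "(\<Sum>r<p. w r) = ?f\<^sup>2" using sum_qform_factor by (simp add: w_def)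
  note [measurable_cong] = vec_lawD(2)[OF law_G]
  have B[measurable]: "B r \<in> sets G" for r unfolding B_def by measurable
  have A[measurable]: "{z \<in> space G. qform p S z \<le> e * ?f\<^sup>2} \<in> sets G" by measurable
  have pt: "indicator {z \<in> space G. qform p S z \<le> e * ?f\<^sup>2} z \<le> 2 * (\<Sum>r<p. w r * indicator (B r) z) / ?f\<^sup>2" for z
  proof (cases "z \<in> space G \<and> qform p S z \<le> e * ?f\<^sup>2")
    case True
    \<comment> \<open>A row outside \<open>B r\<close> has weight at most its squared inner product
      over \<open>2 * e\<close>. When the form is small these rows carry at most half of the total
      weight, so the others carry at least half.\<close>
    have "(\<Sum>r<p. w r) \<le> (\<Sum>r<p. w r * indicator (B r) z + (dotp p (a r) z)\<^sup>2 / (2 * e))"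
    proof (rule sum_mono)
      fix r
      show "w r \<le> w r * indicator (B r) z + (dotp p (a r) z)\<^sup>2 / (2 * e)"
        using True e w0[of r] by (cases "z \<in> B r") (auto simp: B_def field_simps)
    qed
    also have "\<dots> = (\<Sum>r<p. w r * indicator (B r) z) + qform p S z / (2 * e)"
      by (simp add: sum.distrib sum_dotp_factor_sq flip: sum_divide_distrib)
    also have "qform p S z / (2 * e) \<le> ?f\<^sup>2 / 2" using True e by (simp add: field_simps)
    finally show ?thesis using True f by (simp add: sw field_simps)
  next
    case False
    then show ?thesis using w0 by (auto intro!: sum_nonneg divide_nonneg_nonneg mult_nonneg_nonneg)
  qed
  have mB: "w r * measure G (B r) \<le> w r * sqrt (2 * e)" for r
  proof (cases "w r = 0")
    case False
    then have w: "0 < w r" using w0[of r] by simp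
    have "emeasure G (B r) = (\<integral>\<^sup>+z. indicator (B r) z \<partial>G)" by simp
    also have "\<dots> = (\<integral>\<^sup>+z. indicator {y. y\<^sup>2 \<le> 2 * e * w r} (dotp p (a r) z) \<partial>G)"
      by (intro nn_integral_cong) (auto simp: B_def indicator_def)
    also have "\<dots> = (\<integral>\<^sup>+t. indicator {y. y\<^sup>2 \<le> 2 * e * w r} (sqrt (w r) * t) \<partial>std_normal_distribution)"
      unfolding w_def by (rule nn_integral_G_dotp) measurable
    also have "\<dots> = (\<integral>\<^sup>+t. indicator {t. \<bar>t\<bar> \<le> sqrt (2 * e)} t \<partial>std_normal_distribution)"
    proof (rule nn_integral_cong)
      fix t :: real
      have "(sqrt (w r) * t)\<^sup>2 \<le> 2 * e * w r \<longleftrightarrow> t\<^sup>2 \<le> 2 * e" using w by (simp add: power_mult_distrib mult.commute)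
      also have "\<dots> \<longleftrightarrow> \<bar>t\<bar> \<le> sqrt (2 * e)" using e by (metis real_sqrt_abs real_sqrt_le_iff)
      finally show "indicator {y. y\<^sup>2 \<le> 2 * e * w r} (sqrt (w r) * t) = (indicator {t. \<bar>t\<bar> \<le> sqrt (2 * e)} t :: ennreal)"
        by (simp add: indicator_def)
    qed
    also have "\<dots> = emeasure std_normal_distribution {t. \<bar>t\<bar> \<le> sqrt (2 * e)}"
      by (intro nn_integral_indicator) simp
    finally have "measure G (B r) = measure std_normal_distribution {t. \<bar>t\<bar> \<le> sqrt (2 * e)}"
      by (simp add: measure_def)
    also have "\<dots> \<le> sqrt (2 * e)" using e by (intro std_normal_small_ball) simp
    finally show ?thesis using w0 by (intro mult_left_mono)
  qed simp
  have iB: "integrable G (\<lambda>z. w r * indicator (B r) z)" for r by (intro integrable_mult_right) (simp add: G.emeasure_eq_measure)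
  have "measure G {z \<in> space G. qform p S z \<le> e * ?f\<^sup>2} = (\<integral>z. indicator {z \<in> space G. qform p S z \<le> e * ?f\<^sup>2} z \<partial>G)"
    by simp
  also have "\<dots> \<le> (\<integral>z. 2 * (\<Sum>r<p. w r * indicator (B r) z) / ?f\<^sup>2 \<partial>G)"
  proof (rule integral_mono[OF _ _ pt])
    show "integrable G (\<lambda>z. 2 * (\<Sum>r<p. w r * indicator (B r) z) / ?f\<^sup>2)"
      by (intro integrable_divide_zero integrable_mult_right Bochner_Integration.integrable_sum iB)
  qed (simp add: G.emeasure_eq_measure)
  also have "\<dots> = 2 * (\<Sum>r<p. w r * measure G (B r)) / ?f\<^sup>2"
  proof -
    have "(\<integral>z. (\<Sum>r<p. w r * indicator (B r) z) \<partial>G) = (\<Sum>r<p. w r * measure G (B r))"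
      by (subst Bochner_Integration.integral_sum[OF iB]) (simp add: G.emeasure_eq_measure)
    then show ?thesis by (simp only: integral_divide_zero integral_mult_right_zero)
  qed
  also have "\<dots> \<le> 2 * (\<Sum>r<p. w r * sqrt (2 * e)) / ?f\<^sup>2"
    by (intro divide_right_mono mult_left_mono sum_mono mB) auto
  also have "\<dots> = 2 * sqrt (2 * e)" using f by (simp add: sum_distrib_right[symmetric] sw)
  finally show ?thesis .
qed

text \<open>For independent copies \<open>x\<close>, \<open>y\<close> the difference of the squared norms is, after a rotation by
  45 degrees, twice the inner product of two independent copies.\<close>

lemma sqnorm_anticoncentration:
  assumes f: "0 < f2 p S" and h: "0 < h"
  shows "measure G {z \<in> space G. t \<le> (sqnorm p z - f1 p S) / f2 p S \<and> (sqnorm p z - f1 p S) / f2 p S \<le> t + h}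
           \<le> 2 * sqrt (sqrt h)"
proof -
  let ?f = "f2 p S"
  note [measurable_cong] = vec_lawD(2)[OF law_G]
  define A where "A = {z \<in> space G. t \<le> (sqnorm p z - f1 p S) / ?f \<and> (sqnorm p z - f1 p S) / ?f \<le> t + h}"
  have A[measurable]: "A \<in> sets G" unfolding A_def by measurable
  define F where "F = (\<lambda>z. indicator {y::real. \<bar>y\<bar> \<le> h * ?f / 2} (dotp p (fst z) (snd z)) :: ennreal)"
  have F[measurable]: "F \<in> borel_measurable (vec_space p \<Otimes>\<^sub>M vec_space p)" unfolding F_def by measurable
  define c where "c = sqrt (1 / 2)"
  have c: "c\<^sup>2 + c\<^sup>2 = 1" "c \<noteq> 0" "c\<^sup>2 = 1 / 2" by (auto simp: c_def)
  \<comment> \<open>The square of the probability is the probability that two independent copies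
    both fall into the window, hence differ by at most its width. The square is undone by a root at
    the end.\<close>
  have "emeasure G A * emeasure G A = (\<integral>\<^sup>+x. \<integral>\<^sup>+y. indicator A x * indicator A y \<partial>G \<partial>G)"
    by (simp add: nn_integral_cmult nn_integral_multc)
  also have "\<dots> \<le> (\<integral>\<^sup>+x. \<integral>\<^sup>+y. F (vadd p (vscale p c x) (vscale p c y), vadd p (vscale p c y) (vscale p (- c) x)) \<partial>G \<partial>G)"
  proof (intro nn_integral_mono)
    fix x y
    have "dotp p (vadd p (vscale p c x) (vscale p c y)) (vadd p (vscale p c y) (vscale p (- c) x)) = c\<^sup>2 * (sqnorm p y - sqnorm p x)"
      by (simp add: dotp_vadd_left dotp_vadd_right dotp_vscale_left dotp_commute[of p _ "vscale p _ _"]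
          dotp_commute[of p y x] sqnorm_def power2_eq_square algebra_simps)
    moreover have "\<bar>sqnorm p y - sqnorm p x\<bar> \<le> h * ?f" if "x \<in> A" "y \<in> A"
    proof -
      have "\<bar>(sqnorm p y - f1 p S) / ?f - (sqnorm p x - f1 p S) / ?f\<bar> \<le> h" using that unfolding A_def by auto
      then have "\<bar>(sqnorm p y - sqnorm p x) / ?f\<bar> \<le> h" by (simp add: diff_divide_distrib)
      then show ?thesis using f by (simp add: abs_divide divide_le_eq)
    qed
    ultimately show "indicator A x * indicator A y \<le> F (vadd p (vscale p c x) (vscale p c y), vadd p (vscale p c y) (vscale p (- c) x))"
      using c(3) by (auto simp: F_def abs_mult split: split_indicator)
  qed
  also have "\<dots> = (\<integral>\<^sup>+x. \<integral>\<^sup>+y. F (x, y) \<partial>G \<partial>G)" by (rule nn_integral_G_rotation[OF c(1,2) F])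
  \<comment> \<open>Given the first vector, the inner product is normal with variance
    \<open>qform p S x\<close>. The threshold \<open>h * f2^2\<close> makes the contribution of
    small variances and the normal small ball both of order \<open>sqrt h\<close>.\<close>
  also have "\<dots> \<le> (\<integral>\<^sup>+x. indicator {z \<in> space G. qform p S z \<le> h * ?f\<^sup>2} x + ennreal (sqrt h / 2) \<partial>G)"
  proof (rule nn_integral_mono)
    fix x assume x: "x \<in> space G"
    have e: "(\<integral>\<^sup>+y. F (x, y) \<partial>G) = (\<integral>\<^sup>+t. indicator {y::real. \<bar>y\<bar> \<le> h * ?f / 2} (sqrt (qform p S x) * t) \<partial>std_normal_distribution)"
      unfolding F_def fst_conv snd_conv by (rule nn_integral_G_dotp) measurable
    show "(\<integral>\<^sup>+y. F (x, y) \<partial>G) \<le> indicator {z \<in> space G. qform p S z \<le> h * ?f\<^sup>2} x + ennreal (sqrt h / 2)"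
    proof (cases "qform p S x \<le> h * ?f\<^sup>2")
      case True
      have "(\<integral>\<^sup>+y. F (x, y) \<partial>G) \<le> (\<integral>\<^sup>+y. 1 \<partial>G)" by (intro nn_integral_mono) (auto simp: F_def indicator_def)
      also have "\<dots> = 1" by (simp add: G.emeasure_space_1)
      finally show ?thesis using True x by (simp add: add_increasing2)
    next
      case False
      have "sqrt h * ?f \<le> sqrt (qform p S x)"
        using False f real_sqrt_le_mono[of "h * ?f\<^sup>2" "qform p S x"] by (simp add: real_sqrt_mult)
      have "(\<integral>\<^sup>+y. F (x, y) \<partial>G) \<le> (\<integral>\<^sup>+t. indicator {t. \<bar>t\<bar> \<le> sqrt h / 2} t \<partial>std_normal_distribution)"
        unfolding e
      proof (rule nn_integral_mono)
        fix t :: real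
        have "\<bar>t\<bar> \<le> sqrt h / 2" if "\<bar>sqrt (qform p S x) * t\<bar> \<le> h * ?f / 2"
        proof -
          have "sqrt h * ?f * \<bar>t\<bar> \<le> \<bar>sqrt (qform p S x) * t\<bar>"
            unfolding abs_mult using \<open>sqrt h * ?f \<le> sqrt (qform p S x)\<close> by (intro mult_right_mono) auto
          also note that
          also have "h * ?f / 2 = sqrt h * ?f * (sqrt h / 2)" using h by (simp add: field_simps)
          finally show ?thesis using f h by simp
        qed
        then show "indicator {y. \<bar>y\<bar> \<le> h * ?f / 2} (sqrt (qform p S x) * t) \<le> (indicator {t. \<bar>t\<bar> \<le> sqrt h / 2} t :: ennreal)"
          by (auto simp: indicator_def)
      qed
      also have "\<dots> = emeasure std_normal_distribution {t. \<bar>t\<bar> \<le> sqrt h / 2}" by (intro nn_integral_indicator) simp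
      also have "\<dots> \<le> ennreal (sqrt h / 2)"
        using std_normal_small_ball[of "sqrt h / 2"] h by (simp add: N1.emeasure_eq_measure)
      finally show ?thesis by (simp add: add_increasing)
    qed
  qed
  also have "\<dots> = emeasure G {z \<in> space G. qform p S z \<le> h * ?f\<^sup>2} + ennreal (sqrt h / 2)"
    by (subst nn_integral_add) (auto simp: G.emeasure_space_1)
  also have "\<dots> \<le> ennreal (2 * sqrt (2 * h)) + ennreal (sqrt h / 2)"
    using qform_small_ball[OF f h] by (intro add_right_mono) (simp add: G.emeasure_eq_measure ennreal_leI)
  also have "\<dots> = ennreal (2 * sqrt (2 * h) + sqrt h / 2)" using h by (intro ennreal_plus[symmetric]) auto
  also have "\<dots> \<le> ennreal (4 * sqrt h)"
  proof (rule ennreal_leI)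
    have "sqrt 2 \<le> 3 / 2" by (rule real_le_lsqrt) (auto simp: power2_eq_square)
    then have "sqrt 2 * sqrt h \<le> 3 / 2 * sqrt h" using h by (intro mult_right_mono) auto
    moreover have "sqrt (2 * h) = sqrt 2 * sqrt h" by (rule real_sqrt_mult)
    moreover have "0 \<le> sqrt h" using h by simp
    ultimately show "2 * sqrt (2 * h) + sqrt h / 2 \<le> 4 * sqrt h" by linarith
  qed
  finally have "(measure G A)\<^sup>2 \<le> 4 * sqrt h"
    using h by (simp add: G.emeasure_eq_measure ennreal_mult'[symmetric] power2_eq_square)
  then have "measure G A \<le> sqrt (4 * sqrt h)" by (rule real_le_rsqrt)
  then show ?thesis unfolding A_def by (simp add: real_sqrt_mult)
qed

end

section \<open>Gaussian approximation\<close>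

text \<open>The argument is the unnormalised sum of \<open>N\<close> vectors; the centring and the
  scale are the same for every \<open>N\<close>.\<close>

definition normalized :: "nat \<Rightarrow> (nat \<Rightarrow> nat \<Rightarrow> real) \<Rightarrow> real \<Rightarrow> (nat \<Rightarrow> real) \<Rightarrow> real" where
  "normalized p S N z = (sqnorm p z / N - f1 p S) / f2 p S"

lemma normalized_measurable [measurable (raw)]:
  assumes [measurable]: "f \<in> measurable M (vec_space p)"
  shows "(\<lambda>x. normalized p S N (f x)) \<in> borel_measurable M"
  unfolding normalized_def by measurable

lemma test_fun_measurable:
  assumes "test_fun C \<phi> \<phi>1 \<phi>2"
  shows "\<phi> \<in> borel_measurable borel" "\<phi>1 \<in> borel_measurable borel" "\<phi>2 \<in> borel_measurable borel"
proof -
  have C: "0 \<le> C" using assms by (simp add: test_fun_def)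
  have m: "g \<in> borel_measurable borel" if "\<And>x y. \<bar>g x - g y\<bar> \<le> C * \<bar>x - y\<bar>" for g :: "real \<Rightarrow> real"
  proof -
    have "C-lipschitz_on UNIV g" using that C by (intro lipschitz_onI) (auto simp: dist_real_def)
    then show ?thesis by (intro borel_measurable_continuous_onI lipschitz_on_continuous_on)
  qed
  show "\<phi> \<in> borel_measurable borel" "\<phi>1 \<in> borel_measurable borel"
    using test_fun_Lipschitz[OF assms] by (intro m; blast)+
  show "\<phi>2 \<in> borel_measurable borel" using assms by (intro m) (auto simp: test_fun_def)
qed

text \<open>One Lindeberg step. The subtracted integral depends on the added summand through its
  covariance \<open>T\<close> alone, so it cancels when two summands with equal covariance are
  compared. \<open>x0\<close> already contains the mean of the squared norm of the summand, which
  leaves a centred remainder.\<close>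

lemma (in cov_law_pair) abs_integral_test_fun_conv_le:
  fixes c N \<tau> :: real
  assumes t: "test_fun C \<phi> \<phi>1 \<phi>2" and S: "\<And>k l. S k l = c * T k l" and c: "0 \<le> c"
    and f: "0 < f2 p T" and N: "0 < N" and \<tau>: "0 < \<tau>"
  defines "x0 \<equiv> \<lambda>s. normalized p T N s + f1 p T / (N * f2 p T)"
  shows "\<bar>(\<integral>z. \<phi> (normalized p T N z) \<partial>conv p P Q)
            - (\<integral>s. \<phi> (x0 s) + \<phi>2 (x0 s) * (2 * qform p T s / (N * f2 p T)\<^sup>2) \<partial>P)\<bar>
     \<le> C * (8 / (N * f2 p T) powr q * (\<integral>z. \<bar>dotp p (fst z) (snd z)\<bar> powr q \<partial>(P \<Otimes>\<^sub>M Q))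
          + (1 + 1 / (2 * \<tau>)) * ((\<integral>z. (sqnorm p z - f1 p T)\<^sup>2 \<partial>Q) / (N * f2 p T)\<^sup>2) + 2 * \<tau> * c / N\<^sup>2)"
proof -
  let ?f = "f2 p T" and ?M = "P \<Otimes>\<^sub>M Q"
  note [measurable] = test_fun_measurable[OF t]
  have C: "0 \<le> C" and b: "\<And>x. \<bar>\<phi> x\<bar> \<le> 1" "\<And>x. \<bar>\<phi>1 x\<bar> \<le> C" "\<And>x. \<bar>\<phi>2 x\<bar> \<le> C"
    using t by (auto simp: test_fun_def)
  have Nf: "0 < N * ?f" using f N by simp
  have x0m[measurable]: "x0 \<in> borel_measurable (vec_space p)" unfolding x0_def by measurable
  define A where "A = (\<lambda>z::(nat \<Rightarrow> real) \<times> (nat \<Rightarrow> real). 2 * dotp p (fst z) (snd z) / (N * ?f))"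
  define B where "B = (\<lambda>y. (sqnorm p y - f1 p T) / (N * ?f))"
  have [measurable]: "A \<in> borel_measurable (vec_space p \<Otimes>\<^sub>M vec_space p)" "B \<in> borel_measurable (vec_space p)"
    unfolding A_def B_def by measurable
  have R: "normalized p T N (vadd p x y) = x0 x + A (x, y) + B y" for x y
    using f N by (simp add: normalized_def x0_def A_def B_def sqnorm_vadd field_simps)
  have A2: "(A z)\<^sup>2 = 4 / (N * ?f)\<^sup>2 * (dotp p (fst z) (snd z))\<^sup>2" for z
    by (simp add: A_def power_divide power_mult_distrib)
  have iA2: "integrable ?M (\<lambda>z. (A z)\<^sup>2)" unfolding A2 using integrable_pair_dotp_sq by simp
  have sT: "(\<Sum>k<p. \<Sum>l<p. T k l * S l k) = c * ?f\<^sup>2"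
    unfolding Q.f2_sq S by (simp add: sum_distrib_left mult_ac)
  have eA2: "(\<integral>z. (A z)\<^sup>2 \<partial>?M) = 4 * c / N\<^sup>2"
    unfolding A2 using f N by (simp add: integral_pair_dotp_sq sT power_mult_distrib)
  have iB: "integrable Q B" unfolding B_def using Q.integrable_sqnorm by (intro integrable_divide_zero Bochner_Integration.integrable_diff) auto
  have eB: "(\<integral>y. B y \<partial>Q) = 0" unfolding B_def using Q.integrable_sqnorm by (simp add: Q.integral_sqnorm Q.prob_space)
  have B2: "(B y)\<^sup>2 = (sqnorm p y - f1 p T)\<^sup>2 / (N * ?f)\<^sup>2" for y by (simp add: B_def power_divide)
  have iB2: "integrable Q (\<lambda>y. (B y)\<^sup>2)" unfolding B2 using Q.integrable_sqnorm_sq by simp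
  have eB2: "(\<integral>y. (B y)\<^sup>2 \<partial>Q) = (\<integral>z. (sqnorm p z - f1 p T)\<^sup>2 \<partial>Q) / (N * ?f)\<^sup>2" unfolding B2 by simp
  have Aq: "\<bar>A z\<bar> powr q \<le> 8 / (N * ?f) powr q * \<bar>dotp p (fst z) (snd z)\<bar> powr q" for z
  proof -
    have "\<bar>A z\<bar> powr q = (2 * \<bar>dotp p (fst z) (snd z)\<bar> / (N * ?f)) powr q"
      by (simp only: A_def abs_divide abs_mult[of 2] abs_of_pos[OF Nf] abs_numeral)
    also have "\<dots> = 2 powr q * \<bar>dotp p (fst z) (snd z)\<bar> powr q / (N * ?f) powr q"
      using Nf by (simp only: powr_divide powr_mult)
    also have "\<dots> \<le> 2 powr 3 * \<bar>dotp p (fst z) (snd z)\<bar> powr q / (N * ?f) powr q"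
      using P.q by (intro divide_right_mono mult_right_mono powr_mono) auto
    finally show ?thesis by simp
  qed
  have bdd: "integrable ?M g" if "g \<in> borel_measurable (vec_space p \<Otimes>\<^sub>M vec_space p)" "\<And>z. \<bar>g z\<bar> \<le> K" for g :: "_ \<Rightarrow> real" and K
    using that by (intro PQ.P.integrable_const_bound[of _ K]) auto
  have bddP: "integrable P g" if "g \<in> borel_measurable (vec_space p)" "\<And>z. \<bar>g z\<bar> \<le> K" for g :: "_ \<Rightarrow> real" and K
    using that by (intro P.integrable_const_bound[of _ K]) auto
  have i0: "integrable ?M (\<lambda>z. \<phi> (x0 (fst z) + A z + B (snd z)))" by (rule bdd[of _ 1]) (use b in auto)
  have i1: "integrable P (\<lambda>s. \<phi> (x0 s))" by (rule bddP[of _ 1]) (use b in auto)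
  have i1': "integrable P (\<lambda>s. \<phi>1 (x0 s))" by (rule bddP[of _ C]) (use b in auto)
  have i2: "integrable ?M (\<lambda>z. \<phi>1 (x0 (fst z)) * A z)"
  proof (rule Bochner_Integration.integrable_bound[of _ "\<lambda>z. C * (1 + (A z)\<^sup>2)"])
    show "AE z in ?M. norm (\<phi>1 (x0 (fst z)) * A z) \<le> norm (C * (1 + (A z)\<^sup>2))"
    proof (rule AE_I2)
      fix z
      have "\<bar>A z\<bar> \<le> 1 + (A z)\<^sup>2" using sum_squares_bound[of "\<bar>A z\<bar>" 1] by simp
      then have "\<bar>\<phi>1 (x0 (fst z))\<bar> * \<bar>A z\<bar> \<le> C * (1 + (A z)\<^sup>2)" using b C by (intro mult_mono) auto
      then show "norm (\<phi>1 (x0 (fst z)) * A z) \<le> norm (C * (1 + (A z)\<^sup>2))" using C by (simp add: abs_mult)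
    qed
  qed (use iA2 in simp_all)
  \<comment> \<open>\<open>A\<close> is linear in the new summand, which is centred.\<close>
  have e2: "(\<integral>z. \<phi>1 (x0 (fst z)) * A z \<partial>?M) = 0"
    unfolding PQ.integral_fst'[OF i2, symmetric] by (simp add: A_def Q.integral_dotp)
  have i3: "integrable ?M (\<lambda>z. \<phi>1 (x0 (fst z)) * B (snd z))" by (rule integrable_pair_mult[OF i1' iB])
  have e3: "(\<integral>z. \<phi>1 (x0 (fst z)) * B (snd z) \<partial>?M) = 0" by (simp add: integral_pair_mult[OF i1' iB] eB)
  have i4: "integrable ?M (\<lambda>z. \<phi>2 (x0 (fst z)) * (A z)\<^sup>2)"
  proof (rule Bochner_Integration.integrable_bound[of _ "\<lambda>z. C * (A z)\<^sup>2"])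
    show "AE z in ?M. norm (\<phi>2 (x0 (fst z)) * (A z)\<^sup>2) \<le> norm (C * (A z)\<^sup>2)"
      using b C by (intro AE_I2) (auto simp: abs_mult intro!: mult_right_mono)
  qed (use iA2 in simp_all)
  \<comment> \<open>Integrating out the new summand turns the squared inner product into the
    quadratic form of \<open>T\<close>.\<close>
  have e4: "(\<integral>z. \<phi>2 (x0 (fst z)) * (A z)\<^sup>2 \<partial>?M) = (\<integral>s. \<phi>2 (x0 s) * (4 * qform p T s / (N * ?f)\<^sup>2) \<partial>P)"
    using PQ.integral_fst'[OF i4] by (auto simp: A2 Q.integral_dotp_sq)
  have i5: "integrable P (\<lambda>s. \<phi>2 (x0 s) * (2 * qform p T s / (N * ?f)\<^sup>2))"
  proof (rule Bochner_Integration.integrable_bound[of _ "\<lambda>s. C * (2 * qform p T s / (N * ?f)\<^sup>2)"])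
    show "integrable P (\<lambda>s. C * (2 * qform p T s / (N * ?f)\<^sup>2))"
      using P.integrable_qform by (intro integrable_mult_right integrable_divide_zero)
    show "AE z in P. norm (\<phi>2 (x0 z) * (2 * qform p T z / (N * ?f)\<^sup>2)) \<le> norm (C * (2 * qform p T z / (N * ?f)\<^sup>2))"
      using b C Q.qform_nonneg by (intro AE_I2) (auto simp: abs_mult intro!: mult_right_mono divide_right_mono)
  qed simp_all
  let ?D = "\<lambda>z. \<phi> (x0 (fst z) + A z + B (snd z)) - \<phi> (x0 (fst z)) - \<phi>1 (x0 (fst z)) * A z - \<phi>1 (x0 (fst z)) * B (snd z)
      - \<phi>2 (x0 (fst z)) * (A z)\<^sup>2 / 2"
  let ?E = "\<lambda>z. C * (8 / (N * ?f) powr q * \<bar>dotp p (fst z) (snd z)\<bar> powr q + (1 + 1 / (2 * \<tau>)) * (B (snd z))\<^sup>2 + \<tau> / 2 * (A z)\<^sup>2)"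
  have iD: "integrable ?M ?D" using i0 integrable_pair_fst[OF i1] i2 i3 i4 by simp
  have iE: "integrable ?M ?E"
    using integrable_pair_dotp_powr integrable_pair_snd[OF iB2] iA2
    by (intro integrable_mult_right Bochner_Integration.integrable_add)
  have DE: "\<bar>?D z\<bar> \<le> ?E z" for z
  proof -
    \<comment> \<open>Weighted AM-GM for the mixed term. The weight \<open>\<tau>\<close> goes to
      the square of \<open>A\<close>, whose mean \<open>4 * c / N\<^sup>2\<close> is of order 1 / N
      when \<open>c\<close> is close to \<open>N\<close> and hence does not become small after
      \<open>N\<close> steps.\<close>
    have "0 \<le> (\<tau> * \<bar>A z\<bar> - \<bar>B (snd z)\<bar>)\<^sup>2 / (2 * \<tau>)" using \<tau> by simp
    also have "\<dots> = \<tau> / 2 * (A z)\<^sup>2 + 1 / (2 * \<tau>) * (B (snd z))\<^sup>2 - \<bar>A z * B (snd z)\<bar>"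
      using \<tau> by (simp add: power2_diff power_mult_distrib abs_mult field_simps power2_eq_square)
    finally have "\<bar>A z\<bar> powr q + (B (snd z))\<^sup>2 + \<bar>A z * B (snd z)\<bar> \<le>
      8 / (N * ?f) powr q * \<bar>dotp p (fst z) (snd z)\<bar> powr q + (1 + 1 / (2 * \<tau>)) * (B (snd z))\<^sup>2 + \<tau> / 2 * (A z)\<^sup>2"
      using Aq[of z] by (simp add: distrib_right)
    then have "C * (\<bar>A z\<bar> powr q + (B (snd z))\<^sup>2 + \<bar>A z * B (snd z)\<bar>) \<le> ?E z" using C by (intro mult_left_mono)
    moreover have "\<bar>?D z\<bar> \<le> C * (\<bar>A z\<bar> powr q + (B (snd z))\<^sup>2 + \<bar>A z * B (snd z)\<bar>)"
      using test_fun_Taylor[OF t P.q, of "x0 (fst z)" "A z" "B (snd z)"] by (simp add: distrib_left diff_diff_eq)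
    ultimately show ?thesis by linarith
  qed
  have "(\<integral>z. \<phi> (normalized p T N z) \<partial>conv p P Q) = (\<integral>z. \<phi> (x0 (fst z) + A z + B (snd z)) \<partial>?M)"
    by (subst integral_conv) (simp_all add: R)
  moreover have "(\<integral>z. ?D z \<partial>?M) = (\<integral>z. \<phi> (x0 (fst z) + A z + B (snd z)) \<partial>?M) - (\<integral>s. \<phi> (x0 s) \<partial>P)
      - (\<integral>s. \<phi>2 (x0 s) * (4 * qform p T s / (N * ?f)\<^sup>2) \<partial>P) / 2"
    using i0 integrable_pair_fst[OF i1] i2 i3 i4 by (simp add: e2 e3 e4 integral_pair_fst[OF i1])
  moreover have "(\<integral>s. \<phi> (x0 s) + \<phi>2 (x0 s) * (2 * qform p T s / (N * ?f)\<^sup>2) \<partial>P) =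
     (\<integral>s. \<phi> (x0 s) \<partial>P) + (\<integral>s. \<phi>2 (x0 s) * (4 * qform p T s / (N * ?f)\<^sup>2) \<partial>P) / 2"
  proof -
    have "(\<integral>s. \<phi>2 (x0 s) * (4 * qform p T s / (N * ?f)\<^sup>2) \<partial>P) / 2 = (\<integral>s. \<phi>2 (x0 s) * (2 * qform p T s / (N * ?f)\<^sup>2) \<partial>P)"
      unfolding integral_divide_zero[symmetric] by (intro Bochner_Integration.integral_cong) auto
    then show ?thesis using i1 i5 by simp
  qed
  ultimately have "\<bar>(\<integral>z. \<phi> (normalized p T N z) \<partial>conv p P Q)
     - (\<integral>s. \<phi> (x0 s) + \<phi>2 (x0 s) * (2 * qform p T s / (N * ?f)\<^sup>2) \<partial>P)\<bar> = \<bar>\<integral>z. ?D z \<partial>?M\<bar>" by simp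
  also have "\<dots> \<le> (\<integral>z. \<bar>?D z\<bar> \<partial>?M)" by (rule integral_abs_bound)
  also have "\<dots> \<le> (\<integral>z. ?E z \<partial>?M)" using iD iE DE by (intro integral_mono integrable_abs)
  also have "\<dots> = C * (8 / (N * ?f) powr q * (\<integral>z. \<bar>dotp p (fst z) (snd z)\<bar> powr q \<partial>?M)
          + (1 + 1 / (2 * \<tau>)) * ((\<integral>z. (sqnorm p z - f1 p T)\<^sup>2 \<partial>Q) / (N * ?f)\<^sup>2) + \<tau> / 2 * (4 * c / N\<^sup>2))"
    using integrable_pair_dotp_powr integrable_pair_snd[OF iB2] iA2
    by (simp add: integral_pair_snd[OF iB2] eB2 eA2)
  finally show ?thesis by (simp add: mult_ac)
qed

lemma (in cov_law) qform_le: "qform p S z \<le> sqnorm p z * f1 p S"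
proof -
  have "(\<integral>y. (dotp p z y)\<^sup>2 \<partial>P) \<le> (\<integral>y. sqnorm p z * sqnorm p y \<partial>P)"
    using integrable_dotp_sq integrable_sqnorm dotp_Cauchy_Schwarz by (intro integral_mono) auto
  then show ?thesis by (simp add: integral_dotp_sq integral_sqnorm)
qed

lemma (in cov_law) integrable_qform_powr: "integrable P (\<lambda>z. qform p S z powr (q / 2))"
proof (rule integrable_weight_bound[of _ "f1 p S powr (q / 2)"])
  fix z
  have "qform p S z powr (q / 2) \<le> (f1 p S * sqnorm p z) powr (q / 2)"
    using qform_le[of z] qform_nonneg[of z] q by (intro powr_mono2) (auto simp: mult.commute)
  also have "\<dots> = f1 p S powr (q / 2) * sqnorm p z powr (q / 2)" by (rule powr_mult)
  also have "\<dots> \<le> f1 p S powr (q / 2) * (1 + sqnorm p z powr q)"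
    using q by (intro mult_left_mono powr_le_weight) auto
  finally show "\<bar>qform p S z powr (q / 2)\<bar> \<le> f1 p S powr (q / 2) * (1 + sqnorm p z powr q)" by simp
qed simp

locale gauss_approx = cov_law p S q P + Gs: gauss_factor p S a q for p S q P a +
  assumes f2_pos: "0 < f2 p S"
begin

abbreviation "G \<equiv> Gs.G"

lemma conv_scale_G_Suc: "conv p (scale_law p (sqrt (real k)) G) G = scale_law p (sqrt (real (Suc k))) G"
proof -
  have "conv p (scale_law p (sqrt (real k)) G) G = conv p (scale_law p 1 G) (scale_law p (sqrt (real k)) G)"
    using Gs.law_G by (simp add: Gs.scale_G_1 conv_commute vec_law_scale)
  also have "\<dots> = scale_law p (sqrt (real (Suc k))) G" by (subst Gs.conv_scale_G) (simp_all add: add.commute)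
  finally show ?thesis .
qed

text \<open>The hybrid sum with \<open>i\<close> original and \<open>n - Suc i\<close> Gaussian
  summands, so that one place is free. By stability the Gaussian part is a single scaled
  vector.\<close>

definition rest :: "nat \<Rightarrow> nat \<Rightarrow> (nat \<Rightarrow> real) measure" where
  "rest n i = conv p (walk p P i) (scale_law p (sqrt (real (n - Suc i))) G)"

text \<open>Filling the free place by \<open>P\<close> gives hybrid \<open>i + 1\<close>, filling it
  by \<open>G\<close> gives hybrid \<open>i\<close>; commutativity lets the exchanged summand always
  be the last one.\<close>

lemma conv_rest_P: "conv p (rest n i) P = conv p (walk p P (Suc i)) (scale_law p (sqrt (real (n - Suc i))) G)"
proof -
  let ?W = "walk p P i" and ?Y = "scale_law p (sqrt (real (n - Suc i))) G"
  have [simp]: "vec_law p ?W" "vec_law p ?Y" "vec_law p P"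
    using law Gs.law_G by (simp_all add: vec_law_walk vec_law_scale)
  have "conv p (conv p ?W ?Y) P = conv p ?W (conv p ?Y P)" by (rule conv_assoc) simp_all
  also have "conv p ?Y P = conv p P ?Y" by (rule conv_commute) simp_all
  also have "conv p ?W (conv p P ?Y) = conv p (conv p ?W P) ?Y" by (rule conv_assoc[symmetric]) simp_all
  finally show ?thesis by (simp add: rest_def)
qed

lemma conv_rest_G:
  assumes "i < n"
  shows "conv p (rest n i) G = conv p (walk p P i) (scale_law p (sqrt (real (n - i))) G)"
proof -
  have "conv p (scale_law p (sqrt (real (n - Suc i))) G) G = scale_law p (sqrt (real (n - i))) G"
    using conv_scale_G_Suc[of "n - Suc i"] by (simp only: Suc_diff_Suc[OF assms])
  moreover have "vec_law p (walk p P i)" "vec_law p (scale_law p (sqrt (real (n - Suc i))) G)"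
    using law Gs.law_G by (simp_all add: vec_law_walk vec_law_scale)
  ultimately show ?thesis
    unfolding rest_def using Gs.law_G by (simp only: conv_assoc)
qed

lemma cov_law_scale_G: "cov_law p (\<lambda>k l. real c * S k l) q (scale_law p (sqrt (real c)) G)"
  using Gs.G.cov_law_scale[of "sqrt (real c)"] by simp

lemma rest_pair: "cov_law_pair p (\<lambda>k l. real i * S k l) (\<lambda>k l. real (n - Suc i) * S k l) q (walk p P i) (scale_law p (sqrt (real (n - Suc i))) G)"
  using cov_law_walk cov_law_scale_G by (simp add: cov_law_pair_def)

lemma cov_law_rest: "i < n \<Longrightarrow> cov_law p (\<lambda>k l. real (n - 1) * S k l) q (rest n i)"
  unfolding rest_def
  by (rule cov_law_cong[OF cov_law_pair.cov_law_conv[OF rest_pair]]) (simp add: algebra_simps of_nat_diff)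

text \<open>The original and the Gaussian part are separated at the price of a factor 8; then
  \<open>160 = 8 * (16 + 4)\<close>, with 16 from the walk and 4 from the Gaussian part.\<close>

lemma abs_moment_rest:
  assumes i: "i < n"
  shows "(\<integral>s. \<bar>dotp p x s\<bar> powr q \<partial>rest n i)
    \<le> 160 * (real n powr (q / 2) * qform p S x powr (q / 2) + real n * (\<integral>z. \<bar>dotp p x z\<bar> powr q \<partial>P))"
proof -
  let ?Y = "scale_law p (sqrt (real (n - Suc i))) G"
  interpret R: cov_law_pair p "\<lambda>k l. real i * S k l" "\<lambda>k l. real (n - Suc i) * S k l" q "walk p P i" ?Y by (rule rest_pair)
  interpret T: cov_law p "\<lambda>k l. real (n - 1) * S k l" q "rest n i" by (rule cov_law_rest[OF i])
  let ?w = "\<integral>s. \<bar>dotp p x s\<bar> powr q \<partial>walk p P i" and ?y = "\<integral>s. \<bar>dotp p x s\<bar> powr q \<partial>?Y"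
  let ?A = "real n powr (q / 2) * qform p S x powr (q / 2)" and ?B = "\<integral>z. \<bar>dotp p x z\<bar> powr q \<partial>P"
  have iw: "integrable (walk p P i) (\<lambda>s. \<bar>dotp p x s\<bar> powr q)" using R.P.integrable_dotp_powr[of q x] q by simp
  have iy: "integrable ?Y (\<lambda>s. \<bar>dotp p x s\<bar> powr q)" using R.Q.integrable_dotp_powr[of q x] q by simp
  have it: "integrable (rest n i) (\<lambda>s. \<bar>dotp p x s\<bar> powr q)" using T.integrable_dotp_powr[of q x] q by simp
  have "(\<integral>s. \<bar>dotp p x s\<bar> powr q \<partial>rest n i) = (\<integral>z. \<bar>dotp p x (fst z) + dotp p x (snd z)\<bar> powr q \<partial>(walk p P i \<Otimes>\<^sub>M ?Y))"
    unfolding rest_def by (subst R.integral_conv) (simp_all add: dotp_vadd_right)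
  also have "\<dots> \<le> (\<integral>z. 8 * (\<bar>dotp p x (fst z)\<bar> powr q + \<bar>dotp p x (snd z)\<bar> powr q) \<partial>(walk p P i \<Otimes>\<^sub>M ?Y))"
  proof (rule integral_mono)
    show "integrable (walk p P i \<Otimes>\<^sub>M ?Y) (\<lambda>z. \<bar>dotp p x (fst z) + dotp p x (snd z)\<bar> powr q)"
      using it unfolding rest_def by (subst (asm) R.integrable_conv) (simp_all add: dotp_vadd_right)
    show "integrable (walk p P i \<Otimes>\<^sub>M ?Y) (\<lambda>z. 8 * (\<bar>dotp p x (fst z)\<bar> powr q + \<bar>dotp p x (snd z)\<bar> powr q))"
      using R.integrable_pair_fst[OF iw] R.integrable_pair_snd[OF iy] by simp
  qed (use q abs_add_powr_le_8 in simp)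
  also have "\<dots> = 8 * (?w + ?y)"
    using R.integrable_pair_fst[OF iw] R.integrable_pair_snd[OF iy]
    by (simp add: R.integral_pair_fst[OF iw] R.integral_pair_snd[OF iy])
  finally have 1: "(\<integral>s. \<bar>dotp p x s\<bar> powr q \<partial>rest n i) \<le> 8 * (?w + ?y)" .
  have B0: "0 \<le> ?B" by simp
  have "?w \<le> 16 * (real i powr (q / 2) * qform p S x powr (q / 2) + real i * ?B)" by (rule abs_moment_walk)
  also have "\<dots> \<le> 16 * (?A + real n * ?B)"
    using i q B0 by (intro mult_left_mono add_mono mult_right_mono powr_mono2) auto
  finally have 2: "?w \<le> 16 * (?A + real n * ?B)" .
  have "?y = (\<integral>s. real (n - Suc i) powr (q / 2) * \<bar>dotp p x s\<bar> powr q \<partial>G)"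
  proof -
    have "\<bar>dotp p x (vscale p (sqrt (real (n - Suc i))) s)\<bar> powr q = real (n - Suc i) powr (q / 2) * \<bar>dotp p x s\<bar> powr q" for s
    proof -
      have "\<bar>sqrt (real (n - Suc i))\<bar> powr q = real (n - Suc i) powr (q / 2)"
        by (subst square_powr_half[symmetric]) simp
      then show ?thesis by (simp add: dotp_commute[of p x] dotp_vscale_left abs_mult powr_mult)
    qed
    then show ?thesis unfolding scale_law_def by (subst integral_distr) simp_all
  qed
  also have "\<dots> = real (n - Suc i) powr (q / 2) * (\<integral>s. \<bar>dotp p x s\<bar> powr q \<partial>G)" by simp
  also have "\<dots> \<le> real n powr (q / 2) * (4 * qform p S x powr (q / 2))"
    using q by (intro mult_mono powr_mono2 Gs.abs_moment_G) auto
  finally have 3: "?y \<le> 4 * ?A" by simp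
  have "0 \<le> real n * ?B" using B0 by simp
  then show ?thesis using 1 2 3 unfolding distrib_left by linarith
qed

text \<open>The three scale-free moments of the error bound. For the sample, \<open>kappa\<close> is
  the square of \<open>K_delta\<close> at 0, \<open>cross\<close> is the q-th power of
  \<open>D_delta\<close>, and \<open>quad\<close> is the quadratic moment in the hypothesis on the
  rate.\<close>

definition kappa :: real where "kappa = (\<integral>z. (sqnorm p z - f1 p S)\<^sup>2 \<partial>P) / (f2 p S)\<^sup>2"
definition quad :: real where "quad = (\<integral>z. qform p S z powr (q / 2) \<partial>P) / f2 p S powr q"
definition cross :: real where "cross = (\<integral>x. \<integral>z. \<bar>dotp p x z\<bar> powr q \<partial>P \<partial>P) / f2 p S powr q"

text \<open>Given the new summand, its inner product with the rest is a one-dimensional centred sum.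
  Averaging the bound of \<open>abs_moment_rest\<close> over that summand produces
  \<open>quad\<close> and \<open>cross\<close>.\<close>

lemma pair_moment_rest_P:
  assumes i: "i < n"
  shows "(\<integral>z. \<bar>dotp p (fst z) (snd z)\<bar> powr q \<partial>(rest n i \<Otimes>\<^sub>M P))
     \<le> 160 * f2 p S powr q * (real n powr (q / 2) * quad + real n * cross)"
proof -
  interpret R: cov_law_pair p "\<lambda>k l. real (n - 1) * S k l" S q "rest n i" P
    using cov_law_rest[OF i] cov_law_axioms by (simp add: cov_law_pair_def)
  interpret PP: cov_law_pair p S S q P P using cov_law_axioms by (simp add: cov_law_pair_def)
  have i1: "integrable (rest n i \<Otimes>\<^sub>M P) (\<lambda>(s, x). \<bar>dotp p s x\<bar> powr q)"
    using R.integrable_pair_dotp_powr by (simp add: case_prod_unfold)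
  have i2: "integrable P (\<lambda>x. \<integral>z. \<bar>dotp p x z\<bar> powr q \<partial>P)"
    using PP.PQ.integrable_fst'[OF PP.integrable_pair_dotp_powr] by simp
  have "(\<integral>z. \<bar>dotp p (fst z) (snd z)\<bar> powr q \<partial>(rest n i \<Otimes>\<^sub>M P)) = (\<integral>x. \<integral>s. \<bar>dotp p x s\<bar> powr q \<partial>rest n i \<partial>P)"
    using R.PQ.integral_snd[OF i1] by (simp add: case_prod_unfold dotp_commute)
  also have "\<dots> \<le> (\<integral>x. 160 * (real n powr (q / 2) * qform p S x powr (q / 2) + real n * (\<integral>z. \<bar>dotp p x z\<bar> powr q \<partial>P)) \<partial>P)"
  proof (rule integral_mono)
    show "integrable P (\<lambda>x. \<integral>s. \<bar>dotp p x s\<bar> powr q \<partial>rest n i)"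
      using R.PQ.integrable_snd[OF i1] by (simp add: dotp_commute)
  qed (use i2 integrable_qform_powr abs_moment_rest[OF i] in simp_all)
  also have "\<dots> = 160 * (real n powr (q / 2) * (\<integral>x. qform p S x powr (q / 2) \<partial>P) + real n * (\<integral>x. \<integral>z. \<bar>dotp p x z\<bar> powr q \<partial>P \<partial>P))"
    using i2 integrable_qform_powr by simp
  also have "\<dots> = 160 * f2 p S powr q * (real n powr (q / 2) * quad + real n * cross)"
    using f2_pos by (simp add: quad_def cross_def field_simps)
  finally show ?thesis .
qed

text \<open>For a Gaussian summand the quadratic moment is at most 4 on the normalised scale. Its
  mixed moment with a vector of law \<open>P\<close> is at most \<open>4 * quad\<close>, because for
  a fixed second vector the inner product is normal.\<close>

lemma pair_moment_rest_G:
  assumes i: "i < n"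
  shows "(\<integral>z. \<bar>dotp p (fst z) (snd z)\<bar> powr q \<partial>(rest n i \<Otimes>\<^sub>M G))
     \<le> 160 * f2 p S powr q * (real n powr (q / 2) * 4 + real n * (4 * quad))"
proof -
  interpret R: cov_law_pair p "\<lambda>k l. real (n - 1) * S k l" S q "rest n i" G
    using cov_law_rest[OF i] Gs.G.cov_law_axioms by (simp add: cov_law_pair_def)
  interpret GP: cov_law_pair p S S q G P using cov_law_axioms Gs.G.cov_law_axioms by (simp add: cov_law_pair_def)
  have i1: "integrable (rest n i \<Otimes>\<^sub>M G) (\<lambda>(s, x). \<bar>dotp p s x\<bar> powr q)"
    using R.integrable_pair_dotp_powr by (simp add: case_prod_unfold)
  have i3: "integrable (G \<Otimes>\<^sub>M P) (\<lambda>(s, x). \<bar>dotp p s x\<bar> powr q)"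
    using GP.integrable_pair_dotp_powr by (simp add: case_prod_unfold)
  have i2: "integrable G (\<lambda>x. \<integral>z. \<bar>dotp p x z\<bar> powr q \<partial>P)"
    using GP.PQ.integrable_fst'[OF GP.integrable_pair_dotp_powr] by simp
  have iq: "integrable G (\<lambda>x. qform p S x powr (q / 2))" by (rule Gs.G.integrable_qform_powr)
  have "(\<integral>x. \<integral>z. \<bar>dotp p x z\<bar> powr q \<partial>P \<partial>G) = (\<integral>z. \<integral>x. \<bar>dotp p z x\<bar> powr q \<partial>G \<partial>P)"
    using GP.PQ.Fubini_integral[OF i3] by (simp add: dotp_commute)
  also have "\<dots> \<le> (\<integral>z. 4 * qform p S z powr (q / 2) \<partial>P)"
  proof (rule integral_mono)
    show "integrable P (\<lambda>z. \<integral>x. \<bar>dotp p z x\<bar> powr q \<partial>G)"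
      using GP.PQ.integrable_snd[OF i3] by (simp add: dotp_commute)
  qed (use integrable_qform_powr Gs.abs_moment_G in simp_all)
  finally have c: "(\<integral>x. \<integral>z. \<bar>dotp p x z\<bar> powr q \<partial>P \<partial>G) \<le> 4 * (\<integral>z. qform p S z powr (q / 2) \<partial>P)" by simp
  have "(\<integral>z. \<bar>dotp p (fst z) (snd z)\<bar> powr q \<partial>(rest n i \<Otimes>\<^sub>M G)) = (\<integral>x. \<integral>s. \<bar>dotp p x s\<bar> powr q \<partial>rest n i \<partial>G)"
    using R.PQ.integral_snd[OF i1] by (simp add: case_prod_unfold dotp_commute)
  also have "\<dots> \<le> (\<integral>x. 160 * (real n powr (q / 2) * qform p S x powr (q / 2) + real n * (\<integral>z. \<bar>dotp p x z\<bar> powr q \<partial>P)) \<partial>G)"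
  proof (rule integral_mono)
    show "integrable G (\<lambda>x. \<integral>s. \<bar>dotp p x s\<bar> powr q \<partial>rest n i)"
      using R.PQ.integrable_snd[OF i1] by (simp add: dotp_commute)
  qed (use i2 iq abs_moment_rest[OF i] in simp_all)
  also have "\<dots> = 160 * (real n powr (q / 2) * (\<integral>x. qform p S x powr (q / 2) \<partial>G) + real n * (\<integral>x. \<integral>z. \<bar>dotp p x z\<bar> powr q \<partial>P \<partial>G))"
    using i2 iq by simp
  also have "\<dots> \<le> 160 * (real n powr (q / 2) * (4 * f2 p S powr q) + real n * (4 * (\<integral>z. qform p S z powr (q / 2) \<partial>P)))"
    using c Gs.qform_moment_G(2)[OF f2_pos] by (intro mult_left_mono add_mono) auto
  also have "\<dots> = 160 * f2 p S powr q * (real n powr (q / 2) * 4 + real n * (4 * quad))"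
    using f2_pos by (simp add: quad_def field_simps)
  finally show ?thesis .
qed

text \<open>The sum of \<open>n\<close> replacement errors. The term with \<open>\<tau>\<close> is
  independent of \<open>n\<close>; it becomes small only by the choice of \<open>\<tau>\<close>,
  which in turn multiplies the \<open>kappa\<close> term by a constant.\<close>

theorem gauss_approx:
  assumes t: "test_fun C \<phi> \<phi>1 \<phi>2" and n: "0 < n" and \<tau>: "0 < \<tau>"
  shows "\<bar>(\<integral>z. \<phi> (normalized p S (real n) z) \<partial>walk p P n) - (\<integral>z. \<phi> (normalized p S 1 z) \<partial>G)\<bar>
    \<le> C * (1280 * (real n powr (1 - q / 2) * (quad + 4) + real n powr (2 - q) * (cross + 4 * quad))
         + (1 + 1 / (2 * \<tau>)) * ((kappa + 2) / real n) + 4 * \<tau>)"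
proof -
  let ?f = "f2 p S" and ?N = "real n"
  have C: "0 \<le> C" using t by (simp add: test_fun_def)
  note [measurable] = test_fun_measurable[OF t]
  \<comment> \<open>Hybrid \<open>i\<close> has \<open>i\<close> original summands:
    \<open>H 0\<close> is purely Gaussian, \<open>H n\<close> is the walk.\<close>
  define H where "H = (\<lambda>i. \<integral>z. \<phi> (normalized p S ?N z) \<partial>conv p (walk p P i) (scale_law p (sqrt (real (n - i))) G))"
  define x0 where "x0 = (\<lambda>s. normalized p S ?N s + f1 p S / (?N * ?f))"
  let ?q1 = "?N powr (q / 2) * (quad + 4) + ?N * (cross + 4 * quad)"
  let ?B = "C * (1280 * ?f powr q / (?N * ?f) powr q * ?q1
         + (1 + 1 / (2 * \<tau>)) * ((kappa + 2) / ?N\<^sup>2) + 4 * \<tau> * real (n - 1) / ?N\<^sup>2)"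
  have step: "\<bar>H (Suc i) - H i\<bar> \<le> ?B" if i: "i < n" for i
  proof -
    interpret RP: cov_law_pair p "\<lambda>k l. real (n - 1) * S k l" S q "rest n i" P
      using cov_law_rest[OF i] cov_law_axioms by (simp add: cov_law_pair_def)
    interpret RG: cov_law_pair p "\<lambda>k l. real (n - 1) * S k l" S q "rest n i" G
      using cov_law_rest[OF i] Gs.G.cov_law_axioms by (simp add: cov_law_pair_def)
    let ?I = "\<integral>s. \<phi> (x0 s) + \<phi>2 (x0 s) * (2 * qform p S s / (?N * ?f)\<^sup>2) \<partial>rest n i"
    let ?mP = "\<integral>z. \<bar>dotp p (fst z) (snd z)\<bar> powr q \<partial>(rest n i \<Otimes>\<^sub>M P)"
    let ?mG = "\<integral>z. \<bar>dotp p (fst z) (snd z)\<bar> powr q \<partial>(rest n i \<Otimes>\<^sub>M G)"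
    let ?l = "1 + 1 / (2 * \<tau>)"
    have kP: "(\<integral>z. (sqnorm p z - f1 p S)\<^sup>2 \<partial>P) / (?N * ?f)\<^sup>2 = kappa / ?N\<^sup>2"
      by (simp add: kappa_def power_mult_distrib mult.commute)
    have kG: "(\<integral>z. (sqnorm p z - f1 p S)\<^sup>2 \<partial>G) / (?N * ?f)\<^sup>2 = 2 / ?N\<^sup>2"
      using f2_pos by (simp add: Gs.variance_G power_mult_distrib)
    have 1: "\<bar>H (Suc i) - ?I\<bar> \<le> C * (8 / (?N * ?f) powr q * ?mP + ?l * (kappa / ?N\<^sup>2) + 2 * \<tau> * real (n - 1) / ?N\<^sup>2)"
      unfolding H_def conv_rest_P[symmetric] x0_def kP[symmetric]
      by (rule RP.abs_integral_test_fun_conv_le) (use t f2_pos n \<tau> in auto)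
    have 2: "\<bar>H i - ?I\<bar> \<le> C * (8 / (?N * ?f) powr q * ?mG + ?l * (2 / ?N\<^sup>2) + 2 * \<tau> * real (n - 1) / ?N\<^sup>2)"
      unfolding H_def conv_rest_G[OF i, symmetric] x0_def kG[symmetric]
      by (rule RG.abs_integral_test_fun_conv_le) (use t f2_pos n \<tau> in auto)
    have "\<bar>H (Suc i) - H i\<bar> \<le> C * (8 / (?N * ?f) powr q * ?mP + ?l * (kappa / ?N\<^sup>2) + 2 * \<tau> * real (n - 1) / ?N\<^sup>2)
       + C * (8 / (?N * ?f) powr q * ?mG + ?l * (2 / ?N\<^sup>2) + 2 * \<tau> * real (n - 1) / ?N\<^sup>2)"
      using 1 2 by linarith
    also have "\<dots> = C * (8 / (?N * ?f) powr q * (?mP + ?mG) + ?l * ((kappa + 2) / ?N\<^sup>2) + 4 * \<tau> * real (n - 1) / ?N\<^sup>2)"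
      by (simp add: distrib_left add_divide_distrib; simp add: algebra_simps)
    also have "\<dots> \<le> C * (8 / (?N * ?f) powr q * (160 * ?f powr q * ?q1) + ?l * ((kappa + 2) / ?N\<^sup>2) + 4 * \<tau> * real (n - 1) / ?N\<^sup>2)"
    proof (intro mult_left_mono add_right_mono C)
      show "?mP + ?mG \<le> 160 * ?f powr q * ?q1"
        using pair_moment_rest_P[OF i] pair_moment_rest_G[OF i] by (simp add: algebra_simps)
    qed simp
    also have "8 / (?N * ?f) powr q * (160 * ?f powr q * ?q1) = 1280 * ?f powr q / (?N * ?f) powr q * ?q1" by simp
    finally show ?thesis .
  qed
  \<comment> \<open>The Gaussian part is scaled by \<open>sqrt 0\<close>, which gives the point mass
    at the origin, neutral for the convolution.\<close>
  have "H n = (\<integral>z. \<phi> (normalized p S ?N z) \<partial>walk p P n)"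
  proof -
    have "conv p (walk p P n) (return (vec_space p) (vzero p)) = walk p P n"
    proof (rule vec_law_eqI[of p])
      fix F :: "(nat \<Rightarrow> real) \<Rightarrow> ennreal" assume [measurable]: "F \<in> borel_measurable (vec_space p)"
      have v: "vec_law p (walk p P n)" "vec_law p (return (vec_space p) (vzero p))"
        using law by (simp_all add: vec_law_walk vec_law_return)
      have "(\<integral>\<^sup>+x. F x \<partial>conv p (walk p P n) (return (vec_space p) (vzero p))) = (\<integral>\<^sup>+x. F (vadd p x (vzero p)) \<partial>walk p P n)"
        using v by (simp add: nn_integral_conv nn_integral_return)
      also have "\<dots> = (\<integral>\<^sup>+x. F x \<partial>walk p P n)"
        using vec_lawD(3)[OF v(1)] by (intro nn_integral_cong) (simp add: vadd_vzero)
      finally show "(\<integral>\<^sup>+x. F x \<partial>conv p (walk p P n) (return (vec_space p) (vzero p))) = (\<integral>\<^sup>+x. F x \<partial>walk p P n)" .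
    qed (use law in \<open>simp_all add: vec_law_walk vec_law_return vec_law_conv\<close>)
    then show ?thesis by (simp add: H_def Gs.scale_G_0)
  qed
  \<comment> \<open>A sum of \<open>n\<close> Gaussian vectors is one vector scaled by
    \<open>sqrt n\<close>, and the normalisation divides its squared norm by \<open>n\<close>
    again.\<close>
  moreover have "H 0 = (\<integral>z. \<phi> (normalized p S 1 z) \<partial>G)"
  proof -
    have "conv p (return (vec_space p) (vzero p)) (scale_law p (sqrt ?N) G) = scale_law p (sqrt ?N) G"
    proof -
      have "conv p (scale_law p 0 G) (scale_law p (sqrt ?N) G) = conv p (scale_law p (sqrt ?N) G) (scale_law p 0 G)"
        using Gs.law_G by (intro conv_commute vec_law_scale)
      also have "\<dots> = scale_law p (sqrt ?N) G" using n by (subst Gs.conv_scale_G) simp_all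
      finally show ?thesis by (simp add: Gs.scale_G_0)
    qed
    then have "H 0 = (\<integral>z. \<phi> (normalized p S ?N (vscale p (sqrt ?N) z)) \<partial>G)"
      unfolding H_def scale_law_def by (simp add: integral_distr)
    then show ?thesis using n by (simp add: normalized_def sqnorm_vscale)
  qed
  moreover have "\<bar>H k - H 0\<bar> \<le> real k * ?B" if "k \<le> n" for k
    using that
  proof (induction k)
    case (Suc k)
    then have "\<bar>H (Suc k) - H k\<bar> \<le> ?B" "\<bar>H k - H 0\<bar> \<le> real k * ?B" using step by auto
    then have "\<bar>H (Suc k) - H 0\<bar> \<le> ?B + real k * ?B" by linarith
    moreover have "b + real k * b = real (Suc k) * b" for b :: real by (simp add: algebra_simps)
    ultimately show ?case by simp
  qed simp
  ultimately have "\<bar>(\<integral>z. \<phi> (normalized p S ?N z) \<partial>walk p P n) - (\<integral>z. \<phi> (normalized p S 1 z) \<partial>G)\<bar> \<le> ?N * ?B"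
    by (metis order_refl)
  also have "\<dots> = C * (1280 * (?N * (?f powr q / (?N * ?f) powr q) * ?q1)
      + (1 + 1 / (2 * \<tau>)) * ((kappa + 2) / ?N) + 4 * \<tau> * (real (n - 1) / ?N))"
    using n by (simp add: field_simps power2_eq_square)
  \<comment> \<open>The powers of \<open>f2\<close> cancel, and the \<open>n\<close> steps turn the
    power -q of \<open>n\<close> into \<open>1 - q\<close>; the moments of the rest contribute
    \<open>q / 2\<close> and 1.\<close>
  also have "?N * (?f powr q / (?N * ?f) powr q) * ?q1 = ?N powr (1 - q / 2) * (quad + 4) + ?N powr (2 - q) * (cross + 4 * quad)"
  proof -
    have "?N * (?f powr q / (?N * ?f) powr q) = ?N powr 1 * ?N powr (- q)"
      using f2_pos n by (simp add: powr_mult powr_minus divide_inverse)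
    also have "\<dots> = ?N powr (1 - q)" using powr_add[of ?N 1 "- q"] by simp
    finally have "?N * (?f powr q / (?N * ?f) powr q) * ?q1
       = (?N powr (1 - q) * ?N powr (q / 2)) * (quad + 4) + (?N powr (1 - q) * ?N powr 1) * (cross + 4 * quad)"
      using n by (simp add: distrib_left)
    moreover have "?N powr (1 - q) * ?N powr (q / 2) = ?N powr (1 - q / 2)"
      unfolding powr_add[symmetric] by (rule arg_cong[where f = "\<lambda>t. ?N powr t"]) (simp add: field_simps)
    moreover have "?N powr (1 - q) * ?N powr 1 = ?N powr (2 - q)"
      unfolding powr_add[symmetric] by (rule arg_cong[where f = "\<lambda>t. ?N powr t"]) (simp add: field_simps)
    ultimately show ?thesis by simp
  qed
  also have "C * (1280 * (?N powr (1 - q / 2) * (quad + 4) + ?N powr (2 - q) * (cross + 4 * quad))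
      + (1 + 1 / (2 * \<tau>)) * ((kappa + 2) / ?N) + 4 * \<tau> * (real (n - 1) / ?N)) \<le>
    C * (1280 * (?N powr (1 - q / 2) * (quad + 4) + ?N powr (2 - q) * (cross + 4 * quad))
      + (1 + 1 / (2 * \<tau>)) * ((kappa + 2) / ?N) + 4 * \<tau> * 1)"
    using n \<tau> by (intro mult_left_mono add_left_mono C) auto
  finally show ?thesis by simp
qed

end

section \<open>Sums over disjoint blocks\<close>

text \<open>The variance of \<open>\<bar>Y\<bar>\<close> is nonnegative.\<close>

lemma (in prob_space) expectation_abs_le_sqrt:
  fixes Y :: "'a \<Rightarrow> real"
  assumes [measurable]: "random_variable borel Y" and i: "integrable M (\<lambda>x. (Y x)\<^sup>2)"
  shows "integrable M Y" "expectation (\<lambda>x. \<bar>Y x\<bar>) \<le> sqrt (expectation (\<lambda>x. (Y x)\<^sup>2))"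
proof -
  show iY: "integrable M Y" by (rule square_integrable_imp_integrable[OF _ i]) simp
  have "0 \<le> variance (\<lambda>x. \<bar>Y x\<bar>)" by simp
  also have "\<dots> = expectation (\<lambda>x. (Y x)\<^sup>2) - (expectation (\<lambda>x. \<bar>Y x\<bar>))\<^sup>2"
    using iY i by (subst variance_eq) simp_all
  finally show "expectation (\<lambda>x. \<bar>Y x\<bar>) \<le> sqrt (expectation (\<lambda>x. (Y x)\<^sup>2))"
    by (intro real_le_rsqrt) simp
qed

locale iid_vectors = gauss_approx p S q P a + Pr: prob_space M
  for p S q P a and M :: "'a measure" +
  fixes Z :: "nat \<Rightarrow> 'a \<Rightarrow> nat \<Rightarrow> real" and I :: "nat set"
  assumes indep: "Pr.indep_vars (\<lambda>_. vec_space p) Z I"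
    and ident: "i \<in> I \<Longrightarrow> distr M (vec_space p) (Z i) = P"
    and fin: "finite I"
begin

definition vsum :: "nat set \<Rightarrow> 'a \<Rightarrow> nat \<Rightarrow> real" where
  "vsum B \<omega> = (\<lambda>k\<in>{..<p}. \<Sum>b\<in>B. Z b \<omega> k)"

lemma Z_measurable: "i \<in> I \<Longrightarrow> Z i \<in> measurable M (vec_space p)"
  using indep by (simp add: Pr.indep_vars_def)

lemma sum_vec_measurable:
  "(\<lambda>x. \<lambda>k\<in>{..<p}. \<Sum>b\<in>B. x b k) \<in> measurable (PiM B (\<lambda>_. vec_space p)) (vec_space p)"
proof (subst (2) vec_space_def, rule measurable_restrict, rule borel_measurable_sum)
  fix k b assume "k \<in> {..<p}" "b \<in> B"
  then show "(\<lambda>x. x b k) \<in> borel_measurable (PiM B (\<lambda>_. vec_space p))"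
    using measurable_compose[OF measurable_component_singleton[of b B "\<lambda>_. vec_space p"] vec_component_measurable_self[of k p]]
    by simp
qed

lemma vsum_eq_comp: "vsum B = (\<lambda>x. \<lambda>k\<in>{..<p}. \<Sum>b\<in>B. x b k) \<circ> (\<lambda>\<omega>. restrict (\<lambda>i. Z i \<omega>) B)"
  by (auto simp: vsum_def fun_eq_iff)

lemma vsum_measurable: "B \<subseteq> I \<Longrightarrow> vsum B \<in> measurable M (vec_space p)"
  unfolding vsum_eq_comp
  by (rule measurable_comp[OF _ sum_vec_measurable]) (auto intro!: measurable_restrict Z_measurable)

lemma vsum_indep:
  assumes "A \<inter> B = {}" "A \<subseteq> I" "B \<subseteq> I"
  shows "Pr.indep_var (vec_space p) (vsum A) (vec_space p) (vsum B)"
  unfolding vsum_eq_comp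
  by (rule Pr.indep_var_compose[OF Pr.indep_var_restrict[OF indep assms] sum_vec_measurable sum_vec_measurable])

lemma vsum_union:
  assumes "A \<inter> B = {}" "A \<subseteq> I" "B \<subseteq> I"
  shows "vsum (A \<union> B) \<omega> = vadd p (vsum A \<omega>) (vsum B \<omega>)"
  using assms fin by (auto simp: vsum_def vadd_def fun_eq_iff sum.union_disjoint finite_subset)

text \<open>The passage from random variables to laws: the estimates on walks become statements
  about every block, and only the cardinality of the block matters.\<close>

lemma distr_vsum:
  assumes "B \<subseteq> I"
  shows "distr M (vec_space p) (vsum B) = walk p P (card B)"
proof -
  have "finite B" using assms fin finite_subset by blast
  then show ?thesis using assms
  proof (induction B rule: finite_induct)
    case empty
    have "distr M (vec_space p) (vsum {}) = distr M (vec_space p) (\<lambda>_. vzero p)"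
      by (intro distr_cong) (auto simp: vsum_def vzero_def)
    then show ?case by (simp add: Pr.distr_const)
  next
    case (insert b B)
    have d: "B \<inter> {b} = {}" "B \<subseteq> I" "{b} \<subseteq> I" using insert by auto
    have m: "vsum B \<in> measurable M (vec_space p)" "vsum {b} \<in> measurable M (vec_space p)"
      using d vsum_measurable by auto
    have "distr M (vec_space p) (vsum {b}) = distr M (vec_space p) (Z b)"
    proof (rule distr_cong)
      fix \<omega> assume "\<omega> \<in> space M"
      then have "Z b \<omega> \<in> space (vec_space p)" using Z_measurable[of b] d by (auto dest: measurable_space)
      then show "vsum {b} \<omega> = Z b \<omega>" by (auto simp: vsum_def space_vec_space extensional_def fun_eq_iff)
    qed simp_all
    then have b: "distr M (vec_space p) (vsum {b}) = P" using ident d by simp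
    have "distr M (vec_space p) (vsum (insert b B)) = distr M (vec_space p) (\<lambda>\<omega>. vadd p (vsum B \<omega>) (vsum {b} \<omega>))"
      using vsum_union[OF d] by (intro distr_cong) simp_all
    also have "\<dots> = distr (distr M (vec_space p \<Otimes>\<^sub>M vec_space p) (\<lambda>\<omega>. (vsum B \<omega>, vsum {b} \<omega>))) (vec_space p) (\<lambda>(x, y). vadd p x y)"
      using m by (subst distr_distr) (auto simp: comp_def)
    also have "distr M (vec_space p \<Otimes>\<^sub>M vec_space p) (\<lambda>\<omega>. (vsum B \<omega>, vsum {b} \<omega>)) = walk p P (card B) \<Otimes>\<^sub>M P"
      using vsum_indep[OF d] insert.IH d b by (simp add: Pr.indep_var_distribution_eq)
    finally show ?case using insert.hyps by (simp add: conv_def)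
  qed
qed

lemma distr_vsum_pair:
  assumes "A \<inter> B = {}" "A \<subseteq> I" "B \<subseteq> I"
  shows "distr M (vec_space p \<Otimes>\<^sub>M vec_space p) (\<lambda>\<omega>. (vsum A \<omega>, vsum B \<omega>)) = walk p P (card A) \<Otimes>\<^sub>M walk p P (card B)"
  using vsum_indep[OF assms] distr_vsum assms by (simp add: Pr.indep_var_distribution_eq)

lemma integral_vsum:
  fixes F :: "(nat \<Rightarrow> real) \<Rightarrow> real"
  assumes "B \<subseteq> I" "F \<in> borel_measurable (vec_space p)"
  shows "(\<integral>\<omega>. F (vsum B \<omega>) \<partial>M) = (\<integral>z. F z \<partial>walk p P (card B))"
    and "integrable M (\<lambda>\<omega>. F (vsum B \<omega>)) \<longleftrightarrow> integrable (walk p P (card B)) F"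
  using integral_distr[OF vsum_measurable[OF assms(1)] assms(2)]
    integrable_distr_eq[OF vsum_measurable[OF assms(1)] assms(2)]
  by (simp_all add: distr_vsum[OF assms(1)])

lemma kappa_nonneg: "0 \<le> kappa"
  by (simp add: kappa_def)

lemma walk_pair: "cov_law_pair p (\<lambda>k l. real m * S k l) (\<lambda>k l. real n * S k l) q (walk p P m) (walk p P n)"
  using cov_law_walk by (simp add: cov_law_pair_def)

lemma sqnorm_vsum_L1:
  assumes B: "B \<subseteq> I"
  shows "integrable M (\<lambda>\<omega>. sqnorm p (vsum B \<omega>) - real (card B) * f1 p S)"
    and "(\<integral>\<omega>. \<bar>sqnorm p (vsum B \<omega>) - real (card B) * f1 p S\<bar> \<partial>M)
      \<le> f2 p S * sqrt (real (card B) * kappa + 2 * (real (card B))\<^sup>2)"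
proof -
  let ?k = "real (card B)"
  note [measurable] = vsum_measurable[OF B]
  interpret W: cov_law p "\<lambda>k l. ?k * S k l" q "walk p P (card B)" by (rule cov_law_walk)
  have i: "integrable M (\<lambda>\<omega>. (sqnorm p (vsum B \<omega>) - ?k * f1 p S)\<^sup>2)"
    using integral_vsum(2)[OF B, of "\<lambda>z. (sqnorm p z - ?k * f1 p S)\<^sup>2"] W.integrable_sqnorm_sq by simp
  show "integrable M (\<lambda>\<omega>. sqnorm p (vsum B \<omega>) - ?k * f1 p S)"
    by (rule Pr.expectation_abs_le_sqrt(1)[OF _ i]) simp
  have "(\<integral>\<omega>. (sqnorm p (vsum B \<omega>) - ?k * f1 p S)\<^sup>2 \<partial>M) =
     ?k * (kappa * (f2 p S)\<^sup>2) + 2 * ?k * (?k - 1) * (f2 p S)\<^sup>2"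
    using integral_vsum(1)[OF B, of "\<lambda>z. (sqnorm p z - ?k * f1 p S)\<^sup>2"] variance_walk[of "card B"] f2_pos
    by (simp add: kappa_def)
  also have "\<dots> \<le> (f2 p S)\<^sup>2 * (?k * kappa + 2 * ?k\<^sup>2)"
    using f2_pos by (simp add: algebra_simps power2_eq_square)
  finally have "sqrt (\<integral>\<omega>. (sqnorm p (vsum B \<omega>) - ?k * f1 p S)\<^sup>2 \<partial>M) \<le> sqrt ((f2 p S)\<^sup>2 * (?k * kappa + 2 * ?k\<^sup>2))"
    by (rule real_sqrt_le_mono)
  also have "\<dots> = f2 p S * sqrt (?k * kappa + 2 * ?k\<^sup>2)" using f2_pos by (simp add: real_sqrt_mult)
  finally show "(\<integral>\<omega>. \<bar>sqnorm p (vsum B \<omega>) - ?k * f1 p S\<bar> \<partial>M) \<le> f2 p S * sqrt (?k * kappa + 2 * ?k\<^sup>2)"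
    using Pr.expectation_abs_le_sqrt(2)[OF _ i] by simp
qed

lemma dotp_vsum_L1:
  assumes d: "A \<inter> B = {}" "A \<subseteq> I" "B \<subseteq> I"
  shows "integrable M (\<lambda>\<omega>. dotp p (vsum A \<omega>) (vsum B \<omega>))"
    and "(\<integral>\<omega>. \<bar>dotp p (vsum A \<omega>) (vsum B \<omega>)\<bar> \<partial>M) \<le> f2 p S * sqrt (real (card A) * real (card B))"
proof -
  note [measurable] = vsum_measurable[OF d(2)] vsum_measurable[OF d(3)]
  have m: "(\<lambda>\<omega>. (vsum A \<omega>, vsum B \<omega>)) \<in> measurable M (vec_space p \<Otimes>\<^sub>M vec_space p)" by measurable
  interpret W: cov_law_pair p "\<lambda>k l. real (card A) * S k l" "\<lambda>k l. real (card B) * S k l" q "walk p P (card A)" "walk p P (card B)"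
    by (rule walk_pair)
  have i: "integrable M (\<lambda>\<omega>. (dotp p (vsum A \<omega>) (vsum B \<omega>))\<^sup>2)"
    using W.integrable_pair_dotp_sq integrable_distr_eq[OF m, of "\<lambda>z. (dotp p (fst z) (snd z))\<^sup>2"]
    by (simp add: distr_vsum_pair[OF d])
  show "integrable M (\<lambda>\<omega>. dotp p (vsum A \<omega>) (vsum B \<omega>))"
    by (rule Pr.expectation_abs_le_sqrt(1)[OF _ i]) simp
  have "(\<integral>\<omega>. (dotp p (vsum A \<omega>) (vsum B \<omega>))\<^sup>2 \<partial>M) = (\<Sum>k<p. \<Sum>l<p. real (card B) * S k l * (real (card A) * S l k))"
    using W.integral_pair_dotp_sq integral_distr[OF m, of "\<lambda>z. (dotp p (fst z) (snd z))\<^sup>2"]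
    by (simp add: distr_vsum_pair[OF d])
  also have "\<dots> = (f2 p S)\<^sup>2 * (real (card A) * real (card B))"
    unfolding f2_sq by (simp add: sum_distrib_left sum_distrib_right mult_ac)
  finally have "sqrt (\<integral>\<omega>. (dotp p (vsum A \<omega>) (vsum B \<omega>))\<^sup>2 \<partial>M) = f2 p S * sqrt (real (card A) * real (card B))"
    using f2_pos by (simp add: real_sqrt_mult)
  then show "(\<integral>\<omega>. \<bar>dotp p (vsum A \<omega>) (vsum B \<omega>)\<bar> \<partial>M) \<le> f2 p S * sqrt (real (card A) * real (card B))"
    using Pr.expectation_abs_le_sqrt(2)[OF _ i] by simp
qed

subsection \<open>Overlapping blocks\<close>

definition R :: "nat \<Rightarrow> nat set \<Rightarrow> 'a \<Rightarrow> real" where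
  "R m B \<omega> = normalized p S (real m) (vsum B \<omega>)"

text \<open>The statistic of a part \<open>D\<close> of a block of size \<open>m\<close>: scaled
  like the whole block but centred at the trace of \<open>D\<close>. Thus its difference from
  \<open>R\<close> contains no multiple of the trace.\<close>

definition R' :: "nat \<Rightarrow> nat set \<Rightarrow> 'a \<Rightarrow> real" where
  "R' m D \<omega> = (sqnorm p (vsum D \<omega>) - real (card D) * f1 p S) / (real m * f2 p S)"

lemma R_measurable: "B \<subseteq> I \<Longrightarrow> R m B \<in> borel_measurable M"
  using vsum_measurable[of B] unfolding R_def by measurable

lemma R'_measurable: "D \<subseteq> I \<Longrightarrow> R' m D \<in> borel_measurable M"
  using vsum_measurable[of D] unfolding R'_def by measurable

text \<open>Removing the overlap changes the squared norm by twice an inner product of independent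
  sums and by the centred squared norm of the overlap. Both have second moments free of the
  dimension.\<close>

lemma R_minus_R'_L1:
  assumes A: "A \<subseteq> I" "card A = m" and m: "0 < m"
  shows "integrable M (\<lambda>\<omega>. R m A \<omega> - R' m (A - B) \<omega>)"
    and "(\<integral>\<omega>. \<bar>R m A \<omega> - R' m (A - B) \<omega>\<bar> \<partial>M) \<le> 4 * sqrt (real (card (A \<inter> B)) / real m) + sqrt (kappa / real m)"
proof -
  let ?k = "real (card (A \<inter> B))" and ?f = "f2 p S" and ?m = "real m"
  let ?U = "vsum (A - B)" and ?V = "vsum (A \<inter> B)"
  have fA: "finite A" using A fin finite_subset by blast
  have d: "(A - B) \<inter> (A \<inter> B) = {}" "A - B \<subseteq> I" "A \<inter> B \<subseteq> I" using A by auto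
  have cD: "card (A - B) + card (A \<inter> B) = m"
    using fA A card_Un_disjoint[of "A - B" "A \<inter> B"] by (simp add: Int_commute Un_Diff_Int d(1) Diff_Int_distrib2)
  have cD': "?m = real (card (A - B)) + ?k" using cD by (simp flip: of_nat_add)
  have un: "vsum A \<omega> = vadd p (?U \<omega>) (?V \<omega>)" for \<omega> using vsum_union[OF d] by (simp add: Un_Diff_Int)
  have e: "R m A \<omega> - R' m (A - B) \<omega> =
     (2 * dotp p (?U \<omega>) (?V \<omega>) + (sqnorm p (?V \<omega>) - ?k * f1 p S)) / (?m * ?f)" for \<omega>
  proof -
    have "R m A \<omega> = (sqnorm p (?U \<omega>) + 2 * dotp p (?U \<omega>) (?V \<omega>) + sqnorm p (?V \<omega>) - ?m * f1 p S) / (?m * ?f)"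
      using m f2_pos by (simp add: R_def normalized_def un sqnorm_vadd field_simps)
    moreover have "sqnorm p (?U \<omega>) + 2 * dotp p (?U \<omega>) (?V \<omega>) + sqnorm p (?V \<omega>) - ?m * f1 p S
      - (sqnorm p (?U \<omega>) - real (card (A - B)) * f1 p S) = 2 * dotp p (?U \<omega>) (?V \<omega>) + (sqnorm p (?V \<omega>) - ?k * f1 p S)"
      unfolding cD' by (simp add: algebra_simps)
    ultimately show ?thesis
      unfolding R'_def by (simp only: diff_divide_distrib[symmetric])
  qed
  note i1 = dotp_vsum_L1[OF d] and i2 = sqnorm_vsum_L1[OF d(3)]
  show "integrable M (\<lambda>\<omega>. R m A \<omega> - R' m (A - B) \<omega>)"
    unfolding e using i1(1) i2(1) by (intro integrable_divide_zero Bochner_Integration.integrable_add) auto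
  have "(\<integral>\<omega>. \<bar>R m A \<omega> - R' m (A - B) \<omega>\<bar> \<partial>M)
     \<le> (\<integral>\<omega>. (2 * \<bar>dotp p (?U \<omega>) (?V \<omega>)\<bar> + \<bar>sqnorm p (?V \<omega>) - ?k * f1 p S\<bar>) / (?m * ?f) \<partial>M)"
    unfolding e
  proof (rule integral_mono)
    show "\<bar>(2 * dotp p (?U \<omega>) (?V \<omega>) + (sqnorm p (?V \<omega>) - ?k * f1 p S)) / (?m * ?f)\<bar>
      \<le> (2 * \<bar>dotp p (?U \<omega>) (?V \<omega>)\<bar> + \<bar>sqnorm p (?V \<omega>) - ?k * f1 p S\<bar>) / (?m * ?f)" for \<omega>
      unfolding abs_divide using m f2_pos by (simp add: abs_mult) (intro divide_right_mono, auto)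
  qed (use i1(1) i2(1) in auto)
  also have "\<dots> = (2 * (\<integral>\<omega>. \<bar>dotp p (?U \<omega>) (?V \<omega>)\<bar> \<partial>M) + (\<integral>\<omega>. \<bar>sqnorm p (?V \<omega>) - ?k * f1 p S\<bar> \<partial>M)) / (?m * ?f)"
    using i1(1) i2(1) by simp
  also have "\<dots> \<le> (2 * (?f * sqrt (real (card (A - B)) * ?k)) + ?f * sqrt (?k * kappa + 2 * ?k\<^sup>2)) / (?m * ?f)"
    using i1(2) i2(2) m f2_pos by (intro divide_right_mono add_mono mult_left_mono) auto
  also have "\<dots> = (2 * sqrt (real (card (A - B)) * ?k) + sqrt (?k * kappa + 2 * ?k\<^sup>2)) / ?m"
  proof -
    have "2 * (?f * x) + ?f * y = (2 * x + y) * ?f" for x y by (simp add: algebra_simps)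
    then show ?thesis using f2_pos by simp
  qed
  \<comment> \<open>The overlap has at most \<open>m\<close> elements, so its own fluctuation of
    order \<open>?k\<close> is bounded by the geometric mean of \<open>?m\<close> and
    \<open>?k\<close>.\<close>
  also have "\<dots> \<le> (4 * sqrt (?m * ?k) + sqrt (?m * kappa)) / ?m"
  proof (rule divide_right_mono)
    have "sqrt (real (card (A - B)) * ?k) \<le> sqrt (?m * ?k)" using cD' by (intro real_sqrt_le_mono mult_right_mono) auto
    moreover have "sqrt (?k * kappa + 2 * ?k\<^sup>2) \<le> sqrt (?m * kappa) + 2 * sqrt (?m * ?k)"
    proof -
      have "?k * kappa \<le> ?m * kappa" "2 * ?k\<^sup>2 \<le> 4 * (?m * ?k)"
        using cD' kappa_nonneg by (auto simp: power2_eq_square algebra_simps intro!: mult_right_mono)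
      then have "sqrt (?k * kappa + 2 * ?k\<^sup>2) \<le> sqrt (?m * kappa + 4 * (?m * ?k))" by (intro real_sqrt_le_mono) simp
      also have "\<dots> \<le> sqrt (?m * kappa) + sqrt (4 * (?m * ?k))"
        using kappa_nonneg by (intro sqrt_add_le_add_sqrt) auto
      finally show ?thesis by (simp add: real_sqrt_mult)
    qed
    ultimately show "2 * sqrt (real (card (A - B)) * ?k) + sqrt (?k * kappa + 2 * ?k\<^sup>2) \<le> 4 * sqrt (?m * ?k) + sqrt (?m * kappa)"
      by linarith
  qed simp
  also have "\<dots> = 4 * sqrt (?k / ?m) + sqrt (kappa / ?m)"
  proof -
    have "sqrt (?m * t) / ?m = sqrt (t / ?m)" for t
      using m by (simp add: real_sqrt_mult real_sqrt_divide field_simps; simp flip: mult.assoc)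
    then show ?thesis by (simp only: add_divide_distrib times_divide_eq_right[symmetric])
  qed
  finally show "(\<integral>\<omega>. \<bar>R m A \<omega> - R' m (A - B) \<omega>\<bar> \<partial>M) \<le> 4 * sqrt (?k / ?m) + sqrt (kappa / ?m)" .
qed

definition block_mean :: "nat \<Rightarrow> (real \<Rightarrow> real) \<Rightarrow> real" where
  "block_mean m \<phi> = (\<integral>z. \<phi> (normalized p S (real m) z) \<partial>walk p P m)"

lemma expectation_R:
  assumes "test_fun C \<phi> \<phi>1 \<phi>2" "A \<subseteq> I" "card A = m"
  shows "(\<integral>\<omega>. \<phi> (R m A \<omega>) \<partial>M) = block_mean m \<phi>"
proof -
  note [measurable] = test_fun_measurable[OF assms(1)]
  show ?thesis
    using integral_vsum(1)[OF assms(2), of "\<lambda>z. \<phi> (normalized p S (real m) z)"] assms(3)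
    by (simp add: R_def block_mean_def)
qed

lemma test_fun_integrable:
  assumes "test_fun C \<phi> \<phi>1 \<phi>2" "X \<in> borel_measurable M"
  shows "integrable M (\<lambda>\<omega>. \<phi> (X \<omega>))"
  using assms test_fun_measurable[OF assms(1)]
  by (intro Pr.integrable_const_bound[of _ 1]) (auto simp: test_fun_def)

lemma block_mean_range:
  assumes t: "test_fun C \<phi> \<phi>1 \<phi>2"
  shows "0 \<le> block_mean m \<phi>" "block_mean m \<phi> \<le> 1"
proof -
  interpret W: cov_law p "\<lambda>k l. real m * S k l" q "walk p P m" by (rule cov_law_walk)
  note [measurable] = test_fun_measurable[OF t]
  have b: "0 \<le> \<phi> x" "\<phi> x \<le> 1" for x using t by (auto simp: test_fun_def)
  show "0 \<le> block_mean m \<phi>" unfolding block_mean_def using b by (intro integral_nonneg_AE) auto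
  have "integrable (walk p P m) (\<lambda>z. \<phi> (normalized p S (real m) z))"
    by (rule W.integrable_const_bound[of _ 1]) (use b in auto)
  then have "block_mean m \<phi> \<le> (\<integral>z. 1 \<partial>walk p P m)"
    unfolding block_mean_def using b by (intro integral_mono) auto
  then show "block_mean m \<phi> \<le> 1" by (simp add: W.prob_space)
qed

text \<open>Both blocks are reduced to their disjoint parts, which are independent. The Lipschitz
  property costs twice the error of the reduction, and the product of the reduced means once
  more.\<close>

lemma covariance_blocks:
  assumes t: "test_fun C \<phi> \<phi>1 \<phi>2" and A: "A \<subseteq> I" "card A = m" and B: "B \<subseteq> I" "card B = m" and m: "0 < m"
  shows "\<bar>(\<integral>\<omega>. (\<phi> (R m A \<omega>) - block_mean m \<phi>) * (\<phi> (R m B \<omega>) - block_mean m \<phi>) \<partial>M)\<bar>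
     \<le> 4 * C * (4 * sqrt (real (card (A \<inter> B)) / real m) + sqrt (kappa / real m))"
proof -
  let ?\<eta> = "4 * sqrt (real (card (A \<inter> B)) / real m) + sqrt (kappa / real m)" and ?e = "block_mean m \<phi>"
  let ?a = "\<lambda>\<omega>. \<phi> (R m A \<omega>) - ?e" and ?b = "\<lambda>\<omega>. \<phi> (R m B \<omega>) - ?e"
  let ?a' = "\<lambda>\<omega>. \<phi> (R' m (A - B) \<omega>) - ?e" and ?b' = "\<lambda>\<omega>. \<phi> (R' m (B - A) \<omega>) - ?e"
  have C: "0 \<le> C" using t by (simp add: test_fun_def)
  note [measurable] = test_fun_measurable[OF t]
  have dA: "A - B \<subseteq> I" "B - A \<subseteq> I" "(A - B) \<inter> (B - A) = {}" using A B by auto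
  note mR[measurable] = R_measurable[OF A(1), of m] R_measurable[OF B(1), of m] R'_measurable[OF dA(1), of m] R'_measurable[OF dA(2), of m]
  have r: "\<bar>\<phi> x - ?e\<bar> \<le> 1" for x
  proof -
    have "0 \<le> \<phi> x" "\<phi> x \<le> 1" using t by (auto simp: test_fun_def)
    then show ?thesis using block_mean_range[OF t, of m] by linarith
  qed
  have bdd: "integrable M (\<lambda>\<omega>. (\<phi> (X \<omega>) - ?e) * (\<phi> (Y \<omega>) - ?e))"
    if [measurable]: "X \<in> borel_measurable M" "Y \<in> borel_measurable M" for X Y
    by (rule Pr.integrable_const_bound[of _ 1]) (use r in \<open>auto simp: abs_mult intro!: mult_le_one\<close>)
  have bdd1: "integrable M (\<lambda>\<omega>. \<phi> (X \<omega>) - ?e)" if [measurable]: "X \<in> borel_measurable M" for X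
    by (rule Pr.integrable_const_bound[of _ 1]) (use r in auto)
  have L: "\<bar>(\<integral>\<omega>. F \<omega> \<partial>M) - (\<integral>\<omega>. F' \<omega> \<partial>M)\<bar> \<le> (\<integral>\<omega>. K \<omega> \<partial>M)"
    if "integrable M F" "integrable M F'" "integrable M K" "\<And>\<omega>. \<bar>F \<omega> - F' \<omega>\<bar> \<le> K \<omega>" for F F' K :: "'a \<Rightarrow> real"
  proof -
    have "\<bar>(\<integral>\<omega>. F \<omega> \<partial>M) - (\<integral>\<omega>. F' \<omega> \<partial>M)\<bar> = \<bar>\<integral>\<omega>. F \<omega> - F' \<omega> \<partial>M\<bar>" using that by simp
    also have "\<dots> \<le> (\<integral>\<omega>. \<bar>F \<omega> - F' \<omega>\<bar> \<partial>M)" by (rule integral_abs_bound)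
    also have "\<dots> \<le> (\<integral>\<omega>. K \<omega> \<partial>M)" using that by (intro integral_mono) auto
    finally show ?thesis .
  qed
  note iA = R_minus_R'_L1[OF A m, of B] and iB = R_minus_R'_L1[OF B m, of A]
  have lip: "\<bar>\<phi> x - \<phi> y\<bar> \<le> C * \<bar>x - y\<bar>" for x y by (rule test_fun_Lipschitz(1)[OF t])
  have 1: "\<bar>(\<integral>\<omega>. ?a \<omega> * ?b \<omega> \<partial>M) - (\<integral>\<omega>. ?a' \<omega> * ?b' \<omega> \<partial>M)\<bar>
      \<le> (\<integral>\<omega>. C * \<bar>R m A \<omega> - R' m (A - B) \<omega>\<bar> + C * \<bar>R m B \<omega> - R' m (B - A) \<omega>\<bar> \<partial>M)"
  proof (rule L[OF bdd bdd])
    show "integrable M (\<lambda>\<omega>. C * \<bar>R m A \<omega> - R' m (A - B) \<omega>\<bar> + C * \<bar>R m B \<omega> - R' m (B - A) \<omega>\<bar>)"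
      using iA(1) iB(1) by simp
    fix \<omega>
    have "x * y - x' * y' = (x - x') * y + x' * (y - y')" for x y x' y' :: real by (simp add: algebra_simps)
    then have "\<bar>x * y - x' * y'\<bar> \<le> \<bar>x - x'\<bar> * \<bar>y\<bar> + \<bar>x'\<bar> * \<bar>y - y'\<bar>" for x y x' y' :: real
      by (simp only: abs_mult[symmetric] abs_triangle_ineq)
    then have "\<bar>?a \<omega> * ?b \<omega> - ?a' \<omega> * ?b' \<omega>\<bar> \<le> \<bar>?a \<omega> - ?a' \<omega>\<bar> * \<bar>?b \<omega>\<bar> + \<bar>?a' \<omega>\<bar> * \<bar>?b \<omega> - ?b' \<omega>\<bar>" .
    also have "\<dots> \<le> \<bar>?a \<omega> - ?a' \<omega>\<bar> * 1 + 1 * \<bar>?b \<omega> - ?b' \<omega>\<bar>"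
      using mult_left_mono[OF r[of "R m B \<omega>"], of "\<bar>?a \<omega> - ?a' \<omega>\<bar>"]
        mult_right_mono[OF r[of "R' m (A - B) \<omega>"], of "\<bar>?b \<omega> - ?b' \<omega>\<bar>"] by linarith
    also have "\<dots> \<le> C * \<bar>R m A \<omega> - R' m (A - B) \<omega>\<bar> + C * \<bar>R m B \<omega> - R' m (B - A) \<omega>\<bar>"
      using lip[of "R m A \<omega>" "R' m (A - B) \<omega>"] lip[of "R m B \<omega>" "R' m (B - A) \<omega>"] by simp
    finally show "\<bar>?a \<omega> * ?b \<omega> - ?a' \<omega> * ?b' \<omega>\<bar> \<le> C * \<bar>R m A \<omega> - R' m (A - B) \<omega>\<bar> + C * \<bar>R m B \<omega> - R' m (B - A) \<omega>\<bar>" .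
  qed measurable
  also have "(\<integral>\<omega>. C * \<bar>R m A \<omega> - R' m (A - B) \<omega>\<bar> + C * \<bar>R m B \<omega> - R' m (B - A) \<omega>\<bar> \<partial>M)
     = C * (\<integral>\<omega>. \<bar>R m A \<omega> - R' m (A - B) \<omega>\<bar> \<partial>M) + C * (\<integral>\<omega>. \<bar>R m B \<omega> - R' m (B - A) \<omega>\<bar> \<partial>M)"
    using iA(1) iB(1) by simp
  also have "\<dots> \<le> C * ?\<eta> + C * ?\<eta>"
    using iA(2) iB(2) C by (intro add_mono mult_left_mono) (auto simp: Int_commute)
  finally have 1: "\<bar>(\<integral>\<omega>. ?a \<omega> * ?b \<omega> \<partial>M) - (\<integral>\<omega>. ?a' \<omega> * ?b' \<omega> \<partial>M)\<bar> \<le> C * ?\<eta> + C * ?\<eta>" .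
  \<comment> \<open>The full statistic has centred test values, so the mean of the reduced one is as
    small as the error of the reduction. A bound by 1 is enough for the other factor.\<close>
  have ea: "(\<integral>\<omega>. ?a \<omega> \<partial>M) = 0"
    using test_fun_integrable[OF t mR(1)] by (simp add: expectation_R[OF t A] Pr.prob_space)
  have 2: "\<bar>(\<integral>\<omega>. ?a \<omega> \<partial>M) - (\<integral>\<omega>. ?a' \<omega> \<partial>M)\<bar> \<le> (\<integral>\<omega>. C * \<bar>R m A \<omega> - R' m (A - B) \<omega>\<bar> \<partial>M)"
    using iA(1) lip by (intro L bdd1 mR) simp_all
  also have "\<dots> \<le> C * ?\<eta>" using iA(2) C by (simp add: mult_left_mono)
  finally have 2: "\<bar>\<integral>\<omega>. ?a' \<omega> \<partial>M\<bar> \<le> C * ?\<eta>" using ea by simp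
  have "\<bar>\<integral>\<omega>. ?b' \<omega> \<partial>M\<bar> \<le> (\<integral>\<omega>. \<bar>?b' \<omega>\<bar> \<partial>M)" by (rule integral_abs_bound)
  also have "\<dots> \<le> (\<integral>\<omega>. 1 \<partial>M)" using r bdd1[OF mR(4)] by (intro integral_mono) auto
  finally have 3: "\<bar>\<integral>\<omega>. ?b' \<omega> \<partial>M\<bar> \<le> 1" by (simp add: Pr.prob_space)
  have "(\<integral>\<omega>. ?a' \<omega> * ?b' \<omega> \<partial>M) = (\<integral>\<omega>. ?a' \<omega> \<partial>M) * (\<integral>\<omega>. ?b' \<omega> \<partial>M)"
  proof (rule Pr.indep_var_lebesgue_integral)
    have "Pr.indep_var borel ((\<lambda>z. \<phi> ((sqnorm p z - real (card (A - B)) * f1 p S) / (real m * f2 p S)) - ?e) \<circ> vsum (A - B))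
       borel ((\<lambda>z. \<phi> ((sqnorm p z - real (card (B - A)) * f1 p S) / (real m * f2 p S)) - ?e) \<circ> vsum (B - A))"
      by (rule Pr.indep_var_compose[OF vsum_indep[OF dA(3,1,2)]]) measurable
    then show "Pr.indep_var borel ?a' borel ?b'" by (simp add: comp_def R'_def)
  qed (intro bdd1 mR)+
  then have "\<bar>\<integral>\<omega>. ?a' \<omega> * ?b' \<omega> \<partial>M\<bar> \<le> C * ?\<eta> * 1"
    by (simp only: abs_mult) (use 2 3 in \<open>intro mult_mono, auto\<close>)
  then have "\<bar>\<integral>\<omega>. ?a' \<omega> * ?b' \<omega> \<partial>M\<bar> \<le> C * ?\<eta>" by simp
  moreover have "0 \<le> C * ?\<eta>" using C kappa_nonneg by simp
  moreover have "4 * C * ?\<eta> = 4 * (C * ?\<eta>)" by simp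
  ultimately show ?thesis using 1 by linarith
qed

subsection \<open>Centring at the sample mean\<close>

text \<open>The observable statistic on the scale of \<open>R\<close>. Division by
  \<open>1 - m / n\<close>, with \<open>n = card I\<close>, is the exact correction of the mean: the
  difference of the two averages has covariance \<open>(1 / m - 1 / n) * S\<close>.\<close>

definition W :: "nat \<Rightarrow> nat set \<Rightarrow> 'a \<Rightarrow> real" where
  "W m B \<omega> = (real m * sqnorm p (vadd p (vscale p (1 / real m) (vsum B \<omega>)) (vscale p (- 1 / real (card I)) (vsum I \<omega>)))
       / (1 - real m / real (card I)) - f1 p S) / f2 p S"

text \<open>The exact correction makes the trace cancel, and the difference becomes a combination of
  centred statistics with coefficients that vanish with \<open>\<rho>\<close>. A term proportional
  to f1 / f2 would not be controlled.\<close>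

lemma W_minus_R_L1:
  assumes B: "B \<subseteq> I" "card B = m" and m: "0 < m" "m < card I"
  defines "\<rho> \<equiv> real m / real (card I)"
  shows "integrable M (\<lambda>\<omega>. W m B \<omega> - R m B \<omega>)"
    and "(\<integral>\<omega>. \<bar>W m B \<omega> - R m B \<omega>\<bar> \<partial>M) \<le> (2 * \<rho> * sqrt (kappa / real m + 2) + 2 * sqrt \<rho>) / (1 - \<rho>)"
proof -
  let ?N = "real (card I)" and ?m = "real m" and ?f = "f2 p S"
  let ?X = "\<lambda>\<omega>. dotp p (vsum B \<omega>) (vsum (I - B) \<omega>)"
  let ?D = "\<lambda>\<omega>. (- \<rho> * R m B \<omega> + \<rho> * R (card I) I \<omega> - 2 * ?X \<omega> / (?N * ?f)) / (1 - \<rho>)"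
  have N: "0 < ?N" "?m < ?N" "0 < ?m" using m by auto
  have \<rho>: "0 < \<rho>" "\<rho> < 1" using N by (auto simp: \<rho>_def)
  have d: "B \<inter> (I - B) = {}" "B \<subseteq> I" "I - B \<subseteq> I" using B by auto
  have e: "W m B \<omega> - R m B \<omega> = ?D \<omega>" for \<omega>
  proof -
    define T where "T = sqnorm p (vsum B \<omega>)"
    define U where "U = sqnorm p (vsum I \<omega>)"
    define x where "x = ?X \<omega>"
    have I: "vsum I \<omega> = vadd p (vsum B \<omega>) (vsum (I - B) \<omega>)" using vsum_union[OF d, of \<omega>] B(1) by (simp add: Un_absorb1)
    have dI: "dotp p (vsum B \<omega>) (vsum I \<omega>) = T + x"
      unfolding I dotp_vadd_right T_def x_def sqnorm_def ..
    have "?m * sqnorm p (vadd p (vscale p (1 / ?m) (vsum B \<omega>)) (vscale p (- 1 / ?N) (vsum I \<omega>)))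
       = T / ?m - 2 * (T + x) / ?N + \<rho> * (U / ?N)"
    proof -
      have "dotp p (vscale p (1 / ?m) (vsum B \<omega>)) (vscale p (- 1 / ?N) (vsum I \<omega>)) = (1 / ?m) * ((- 1 / ?N) * (T + x))"
        by (simp only: dotp_vscale_left dotp_commute[of p "vsum B \<omega>" "vscale p _ _"] dotp_commute[of p "vsum I \<omega>"] dI)
      then have "?m * sqnorm p (vadd p (vscale p (1 / ?m) (vsum B \<omega>)) (vscale p (- 1 / ?N) (vsum I \<omega>)))
         = ?m * ((1 / ?m)\<^sup>2 * T + 2 * ((1 / ?m) * ((- 1 / ?N) * (T + x))) + (- 1 / ?N)\<^sup>2 * U)"
        by (simp only: sqnorm_vadd sqnorm_vscale T_def U_def)
      also have "\<dots> = T / ?m - 2 * (T + x) / ?N + \<rho> * (U / ?N)"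
        using N by (simp add: \<rho>_def field_simps power2_eq_square)
      finally show ?thesis .
    qed
    then have w1: "W m B \<omega> = ((T / ?m - 2 * (T + x) / ?N + \<rho> * (U / ?N)) / (1 - \<rho>) - f1 p S) / ?f"
      by (simp add: W_def \<rho>_def)
    have w2: "2 * (T + x) / ?N = 2 * \<rho> * (T / ?m) + 2 * x / ?N" using N by (simp add: \<rho>_def field_simps)
    have r: "R m B \<omega> = (T / ?m - f1 p S) / ?f" "R (card I) I \<omega> = (U / ?N - f1 p S) / ?f"
      by (simp_all add: R_def normalized_def T_def U_def)
    \<comment> \<open>\<open>t\<close>, \<open>u\<close> and \<open>c\<close> stand for the scaled
      squared norms of block and sample and for the trace. The coefficients of \<open>c\<close> on
      both sides agree only thanks to the division by \<open>1 - \<rho>\<close>.\<close>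
    have gen: "((t - (2 * \<rho> * t + y) + \<rho> * u) / (1 - \<rho>) - c) / g - (t - c) / g
       = (- \<rho> * ((t - c) / g) + \<rho> * ((u - c) / g) - y / g) / (1 - \<rho>)" if "g \<noteq> 0" for t y u c g :: real
      using that \<rho> by (simp add: field_simps)
    show ?thesis unfolding w1 w2 r x_def[symmetric] by (subst gen) (use f2_pos in simp_all)
  qed
  \<comment> \<open>Stated for every size \<open>n\<close> of at least \<open>m\<close>, because it
    is needed for the block and for the full sample.\<close>
  have iR: "integrable M (R n A)" "(\<integral>\<omega>. \<bar>R n A \<omega>\<bar> \<partial>M) \<le> sqrt (kappa / ?m + 2)"
    if A: "A \<subseteq> I" "card A = n" "m \<le> n" for A n
  proof -
    have n: "0 < real n" "?m \<le> real n" using that m by auto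
    have eR: "R n A \<omega> = (sqnorm p (vsum A \<omega>) - real (card A) * f1 p S) / (real n * ?f)" for \<omega>
      using n A f2_pos by (simp add: R_def normalized_def field_simps)
    show "integrable M (R n A)" unfolding eR[abs_def] using sqnorm_vsum_L1(1)[OF A(1)] by simp
    have "(\<integral>\<omega>. \<bar>R n A \<omega>\<bar> \<partial>M) = (\<integral>\<omega>. \<bar>sqnorm p (vsum A \<omega>) - real (card A) * f1 p S\<bar> \<partial>M) / (real n * ?f)"
      unfolding eR using n f2_pos by (simp add: abs_divide abs_mult)
    also have "\<dots> \<le> (?f * sqrt (real n * kappa + 2 * (real n)\<^sup>2)) / (real n * ?f)"
      using sqnorm_vsum_L1(2)[OF A(1)] n f2_pos A(2) by (intro divide_right_mono) auto
    also have "\<dots> = sqrt (real n * kappa + 2 * (real n)\<^sup>2) / sqrt ((real n)\<^sup>2)" using f2_pos n by simp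
    also have "\<dots> = sqrt (kappa / real n + 2)"
      unfolding real_sqrt_divide[symmetric] using n by (simp add: field_simps power2_eq_square)
    also have "\<dots> \<le> sqrt (kappa / ?m + 2)"
      using n N kappa_nonneg by (intro real_sqrt_le_mono add_right_mono divide_left_mono) auto
    finally show "(\<integral>\<omega>. \<bar>R n A \<omega>\<bar> \<partial>M) \<le> sqrt (kappa / ?m + 2)" .
  qed
  note i1 = iR[OF B order_refl] and i2 = iR[OF order_refl refl less_imp_le[OF m(2)]] and i3 = dotp_vsum_L1[OF d]
  show "integrable M (\<lambda>\<omega>. W m B \<omega> - R m B \<omega>)" unfolding e using i1(1) i2(1) i3(1) by simp
  have "(\<integral>\<omega>. \<bar>W m B \<omega> - R m B \<omega>\<bar> \<partial>M)
     \<le> (\<integral>\<omega>. (\<rho> * \<bar>R m B \<omega>\<bar> + \<rho> * \<bar>R (card I) I \<omega>\<bar> + 2 / (?N * ?f) * \<bar>?X \<omega>\<bar>) / (1 - \<rho>) \<partial>M)"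
  proof (rule integral_mono)
    show "integrable M (\<lambda>\<omega>. \<bar>W m B \<omega> - R m B \<omega>\<bar>)" unfolding e using i1(1) i2(1) i3(1) by simp
    show "integrable M (\<lambda>\<omega>. (\<rho> * \<bar>R m B \<omega>\<bar> + \<rho> * \<bar>R (card I) I \<omega>\<bar> + 2 / (?N * ?f) * \<bar>?X \<omega>\<bar>) / (1 - \<rho>))"
      using i1(1) i2(1) i3(1) by simp
    fix \<omega>
    have "\<bar>- \<rho> * R m B \<omega> + \<rho> * R (card I) I \<omega> - 2 * ?X \<omega> / (?N * ?f)\<bar>
      \<le> \<bar>- \<rho> * R m B \<omega>\<bar> + \<bar>\<rho> * R (card I) I \<omega>\<bar> + \<bar>2 * ?X \<omega> / (?N * ?f)\<bar>"
      by (rule order_trans[OF abs_triangle_ineq4 add_right_mono[OF abs_triangle_ineq]])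
    also have "\<dots> = \<rho> * \<bar>R m B \<omega>\<bar> + \<rho> * \<bar>R (card I) I \<omega>\<bar> + 2 / (?N * ?f) * \<bar>?X \<omega>\<bar>"
      using \<rho> f2_pos by (simp add: abs_mult abs_divide)
    finally show "\<bar>W m B \<omega> - R m B \<omega>\<bar> \<le> (\<rho> * \<bar>R m B \<omega>\<bar> + \<rho> * \<bar>R (card I) I \<omega>\<bar> + 2 / (?N * ?f) * \<bar>?X \<omega>\<bar>) / (1 - \<rho>)"
      unfolding e abs_divide using \<rho> by (simp add: divide_right_mono)
  qed
  also have "\<dots> = (\<rho> * (\<integral>\<omega>. \<bar>R m B \<omega>\<bar> \<partial>M) + \<rho> * (\<integral>\<omega>. \<bar>R (card I) I \<omega>\<bar> \<partial>M) + 2 / (?N * ?f) * (\<integral>\<omega>. \<bar>?X \<omega>\<bar> \<partial>M)) / (1 - \<rho>)"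
    using i1(1) i2(1) i3(1) by simp
  also have "\<dots> \<le> (\<rho> * sqrt (kappa / ?m + 2) + \<rho> * sqrt (kappa / ?m + 2) + 2 * sqrt \<rho>) / (1 - \<rho>)"
  proof (intro divide_right_mono add_mono mult_left_mono)
    show "(\<integral>\<omega>. \<bar>R m B \<omega>\<bar> \<partial>M) \<le> sqrt (kappa / ?m + 2)" by (rule i1(2))
    show "(\<integral>\<omega>. \<bar>R (card I) I \<omega>\<bar> \<partial>M) \<le> sqrt (kappa / ?m + 2)" by (rule i2(2))
    have "2 / (?N * ?f) * (\<integral>\<omega>. \<bar>?X \<omega>\<bar> \<partial>M) \<le> 2 / (?N * ?f) * (?f * sqrt (?m * ?N))"
    proof (intro mult_left_mono)
      have "(\<integral>\<omega>. \<bar>?X \<omega>\<bar> \<partial>M) \<le> ?f * sqrt (real (card B) * real (card (I - B)))" by (rule i3(2))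
      also have "\<dots> \<le> ?f * sqrt (?m * ?N)"
        using B f2_pos fin card_mono[of I "I - B"] by (intro mult_left_mono real_sqrt_le_mono mult_mono) auto
      finally show "(\<integral>\<omega>. \<bar>?X \<omega>\<bar> \<partial>M) \<le> ?f * sqrt (?m * ?N)" .
    qed (use f2_pos in simp)
    also have "\<dots> = 2 * (sqrt (?m * ?N) / sqrt (?N * ?N))" using f2_pos N by simp
    also have "\<dots> = 2 * sqrt \<rho>" unfolding real_sqrt_divide[symmetric] \<rho>_def using N by simp
    finally show "2 / (?N * ?f) * (\<integral>\<omega>. \<bar>?X \<omega>\<bar> \<partial>M) \<le> 2 * sqrt \<rho>" .
  qed (use \<rho> in auto)
  finally show "(\<integral>\<omega>. \<bar>W m B \<omega> - R m B \<omega>\<bar> \<partial>M) \<le> (2 * \<rho> * sqrt (kappa / real m + 2) + 2 * sqrt \<rho>) / (1 - \<rho>)"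
    by (simp add: mult.assoc)
qed

end

section \<open>Averages over random blocks\<close>

text \<open>Conditioning on a random index with finitely many values, written as a sum over its
  level sets. The last hypothesis is the independence of the index and each \<open>Y d\<close> in
  integrated form.\<close>

lemma (in prob_space) mixture_integral:
  fixes Y :: "'d \<Rightarrow> 'a \<Rightarrow> real"
  assumes fin: "finite \<D>" and D: "\<And>\<omega>. \<omega> \<in> space M \<Longrightarrow> D \<omega> \<in> \<D>"
    and ev: "\<And>d. d \<in> \<D> \<Longrightarrow> {\<omega> \<in> space M. D \<omega> = d} \<in> events"
    and int: "\<And>d. d \<in> \<D> \<Longrightarrow> integrable M (Y d)"
    and ind: "\<And>d. d \<in> \<D> \<Longrightarrow> (\<integral>\<omega>. indicator {\<omega> \<in> space M. D \<omega> = d} \<omega> * Y d \<omega> \<partial>M) = prob {\<omega> \<in> space M. D \<omega> = d} * expectation (Y d)"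
  shows "integrable M (\<lambda>\<omega>. Y (D \<omega>) \<omega>)"
    and "expectation (\<lambda>\<omega>. Y (D \<omega>) \<omega>) = (\<Sum>d\<in>\<D>. prob {\<omega> \<in> space M. D \<omega> = d} * expectation (Y d))"
proof -
  let ?E = "\<lambda>d. {\<omega> \<in> space M. D \<omega> = d}"
  have e: "Y (D \<omega>) \<omega> = (\<Sum>d\<in>\<D>. indicator (?E d) \<omega> * Y d \<omega>)" if "\<omega> \<in> space M" for \<omega>
  proof -
    have "(\<Sum>d\<in>\<D>. indicator (?E d) \<omega> * Y d \<omega>) = (\<Sum>d\<in>\<D>. if d = D \<omega> then Y d \<omega> else 0)"
      using that by (intro sum.cong) auto
    then show ?thesis using fin D[OF that] by simp
  qed
  have i: "integrable M (\<lambda>\<omega>. indicator (?E d) \<omega> * Y d \<omega>)" if "d \<in> \<D>" for d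
    using integrable_mult_indicator[OF ev[OF that] int[OF that]] by simp
  have "integrable M (\<lambda>\<omega>. \<Sum>d\<in>\<D>. indicator (?E d) \<omega> * Y d \<omega>)"
    using i by (rule Bochner_Integration.integrable_sum)
  then show "integrable M (\<lambda>\<omega>. Y (D \<omega>) \<omega>)"
    by (rule Bochner_Integration.integrable_cong[THEN iffD1, rotated -1]) (auto simp: e)
  have "expectation (\<lambda>\<omega>. Y (D \<omega>) \<omega>) = expectation (\<lambda>\<omega>. \<Sum>d\<in>\<D>. indicator (?E d) \<omega> * Y d \<omega>)"
    by (intro Bochner_Integration.integral_cong) (auto simp: e)
  also have "\<dots> = (\<Sum>d\<in>\<D>. expectation (\<lambda>\<omega>. indicator (?E d) \<omega> * Y d \<omega>))"
    using i by (rule Bochner_Integration.integral_sum)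
  also have "\<dots> = (\<Sum>d\<in>\<D>. prob (?E d) * expectation (Y d))" by (intro sum.cong refl ind)
  finally show "expectation (\<lambda>\<omega>. Y (D \<omega>) \<omega>) = (\<Sum>d\<in>\<D>. prob (?E d) * expectation (Y d))" .
qed

text \<open>Bounds for fixed blocks are thereby averaged over random blocks. The right side is a
  mixture as well, with constant random variables.\<close>

lemma (in prob_space) mixture_integral_le:
  fixes Y :: "'d \<Rightarrow> 'a \<Rightarrow> real"
  assumes fin: "finite \<D>" and D: "\<And>\<omega>. \<omega> \<in> space M \<Longrightarrow> D \<omega> \<in> \<D>"
    and ev: "\<And>d. d \<in> \<D> \<Longrightarrow> {\<omega> \<in> space M. D \<omega> = d} \<in> events"
    and int: "\<And>d. d \<in> \<D> \<Longrightarrow> integrable M (Y d)"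
    and ind: "\<And>d. d \<in> \<D> \<Longrightarrow> (\<integral>\<omega>. indicator {\<omega> \<in> space M. D \<omega> = d} \<omega> * Y d \<omega> \<partial>M) = prob {\<omega> \<in> space M. D \<omega> = d} * expectation (Y d)"
    and le: "\<And>d. d \<in> \<D> \<Longrightarrow> expectation (Y d) \<le> g d"
  shows "expectation (\<lambda>\<omega>. Y (D \<omega>) \<omega>) \<le> expectation (\<lambda>\<omega>. g (D \<omega>))"
    and "integrable M (\<lambda>\<omega>. g (D \<omega>))"
proof -
  have const: "(\<integral>\<omega>. indicator {\<omega> \<in> space M. D \<omega> = d} \<omega> * g d \<partial>M)
      = prob {\<omega> \<in> space M. D \<omega> = d} * expectation (\<lambda>_. g d)" if "d \<in> \<D>" for d
    using ev[OF that] by (simp add: prob_space)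
  have "expectation (\<lambda>\<omega>. Y (D \<omega>) \<omega>) = (\<Sum>d\<in>\<D>. prob {\<omega> \<in> space M. D \<omega> = d} * expectation (Y d))"
    using fin D ev int ind by (rule mixture_integral)
  also have "\<dots> \<le> (\<Sum>d\<in>\<D>. prob {\<omega> \<in> space M. D \<omega> = d} * g d)"
    using le by (intro sum_mono mult_left_mono) auto
  also have "\<dots> = (\<Sum>d\<in>\<D>. prob {\<omega> \<in> space M. D \<omega> = d} * expectation (\<lambda>_. g d))" by (simp add: prob_space)
  also have "\<dots> = expectation (\<lambda>\<omega>. g (D \<omega>))"
    by (rule mixture_integral(2)[OF fin D ev integrable_const const, symmetric])
  finally show "expectation (\<lambda>\<omega>. Y (D \<omega>) \<omega>) \<le> expectation (\<lambda>\<omega>. g (D \<omega>))" .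
  show "integrable M (\<lambda>\<omega>. g (D \<omega>))"
    by (rule mixture_integral(1)[OF fin D ev integrable_const const])
qed

text \<open>The sigma-algebra \<open>F\<close> carries the sample. The integral form of independence covers both deterministic
  blocks, with \<open>F = M\<close>, and random subsets independent of the sample.\<close>

locale random_blocks = iid_vectors p S q P a M Z I for p S q P a and M :: "'a measure" and Z I +
  fixes F :: "'a measure" and A :: "nat \<Rightarrow> 'a \<Rightarrow> nat set" and J m :: nat and \<eta> :: real
  assumes Z_F: "i \<in> I \<Longrightarrow> Z i \<in> measurable F (vec_space p)"
    and A_ev: "{\<omega> \<in> space M. A j \<omega> = b} \<in> Pr.events"
    and A_block: "\<omega> \<in> space M \<Longrightarrow> A j \<omega> \<subseteq> I \<and> card (A j \<omega>) = m"
    and A_indep: "i \<in> {1..J} \<Longrightarrow> j \<in> {1..J} \<Longrightarrow> Y \<in> borel_measurable F \<Longrightarrow> integrable M Y \<Longrightarrow>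
        (\<integral>\<omega>. indicator {\<omega> \<in> space M. A i \<omega> = b \<and> A j \<omega> = c} \<omega> * Y \<omega> \<partial>M)
          = Pr.prob {\<omega> \<in> space M. A i \<omega> = b \<and> A j \<omega> = c} * (\<integral>\<omega>. Y \<omega> \<partial>M)"
    and overlap: "i \<in> {1..J} \<Longrightarrow> j \<in> {1..J} \<Longrightarrow> i \<noteq> j \<Longrightarrow>
        (\<integral>\<omega>. sqrt (real (card (A i \<omega> \<inter> A j \<omega>)) / real m) \<partial>M) \<le> \<eta>"
    and eta: "0 \<le> \<eta>" and m_pos: "0 < m" and m_less: "m < card I" and J_pos: "0 < J"
begin

lemma vsum_measurable_F: "B \<subseteq> I \<Longrightarrow> vsum B \<in> measurable F (vec_space p)"
  unfolding vsum_eq_comp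
  by (rule measurable_comp[OF _ sum_vec_measurable]) (auto intro!: measurable_restrict Z_F)

lemma R_measurable_F: "B \<subseteq> I \<Longrightarrow> R m B \<in> borel_measurable F"
  using vsum_measurable_F[of B] unfolding R_def by measurable

lemma W_measurable_F: "B \<subseteq> I \<Longrightarrow> W m B \<in> borel_measurable F"
  using vsum_measurable_F[of B] vsum_measurable_F[of I] unfolding W_def by measurable

definition blocks :: "nat set set" where "blocks = {B. B \<subseteq> I \<and> card B = m}"

lemma finite_blocks: "finite blocks"
  unfolding blocks_def using fin by (auto intro: finite_subset[of _ "Pow I"])

lemma A_ev2: "{\<omega> \<in> space M. A i \<omega> = b \<and> A j \<omega> = c} \<in> Pr.events"
proof -
  have "{\<omega> \<in> space M. A i \<omega> = b \<and> A j \<omega> = c} = {\<omega> \<in> space M. A i \<omega> = b} \<inter> {\<omega> \<in> space M. A j \<omega> = c}" by auto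
  then show ?thesis using A_ev by simp
qed

text \<open>A single block is treated as a pair of equal blocks.\<close>

lemma
  fixes Y :: "nat set \<Rightarrow> 'a \<Rightarrow> real"
  assumes j: "j \<in> {1..J}" and Y: "\<And>b. b \<in> blocks \<Longrightarrow> integrable M (Y b)" "\<And>b. b \<in> blocks \<Longrightarrow> Y b \<in> borel_measurable F"
  shows integrable_block: "integrable M (\<lambda>\<omega>. Y (A j \<omega>) \<omega>)"
    and integral_block_le: "(\<And>b. b \<in> blocks \<Longrightarrow> (\<integral>\<omega>. Y b \<omega> \<partial>M) \<le> w) \<Longrightarrow> (\<integral>\<omega>. Y (A j \<omega>) \<omega> \<partial>M) \<le> w"
proof -
  have ind: "(\<integral>\<omega>. indicator {\<omega> \<in> space M. A j \<omega> = b} \<omega> * Y b \<omega> \<partial>M) = Pr.prob {\<omega> \<in> space M. A j \<omega> = b} * (\<integral>\<omega>. Y b \<omega> \<partial>M)"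
    if "b \<in> blocks" for b
    using A_indep[OF j j Y(2)[OF that] Y(1)[OF that], of b b] by simp
  have D: "\<omega> \<in> space M \<Longrightarrow> A j \<omega> \<in> blocks" for \<omega> using A_block by (auto simp: blocks_def)
  show "integrable M (\<lambda>\<omega>. Y (A j \<omega>) \<omega>)"
    by (rule Pr.mixture_integral(1)[OF finite_blocks D A_ev Y(1) ind])
  assume le: "\<And>b. b \<in> blocks \<Longrightarrow> (\<integral>\<omega>. Y b \<omega> \<partial>M) \<le> w"
  have "(\<integral>\<omega>. Y (A j \<omega>) \<omega> \<partial>M) \<le> (\<integral>\<omega>. w \<partial>M)"
    by (rule Pr.mixture_integral_le(1)[OF finite_blocks D A_ev Y(1) ind le])
  then show "(\<integral>\<omega>. Y (A j \<omega>) \<omega> \<partial>M) \<le> w" by (simp add: Pr.prob_space)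
qed

definition avg :: "(real \<Rightarrow> real) \<Rightarrow> 'a \<Rightarrow> real" where
  "avg \<phi> \<omega> = (\<Sum>j\<in>{1..J}. \<phi> (R m (A j \<omega>) \<omega>)) / real J"

text \<open>The average cost of centring at the sample mean; it bounds that cost for all test
  functions at once, up to their Lipschitz constants.\<close>

definition dev :: "'a \<Rightarrow> real" where
  "dev \<omega> = (\<Sum>j\<in>{1..J}. \<bar>W m (A j \<omega>) \<omega> - R m (A j \<omega>) \<omega>\<bar>) / real J"

lemma dev_L1:
  defines "\<rho> \<equiv> real m / real (card I)"
  shows "integrable M dev" "(\<integral>\<omega>. dev \<omega> \<partial>M) \<le> (2 * \<rho> * sqrt (kappa / real m + 2) + 2 * sqrt \<rho>) / (1 - \<rho>)"
proof -
  let ?w = "(2 * \<rho> * sqrt (kappa / real m + 2) + 2 * sqrt \<rho>) / (1 - \<rho>)"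
  have i: "integrable M (\<lambda>\<omega>. \<bar>W m b \<omega> - R m b \<omega>\<bar>)" "(\<lambda>\<omega>. \<bar>W m b \<omega> - R m b \<omega>\<bar>) \<in> borel_measurable F"
    "(\<integral>\<omega>. \<bar>W m b \<omega> - R m b \<omega>\<bar> \<partial>M) \<le> ?w" if "b \<in> blocks" for b
  proof -
    have b: "b \<subseteq> I" "card b = m" using that by (auto simp: blocks_def)
    note [measurable] = R_measurable_F[OF b(1)] W_measurable_F[OF b(1)]
    show "integrable M (\<lambda>\<omega>. \<bar>W m b \<omega> - R m b \<omega>\<bar>)" "(\<integral>\<omega>. \<bar>W m b \<omega> - R m b \<omega>\<bar> \<partial>M) \<le> ?w"
      using W_minus_R_L1[OF b m_pos m_less] by (auto simp: \<rho>_def)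
    show "(\<lambda>\<omega>. \<bar>W m b \<omega> - R m b \<omega>\<bar>) \<in> borel_measurable F" by measurable
  qed
  have ib: "integrable M (\<lambda>\<omega>. \<bar>W m (A j \<omega>) \<omega> - R m (A j \<omega>) \<omega>\<bar>)" if "j \<in> {1..J}" for j
    by (rule integrable_block[OF that i(1,2)])
  show "integrable M dev" unfolding dev_def using ib by (intro integrable_divide_zero Bochner_Integration.integrable_sum)
  have "(\<integral>\<omega>. dev \<omega> \<partial>M) = (\<Sum>j\<in>{1..J}. \<integral>\<omega>. \<bar>W m (A j \<omega>) \<omega> - R m (A j \<omega>) \<omega>\<bar> \<partial>M) / real J"
    unfolding dev_def using ib by (simp add: Bochner_Integration.integral_sum)
  also have "\<dots> \<le> (\<Sum>j\<in>{1..J}. ?w) / real J"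
    by (intro divide_right_mono sum_mono integral_block_le[where Y = "\<lambda>b \<omega>. \<bar>W m b \<omega> - R m b \<omega>\<bar>"] i) auto
  also have "\<dots> = ?w" using J_pos by simp
  finally show "(\<integral>\<omega>. dev \<omega> \<partial>M) \<le> ?w" .
qed

text \<open>Second moment of a centred average: \<open>J\<close> diagonal terms of at most 1 and the
  covariances of distinct blocks, divided by the square of \<open>J\<close>.\<close>

lemma avg_L1:
  assumes t: "test_fun C \<phi> \<phi>1 \<phi>2"
  shows "integrable M (avg \<phi>)"
    and "(\<integral>\<omega>. \<bar>avg \<phi> \<omega> - block_mean m \<phi>\<bar> \<partial>M) \<le> sqrt (1 / real J + 4 * C * (4 * \<eta> + sqrt (kappa / real m)))"
proof -
  let ?e = "block_mean m \<phi>" and ?s = "sqrt (kappa / real m)"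
  have C: "0 \<le> C" using t by (simp add: test_fun_def)
  note [measurable] = test_fun_measurable[OF t]
  have bnd: "\<bar>\<phi> x - ?e\<bar> \<le> 1" for x
  proof -
    have "0 \<le> \<phi> x" "\<phi> x \<le> 1" using t by (auto simp: test_fun_def)
    then show ?thesis using block_mean_range[OF t, of m] by linarith
  qed
  have ib: "integrable M (\<lambda>\<omega>. \<phi> (R m (A j \<omega>) \<omega>))" if "j \<in> {1..J}" for j
  proof (rule integrable_block[OF that])
    fix b assume "b \<in> blocks"
    then have b: "b \<subseteq> I" by (simp add: blocks_def)
    show "integrable M (\<lambda>\<omega>. \<phi> (R m b \<omega>))" by (rule test_fun_integrable[OF t R_measurable[OF b]])
    show "(\<lambda>\<omega>. \<phi> (R m b \<omega>)) \<in> borel_measurable F" using R_measurable_F[OF b] by measurable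
  qed
  show iavg: "integrable M (avg \<phi>)" unfolding avg_def using ib by (intro integrable_divide_zero Bochner_Integration.integrable_sum)
  let ?g = "\<lambda>j \<omega>. \<phi> (R m (A j \<omega>) \<omega>) - ?e"
  have mg[measurable]: "?g j \<in> borel_measurable M" if "j \<in> {1..J}" for j
    using borel_measurable_integrable[OF ib[OF that]] by measurable
  have igg: "integrable M (\<lambda>\<omega>. ?g i \<omega> * ?g j \<omega>)" if "i \<in> {1..J}" "j \<in> {1..J}" for i j
    using mg[OF that(1)] mg[OF that(2)]
    by (intro Pr.integrable_const_bound[of _ 1]) (use bnd in \<open>auto simp: abs_mult intro!: mult_le_one AE_I2\<close>)
  \<comment> \<open>The pair of blocks is the random index here. The covariance bound of a fixed
    pair is averaged, and only the mean root of the relative overlap is left.\<close>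
  have off: "(\<integral>\<omega>. ?g i \<omega> * ?g j \<omega> \<partial>M) \<le> 4 * C * (4 * \<eta> + ?s)" if ij: "i \<in> {1..J}" "j \<in> {1..J}" "i \<noteq> j" for i j
  proof -
    let ?Y = "\<lambda>d \<omega>. (\<phi> (R m (fst d) \<omega>) - ?e) * (\<phi> (R m (snd d) \<omega>) - ?e)"
    let ?D = "\<lambda>\<omega>. (A i \<omega>, A j \<omega>)"
    let ?h = "\<lambda>d. 4 * C * (4 * sqrt (real (card (fst d \<inter> snd d)) / real m) + ?s)"
    have fin2: "finite (blocks \<times> blocks)" using finite_blocks by simp
    have D: "\<omega> \<in> space M \<Longrightarrow> ?D \<omega> \<in> blocks \<times> blocks" for \<omega> using A_block by (auto simp: blocks_def)
    have ev: "{\<omega> \<in> space M. ?D \<omega> = d} \<in> Pr.events" for d using A_ev2[of i "fst d" j "snd d"] by (cases d) simp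
    have mY: "?Y d \<in> borel_measurable F" "integrable M (?Y d)" if "d \<in> blocks \<times> blocks" for d
    proof -
      have b: "fst d \<subseteq> I" "snd d \<subseteq> I" using that by (auto simp: blocks_def)
      note [measurable] = R_measurable_F[OF b(1)] R_measurable_F[OF b(2)] R_measurable[OF b(1), of m] R_measurable[OF b(2), of m]
      show "?Y d \<in> borel_measurable F" by measurable
      show "integrable M (?Y d)"
        by (intro Pr.integrable_const_bound[of _ 1]) (use bnd in \<open>auto simp: abs_mult intro!: mult_le_one AE_I2\<close>)
    qed
    have ind: "(\<integral>\<omega>. indicator {\<omega> \<in> space M. ?D \<omega> = d} \<omega> * ?Y d \<omega> \<partial>M) = Pr.prob {\<omega> \<in> space M. ?D \<omega> = d} * (\<integral>\<omega>. ?Y d \<omega> \<partial>M)"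
      if "d \<in> blocks \<times> blocks" for d
      using A_indep[OF ij(1,2) mY[OF that], of "fst d" "snd d"] by (cases d) simp
    have le: "(\<integral>\<omega>. ?Y d \<omega> \<partial>M) \<le> ?h d" if "d \<in> blocks \<times> blocks" for d
      using covariance_blocks[OF t _ _ _ _ m_pos, of "fst d" "snd d"] that by (auto simp: blocks_def)
    have "(\<integral>\<omega>. ?g i \<omega> * ?g j \<omega> \<partial>M) = (\<integral>\<omega>. ?Y (?D \<omega>) \<omega> \<partial>M)" by simp
    also have "\<dots> \<le> (\<integral>\<omega>. ?h (?D \<omega>) \<partial>M)"
      by (rule Pr.mixture_integral_le(1)[OF fin2 D ev mY(2) ind le])
    also have "\<dots> = 4 * C * (4 * (\<integral>\<omega>. sqrt (real (card (A i \<omega> \<inter> A j \<omega>)) / real m) \<partial>M) + ?s)"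
    proof -
      have "integrable M (\<lambda>\<omega>. sqrt (real (card (fst (?D \<omega>) \<inter> snd (?D \<omega>))) / real m))"
        by (rule Pr.mixture_integral_le(2)[OF fin2 D ev, where Y = "\<lambda>d _. sqrt (real (card (fst d \<inter> snd d)) / real m)" and g = "\<lambda>d. sqrt (real (card (fst d \<inter> snd d)) / real m)"])
           (use ev in \<open>auto simp: Pr.prob_space Pr.emeasure_eq_measure\<close>)
      then show ?thesis by (simp add: Pr.prob_space)
    qed
    also have "\<dots> \<le> 4 * C * (4 * \<eta> + ?s)" using overlap[OF ij] C by (intro mult_left_mono) auto
    finally show ?thesis .
  qed
  have diag: "(\<integral>\<omega>. ?g j \<omega> * ?g j \<omega> \<partial>M) \<le> 1" if "j \<in> {1..J}" for j
  proof -
    have "?g j \<omega> * ?g j \<omega> \<le> 1" for \<omega>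
      using mult_le_one[OF bnd[of "R m (A j \<omega>) \<omega>"] _ bnd[of "R m (A j \<omega>) \<omega>"]] by (simp add: abs_mult_self_eq flip: abs_mult)
    then have "(\<integral>\<omega>. ?g j \<omega> * ?g j \<omega> \<partial>M) \<le> (\<integral>\<omega>. 1 \<partial>M)"
      using igg[OF that that] by (intro integral_mono) auto
    then show ?thesis by (simp add: Pr.prob_space)
  qed
  have e: "avg \<phi> \<omega> - ?e = (\<Sum>j\<in>{1..J}. ?g j \<omega>) / real J" for \<omega>
    using J_pos by (simp add: avg_def sum_subtractf diff_divide_distrib)
  have e2: "(avg \<phi> \<omega> - ?e)\<^sup>2 = (\<Sum>i\<in>{1..J}. \<Sum>j\<in>{1..J}. ?g i \<omega> * ?g j \<omega>) / (real J)\<^sup>2" for \<omega>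
    unfolding e power_divide by (simp add: power2_eq_square sum_product)
  have i2: "integrable M (\<lambda>\<omega>. (avg \<phi> \<omega> - ?e)\<^sup>2)"
    unfolding e2 using igg by (intro integrable_divide_zero Bochner_Integration.integrable_sum) auto
  let ?b = "4 * C * (4 * \<eta> + ?s)"
  have b0: "0 \<le> ?b" using C eta kappa_nonneg by simp
  have "(\<integral>\<omega>. (avg \<phi> \<omega> - ?e)\<^sup>2 \<partial>M) = (\<Sum>i\<in>{1..J}. \<Sum>j\<in>{1..J}. (\<integral>\<omega>. ?g i \<omega> * ?g j \<omega> \<partial>M)) / (real J)\<^sup>2"
  proof -
    have "(\<integral>\<omega>. (\<Sum>i\<in>{1..J}. \<Sum>j\<in>{1..J}. ?g i \<omega> * ?g j \<omega>) \<partial>M) = (\<Sum>i\<in>{1..J}. \<integral>\<omega>. (\<Sum>j\<in>{1..J}. ?g i \<omega> * ?g j \<omega>) \<partial>M)"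
      using igg by (intro Bochner_Integration.integral_sum Bochner_Integration.integrable_sum)
    also have "\<dots> = (\<Sum>i\<in>{1..J}. \<Sum>j\<in>{1..J}. (\<integral>\<omega>. ?g i \<omega> * ?g j \<omega> \<partial>M))"
      using igg by (intro sum.cong Bochner_Integration.integral_sum) auto
    finally show ?thesis unfolding e2 by (simp only: integral_divide_zero)
  qed
  also have "\<dots> \<le> (\<Sum>i\<in>{1..J}. 1 + real (J - 1) * ?b) / (real J)\<^sup>2"
  proof (intro divide_right_mono sum_mono)
    fix i assume i: "i \<in> {1..J}"
    have "(\<Sum>j\<in>{1..J}. (\<integral>\<omega>. ?g i \<omega> * ?g j \<omega> \<partial>M)) = (\<integral>\<omega>. ?g i \<omega> * ?g i \<omega> \<partial>M) + (\<Sum>j\<in>{1..J} - {i}. (\<integral>\<omega>. ?g i \<omega> * ?g j \<omega> \<partial>M))"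
      using i by (intro sum.remove) auto
    also have "\<dots> \<le> 1 + (\<Sum>j\<in>{1..J} - {i}. ?b)"
      using i by (intro add_mono diag sum_mono off) auto
    also have "\<dots> = 1 + real (J - 1) * ?b" using i by simp
    finally show "(\<Sum>j\<in>{1..J}. (\<integral>\<omega>. ?g i \<omega> * ?g j \<omega> \<partial>M)) \<le> 1 + real (J - 1) * ?b" .
  qed simp
  also have "\<dots> = 1 / real J + real (J - 1) / real J * ?b"
    using J_pos by (simp add: power2_eq_square add_divide_distrib)
  also have "\<dots> \<le> 1 / real J + ?b"
    using J_pos mult_right_mono[OF _ b0, of "real (J - 1) / real J" 1] by simp
  finally have 1: "(\<integral>\<omega>. (avg \<phi> \<omega> - ?e)\<^sup>2 \<partial>M) \<le> 1 / real J + ?b" .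
  have "(\<lambda>\<omega>. avg \<phi> \<omega> - ?e) \<in> borel_measurable M" using borel_measurable_integrable[OF iavg] by measurable
  then have "(\<integral>\<omega>. \<bar>avg \<phi> \<omega> - ?e\<bar> \<partial>M) \<le> sqrt (\<integral>\<omega>. (avg \<phi> \<omega> - ?e)\<^sup>2 \<partial>M)"
    using i2 by (rule Pr.expectation_abs_le_sqrt(2))
  also have "\<dots> \<le> sqrt (1 / real J + ?b)" using 1 by (rule real_sqrt_le_mono)
  finally show "(\<integral>\<omega>. \<bar>avg \<phi> \<omega> - ?e\<bar> \<partial>M) \<le> sqrt (1 / real J + ?b)" .
qed

text \<open>The argument is on the normalised scale, \<open>u = (t - f1) / f2\<close>, where the
  limit laws are tight uniformly in the dimension.\<close>

definition ecdf :: "'a \<Rightarrow> real \<Rightarrow> real" where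
  "ecdf \<omega> u = (\<Sum>j\<in>{1..J}. if W m (A j \<omega>) \<omega> \<le> u then 1 else 0) / real J"

text \<open>A smooth majorant replaces the indicator, after which passing from \<open>W\<close> to
  \<open>R\<close> costs only the Lipschitz constant times \<open>dev\<close>; an indicator would
  not allow this exchange.\<close>

lemma ecdf_le_avg:
  assumes t: "test_fun C \<phi> \<phi>1 \<phi>2" and s: "\<And>x. x \<le> u \<Longrightarrow> \<phi> x = 1"
  shows "ecdf \<omega> u \<le> avg \<phi> \<omega> + C * dev \<omega>"
proof -
  have "(if W m (A j \<omega>) \<omega> \<le> u then 1 else 0) \<le> \<phi> (R m (A j \<omega>) \<omega>) + C * \<bar>W m (A j \<omega>) \<omega> - R m (A j \<omega>) \<omega>\<bar>" for j
  proof -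
    have "(if W m (A j \<omega>) \<omega> \<le> u then 1 else 0) \<le> \<phi> (W m (A j \<omega>) \<omega>)" using t s by (auto simp: test_fun_def)
    then show ?thesis using test_fun_Lipschitz(1)[OF t, of "W m (A j \<omega>) \<omega>" "R m (A j \<omega>) \<omega>"] by linarith
  qed
  then have "ecdf \<omega> u \<le> (\<Sum>j\<in>{1..J}. \<phi> (R m (A j \<omega>) \<omega>) + C * \<bar>W m (A j \<omega>) \<omega> - R m (A j \<omega>) \<omega>\<bar>) / real J"
    unfolding ecdf_def by (intro divide_right_mono sum_mono) auto
  then show ?thesis by (simp add: avg_def dev_def sum.distrib sum_distrib_left add_divide_distrib)
qed

lemma avg_le_ecdf:
  assumes t: "test_fun C \<phi> \<phi>1 \<phi>2" and s: "\<And>x. u < x \<Longrightarrow> \<phi> x = 0"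
  shows "avg \<phi> \<omega> - C * dev \<omega> \<le> ecdf \<omega> u"
proof -
  have "\<phi> (R m (A j \<omega>) \<omega>) - C * \<bar>W m (A j \<omega>) \<omega> - R m (A j \<omega>) \<omega>\<bar> \<le> (if W m (A j \<omega>) \<omega> \<le> u then 1 else 0)" for j
  proof -
    have "\<phi> (W m (A j \<omega>) \<omega>) \<le> (if W m (A j \<omega>) \<omega> \<le> u then 1 else 0)" using t s by (auto simp: test_fun_def)
    then show ?thesis using test_fun_Lipschitz(1)[OF t, of "W m (A j \<omega>) \<omega>" "R m (A j \<omega>) \<omega>"] by linarith
  qed
  then have "(\<Sum>j\<in>{1..J}. \<phi> (R m (A j \<omega>) \<omega>) - C * \<bar>W m (A j \<omega>) \<omega> - R m (A j \<omega>) \<omega>\<bar>) / real J \<le> ecdf \<omega> u"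
    unfolding ecdf_def by (intro divide_right_mono sum_mono) auto
  then show ?thesis by (simp add: avg_def dev_def sum_subtractf sum_distrib_left diff_divide_distrib)
qed

lemma ecdf_mono: "u \<le> v \<Longrightarrow> ecdf \<omega> u \<le> ecdf \<omega> v"
  unfolding ecdf_def by (intro divide_right_mono sum_mono) auto

lemma ecdf_range: "0 \<le> ecdf \<omega> u" "ecdf \<omega> u \<le> 1"
proof -
  show "0 \<le> ecdf \<omega> u" unfolding ecdf_def by (intro divide_nonneg_nonneg sum_nonneg) auto
  have "ecdf \<omega> u \<le> (\<Sum>j\<in>{1..J}. 1) / real J"
    unfolding ecdf_def by (intro divide_right_mono sum_mono) auto
  then show "ecdf \<omega> u \<le> 1" using J_pos by simp
qed

end

section \<open>Distribution function of the Gaussian limit\<close>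

context gauss_approx
begin

definition gcdf :: "real \<Rightarrow> real" where
  "gcdf u = measure G {z \<in> space G. normalized p S 1 z \<le> u}"

lemma G_events [measurable]: "{z \<in> space G. normalized p S 1 z \<le> u} \<in> sets G"
proof -
  note [measurable_cong] = vec_lawD(2)[OF Gs.law_G]
  show ?thesis by measurable
qed

lemma gcdf_mono: "u \<le> v \<Longrightarrow> gcdf u \<le> gcdf v"
  unfolding gcdf_def by (intro Gs.G.finite_measure_mono G_events) auto

lemma gcdf_range: "0 \<le> gcdf u" "gcdf u \<le> 1"
  by (simp_all add: gcdf_def)

lemma gcdf_increment: "0 < h \<Longrightarrow> gcdf (u + h) - gcdf u \<le> 2 * sqrt (sqrt h)"
proof -
  assume h: "0 < h"
  note [measurable_cong] = vec_lawD(2)[OF Gs.law_G]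
  let ?B = "{z \<in> space G. u \<le> (sqnorm p z - f1 p S) / f2 p S \<and> (sqnorm p z - f1 p S) / f2 p S \<le> u + h}"
  have B: "?B \<in> sets G" by measurable
  have "gcdf (u + h) \<le> measure G ({z \<in> space G. normalized p S 1 z \<le> u} \<union> ?B)"
    unfolding gcdf_def by (intro Gs.G.finite_measure_mono sets.Un G_events B) (auto simp: normalized_def)
  also have "\<dots> \<le> gcdf u + measure G ?B"
    unfolding gcdf_def by (intro measure_Un_le G_events B)
  also have "measure G ?B \<le> 2 * sqrt (sqrt h)" by (rule Gs.sqnorm_anticoncentration[OF f2_pos h])
  finally show ?thesis by simp
qed

text \<open>Chebyshev's inequality. The normalised Gaussian statistic has variance 2 for every
  \<open>p\<close> and \<open>S\<close>, whence tightness along the whole sequence.\<close>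

lemma gcdf_tails:
  assumes U: "0 < U"
  shows "gcdf (- U) \<le> 2 / U\<^sup>2" "1 - 2 / U\<^sup>2 \<le> gcdf U"
proof -
  note [measurable_cong] = vec_lawD(2)[OF Gs.law_G]
  let ?T = "{z \<in> space G. U\<^sup>2 \<le> (normalized p S 1 z)\<^sup>2}"
  have T: "?T \<in> sets G" by measurable
  have e: "(normalized p S 1 z)\<^sup>2 = (sqnorm p z - f1 p S)\<^sup>2 / (f2 p S)\<^sup>2" for z
    by (simp add: normalized_def power_divide)
  have i: "integrable G (\<lambda>z. (normalized p S 1 z)\<^sup>2)"
    unfolding e using Gs.G.integrable_sqnorm_sq by simp
  have "(\<integral>z. (normalized p S 1 z)\<^sup>2 \<partial>G) = 2"
    unfolding e using Gs.variance_G f2_pos by simp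
  then have m: "measure G ?T \<le> 2 / U\<^sup>2"
    using integral_Markov_inequality_measure[OF i T, of "U\<^sup>2"] U by simp
  have "gcdf (- U) \<le> measure G ?T"
    unfolding gcdf_def
  proof (intro Gs.G.finite_measure_mono T subsetI)
    fix z assume "z \<in> {z \<in> space G. normalized p S 1 z \<le> - U}"
    then show "z \<in> ?T" using U power_mono[of U "- normalized p S 1 z" 2] by auto
  qed
  with m show "gcdf (- U) \<le> 2 / U\<^sup>2" by simp
  have "1 - gcdf U = measure G (space G - {z \<in> space G. normalized p S 1 z \<le> U})"
    unfolding gcdf_def by (simp add: Gs.G.prob_compl)
  also have "\<dots> \<le> measure G ?T"
  proof (intro Gs.G.finite_measure_mono T subsetI)
    fix z assume "z \<in> space G - {z \<in> space G. normalized p S 1 z \<le> U}"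
    then show "z \<in> ?T" using U power_mono[of U "normalized p S 1 z" 2] by auto
  qed
  finally show "1 - 2 / U\<^sup>2 \<le> gcdf U" using m by simp
qed

lemma gcdf_le_integral_test_fun:
  assumes t: "test_fun C \<phi> \<phi>1 \<phi>2"
  shows "(\<And>x. x \<le> u \<Longrightarrow> \<phi> x = 1) \<Longrightarrow> gcdf u \<le> (\<integral>z. \<phi> (normalized p S 1 z) \<partial>G)"
    and "(\<And>x. u < x \<Longrightarrow> \<phi> x = 0) \<Longrightarrow> (\<integral>z. \<phi> (normalized p S 1 z) \<partial>G) \<le> gcdf u"
proof -
  note [measurable] = test_fun_measurable[OF t]
  have b: "0 \<le> \<phi> x" "\<phi> x \<le> 1" for x using t by (auto simp: test_fun_def)
  have i: "integrable G (\<lambda>z. \<phi> (normalized p S 1 z))"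
    by (rule Gs.G.integrable_const_bound[of _ 1]) (use b in auto)
  have c: "gcdf u = (\<integral>z. indicator {z \<in> space G. normalized p S 1 z \<le> u} z \<partial>G)" by (simp add: gcdf_def)
  have ii: "integrable G (indicator {z \<in> space G. normalized p S 1 z \<le> u} :: _ \<Rightarrow> real)"
    by (simp add: Gs.G.emeasure_eq_measure)
  show "gcdf u \<le> (\<integral>z. \<phi> (normalized p S 1 z) \<partial>G)" if "\<And>x. x \<le> u \<Longrightarrow> \<phi> x = 1"
    unfolding c by (intro integral_mono i ii) (use b that in \<open>auto simp: indicator_def\<close>)
  show "(\<integral>z. \<phi> (normalized p S 1 z) \<partial>G) \<le> gcdf u" if "\<And>x. u < x \<Longrightarrow> \<phi> x = 0"
    unfolding c by (intro integral_mono i ii) (use b that in \<open>auto simp: indicator_def not_le\<close>)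
qed

end

section \<open>Distribution function of the full sample\<close>

context iid_vectors
begin

definition total_cdf :: "real \<Rightarrow> real" where
  "total_cdf u = Pr.prob {\<omega> \<in> space M. R (card I) I \<omega> \<le> u}"

lemma total_events: "{\<omega> \<in> space M. R (card I) I \<omega> \<le> u} \<in> Pr.events"
  using R_measurable[OF order_refl, of "card I"] by measurable

lemma total_cdf_mono: "u \<le> v \<Longrightarrow> total_cdf u \<le> total_cdf v"
  unfolding total_cdf_def by (intro Pr.finite_measure_mono total_events) auto

lemma total_cdf_range: "0 \<le> total_cdf u" "total_cdf u \<le> 1"
  by (simp_all add: total_cdf_def)

lemma total_cdf_sandwich:
  assumes t: "test_fun C \<phi> \<phi>1 \<phi>2"
  shows "(\<And>x. x \<le> u \<Longrightarrow> \<phi> x = 1) \<Longrightarrow> total_cdf u \<le> block_mean (card I) \<phi>"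
    and "(\<And>x. u < x \<Longrightarrow> \<phi> x = 0) \<Longrightarrow> block_mean (card I) \<phi> \<le> total_cdf u"
proof -
  have b: "0 \<le> \<phi> x" "\<phi> x \<le> 1" for x using t by (auto simp: test_fun_def)
  note e = expectation_R[OF t order_refl refl, symmetric]
  have i: "integrable M (\<lambda>\<omega>. \<phi> (R (card I) I \<omega>))" by (rule test_fun_integrable[OF t R_measurable[OF order_refl]])
  have c: "total_cdf u = (\<integral>\<omega>. indicator {\<omega> \<in> space M. R (card I) I \<omega> \<le> u} \<omega> \<partial>M)"
    by (simp add: total_cdf_def) (rule arg_cong[where f = Pr.prob], auto)
  have ii: "integrable M (indicator {\<omega> \<in> space M. R (card I) I \<omega> \<le> u} :: _ \<Rightarrow> real)"
    using total_events by (simp add: Pr.emeasure_eq_measure)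
  show "total_cdf u \<le> block_mean (card I) \<phi>" if "\<And>x. x \<le> u \<Longrightarrow> \<phi> x = 1"
    unfolding c e by (intro integral_mono i ii) (use b that in \<open>auto simp: indicator_def\<close>)
  show "block_mean (card I) \<phi> \<le> total_cdf u" if "\<And>x. u < x \<Longrightarrow> \<phi> x = 0"
    unfolding c e by (intro integral_mono i ii) (use b that in \<open>auto simp: indicator_def not_le\<close>)
qed

end

section \<open>Convergence in probability\<close>

text \<open>Stated with dominating events, so that no measurability of the supremum is required.\<close>

definition unif_small :: "(nat \<Rightarrow> 'a measure) \<Rightarrow> (nat \<Rightarrow> 'a \<Rightarrow> 'u \<Rightarrow> real) \<Rightarrow> bool" where
  "unif_small M D \<longleftrightarrow> (\<forall>\<epsilon>>0. \<forall>\<eta>>0. \<forall>\<^sub>F n in sequentially.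
     \<exists>E\<in>sets (M n). measure (M n) E \<le> \<eta> \<and> (AE \<omega> in M n. \<omega> \<notin> E \<longrightarrow> (\<forall>u. \<bar>D n \<omega> u\<bar> \<le> \<epsilon>)))"

lemma unif_small_imp_tendsto_in_prob_zero:
  fixes D :: "nat \<Rightarrow> 'a \<Rightarrow> 'u \<Rightarrow> real"
  assumes pr: "\<And>n. prob_space (M n)" and s: "unif_small M D"
  shows "tendsto_in_prob_zero M (\<lambda>n \<omega>. SUP u. \<bar>D n \<omega> u\<bar>)"
  unfolding tendsto_in_prob_zero_def
proof (intro allI impI LIMSEQ_I)
  fix \<epsilon> r :: real assume \<epsilon>: "0 < \<epsilon>" and r: "0 < r"
  let ?S = "\<lambda>n. {\<omega> \<in> space (M n). \<epsilon> < \<bar>SUP u. \<bar>D n \<omega> u\<bar>\<bar>}"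
  have "\<forall>\<^sub>F n in sequentially. \<exists>E\<in>sets (M n). measure (M n) E \<le> r / 2 \<and> (AE \<omega> in M n. \<omega> \<notin> E \<longrightarrow> (\<forall>u. \<bar>D n \<omega> u\<bar> \<le> \<epsilon>))"
    using s \<epsilon> r unfolding unif_small_def by (meson half_gt_zero)
  then have "\<forall>\<^sub>F n in sequentially. norm (measure (M n) (?S n) - 0) < r"
  proof eventually_elim
    case (elim n)
    then obtain E where E: "E \<in> sets (M n)" "measure (M n) E \<le> r / 2" "AE \<omega> in M n. \<omega> \<notin> E \<longrightarrow> (\<forall>u. \<bar>D n \<omega> u\<bar> \<le> \<epsilon>)" by blast
    interpret prob_space "M n" by (rule pr)
    have "measure (M n) (?S n) \<le> r / 2"
    proof (cases "?S n \<in> sets (M n)")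
      case True
      have "AE \<omega> in M n. \<omega> \<in> ?S n \<longrightarrow> \<omega> \<in> E"
        using E(3)
      proof eventually_elim
        case (elim \<omega>)
        show ?case
        proof (intro impI, rule ccontr)
          assume a: "\<omega> \<in> ?S n" "\<omega> \<notin> E"
          then have b: "\<bar>D n \<omega> u\<bar> \<le> \<epsilon>" for u using elim by blast
          have "(SUP u. \<bar>D n \<omega> u\<bar>) \<le> \<epsilon>" using b by (intro cSUP_least) auto
          \<comment> \<open>Any one index shows that the supremum is nonnegative, which disposes of
            the outer absolute value.\<close>
          moreover have "\<bar>D n \<omega> undefined\<bar> \<le> (SUP u. \<bar>D n \<omega> u\<bar>)"
            using b by (intro cSUP_upper) (auto intro!: bdd_aboveI2)
          ultimately have "\<bar>SUP u. \<bar>D n \<omega> u\<bar>\<bar> \<le> \<epsilon>" by linarith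
          then show False using a by simp
        qed
      qed
      then have "measure (M n) (?S n) \<le> measure (M n) E" using E(1) by (intro finite_measure_mono_AE)
      then show ?thesis using E by simp
    \<comment> \<open>A set that is not measurable has measure 0 by convention.\<close>
    next
      case False
      then show ?thesis using r by (simp add: measure_notin_sets)
    qed
    then show ?case using r by simp
  qed
  then show "\<exists>no. \<forall>n\<ge>no. norm (measure (M n) (?S n) - 0) < r" by (simp add: eventually_sequentially)
qed

text \<open>The index \<open>v\<close> may depend on \<open>u\<close> and on the outcome, which
  covers the change of variable from \<open>t\<close> to \<open>(t - f1) / f2\<close>.\<close>

lemma unif_small_cong:
  assumes "unif_small M D" "\<forall>\<^sub>F n in sequentially. AE \<omega> in M n. \<forall>u. \<exists>v. \<bar>D' n \<omega> u\<bar> \<le> \<bar>D n \<omega> v\<bar>"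
  shows "unif_small M D'"
  unfolding unif_small_def
proof (intro allI impI)
  fix \<epsilon> \<eta> :: real assume "0 < \<epsilon>" "0 < \<eta>"
  then have "\<forall>\<^sub>F n in sequentially. \<exists>E\<in>sets (M n). measure (M n) E \<le> \<eta> \<and> (AE \<omega> in M n. \<omega> \<notin> E \<longrightarrow> (\<forall>u. \<bar>D n \<omega> u\<bar> \<le> \<epsilon>))"
    using assms(1) by (auto simp: unif_small_def)
  with assms(2) show "\<forall>\<^sub>F n in sequentially. \<exists>E\<in>sets (M n). measure (M n) E \<le> \<eta> \<and> (AE \<omega> in M n. \<omega> \<notin> E \<longrightarrow> (\<forall>u. \<bar>D' n \<omega> u\<bar> \<le> \<epsilon>))"
  proof eventually_elim
    case (elim n)
    then obtain E where E: "E \<in> sets (M n)" "measure (M n) E \<le> \<eta>" "AE \<omega> in M n. \<omega> \<notin> E \<longrightarrow> (\<forall>u. \<bar>D n \<omega> u\<bar> \<le> \<epsilon>)" by blast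
    have "AE \<omega> in M n. \<omega> \<notin> E \<longrightarrow> (\<forall>u. \<bar>D' n \<omega> u\<bar> \<le> \<epsilon>)"
      using E(3) elim(1) by eventually_elim (meson order_trans)
    then show ?case using E by blast
  qed
qed

lemma unif_small_diff:
  assumes pr: "\<And>n. prob_space (M n)" and "unif_small M D" "unif_small M D'"
  shows "unif_small M (\<lambda>n \<omega> u. D n \<omega> u - D' n \<omega> u)"
  unfolding unif_small_def
proof (intro allI impI)
  fix \<epsilon> \<eta> :: real assume "0 < \<epsilon>" "0 < \<eta>"
  then have h: "0 < \<epsilon> / 2" "0 < \<eta> / 2" by auto
  have "\<forall>\<^sub>F n in sequentially. \<exists>E\<in>sets (M n). measure (M n) E \<le> \<eta> / 2 \<and> (AE \<omega> in M n. \<omega> \<notin> E \<longrightarrow> (\<forall>u. \<bar>D n \<omega> u\<bar> \<le> \<epsilon> / 2))"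
    "\<forall>\<^sub>F n in sequentially. \<exists>E\<in>sets (M n). measure (M n) E \<le> \<eta> / 2 \<and> (AE \<omega> in M n. \<omega> \<notin> E \<longrightarrow> (\<forall>u. \<bar>D' n \<omega> u\<bar> \<le> \<epsilon> / 2))"
    using assms(2,3) h unfolding unif_small_def by blast+
  then show "\<forall>\<^sub>F n in sequentially. \<exists>E\<in>sets (M n). measure (M n) E \<le> \<eta> \<and> (AE \<omega> in M n. \<omega> \<notin> E \<longrightarrow> (\<forall>u. \<bar>D n \<omega> u - D' n \<omega> u\<bar> \<le> \<epsilon>))"
  proof eventually_elim
    case (elim n)
    obtain E where E: "E \<in> sets (M n)" "measure (M n) E \<le> \<eta> / 2" "AE \<omega> in M n. \<omega> \<notin> E \<longrightarrow> (\<forall>u. \<bar>D n \<omega> u\<bar> \<le> \<epsilon> / 2)" using elim(1) by blast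
    obtain E' where E': "E' \<in> sets (M n)" "measure (M n) E' \<le> \<eta> / 2" "AE \<omega> in M n. \<omega> \<notin> E' \<longrightarrow> (\<forall>u. \<bar>D' n \<omega> u\<bar> \<le> \<epsilon> / 2)" using elim(2) by blast
    interpret prob_space "M n" by (rule pr)
    have "measure (M n) (E \<union> E') \<le> \<eta>" using measure_Un_le[OF E(1) E'(1)] E(2) E'(2) by linarith
    moreover have "AE \<omega> in M n. \<omega> \<notin> E \<union> E' \<longrightarrow> (\<forall>u. \<bar>D n \<omega> u - D' n \<omega> u\<bar> \<le> \<epsilon>)"
      using E(3) E'(3)
    proof eventually_elim
      case (elim \<omega>)
      show ?case
      proof (intro impI allI)
        fix u assume "\<omega> \<notin> E \<union> E'"
        then have "\<bar>D n \<omega> u\<bar> \<le> \<epsilon> / 2" "\<bar>D' n \<omega> u\<bar> \<le> \<epsilon> / 2" using elim by auto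
        then show "\<bar>D n \<omega> u - D' n \<omega> u\<bar> \<le> \<epsilon>" by linarith
      qed
    qed
    ultimately show ?case using E(1) E'(1) by blast
  qed
qed

text \<open>Convergence at finitely many points suffices: the limiting distribution functions are uniformly
  equicontinuous and tight, and all functions are monotone with values in \<open>[0,1]\<close>.\<close>

lemma unif_small_monotone:
  fixes F :: "nat \<Rightarrow> 'a \<Rightarrow> real \<Rightarrow> real" and G :: "nat \<Rightarrow> real \<Rightarrow> real"
  assumes pr: "\<And>n. prob_space (M n)"
    and FG: "\<forall>\<^sub>F n in sequentially. (\<forall>\<omega>. mono (F n \<omega>) \<and> (\<forall>u. 0 \<le> F n \<omega> u \<and> F n \<omega> u \<le> 1)) \<and> (\<forall>u. 0 \<le> G n u \<and> G n u \<le> 1) \<and> mono (G n)"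
    and cont: "\<And>\<epsilon>. 0 < \<epsilon> \<Longrightarrow> \<exists>h>0. \<forall>\<^sub>F n in sequentially. \<forall>u. G n (u + h) - G n u \<le> \<epsilon>"
    and tight: "\<And>\<epsilon>. 0 < \<epsilon> \<Longrightarrow> \<exists>U>0. \<forall>\<^sub>F n in sequentially. G n (- U) \<le> \<epsilon> \<and> 1 - \<epsilon> \<le> G n U"
    and ptw: "\<And>u. unif_small M (\<lambda>n \<omega> (_::unit). F n \<omega> u - G n u)"
  shows "unif_small M (\<lambda>n \<omega> u. F n \<omega> u - G n u)"
  unfolding unif_small_def
proof (intro allI impI)
  fix \<epsilon>0 \<eta> :: real assume e0: "0 < \<epsilon>0" and \<eta>: "0 < \<eta>"
  \<comment> \<open>One half is spent at the grid points, the other on the oscillation between them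
    or on the tails.\<close>
  define \<epsilon> where "\<epsilon> = \<epsilon>0 / 2"
  have \<epsilon>: "0 < \<epsilon>" using e0 by (simp add: \<epsilon>_def)
  obtain h where h: "0 < h" "\<forall>\<^sub>F n in sequentially. \<forall>u. G n (u + h) - G n u \<le> \<epsilon>" using cont[OF \<epsilon>] by blast
  obtain U where U: "0 < U" "\<forall>\<^sub>F n in sequentially. G n (- U) \<le> \<epsilon> \<and> 1 - \<epsilon> \<le> G n U" using tight[OF \<epsilon>] by blast
  \<comment> \<open>Number of steps of length \<open>h\<close> that lead from \<open>- U\<close> to
    at least \<open>U\<close>.\<close>
  define K where "K = nat \<lceil>2 * U / h\<rceil>"
  define x where "x = (\<lambda>i::nat. - U + real i * h)"
  have xK: "U \<le> x K"
  proof -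
    have "2 * U / h \<le> real K" unfolding K_def by linarith
    then have "2 * U \<le> real K * h" using h by (simp add: divide_le_eq)
    then show ?thesis by (simp add: x_def)
  qed
  have "\<forall>i\<in>{..K}. \<forall>\<^sub>F n in sequentially. \<exists>E\<in>sets (M n). measure (M n) E \<le> \<eta> / (real K + 1) \<and> (AE \<omega> in M n. \<omega> \<notin> E \<longrightarrow> \<bar>F n \<omega> (x i) - G n (x i)\<bar> \<le> \<epsilon>)"
  proof
    fix i
    \<comment> \<open>The exceptional probability is shared equally among the \<open>K + 1\<close>
      grid points.\<close>
    have "0 < \<eta> / (real K + 1)" using \<eta> by simp
    then show "\<forall>\<^sub>F n in sequentially. \<exists>E\<in>sets (M n). measure (M n) E \<le> \<eta> / (real K + 1) \<and> (AE \<omega> in M n. \<omega> \<notin> E \<longrightarrow> \<bar>F n \<omega> (x i) - G n (x i)\<bar> \<le> \<epsilon>)"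
      using ptw[of "x i"] \<epsilon> unfolding unif_small_def by simp
  qed
  then have "\<forall>\<^sub>F n in sequentially. \<forall>i\<in>{..K}. \<exists>E\<in>sets (M n). measure (M n) E \<le> \<eta> / (real K + 1) \<and> (AE \<omega> in M n. \<omega> \<notin> E \<longrightarrow> \<bar>F n \<omega> (x i) - G n (x i)\<bar> \<le> \<epsilon>)"
    by (subst eventually_ball_finite_distrib) auto
  with FG h(2) U(2)
  show "\<forall>\<^sub>F n in sequentially. \<exists>E\<in>sets (M n). measure (M n) E \<le> \<eta> \<and> (AE \<omega> in M n. \<omega> \<notin> E \<longrightarrow> (\<forall>u. \<bar>F n \<omega> u - G n u\<bar> \<le> \<epsilon>0))"
  proof eventually_elim
    case (elim n)
    interpret prob_space "M n" by (rule pr)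
    have Fm: "F n \<omega> u \<le> F n \<omega> v" if "u \<le> v" for \<omega> u v using elim(1) that by (auto dest: monoD)
    have Gm: "G n u \<le> G n v" if "u \<le> v" for u v using elim(1) that by (auto dest: monoD)
    have rF: "0 \<le> F n \<omega> u" "F n \<omega> u \<le> 1" for \<omega> u using elim(1) by auto
    have rG: "0 \<le> G n u" "G n u \<le> 1" for u using elim(1) by auto
    have "\<forall>i\<in>{..K}. \<exists>E. E \<in> sets (M n) \<and> measure (M n) E \<le> \<eta> / (real K + 1) \<and> (AE \<omega> in M n. \<omega> \<notin> E \<longrightarrow> \<bar>F n \<omega> (x i) - G n (x i)\<bar> \<le> \<epsilon>)"
      using elim(4) unfolding Bex_def .
    from bchoice[OF this] obtain E where E': "\<forall>i\<in>{..K}. E i \<in> sets (M n) \<and> measure (M n) (E i) \<le> \<eta> / (real K + 1)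
      \<and> (AE \<omega> in M n. \<omega> \<notin> E i \<longrightarrow> \<bar>F n \<omega> (x i) - G n (x i)\<bar> \<le> \<epsilon>)" ..
    have E: "E i \<in> sets (M n)" "measure (M n) (E i) \<le> \<eta> / (real K + 1)"
      "AE \<omega> in M n. \<omega> \<notin> E i \<longrightarrow> \<bar>F n \<omega> (x i) - G n (x i)\<bar> \<le> \<epsilon>" if "i \<le> K" for i
      using bspec[OF E', of i] that by simp_all
    let ?E = "\<Union>i\<in>{..K}. E i"
    have "measure (M n) ?E \<le> (\<Sum>i\<in>{..K}. measure (M n) (E i))" using E(1) by (intro finite_measure_subadditive_finite) auto
    also have "\<dots> \<le> (\<Sum>i\<in>{..K}. \<eta> / (real K + 1))" using E(2) by (intro sum_mono) auto
    also have "\<dots> = \<eta>" by (simp add: field_simps)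
    finally have "measure (M n) ?E \<le> \<eta>" .
    moreover have "AE \<omega> in M n. \<forall>i\<in>{..K}. \<omega> \<notin> E i \<longrightarrow> \<bar>F n \<omega> (x i) - G n (x i)\<bar> \<le> \<epsilon>"
      using E(3) by (intro AE_finite_allI) auto
    then have "AE \<omega> in M n. \<omega> \<notin> ?E \<longrightarrow> (\<forall>u. \<bar>F n \<omega> u - G n u\<bar> \<le> \<epsilon>0)"
    proof eventually_elim
      case (elim \<omega>)
      show ?case
      proof (intro impI allI)
        fix u assume "\<omega> \<notin> ?E"
        then have g: "\<bar>F n \<omega> (x i) - G n (x i)\<bar> \<le> \<epsilon>" if "i \<le> K" for i using elim that by auto
        consider "u < - U" | "x K \<le> u" | "- U \<le> u" "u < x K" by linarith
        then have "\<bar>F n \<omega> u - G n u\<bar> \<le> 2 * \<epsilon>"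
        proof cases
          case 1
          have "x 0 = - U" by (simp add: x_def)
          then have "F n \<omega> u \<le> 2 * \<epsilon>" "G n u \<le> \<epsilon>"
            using g[of 0] Fm[of u "- U" \<omega>] Gm[of u "- U"] 1 \<open>G n (- U) \<le> \<epsilon> \<and> 1 - \<epsilon> \<le> G n U\<close> by auto
          then show ?thesis using rF[of \<omega> u] rG[of u] \<epsilon> by linarith
        next
          case 2
          have "1 - 2 * \<epsilon> \<le> F n \<omega> u" "1 - \<epsilon> \<le> G n u"
            using g[of K] Fm[of "x K" u \<omega>] Gm[of "x K" u] Gm[of U "x K"] 2 xK \<open>G n (- U) \<le> \<epsilon> \<and> 1 - \<epsilon> \<le> G n U\<close> by auto
          then show ?thesis using rF[of \<omega> u] rG[of u] \<epsilon> by linarith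
        next
          case 3
          \<comment> \<open>The grid cell that contains \<open>u\<close>; its right end is still a
            grid point because \<open>u\<close> lies below \<open>x K\<close>.\<close>
          define i where "i = nat \<lfloor>(u + U) / h\<rfloor>"
          have "0 \<le> (u + U) / h" using 3 h by simp
          then have i: "real i \<le> (u + U) / h" "(u + U) / h < real i + 1" unfolding i_def by linarith+
          have xi: "x i \<le> u" "u < x (Suc i)" using i h by (simp_all add: x_def field_simps)
          have "x i < x K" using xi 3 by linarith
          then have iK: "Suc i \<le> K" using h by (simp add: x_def)
          have e: "x (Suc i) = x i + h" by (simp add: x_def algebra_simps)
          have "G n (x i + h) - G n (x i) \<le> \<epsilon>" using \<open>\<forall>u. G n (u + h) - G n u \<le> \<epsilon>\<close> by blast
          then show ?thesis
            using g[of i] g[of "Suc i"] iK Fm[of "x i" u \<omega>] Fm[of u "x (Suc i)" \<omega>] Gm[of "x i" u] Gm[of u "x (Suc i)"] xi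
            unfolding e by linarith
        qed
        then show "\<bar>F n \<omega> u - G n u\<bar> \<le> \<epsilon>0" by (simp add: \<epsilon>_def)
      qed
    qed
    ultimately show ?case using E(1) by (intro bexI[of _ ?E]) auto
  qed
qed

text \<open>Markov's inequality for a dominating variable with vanishing mean. The fixed part
  \<open>\<epsilon>\<close> absorbs an error that does not vanish with \<open>n\<close>, such as the
  smoothing of an indicator.\<close>

lemma unif_small_Markov:
  fixes D :: "nat \<Rightarrow> 'a \<Rightarrow> 'u \<Rightarrow> real"
  assumes pr: "\<And>n. prob_space (M n)"
    and dom: "\<And>\<epsilon>. 0 < \<epsilon> \<Longrightarrow> \<exists>Y b. (\<forall>\<^sub>F n in sequentially. integrable (M n) (Y n) \<and> (\<forall>\<omega>. 0 \<le> Y n \<omega>) \<and> (\<integral>\<omega>. Y n \<omega> \<partial>M n) \<le> b n \<and>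
          (AE \<omega> in M n. \<forall>u. \<bar>D n \<omega> u\<bar> \<le> \<epsilon> + Y n \<omega>)) \<and> b \<longlonglongrightarrow> (0::real)"
  shows "unif_small M D"
  unfolding unif_small_def
proof (intro allI impI)
  fix \<epsilon> \<eta> :: real assume \<epsilon>: "0 < \<epsilon>" and \<eta>: "0 < \<eta>"
  obtain Y b where Y: "\<forall>\<^sub>F n in sequentially. integrable (M n) (Y n) \<and> (\<forall>\<omega>. 0 \<le> Y n \<omega>) \<and> (\<integral>\<omega>. Y n \<omega> \<partial>M n) \<le> b n \<and>
          (AE \<omega> in M n. \<forall>u. \<bar>D n \<omega> u\<bar> \<le> \<epsilon> / 2 + Y n \<omega>)" and b: "b \<longlonglongrightarrow> 0"
    using dom[of "\<epsilon> / 2"] \<epsilon> by (meson half_gt_zero)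
  have "\<forall>\<^sub>F n in sequentially. b n < \<eta> * (\<epsilon> / 2)" using \<epsilon> \<eta> by (intro order_tendstoD(2)[OF b]) simp
  with Y show "\<forall>\<^sub>F n in sequentially. \<exists>E\<in>sets (M n). measure (M n) E \<le> \<eta> \<and> (AE \<omega> in M n. \<omega> \<notin> E \<longrightarrow> (\<forall>u. \<bar>D n \<omega> u\<bar> \<le> \<epsilon>))"
  proof eventually_elim
    case (elim n)
    interpret prob_space "M n" by (rule pr)
    have [measurable]: "Y n \<in> borel_measurable (M n)" using elim by auto
    let ?E = "{\<omega> \<in> space (M n). \<epsilon> / 2 \<le> Y n \<omega>}"
    have E: "?E \<in> sets (M n)" by measurable
    have "measure (M n) ?E \<le> (\<integral>\<omega>. Y n \<omega> \<partial>M n) / (\<epsilon> / 2)"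
      using integral_Markov_inequality_measure[of "M n" "Y n" "{}" "\<epsilon> / 2"] elim \<epsilon> by simp
    also have "\<dots> \<le> b n / (\<epsilon> / 2)" using elim \<epsilon> by (intro divide_right_mono) auto
    also have "\<dots> \<le> \<eta>" using elim \<epsilon> by (simp add: field_simps)
    finally have "measure (M n) ?E \<le> \<eta>" .
    moreover have "AE \<omega> in M n. \<forall>u. \<bar>D n \<omega> u\<bar> \<le> \<epsilon> / 2 + Y n \<omega>" using elim by blast
    then have "AE \<omega> in M n. \<omega> \<notin> ?E \<longrightarrow> (\<forall>u. \<bar>D n \<omega> u\<bar> \<le> \<epsilon>)"
      using AE_space
    proof eventually_elim
      case (elim \<omega>)
      show ?case
      proof (intro impI allI)
        fix u assume "\<omega> \<notin> ?E"
        then have "Y n \<omega> < \<epsilon> / 2" using elim by auto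
        then show "\<bar>D n \<omega> u\<bar> \<le> \<epsilon>" using elim(1)[rule_format, of u] by linarith
      qed
    qed
    ultimately show ?case using E by blast
  qed
qed

section \<open>Sequences of block averages\<close>

text \<open>All exponents of \<open>n\<close> are nonpositive, so a bound in terms of
  \<open>m\<close> holds for every sum of at least \<open>m\<close> vectors. The same conditions
  then serve the blocks and the full sample.\<close>

lemma (in gauss_approx) gauss_approx_block:
  assumes t: "test_fun C \<phi> \<phi>1 \<phi>2" and m: "0 < m" "m \<le> n" and \<tau>: "0 < \<tau>"
  shows "\<bar>(\<integral>z. \<phi> (normalized p S (real n) z) \<partial>walk p P n) - (\<integral>z. \<phi> (normalized p S 1 z) \<partial>G)\<bar>
    \<le> C * (1280 * (5 * (real m powr (1 - q / 2) * quad) + 4 * real m powr (1 - q / 2) + real m powr (2 - q) * cross)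
         + (1 + 1 / (2 * \<tau>)) * (kappa / real m + 2 / real m) + 4 * \<tau>)"
proof -
  have C: "0 \<le> C" using t by (simp add: test_fun_def)
  have n: "0 < n" "1 \<le> real m" "real m \<le> real n" using m by auto
  have quad0: "0 \<le> quad" unfolding quad_def by (intro divide_nonneg_nonneg) auto
  have cross0: "0 \<le> cross" unfolding cross_def by (intro divide_nonneg_nonneg) (auto intro!: integral_nonneg_AE)
  have kappa0: "0 \<le> kappa" by (simp add: kappa_def)
  have neg: "real n powr s \<le> real m powr s" if "s \<le> 0" for s
    using powr_mono2'[of s "real m" "real n"] that n by simp
  have "real n powr (1 - q / 2) * (quad + 4) + real n powr (2 - q) * (cross + 4 * quad)
      \<le> real m powr (1 - q / 2) * (quad + 4) + (real m powr (2 - q) * cross + real m powr (1 - q / 2) * (4 * quad))"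
  proof -
    have 1: "real n powr (1 - q / 2) * (quad + 4) \<le> real m powr (1 - q / 2) * (quad + 4)"
      using q quad0 by (intro mult_right_mono neg) auto
    have 2: "real n powr (2 - q) * cross \<le> real m powr (2 - q) * cross"
      using q cross0 by (intro mult_right_mono neg) auto
    \<comment> \<open>Since \<open>2 - q\<close> is at most \<open>1 - q / 2\<close>, the mixed
      contribution of \<open>quad\<close> is covered by the condition on its main
      contribution.\<close>
    have "real n powr (2 - q) \<le> real m powr (2 - q)" using q by (intro neg) auto
    also have "\<dots> \<le> real m powr (1 - q / 2)" using q n by (intro powr_mono) auto
    finally have 3: "real n powr (2 - q) * (4 * quad) \<le> real m powr (1 - q / 2) * (4 * quad)"
      using quad0 by (intro mult_right_mono) auto
    show ?thesis using 1 2 3 by (simp only: distrib_left)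
  qed
  also have "\<dots> = 5 * (real m powr (1 - q / 2) * quad) + 4 * real m powr (1 - q / 2) + real m powr (2 - q) * cross"
    by (simp add: algebra_simps)
  finally have A: "real n powr (1 - q / 2) * (quad + 4) + real n powr (2 - q) * (cross + 4 * quad)
      \<le> 5 * (real m powr (1 - q / 2) * quad) + 4 * real m powr (1 - q / 2) + real m powr (2 - q) * cross" .
  have "(kappa + 2) / real n \<le> (kappa + 2) / real m"
    using n m kappa0 by (intro divide_left_mono) auto
  then have "(kappa + 2) / real n \<le> kappa / real m + 2 / real m" by (simp add: add_divide_distrib)
  then have B: "(1 + 1 / (2 * \<tau>)) * ((kappa + 2) / real n) \<le> (1 + 1 / (2 * \<tau>)) * (kappa / real m + 2 / real m)"
    using \<tau> by (intro mult_left_mono) auto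
  have "C * (1280 * (real n powr (1 - q / 2) * (quad + 4) + real n powr (2 - q) * (cross + 4 * quad))
         + (1 + 1 / (2 * \<tau>)) * ((kappa + 2) / real n) + 4 * \<tau>)
    \<le> C * (1280 * (5 * (real m powr (1 - q / 2) * quad) + 4 * real m powr (1 - q / 2) + real m powr (2 - q) * cross)
         + (1 + 1 / (2 * \<tau>)) * (kappa / real m + 2 / real m) + 4 * \<tau>)"
    by (rule mult_left_mono[OF add_right_mono[OF add_mono[OF mult_left_mono[OF A] B]] C]) simp
  then show ?thesis using gauss_approx[OF t n(1) \<tau>] by linarith
qed

text \<open>The order of limits for \<open>\<tau>\<close>: the vanishing part may depend on
  \<open>\<tau>\<close>, while the remainder is proportional to it.\<close>

lemma tendsto_zero_if_small_rest:
  fixes x :: "nat \<Rightarrow> real"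
  assumes "\<And>\<tau>. 0 < \<tau> \<Longrightarrow> \<exists>y. y \<longlonglongrightarrow> 0 \<and> (\<forall>\<^sub>F n in sequentially. \<bar>x n\<bar> \<le> y n + K * \<tau>)"
  shows "x \<longlonglongrightarrow> 0"
proof (rule LIMSEQ_I)
  fix r :: real assume r: "0 < r"
  \<comment> \<open>The added 1 avoids division by zero when \<open>K = 0\<close>.\<close>
  define \<tau> where "\<tau> = r / (2 * (\<bar>K\<bar> + 1))"
  have \<tau>: "0 < \<tau>" using r by (simp add: \<tau>_def)
  obtain y where y: "y \<longlonglongrightarrow> 0" "\<forall>\<^sub>F n in sequentially. \<bar>x n\<bar> \<le> y n + K * \<tau>" using assms[OF \<tau>] by blast
  have "K * \<tau> \<le> (\<bar>K\<bar> + 1) * \<tau>" using \<tau> by (intro mult_right_mono) auto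
  also have "\<dots> = r / 2" by (simp add: \<tau>_def add_pos_nonneg field_simps)
  finally have K: "K * \<tau> \<le> r / 2" .
  have "\<forall>\<^sub>F n in sequentially. y n < r / 2" using r by (intro order_tendstoD(2)[OF y(1)]) simp
  with y(2) have "\<forall>\<^sub>F n in sequentially. norm (x n - 0) < r"
    by eventually_elim (use K in auto)
  then show "\<exists>no. \<forall>n\<ge>no. norm (x n - 0) < r" by (simp add: eventually_sequentially)
qed

abbreviation "kap p S P \<equiv> gauss_approx.kappa p S P"
abbreviation "qd p S q P \<equiv> gauss_approx.quad p S q P"
abbreviation "crs p S q P \<equiv> gauss_approx.cross p S q P"

text \<open>Dimension, covariance, law and Gaussian factor all vary with \<open>n\<close>. The
  structural assumption is asked for only eventually, since samples with fewer than two vectors are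
  left out.\<close>

locale moment_conditions =
  fixes p :: "nat \<Rightarrow> nat" and S :: "nat \<Rightarrow> nat \<Rightarrow> nat \<Rightarrow> real" and q :: real and P :: "nat \<Rightarrow> (nat \<Rightarrow> real) measure"
    and a :: "nat \<Rightarrow> nat \<Rightarrow> nat \<Rightarrow> real" and m :: "nat \<Rightarrow> nat"
  assumes ga: "\<forall>\<^sub>F n in sequentially. gauss_approx (p n) (S n) q (P n) (a n)"
    and q_gt: "2 < q"
    and m_inf: "filterlim m at_top sequentially"
    and m_small: "(\<lambda>n. real (m n) / real n) \<longlonglongrightarrow> 0"
    and kap_lim: "(\<lambda>n. kap (p n) (S n) (P n) / real (m n)) \<longlonglongrightarrow> 0"
    and quad_lim: "(\<lambda>n. real (m n) powr (1 - q / 2) * qd (p n) (S n) q (P n)) \<longlonglongrightarrow> 0"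
    and cross_lim: "(\<lambda>n. real (m n) powr (2 - q) * crs (p n) (S n) q (P n)) \<longlonglongrightarrow> 0"
begin

abbreviation gexp :: "(real \<Rightarrow> real) \<Rightarrow> nat \<Rightarrow> real" where
  "gexp \<phi> n \<equiv> (\<integral>z. \<phi> (normalized (p n) (S n) 1 z) \<partial>gauss_factor.G (p n) (a n))"

abbreviation bmean :: "(real \<Rightarrow> real) \<Rightarrow> nat \<Rightarrow> nat \<Rightarrow> real" where
  "bmean \<phi> n l \<equiv> (\<integral>z. \<phi> (normalized (p n) (S n) (real l) z) \<partial>walk (p n) (P n) l)"

lemma m_real_inf: "filterlim (\<lambda>n. real (m n)) at_top sequentially"
  using m_inf by (rule filterlim_compose[OF filterlim_real_sequentially])

lemma m_pos: "\<forall>\<^sub>F n in sequentially. 0 < m n"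
  using m_inf eventually_gt_at_top[of 0] by (rule filterlim_iff[THEN iffD1, rule_format])

lemma m_less: "\<forall>\<^sub>F n in sequentially. m n < n"
proof -
  have "\<forall>\<^sub>F n in sequentially. real (m n) / real n < 1" by (rule order_tendstoD(2)[OF m_small]) simp
  then show ?thesis using eventually_gt_at_top[of 0] by eventually_elim (simp add: divide_less_eq)
qed

lemma bmean_tendsto:
  assumes t: "test_fun C \<phi> \<phi>1 \<phi>2" and l: "\<forall>\<^sub>F n in sequentially. m n \<le> l n"
  shows "(\<lambda>n. bmean \<phi> n (l n) - gexp \<phi> n) \<longlonglongrightarrow> 0"
proof (rule tendsto_zero_if_small_rest[where K = "4 * C"])
  fix \<tau> :: real assume \<tau>: "0 < \<tau>"
  let ?y = "\<lambda>n. C * (1280 * (5 * (real (m n) powr (1 - q / 2) * qd (p n) (S n) q (P n)) + 4 * real (m n) powr (1 - q / 2)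
      + real (m n) powr (2 - q) * crs (p n) (S n) q (P n)) + (1 + 1 / (2 * \<tau>)) * (kap (p n) (S n) (P n) / real (m n) + 2 / real (m n)))"
  have "(\<lambda>n. real (m n) powr (1 - q / 2)) \<longlonglongrightarrow> 0"
    using q_gt by (intro tendsto_neg_powr m_real_inf) simp
  moreover have "(\<lambda>n. 2 / real (m n)) \<longlonglongrightarrow> 0"
    by (intro real_tendsto_divide_at_top[OF tendsto_const m_real_inf])
  ultimately have "?y \<longlonglongrightarrow> C * (1280 * (5 * 0 + 4 * 0 + 0) + (1 + 1 / (2 * \<tau>)) * (0 + 0))"
    using kap_lim quad_lim cross_lim by (intro tendsto_intros)
  moreover have "\<forall>\<^sub>F n in sequentially. \<bar>bmean \<phi> n (l n) - gexp \<phi> n\<bar> \<le> ?y n + 4 * C * \<tau>"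
    using ga m_pos l
  proof eventually_elim
    case (elim n)
    from gauss_approx.gauss_approx_block[OF elim(1) t elim(2,3) \<tau>]
    show ?case by (simp add: distrib_left mult.assoc)
  qed
  ultimately show "\<exists>y. y \<longlonglongrightarrow> 0 \<and> (\<forall>\<^sub>F n in sequentially. \<bar>bmean \<phi> n (l n) - gexp \<phi> n\<bar> \<le> y n + 4 * C * \<tau>)"
    by (intro exI[of _ ?y]) simp
qed

abbreviation gc :: "nat \<Rightarrow> real \<Rightarrow> real" where
  "gc n \<equiv> gauss_approx.gcdf (p n) (S n) (a n)"

lemma root4:
  assumes "0 < \<epsilon>" shows "\<exists>h>0. 2 * sqrt (sqrt h) \<le> \<epsilon>"
proof (intro exI conjI)
  show "0 < (\<epsilon> / 2) ^ 4" using assms by simp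
  have "sqrt ((\<epsilon> / 2) ^ 4) = (\<epsilon> / 2)\<^sup>2" by (rule real_sqrt_unique) (simp_all flip: power_mult)
  then show "2 * sqrt (sqrt ((\<epsilon> / 2) ^ 4)) \<le> \<epsilon>" using assms by simp
qed

text \<open>Shared by the random empirical functions and the deterministic target. The hypothesis
  \<open>sm\<close> asks for a sandwich by Gaussian means of test functions with an error small in
  mean, and says nothing about the origin of \<open>F\<close>.\<close>

lemma unif_small_of_pointwise:
  fixes M :: "nat \<Rightarrow> 'a measure" and F :: "nat \<Rightarrow> 'a \<Rightarrow> real \<Rightarrow> real"
  assumes pr: "\<And>n. prob_space (M n)"
    and F: "\<forall>\<^sub>F n in sequentially. \<forall>\<omega>. mono (F n \<omega>) \<and> (\<forall>u. 0 \<le> F n \<omega> u \<and> F n \<omega> u \<le> 1)"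
    and sm: "\<And>C \<phi> \<phi>1 \<phi>2. test_fun C \<phi> \<phi>1 \<phi>2 \<Longrightarrow>
      \<exists>Y b. (\<forall>\<^sub>F n in sequentially. integrable (M n) (Y n) \<and> (\<forall>\<omega>. 0 \<le> Y n \<omega>) \<and> (\<integral>\<omega>. Y n \<omega> \<partial>M n) \<le> b n \<and>
        (\<forall>u. (\<forall>x\<le>u. \<phi> x = 1) \<longrightarrow> (\<forall>\<omega>. F n \<omega> u \<le> gexp \<phi> n + Y n \<omega>)) \<and>
        (\<forall>u. (\<forall>x>u. \<phi> x = 0) \<longrightarrow> (\<forall>\<omega>. gexp \<phi> n - Y n \<omega> \<le> F n \<omega> u))) \<and> b \<longlonglongrightarrow> 0"
  shows "unif_small M (\<lambda>n \<omega> u. F n \<omega> u - gc n u)"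
proof (rule unif_small_monotone[OF pr])
  show "\<forall>\<^sub>F n in sequentially. (\<forall>\<omega>. mono (F n \<omega>) \<and> (\<forall>u. 0 \<le> F n \<omega> u \<and> F n \<omega> u \<le> 1)) \<and> (\<forall>u. 0 \<le> gc n u \<and> gc n u \<le> 1) \<and> mono (gc n)"
    using F ga
  proof eventually_elim
    case (elim n)
    interpret gauss_approx "p n" "S n" q "P n" "a n" by (rule elim(2))
    show ?case using elim(1) gcdf_range gcdf_mono by (auto intro!: monoI)
  qed
  show "\<exists>h>0. \<forall>\<^sub>F n in sequentially. \<forall>u. gc n (u + h) - gc n u \<le> \<epsilon>" if \<epsilon>: "0 < \<epsilon>" for \<epsilon>
  proof -
    obtain h where h: "0 < h" "2 * sqrt (sqrt h) \<le> \<epsilon>" using root4[OF \<epsilon>] by blast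
    have "\<forall>\<^sub>F n in sequentially. \<forall>u. gc n (u + h) - gc n u \<le> \<epsilon>"
      using ga by eventually_elim (use h gauss_approx.gcdf_increment[OF _ h(1)] in \<open>meson order_trans\<close>)
    then show ?thesis using h by blast
  qed
  show "\<exists>U>0. \<forall>\<^sub>F n in sequentially. gc n (- U) \<le> \<epsilon> \<and> 1 - \<epsilon> \<le> gc n U" if \<epsilon>: "0 < \<epsilon>" for \<epsilon>
  proof -
    define U where "U = sqrt (2 / \<epsilon>)"
    have U: "0 < U" "2 / U\<^sup>2 = \<epsilon>" using \<epsilon> by (auto simp: U_def)
    have "\<forall>\<^sub>F n in sequentially. gc n (- U) \<le> \<epsilon> \<and> 1 - \<epsilon> \<le> gc n U"
      using ga by eventually_elim (use gauss_approx.gcdf_tails[OF _ U(1)] U(2) in auto)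
    then show ?thesis using U by blast
  qed
  show "unif_small M (\<lambda>n \<omega> (_::unit). F n \<omega> u - gc n u)" for u
  proof (rule unif_small_Markov[OF pr])
    fix \<epsilon> :: real assume \<epsilon>: "0 < \<epsilon>"
    obtain h where h: "0 < h" "2 * sqrt (sqrt h) \<le> \<epsilon>" using root4[OF \<epsilon>] by blast
    \<comment> \<open>One test function descends to the right of \<open>u\<close>, the other to the
      left. Their Gaussian means lie within the increments of the limit over distance
      \<open>h\<close>, so each smoothing error is at most \<open>\<epsilon>\<close>.\<close>
    obtain C \<phi> \<phi>1 \<phi>2 where t: "test_fun C \<phi> \<phi>1 \<phi>2" "\<And>x. x \<le> u \<Longrightarrow> \<phi> x = 1" "\<And>x. u + h \<le> x \<Longrightarrow> \<phi> x = 0"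
      by (rule test_fun_step[OF h(1), of u]) blast
    obtain C' \<psi> \<psi>1 \<psi>2 where t': "test_fun C' \<psi> \<psi>1 \<psi>2" "\<And>x. x \<le> u - h \<Longrightarrow> \<psi> x = 1" "\<And>x. u \<le> x \<Longrightarrow> \<psi> x = 0"
      by (rule test_fun_step[OF h(1), of "u - h"]) simp
    obtain Y b where Y: "\<forall>\<^sub>F n in sequentially. integrable (M n) (Y n) \<and> (\<forall>\<omega>. 0 \<le> Y n \<omega>) \<and> (\<integral>\<omega>. Y n \<omega> \<partial>M n) \<le> b n \<and>
        (\<forall>u. (\<forall>x\<le>u. \<phi> x = 1) \<longrightarrow> (\<forall>\<omega>. F n \<omega> u \<le> gexp \<phi> n + Y n \<omega>)) \<and>
        (\<forall>u. (\<forall>x>u. \<phi> x = 0) \<longrightarrow> (\<forall>\<omega>. gexp \<phi> n - Y n \<omega> \<le> F n \<omega> u))" "b \<longlonglongrightarrow> 0"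
      using sm[OF t(1)] by blast
    obtain Y' b' where Y': "\<forall>\<^sub>F n in sequentially. integrable (M n) (Y' n) \<and> (\<forall>\<omega>. 0 \<le> Y' n \<omega>) \<and> (\<integral>\<omega>. Y' n \<omega> \<partial>M n) \<le> b' n \<and>
        (\<forall>u. (\<forall>x\<le>u. \<psi> x = 1) \<longrightarrow> (\<forall>\<omega>. F n \<omega> u \<le> gexp \<psi> n + Y' n \<omega>)) \<and>
        (\<forall>u. (\<forall>x>u. \<psi> x = 0) \<longrightarrow> (\<forall>\<omega>. gexp \<psi> n - Y' n \<omega> \<le> F n \<omega> u))" "b' \<longlonglongrightarrow> 0"
      using sm[OF t'(1)] by blast
    have "\<forall>\<^sub>F n in sequentially. integrable (M n) (\<lambda>\<omega>. Y n \<omega> + Y' n \<omega>) \<and> (\<forall>\<omega>. 0 \<le> Y n \<omega> + Y' n \<omega>) \<and>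
        (\<integral>\<omega>. Y n \<omega> + Y' n \<omega> \<partial>M n) \<le> b n + b' n \<and> (AE \<omega> in M n. \<forall>_::unit. \<bar>F n \<omega> u - gc n u\<bar> \<le> \<epsilon> + (Y n \<omega> + Y' n \<omega>))"
      using Y(1) Y'(1) ga
    proof eventually_elim
      case (elim n)
      interpret gauss_approx "p n" "S n" q "P n" "a n" by (rule elim(3))
      have "\<bar>F n \<omega> u - gcdf u\<bar> \<le> \<epsilon> + (Y n \<omega> + Y' n \<omega>)" for \<omega>
      proof -
        have p: "0 \<le> Y n \<omega>" "0 \<le> Y' n \<omega>" using elim(1,2) by auto
        have 1: "F n \<omega> u \<le> gexp \<phi> n + Y n \<omega>" using elim(1) t(2) by blast
        have 2: "gexp \<phi> n \<le> gcdf (u + h)" by (rule gcdf_le_integral_test_fun(2)[OF t(1)]) (use t(3) in auto)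
        have 3: "gexp \<psi> n - Y' n \<omega> \<le> F n \<omega> u" using elim(2) t'(3) by (meson less_imp_le)
        have 4: "gcdf (u - h) \<le> gexp \<psi> n" by (rule gcdf_le_integral_test_fun(1)[OF t'(1)]) (use t'(2) in auto)
        have 5: "gcdf (u + h) - gcdf u \<le> \<epsilon>" "gcdf u - gcdf (u - h) \<le> \<epsilon>"
          using gcdf_increment[OF h(1), of u] gcdf_increment[OF h(1), of "u - h"] h(2) by auto
        show ?thesis using p 1 2 3 4 5 by linarith
      qed
      then show ?case using elim(1,2) by (auto simp: add_mono)
    qed
    moreover have "(\<lambda>n. b n + b' n) \<longlonglongrightarrow> 0" using tendsto_add[OF Y(2) Y'(2)] by simp
    ultimately show "\<exists>Y b. (\<forall>\<^sub>F n in sequentially. integrable (M n) (Y n) \<and> (\<forall>\<omega>. 0 \<le> Y n \<omega>) \<and> (\<integral>\<omega>. Y n \<omega> \<partial>M n) \<le> b n \<and>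
          (AE \<omega> in M n. \<forall>_::unit. \<bar>F n \<omega> u - gc n u\<bar> \<le> \<epsilon> + Y n \<omega>)) \<and> b \<longlonglongrightarrow> 0"
      by (intro exI[of _ "\<lambda>n \<omega>. Y n \<omega> + Y' n \<omega>"] exI[of _ "\<lambda>n. b n + b' n"] conjI)
  qed
qed

lemma unif_small_ecdf:
  fixes M :: "nat \<Rightarrow> 'a measure"
  assumes pr: "\<And>n. prob_space (M n)"
    and rb: "\<forall>\<^sub>F n in sequentially. random_blocks (p n) (S n) q (P n) (a n) (M n) (Z n) {1..n} (F n) (A n) (J n) (m n) (\<eta> n)"
    and J: "filterlim J at_top sequentially" and \<eta>: "\<eta> \<longlonglongrightarrow> 0"
  shows "unif_small M (\<lambda>n \<omega> u. random_blocks.ecdf (p n) (S n) (Z n) {1..n} (A n) (J n) (m n) \<omega> u - gc n u)"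
proof (rule unif_small_of_pointwise[OF pr])
  show "\<forall>\<^sub>F n in sequentially. \<forall>\<omega>. mono (random_blocks.ecdf (p n) (S n) (Z n) {1..n} (A n) (J n) (m n) \<omega>) \<and>
      (\<forall>u. 0 \<le> random_blocks.ecdf (p n) (S n) (Z n) {1..n} (A n) (J n) (m n) \<omega> u \<and> random_blocks.ecdf (p n) (S n) (Z n) {1..n} (A n) (J n) (m n) \<omega> u \<le> 1)"
    using rb
  proof eventually_elim
    case (elim n)
    interpret random_blocks "p n" "S n" q "P n" "a n" "M n" "Z n" "{1..n}" "F n" "A n" "J n" "m n" "\<eta> n" by (rule elim)
    show ?case using ecdf_mono ecdf_range by (auto intro!: monoI)
  qed
  fix C \<phi> \<phi>1 \<phi>2 assume t: "test_fun C \<phi> \<phi>1 \<phi>2"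
  have C: "0 \<le> C" using t by (simp add: test_fun_def)
  let ?av = "\<lambda>n \<omega>. random_blocks.avg (p n) (S n) (Z n) (A n) (J n) (m n) \<phi> \<omega>"
  let ?dv = "\<lambda>n \<omega>. random_blocks.dev (p n) (S n) (Z n) {1..n} (A n) (J n) (m n) \<omega>"
  let ?e = "\<lambda>n. \<bar>bmean \<phi> n (m n) - gexp \<phi> n\<bar>"
  let ?\<rho> = "\<lambda>n. real (m n) / real n"
  let ?k = "\<lambda>n. kap (p n) (S n) (P n) / real (m n)"
  \<comment> \<open>Three sources of error: fluctuation of the block average, centring at the sample
    mean, and Gaussian approximation of a single block.\<close>
  let ?Y = "\<lambda>n \<omega>. \<bar>?av n \<omega> - bmean \<phi> n (m n)\<bar> + C * \<bar>?dv n \<omega>\<bar> + ?e n"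
  let ?b = "\<lambda>n. sqrt (1 / real (J n) + 4 * C * (4 * \<eta> n + sqrt (?k n))) + C * ((2 * ?\<rho> n * sqrt (?k n + 2) + 2 * sqrt (?\<rho> n)) / (1 - ?\<rho> n)) + ?e n"
  have "(\<lambda>n. 1 / real (J n)) \<longlonglongrightarrow> 0"
    by (intro real_tendsto_divide_at_top[OF tendsto_const] filterlim_compose[OF filterlim_real_sequentially J])
  moreover have "(\<lambda>n. ?e n) \<longlonglongrightarrow> 0" using bmean_tendsto[OF t, of m] by (intro tendsto_rabs_zero) simp
  \<comment> \<open>\<open>kappa / m\<close>, \<open>m / n\<close>, the overlap bound and
    \<open>1 / J\<close> are all sent to 0 in a continuous expression.\<close>
  ultimately have "?b \<longlonglongrightarrow> sqrt (0 + 4 * C * (4 * 0 + sqrt 0)) + C * ((2 * 0 * sqrt (0 + 2) + 2 * sqrt 0) / (1 - 0)) + 0"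
    using kap_lim m_small \<eta> by (intro tendsto_intros) auto
  then have b: "?b \<longlonglongrightarrow> 0" by simp
  have "\<forall>\<^sub>F n in sequentially. integrable (M n) (?Y n) \<and> (\<forall>\<omega>. 0 \<le> ?Y n \<omega>) \<and> (\<integral>\<omega>. ?Y n \<omega> \<partial>M n) \<le> ?b n \<and>
        (\<forall>u. (\<forall>x\<le>u. \<phi> x = 1) \<longrightarrow> (\<forall>\<omega>. random_blocks.ecdf (p n) (S n) (Z n) {1..n} (A n) (J n) (m n) \<omega> u \<le> gexp \<phi> n + ?Y n \<omega>)) \<and>
        (\<forall>u. (\<forall>x>u. \<phi> x = 0) \<longrightarrow> (\<forall>\<omega>. gexp \<phi> n - ?Y n \<omega> \<le> random_blocks.ecdf (p n) (S n) (Z n) {1..n} (A n) (J n) (m n) \<omega> u))"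
    using rb
  proof eventually_elim
    case (elim n)
    interpret random_blocks "p n" "S n" q "P n" "a n" "M n" "Z n" "{1..n}" "F n" "A n" "J n" "m n" "\<eta> n" by (rule elim)
    have bm: "block_mean (m n) \<phi> = bmean \<phi> n (m n)" by (simp add: block_mean_def)
    have d0: "0 \<le> dev \<omega>" for \<omega> unfolding dev_def by (intro divide_nonneg_nonneg sum_nonneg) auto
    have i: "integrable (M n) (\<lambda>\<omega>. \<bar>avg \<phi> \<omega> - bmean \<phi> n (m n)\<bar>)" "integrable (M n) dev"
      using avg_L1(1)[OF t] dev_L1(1) by auto
    have "(\<integral>\<omega>. ?Y n \<omega> \<partial>M n) = (\<integral>\<omega>. \<bar>avg \<phi> \<omega> - bmean \<phi> n (m n)\<bar> \<partial>M n) + C * (\<integral>\<omega>. dev \<omega> \<partial>M n) + ?e n"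
      using i d0 by (simp add: Pr.prob_space)
    also have "\<dots> \<le> ?b n"
      using avg_L1(2)[OF t] dev_L1(2) C unfolding bm by (intro add_mono mult_left_mono) auto
    finally have 1: "(\<integral>\<omega>. ?Y n \<omega> \<partial>M n) \<le> ?b n" .
    have 2: "ecdf \<omega> u \<le> gexp \<phi> n + ?Y n \<omega>" if "\<forall>x\<le>u. \<phi> x = 1" for u \<omega>
      using ecdf_le_avg[OF t, of u \<omega>] that d0[of \<omega>] by (simp; linarith)
    have 3: "gexp \<phi> n - ?Y n \<omega> \<le> ecdf \<omega> u" if "\<forall>x>u. \<phi> x = 0" for u \<omega>
      using avg_le_ecdf[OF t, of u \<omega>] that d0[of \<omega>] by (simp; linarith)
    show ?case using i 1 2 3 C d0 by auto
  qed
  then show "\<exists>Y b. (\<forall>\<^sub>F n in sequentially. integrable (M n) (Y n) \<and> (\<forall>\<omega>. 0 \<le> Y n \<omega>) \<and> (\<integral>\<omega>. Y n \<omega> \<partial>M n) \<le> b n \<and>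
        (\<forall>u. (\<forall>x\<le>u. \<phi> x = 1) \<longrightarrow> (\<forall>\<omega>. random_blocks.ecdf (p n) (S n) (Z n) {1..n} (A n) (J n) (m n) \<omega> u \<le> gexp \<phi> n + Y n \<omega>)) \<and>
        (\<forall>u. (\<forall>x>u. \<phi> x = 0) \<longrightarrow> (\<forall>\<omega>. gexp \<phi> n - Y n \<omega> \<le> random_blocks.ecdf (p n) (S n) (Z n) {1..n} (A n) (J n) (m n) \<omega> u))) \<and> b \<longlonglongrightarrow> 0"
    using b by (intro exI[of _ ?Y] exI[of _ ?b] conjI)
qed

text \<open>The target is deterministic, so its outcome argument is a dummy and the error is a
  constant. Gaussian approximation applies because the sample size eventually exceeds
  \<open>m\<close>.\<close>

lemma unif_small_total_cdf:
  fixes M :: "nat \<Rightarrow> 'a measure"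
  assumes pr: "\<And>n. prob_space (M n)"
    and iv: "\<forall>\<^sub>F n in sequentially. iid_vectors (p n) (S n) q (P n) (a n) (M n) (Z n) {1..n}"
  shows "unif_small M (\<lambda>n \<omega> u. iid_vectors.total_cdf (p n) (S n) (M n) (Z n) {1..n} u - gc n u)"
proof (rule unif_small_of_pointwise[OF pr])
  show "\<forall>\<^sub>F n in sequentially. \<forall>\<omega>::'a. mono (iid_vectors.total_cdf (p n) (S n) (M n) (Z n) {1..n}) \<and>
      (\<forall>u. 0 \<le> iid_vectors.total_cdf (p n) (S n) (M n) (Z n) {1..n} u \<and> iid_vectors.total_cdf (p n) (S n) (M n) (Z n) {1..n} u \<le> 1)"
    using iv
  proof eventually_elim
    case (elim n)
    interpret iid_vectors "p n" "S n" q "P n" "a n" "M n" "Z n" "{1..n}" by (rule elim)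
    show ?case using total_cdf_mono total_cdf_range by (auto intro!: monoI)
  qed
  fix C \<phi> \<phi>1 \<phi>2 assume t: "test_fun C \<phi> \<phi>1 \<phi>2"
  let ?e = "\<lambda>n. \<bar>bmean \<phi> n n - gexp \<phi> n\<bar>"
  have e: "?e \<longlonglongrightarrow> 0"
  proof (intro tendsto_rabs_zero bmean_tendsto[OF t])
    show "\<forall>\<^sub>F n in sequentially. m n \<le> n" using m_less by eventually_elim simp
  qed
  have "\<forall>\<^sub>F n in sequentially. integrable (M n) (\<lambda>_. ?e n) \<and> (\<forall>\<omega>::'a. 0 \<le> ?e n) \<and> (\<integral>\<omega>. ?e n \<partial>M n) \<le> ?e n \<and>
        (\<forall>u. (\<forall>x\<le>u. \<phi> x = 1) \<longrightarrow> (\<forall>\<omega>::'a. iid_vectors.total_cdf (p n) (S n) (M n) (Z n) {1..n} u \<le> gexp \<phi> n + ?e n)) \<and>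
        (\<forall>u. (\<forall>x>u. \<phi> x = 0) \<longrightarrow> (\<forall>\<omega>::'a. gexp \<phi> n - ?e n \<le> iid_vectors.total_cdf (p n) (S n) (M n) (Z n) {1..n} u))"
    using iv
  proof eventually_elim
    case (elim n)
    interpret iid_vectors "p n" "S n" q "P n" "a n" "M n" "Z n" "{1..n}" by (rule elim)
    have bm: "block_mean (card {1..n}) \<phi> = bmean \<phi> n n" by (simp add: block_mean_def)
    have 2: "total_cdf u \<le> gexp \<phi> n + ?e n" if "\<forall>x\<le>u. \<phi> x = 1" for u
      using total_cdf_sandwich(1)[OF t, of u] that unfolding bm by (simp; linarith)
    have 3: "gexp \<phi> n - ?e n \<le> total_cdf u" if "\<forall>x>u. \<phi> x = 0" for u
      using total_cdf_sandwich(2)[OF t, of u] that unfolding bm by (simp; linarith)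
    show ?case using 2 3 by (auto simp: Pr.prob_space)
  qed
  then show "\<exists>Y b. (\<forall>\<^sub>F n in sequentially. integrable (M n) (Y n) \<and> (\<forall>\<omega>. 0 \<le> Y n \<omega>) \<and> (\<integral>\<omega>. Y n \<omega> \<partial>M n) \<le> b n \<and>
        (\<forall>u. (\<forall>x\<le>u. \<phi> x = 1) \<longrightarrow> (\<forall>\<omega>. iid_vectors.total_cdf (p n) (S n) (M n) (Z n) {1..n} u \<le> gexp \<phi> n + Y n \<omega>)) \<and>
        (\<forall>u. (\<forall>x>u. \<phi> x = 0) \<longrightarrow> (\<forall>\<omega>. gexp \<phi> n - Y n \<omega> \<le> iid_vectors.total_cdf (p n) (S n) (M n) (Z n) {1..n} u))) \<and> b \<longlonglongrightarrow> 0"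
    using e by (intro exI[of _ "\<lambda>n _. ?e n"] exI[of _ ?e] conjI)
qed

end

section \<open>Samples and subsamples\<close>

text \<open>The bound on \<open>n\<close> puts the second vector inside the sample, as the moment of
  the inner product requires.\<close>

locale iid_sample = prob_space M for M :: "'a measure" +
  fixes p n :: nat and X :: "nat \<Rightarrow> 'a \<Rightarrow> nat \<Rightarrow> real" and \<delta> :: real
  assumes n: "2 \<le> n"
    and X_measurable: "X i \<in> measurable M (vec_space p)"
    and X_indep: "indep_vars (\<lambda>_. vec_space p) X {1..n}"
    and X_ident: "i \<in> {1..n} \<Longrightarrow> distr M (vec_space p) (X i) = distr M (vec_space p) (X 1)"
    and sq_int: "k < p \<Longrightarrow> integrable M (\<lambda>\<omega>. (X 1 \<omega> k)\<^sup>2)"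
    and cov_nz: "\<exists>k<p. \<exists>l<p. cov_mat M (X 1) k l \<noteq> 0"
    and delta: "0 < \<delta>" "\<delta> \<le> 1"
    and K_fin: "integrable M (K_integrand M p (X 1) \<delta>)"
    and D_fin: "integrable M (D_integrand M p (X 1) (X 2) \<delta>)"
begin

text \<open>Keeps terms such as \<open>X 1\<close> from being rewritten to \<open>X (Suc 0)\<close>,
  so that facts about the first vector continue to match.\<close>

declare One_nat_def [simp del]

abbreviation "mu \<equiv> mean_vec M (X 1)"
abbreviation "Sg \<equiv> cov_mat M (X 1)"

definition Z :: "nat \<Rightarrow> 'a \<Rightarrow> nat \<Rightarrow> real" where
  "Z i \<omega> = (\<lambda>k\<in>{..<p}. X i \<omega> k - mu k)"

definition law :: "(nat \<Rightarrow> real) measure" where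
  "law = distr M (vec_space p) (Z 1)"

lemma center_measurable: "(\<lambda>x. \<lambda>k\<in>{..<p}. x k - mu k) \<in> measurable (vec_space p) (vec_space p)"
  by (subst (2) vec_space_def, rule measurable_restrict)
    (intro borel_measurable_diff borel_measurable_const vec_component_measurable_self, simp)

lemma Z_comp: "Z i = (\<lambda>\<omega>. (\<lambda>x. \<lambda>k\<in>{..<p}. x k - mu k) (X i \<omega>))"
  by (auto simp: Z_def fun_eq_iff)

lemma Z_measurable_of: "X i \<in> measurable N (vec_space p) \<Longrightarrow> Z i \<in> measurable N (vec_space p)"
  unfolding Z_comp by (rule measurable_compose[OF _ center_measurable])

lemma Z_measurable: "Z i \<in> measurable M (vec_space p)"
  by (rule Z_measurable_of[OF X_measurable])

lemma Z_indep: "indep_vars (\<lambda>_. vec_space p) Z {1..n}"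
  unfolding Z_comp[abs_def] by (rule indep_vars_compose2[OF X_indep center_measurable])

lemma Z_ident: "i \<in> {1..n} \<Longrightarrow> distr M (vec_space p) (Z i) = law"
proof -
  assume i: "i \<in> {1..n}"
  have "distr M (vec_space p) (Z j) = distr (distr M (vec_space p) (X j)) (vec_space p) (\<lambda>x. \<lambda>k\<in>{..<p}. x k - mu k)" for j
    by (simp add: distr_distr[OF center_measurable X_measurable] Z_comp comp_def)
  then show ?thesis using X_ident[OF i] by (simp add: law_def)
qed

lemma vec_law: "vec_law p law"
  unfolding vec_law_def law_def using Z_measurable by (simp add: prob_space_distr)

lemma integral_law: "F \<in> borel_measurable (vec_space p) \<Longrightarrow> (\<integral>z. F z \<partial>law) = (\<integral>\<omega>. F (Z 1 \<omega>) \<partial>M :: real)"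
  unfolding law_def by (rule integral_distr[OF Z_measurable])

lemma integrable_law:
  fixes F :: "(nat \<Rightarrow> real) \<Rightarrow> real"
  shows "F \<in> borel_measurable (vec_space p) \<Longrightarrow> integrable law F \<longleftrightarrow> integrable M (\<lambda>\<omega>. F (Z 1 \<omega>))"
  unfolding law_def by (rule integrable_distr_eq[OF Z_measurable])

lemma sqnorm_Z: "sqnorm p (Z 1 \<omega>) = sqnorm p (centered M (X 1) \<omega>)"
  by (simp add: sqnorm_def dotp_def Z_def centered_def)

lemma qform_Z: "qform p A (Z 1 \<omega>) = (\<Sum>k<p. \<Sum>l<p. centered M (X 1) \<omega> k * A k l * centered M (X 1) \<omega> l)"
  by (simp add: qform_def Z_def centered_def)

lemma integrable_X1: "k < p \<Longrightarrow> integrable M (\<lambda>\<omega>. X 1 \<omega> k)"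
  by (rule square_integrable_imp_integrable[OF _ sq_int])
    (auto intro: vec_component_measurable[OF X_measurable])

lemma mean_X2: "k < p \<Longrightarrow> mean_vec M (X 2) k = mu k"
proof -
  assume k: "k < p"
  have "(\<integral>\<omega>. X i \<omega> k \<partial>M) = (\<integral>z. z k \<partial>distr M (vec_space p) (X i))" for i
    by (rule integral_distr[OF X_measurable vec_component_measurable_self[OF k], symmetric])
  then show ?thesis using X_ident[of 2] n by (simp add: mean_vec_def)
qed

lemma dotp_Z: "dotp p (Z 1 \<omega>) (Z 2 \<omega>) = dotp p (centered M (X 1) \<omega>) (centered M (X 2) \<omega>)"
  by (simp add: dotp_def Z_def centered_def mean_X2)

lemma Sg_sym: "Sg k l = Sg l k"
  by (simp add: cov_mat_def mult.commute)

lemma f2_pos: "0 < f2 p Sg"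
proof -
  obtain k l where kl: "k < p" "l < p" "Sg k l \<noteq> 0" using cov_nz by blast
  have "0 < Sg k l * Sg k l" using kl(3) not_real_square_gt_zero by blast
  also have "Sg k l * Sg k l \<le> (\<Sum>l<p. Sg k l * Sg k l)"
    by (rule member_le_sum) (use kl in auto)
  also have "\<dots> \<le> (\<Sum>k<p. \<Sum>l<p. Sg k l * Sg k l)"
    by (rule member_le_sum[where f = "\<lambda>k. \<Sum>l<p. Sg k l * Sg k l"]) (use kl in \<open>auto intro: sum_nonneg\<close>)
  finally show ?thesis using Sg_sym by (simp add: f2_def)
qed

text \<open>The squared norm is the trace plus \<open>f2\<close> times the deviation inside
  \<open>K_delta\<close>, so the finiteness of the latter supplies the required moment.\<close>

lemma cov_law_law: "cov_law p Sg (2 + \<delta>) law"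
proof
  show "vec_law p law" by (rule vec_law)
  show "2 \<le> 2 + \<delta>" "2 + \<delta> \<le> 3" using delta by auto
  show "(\<integral>z. z k \<partial>law) = 0" if k: "k < p" for k
  proof -
    have "(\<integral>z. z k \<partial>law) = (\<integral>\<omega>. X 1 \<omega> k - mu k \<partial>M)"
      using k by (simp add: integral_law[OF vec_component_measurable_self[OF k]] Z_def)
    also have "\<dots> = 0" using integrable_X1[OF k] by (simp add: prob_space mean_vec_def)
    finally show ?thesis .
  qed
  show "(\<integral>z. z k * z l \<partial>law) = Sg k l" if k: "k < p" and l: "l < p" for k l
    using k l by (subst integral_law)
      (auto simp: Z_def cov_mat_def intro: borel_measurable_times vec_component_measurable_self)
  show "integrable law (\<lambda>z. sqnorm p z powr (2 + \<delta>))"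
  proof (subst integrable_law)
    note [measurable] = Z_measurable
    let ?q = "2 + \<delta>" and ?c = "f1 p Sg" and ?f = "f2 p Sg"
    show "(\<lambda>z. sqnorm p z powr (2 + \<delta>)) \<in> borel_measurable (vec_space p)" by measurable
    show "integrable M (\<lambda>\<omega>. sqnorm p (Z 1 \<omega>) powr ?q)"
    proof (rule Bochner_Integration.integrable_bound)
      show "integrable M (\<lambda>\<omega>. 8 * (?f powr ?q * K_integrand M p (X 1) \<delta> \<omega> + \<bar>?c\<bar> powr ?q))"
        using K_fin by simp
      show "(\<lambda>\<omega>. sqnorm p (Z 1 \<omega>) powr ?q) \<in> borel_measurable M" by measurable
      show "AE \<omega> in M. norm (sqnorm p (Z 1 \<omega>) powr ?q)
          \<le> norm (8 * (?f powr ?q * K_integrand M p (X 1) \<delta> \<omega> + \<bar>?c\<bar> powr ?q))"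
      proof (rule AE_I2)
        fix \<omega>
        let ?s = "sqnorm p (Z 1 \<omega>)"
        have "?s powr ?q = \<bar>(?s - ?c) + ?c\<bar> powr ?q" by simp
        also have "\<dots> \<le> 8 * (\<bar>?s - ?c\<bar> powr ?q + \<bar>?c\<bar> powr ?q)"
          using delta by (intro abs_add_powr_le_8) auto
        also have "\<bar>?s - ?c\<bar> powr ?q = ?f powr ?q * K_integrand M p (X 1) \<delta> \<omega>"
          using f2_pos by (simp add: K_integrand_def sqnorm_Z abs_divide powr_divide)
        finally show "norm (?s powr ?q) \<le> norm (8 * (?f powr ?q * K_integrand M p (X 1) \<delta> \<omega> + \<bar>?c\<bar> powr ?q))"
          by (simp add: K_integrand_def)
      qed
    qed
  qed
qed

definition factor :: "nat \<Rightarrow> nat \<Rightarrow> real" where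
  "factor = (SOME a. \<forall>k<p. \<forall>l<p. Sg k l = (\<Sum>r<p. a r k * a r l))"

lemma factor: "k < p \<Longrightarrow> l < p \<Longrightarrow> Sg k l = (\<Sum>r<p. factor r k * factor r l)"
proof -
  interpret L: cov_law p Sg "2 + \<delta>" law by (rule cov_law_law)
  have "\<exists>a. \<forall>k<p. \<forall>l<p. Sg k l = (\<Sum>r<p. a r k * a r l)"
    using L.qform_nonneg by (intro psd_sum_of_squares Sg_sym) (simp add: qform_def)
  then have "\<forall>k<p. \<forall>l<p. Sg k l = (\<Sum>r<p. factor r k * factor r l)"
    unfolding factor_def by (rule someI_ex)
  then show "k < p \<Longrightarrow> l < p \<Longrightarrow> Sg k l = (\<Sum>r<p. factor r k * factor r l)" by blast
qed

lemma gauss_approx_law: "gauss_approx p Sg (2 + \<delta>) law factor"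
proof -
  interpret L: cov_law p Sg "2 + \<delta>" law by (rule cov_law_law)
  show ?thesis by unfold_locales (use factor f2_pos delta in auto)
qed

lemma iid_vectors_Z: "iid_vectors p Sg (2 + \<delta>) law factor M Z {1..n}"
proof -
  interpret L: gauss_approx p Sg "2 + \<delta>" law factor by (rule gauss_approx_law)
  show ?thesis
  proof (intro iid_vectors.intro iid_vectors_axioms.intro)
    show "gauss_approx p Sg (2 + \<delta>) law factor" by (rule gauss_approx_law)
    show "prob_space M" by (rule prob_space_axioms)
    show "indep_vars (\<lambda>_. vec_space p) Z {1..n}" by (rule Z_indep)
    show "distr M (vec_space p) (Z i) = law" if "i \<in> {1..n}" for i using that by (rule Z_ident)
    show "finite {1..n}" by simp
  qed
qed

sublocale V: iid_vectors p Sg "2 + \<delta>" law factor M Z "{1..n}"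
  by (rule iid_vectors_Z)

subsection \<open>Moment conditions\<close>

definition rate :: "nat \<Rightarrow> real" where
  "rate m = (Kt_delta M p (X 1) 0)\<^sup>2 / real m
     + (Kt_delta M p (X 1) \<delta>) powr (2 + \<delta>) / real m powr ((2 + \<delta>) - 1)
     + quad_moment M p (X 1) (2 + \<delta>) / (real m powr (\<delta> / 2) * f2 p Sg powr (2 + \<delta>))
     + (Dt_delta M p (X 1) (X 2) \<delta>) powr (2 + \<delta>) / real m powr \<delta>"

text \<open>At exponent 2 the moment \<open>K_delta\<close> is the root of \<open>kappa\<close>; the
  added Gaussian constant is nonnegative.\<close>

lemma kappa_le: "V.kappa \<le> (Kt_delta M p (X 1) 0)\<^sup>2"
proof -
  have c: "0 \<le> c_delta 0" by (simp add: c_delta_def gauss_Lq_norm_def)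
  have "V.kappa = (\<integral>\<omega>. (sqnorm p (Z 1 \<omega>) - f1 p Sg)\<^sup>2 \<partial>M) / (f2 p Sg)\<^sup>2"
    unfolding V.kappa_def by (subst integral_law) auto
  also have "\<dots> = (\<integral>\<omega>. (sqnorm p (Z 1 \<omega>) - f1 p Sg)\<^sup>2 / (f2 p Sg)\<^sup>2 \<partial>M)" by simp
  also have "\<dots> = (\<integral>\<omega>. K_integrand M p (X 1) 0 \<omega> \<partial>M)"
    by (intro Bochner_Integration.integral_cong refl)
      (simp add: K_integrand_def sqnorm_Z power_divide flip: abs_divide)
  finally have k: "V.kappa = (\<integral>\<omega>. K_integrand M p (X 1) 0 \<omega> \<partial>M)" .
  have "V.kappa = (K_delta M p (X 1) 0)\<^sup>2"
    unfolding K_delta_def k[symmetric] using V.kappa_nonneg by (simp add: powr_half_sqrt)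
  also have "\<dots> \<le> (Kt_delta M p (X 1) 0)\<^sup>2"
    using c by (intro power_mono) (auto simp: Kt_delta_def K_delta_def)
  finally show ?thesis .
qed

lemma quad_eq: "V.quad = quad_moment M p (X 1) (2 + \<delta>) / f2 p Sg powr (2 + \<delta>)"
proof -
  have m: "(\<lambda>z. qform p Sg z powr ((2 + \<delta>) / 2)) \<in> borel_measurable (vec_space p)" by measurable
  show ?thesis unfolding V.quad_def quad_moment_def integral_law[OF m] qform_Z ..
qed

text \<open>By independence the pair of the first two centred vectors has law
  \<open>law \<Otimes>\<^sub>M law\<close>, which turns the iterated integral of
  \<open>cross\<close> into an expectation over the sample.\<close>

lemma cross_eq: "V.cross = (\<integral>\<omega>. D_integrand M p (X 1) (X 2) \<delta> \<omega> \<partial>M)"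
proof -
  let ?q = "2 + \<delta>" and ?f = "f2 p Sg" and ?V = "vec_space p \<Otimes>\<^sub>M vec_space p"
  let ?g = "\<lambda>z. \<bar>dotp p (fst z) (snd z)\<bar> powr ?q :: real"
  note Zm [measurable] = Z_measurable
  interpret LL: pair_prob_space law law ..
  have ind: "indep_var (vec_space p) (Z 1) (vec_space p) (Z 2)"
  proof -
    have "indep_vars (\<lambda>_. vec_space p) Z {1, 2}"
      by (rule indep_vars_subset[OF Z_indep]) (use n in auto)
    then have "indep_var (PiM {1} (\<lambda>_. vec_space p)) (\<lambda>\<omega>. restrict (\<lambda>i. Z i \<omega>) {1})
        (PiM {2} (\<lambda>_. vec_space p)) (\<lambda>\<omega>. restrict (\<lambda>i. Z i \<omega>) {2})"
      by (rule indep_var_restrict) auto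
    from indep_var_compose[OF this, of "\<lambda>x. x 1" "vec_space p" "\<lambda>x. x 2" "vec_space p"]
    show ?thesis by (auto simp: comp_def)
  qed
  have d: "distr M ?V (\<lambda>\<omega>. (Z 1 \<omega>, Z 2 \<omega>)) = law \<Otimes>\<^sub>M law"
    using ind Z_ident[of 1] Z_ident[of 2] n by (simp add: indep_var_distribution_eq)
  have m: "(\<lambda>\<omega>. (Z 1 \<omega>, Z 2 \<omega>)) \<in> measurable M ?V" "?g \<in> borel_measurable ?V" by measurable
  have gD: "?g (Z 1 \<omega>, Z 2 \<omega>) = ?f powr ?q * D_integrand M p (X 1) (X 2) \<delta> \<omega>" for \<omega>
    using f2_pos by (simp add: D_integrand_def dotp_Z abs_divide powr_divide)
  have i: "integrable (law \<Otimes>\<^sub>M law) ?g"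
    unfolding d[symmetric] integrable_distr_eq[OF m] gD using D_fin by simp
  have "(\<integral>x. \<integral>z. \<bar>dotp p x z\<bar> powr ?q \<partial>law \<partial>law) = (\<integral>z. ?g z \<partial>(law \<Otimes>\<^sub>M law))"
    using LL.integral_fst'[OF i] by simp
  also have "\<dots> = ?f powr ?q * (\<integral>\<omega>. D_integrand M p (X 1) (X 2) \<delta> \<omega> \<partial>M)"
    unfolding d[symmetric] integral_distr[OF m] gD by simp
  finally show ?thesis using f2_pos by (simp add: V.cross_def)
qed

lemma cross_le: "V.cross \<le> (Dt_delta M p (X 1) (X 2) \<delta>) powr (2 + \<delta>)"
proof -
  have i: "0 \<le> (\<integral>\<omega>. D_integrand M p (X 1) (X 2) \<delta> \<omega> \<partial>M)"
    by (intro integral_nonneg_AE) (simp add: D_integrand_def)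
  have d: "0 \<le> d_delta \<delta>" using delta by (simp add: d_delta_def)
  have "V.cross = (D_delta M p (X 1) (X 2) \<delta>) powr (2 + \<delta>)"
    using i delta unfolding cross_eq D_delta_def by (simp add: powr_powr)
  also have "\<dots> \<le> (Dt_delta M p (X 1) (X 2) \<delta>) powr (2 + \<delta>)"
    using d delta by (intro powr_mono2) (auto simp: Dt_delta_def D_delta_def)
  finally show ?thesis .
qed

lemma moments_le_rate:
  shows "0 \<le> V.kappa / real m" "V.kappa / real m \<le> rate m"
    and "0 \<le> real m powr (1 - (2 + \<delta>) / 2) * V.quad" "real m powr (1 - (2 + \<delta>) / 2) * V.quad \<le> rate m"
    and "0 \<le> real m powr (2 - (2 + \<delta>)) * V.cross" "real m powr (2 - (2 + \<delta>)) * V.cross \<le> rate m"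
proof -
  let ?t1 = "(Kt_delta M p (X 1) 0)\<^sup>2 / real m"
    and ?t2 = "(Kt_delta M p (X 1) \<delta>) powr (2 + \<delta>) / real m powr ((2 + \<delta>) - 1)"
    and ?t3 = "quad_moment M p (X 1) (2 + \<delta>) / (real m powr (\<delta> / 2) * f2 p Sg powr (2 + \<delta>))"
    and ?t4 = "(Dt_delta M p (X 1) (X 2) \<delta>) powr (2 + \<delta>) / real m powr \<delta>"
  have qm: "0 \<le> quad_moment M p (X 1) (2 + \<delta>)"
    unfolding quad_moment_def by (intro integral_nonneg_AE) simp
  have pos: "0 \<le> ?t1" "0 \<le> ?t2" "0 \<le> ?t3" "0 \<le> ?t4" using qm by auto
  have c: "0 \<le> V.cross"
    unfolding cross_eq by (intro integral_nonneg_AE) (simp add: D_integrand_def)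
  have e3: "real m powr (1 - (2 + \<delta>) / 2) * V.quad = ?t3"
  proof -
    have "1 - (2 + \<delta>) / 2 = - (\<delta> / 2)" by (simp add: field_simps)
    then show ?thesis by (simp add: quad_eq powr_minus_divide)
  qed
  have e4: "real m powr (2 - (2 + \<delta>)) * V.cross = V.cross / real m powr \<delta>"
    by (simp add: powr_minus_divide)
  show "0 \<le> V.kappa / real m" using V.kappa_nonneg by simp
  show "0 \<le> real m powr (1 - (2 + \<delta>) / 2) * V.quad" using pos e3 by simp
  show "0 \<le> real m powr (2 - (2 + \<delta>)) * V.cross" using c by simp
  have "V.kappa / real m \<le> ?t1" using kappa_le by (rule divide_right_mono) simp
  then show "V.kappa / real m \<le> rate m" using pos unfolding rate_def by linarith
  show "real m powr (1 - (2 + \<delta>) / 2) * V.quad \<le> rate m" using pos e3 unfolding rate_def by linarith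
  have "V.cross / real m powr \<delta> \<le> ?t4" using cross_le by (rule divide_right_mono) simp
  then show "real m powr (2 - (2 + \<delta>)) * V.cross \<le> rate m" using pos e4 unfolding rate_def by linarith
qed

subsection \<open>Empirical distribution functions\<close>

text \<open>The unknown mean cancels in a difference of two averages. Multiplying out uses that
  \<open>f2\<close> and \<open>1 - m / n\<close> are positive.\<close>

lemma W_le_iff:
  assumes B: "B \<subseteq> {1..n}" "card B = m" and m: "0 < m" "m < n"
  shows "V.W m B \<omega> \<le> (t - f1 p Sg) / f2 p Sg \<longleftrightarrow>
    real m * sqnorm p (\<lambda>k. set_mean B (\<lambda>i. X i \<omega>) k - set_mean {1..n} (\<lambda>i. X i \<omega>) k) \<le> t * (1 - real m / real n)"
proof -
  let ?v = "vadd p (vscale p (1 / real m) (V.vsum B \<omega>)) (vscale p (- (1 / real n)) (V.vsum {1..n} \<omega>))"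
  have r: "0 < 1 - real m / real n" using m by simp
  have "?v k = set_mean B (\<lambda>i. X i \<omega>) k - set_mean {1..n} (\<lambda>i. X i \<omega>) k" if "k < p" for k
    using that m B by (simp add: vadd_def vscale_def V.vsum_def Z_def set_mean_def sum_subtractf field_simps)
  then have s: "sqnorm p ?v = sqnorm p (\<lambda>k. set_mean B (\<lambda>i. X i \<omega>) k - set_mean {1..n} (\<lambda>i. X i \<omega>) k)"
    by (simp add: sqnorm_def dotp_def)
  show ?thesis
    using f2_pos r unfolding V.W_def
    by (simp add: divide_le_cancel s pos_divide_le_eq)
qed

lemma target_cdf_eq: "target_cdf M n p X mu t = V.total_cdf ((t - f1 p Sg) / f2 p Sg)"
proof -
  have "V.R n {1..n} \<omega> \<le> (t - f1 p Sg) / f2 p Sg \<longleftrightarrow>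
    real n * sqnorm p (\<lambda>k. set_mean {1..n} (\<lambda>i. X i \<omega>) k - mu k) \<le> t" for \<omega>
  proof -
    let ?v = "vscale p (1 / real n) (V.vsum {1..n} \<omega>)"
    have "?v k = set_mean {1..n} (\<lambda>i. X i \<omega>) k - mu k" if "k < p" for k
      using that n by (simp add: vscale_def V.vsum_def Z_def set_mean_def sum_subtractf field_simps)
    then have "sqnorm p (\<lambda>k. set_mean {1..n} (\<lambda>i. X i \<omega>) k - mu k) = sqnorm p ?v"
      by (simp add: sqnorm_def dotp_def)
    then have "real n * sqnorm p (\<lambda>k. set_mean {1..n} (\<lambda>i. X i \<omega>) k - mu k) = sqnorm p (V.vsum {1..n} \<omega>) / real n"
      using n by (simp add: sqnorm_vscale power2_eq_square)
    then show ?thesis using f2_pos by (simp add: V.R_def normalized_def divide_le_cancel)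
  qed
  then show ?thesis by (simp add: target_cdf_def V.total_cdf_def)
qed

text \<open>Every index must carry an admissible block, so indices beyond \<open>n div m\<close>
  repeat the first one; sums over \<open>1..n div m\<close> do not see them. Disjointness gives
  overlap 0.\<close>

lemma consecutive_blocks:
  assumes m: "0 < m" "m < n"
  defines "A \<equiv> \<lambda>j (_::'a). if j \<in> {1..n div m} then block m j else block m 1"
  shows "random_blocks p Sg (2 + \<delta>) law factor M Z {1..n} M A (n div m) m 0"
    and "Fhat n p m (\<lambda>i. X i \<omega>) t = random_blocks.ecdf p Sg Z {1..n} A (n div m) m \<omega> ((t - f1 p Sg) / f2 p Sg)"
proof -
  have block: "block m j \<subseteq> {1..n} \<and> card (block m j) = m" if "j \<in> {1..n div m}" for j
  proof -
    have "j * m \<le> n div m * m" using that by (intro mult_right_mono) auto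
    also have "\<dots> \<le> n" by (simp add: div_times_less_eq_dividend)
    finally have "block m j \<subseteq> {1..n}" by (auto simp: block_def)
    moreover have "j * m = (j - 1) * m + m" using that by (cases j) auto
    ultimately show ?thesis by (simp add: block_def)
  qed
  have "0 < n div m" using m by (simp add: div_greater_zero_iff)
  then have one: "1 \<in> {1..n div m}" by simp
  have disj: "block m i \<inter> block m j = {}" if "i < j" for i j
  proof -
    have "i * m \<le> (j - 1) * m" using that by (intro mult_right_mono) auto
    then show ?thesis by (auto simp: block_def)
  qed
  have A: "A j \<omega> \<subseteq> {1..n} \<and> card (A j \<omega>) = m" for j \<omega>
    using block[of j] block[OF one] by (simp add: A_def)
  show rb: "random_blocks p Sg (2 + \<delta>) law factor M Z {1..n} M A (n div m) m 0"
  proof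
    show "{\<omega> \<in> space M. A j \<omega> = b} \<in> events" for j b unfolding A_def by simp
    show "A j \<omega> \<subseteq> {1..n} \<and> card (A j \<omega>) = m" for j \<omega> by (rule A)
    show "(\<integral>\<omega>. indicator {\<omega> \<in> space M. A i \<omega> = b \<and> A j \<omega> = c} \<omega> * Y \<omega> \<partial>M)
          = prob {\<omega> \<in> space M. A i \<omega> = b \<and> A j \<omega> = c} * expectation Y" for i j b c Y
    \<comment> \<open>The blocks do not depend on the outcome, so the event is either everything or
      empty.\<close>
    proof (cases "A i undefined = b \<and> A j undefined = c")
      case True
      then have "{\<omega> \<in> space M. A i \<omega> = b \<and> A j \<omega> = c} = space M" by (auto simp: A_def)
      moreover have "(\<integral>\<omega>. indicator (space M) \<omega> * Y \<omega> \<partial>M) = expectation Y"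
        by (intro Bochner_Integration.integral_cong) auto
      ultimately show ?thesis by (simp add: prob_space)
    next
      case False
      then have e: "{\<omega> \<in> space M. A i \<omega> = b \<and> A j \<omega> = c} = {}" by (auto simp: A_def)
      show ?thesis unfolding e by simp
    qed
    show "(\<integral>\<omega>. sqrt (real (card (A i \<omega> \<inter> A j \<omega>)) / real m) \<partial>M) \<le> 0"
      if "i \<in> {1..n div m}" "j \<in> {1..n div m}" "i \<noteq> j" for i j
      using that disj[of i j] disj[of j i] by (cases i j rule: linorder_cases) (auto simp: A_def Int_commute)
    show "0 < n div m" using one by simp
  qed (use m Z_measurable in auto)
  interpret rb: random_blocks p Sg "2 + \<delta>" law factor M Z "{1..n}" M A "n div m" m 0 by (rule rb)
  show "Fhat n p m (\<lambda>i. X i \<omega>) t = rb.ecdf \<omega> ((t - f1 p Sg) / f2 p Sg)"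
  proof -
    have "(real m * sqnorm p (\<lambda>k. set_mean (block m j) (\<lambda>i. X i \<omega>) k - set_mean {1..n} (\<lambda>i. X i \<omega>) k)
        \<le> t * (1 - real m / real n)) = (V.W m (A j \<omega>) \<omega> \<le> (t - f1 p Sg) / f2 p Sg)"
      if "j \<in> {1..n div m}" for j
      using that block[OF that] W_le_iff[OF _ _ m, of "block m j" \<omega> t] by (simp add: A_def)
    then show ?thesis
      by (simp only: Fhat_def Let_def rb.ecdf_def times_divide_eq_left mult_1_left cong: sum.cong)
  qed
qed

text \<open>Subsets avoiding \<open>x\<close> are counted instead, and the absorption identity for
  binomial coefficients relates the two counts.\<close>

lemma card_blocks_containing:
  assumes x: "x \<in> {1..n}" and m: "m \<le> n"
  shows "real (card {b. b \<subseteq> {1..n} \<and> card b = m \<and> x \<in> b}) / real (card {b. b \<subseteq> {1..n} \<and> card b = m}) = real m / real n"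
proof -
  let ?B = "{b. b \<subseteq> {1..n} \<and> card b = m}"
  have fin: "finite ?B" by (rule finite_subset[of _ "Pow {1..n}"]) auto
  have 1: "{b. b \<subseteq> {1..n} \<and> card b = m \<and> x \<in> b} = ?B - {b. b \<subseteq> {1..n} - {x} \<and> card b = m}" by auto
  have 2: "card {b. b \<subseteq> {1..n} - {x} \<and> card b = m} = (n - 1) choose m"
    using x by (subst n_subsets) auto
  have 3: "card ?B = n choose m" by (subst n_subsets) auto
  have le: "card {b. b \<subseteq> {1..n} - {x} \<and> card b = m} \<le> card ?B"
    by (rule card_mono[OF fin]) auto
  have "card {b. b \<subseteq> {1..n} \<and> card b = m \<and> x \<in> b} = card ?B - card {b. b \<subseteq> {1..n} - {x} \<and> card b = m}"
    unfolding 1 by (rule card_Diff_subset) (auto intro: finite_subset[OF _ fin])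
  then have 4: "real (card {b. b \<subseteq> {1..n} \<and> card b = m \<and> x \<in> b}) = real (n choose m) - real ((n - 1) choose m)"
    using le 2 3 by (simp add: of_nat_diff)
  have "(n - m) * (n choose m) = n * ((n - 1) choose m)" by (rule binomial_absorb_comp)
  then have 5: "(real n - real m) * real (n choose m) = real n * real ((n - 1) choose m)"
    using m by (metis of_nat_diff of_nat_mult)
  have "0 < n choose m" using m by simp
  then show ?thesis unfolding 3 4 using 5 n by (simp add: field_simps)
qed

text \<open>\<open>A'\<close> is the version of \<open>A\<close> that takes its values in the admissible subsets everywhere, not only
  almost surely.\<close>

lemma random_subsets:
  fixes A :: "nat \<Rightarrow> 'a \<Rightarrow> nat set"
  assumes m: "0 < m" "m < n" and J: "0 < J"
    and A_measurable: "\<And>j. A j \<in> measurable M (count_space UNIV)"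
    and A_indep: "indep_vars (\<lambda>_. count_space UNIV) A {1..J}"
    and A_distr: "\<And>j. j \<in> {1..J} \<Longrightarrow> distr M (count_space UNIV) (A j) = measure_pmf (pmf_of_set {B. B \<subseteq> {1..n} \<and> card B = m})"
    and XA: "indep_set
       (sets (vimage_algebra (space M) (\<lambda>\<omega>. \<lambda>i\<in>{1..n}. X i \<omega>) (PiM {1..n} (\<lambda>_. vec_space p))))
       (sets (vimage_algebra (space M) (\<lambda>\<omega>. \<lambda>j\<in>{1..J}. A j \<omega>) (PiM {1..J} (\<lambda>_. count_space UNIV))))"
  defines "A' \<equiv> \<lambda>j \<omega>. if A j \<omega> \<subseteq> {1..n} \<and> card (A j \<omega>) = m then A j \<omega> else {1..m}"
    and "F \<equiv> vimage_algebra (space M) (\<lambda>\<omega>. \<lambda>i\<in>{1..n}. X i \<omega>) (PiM {1..n} (\<lambda>_. vec_space p))"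
  shows "random_blocks p Sg (2 + \<delta>) law factor M Z {1..n} F A' J m (sqrt (real m / real n))"
    and "AE \<omega> in M. \<forall>t. Fcheck n p m J (\<lambda>j. A j \<omega>) (\<lambda>i. X i \<omega>) t
        = random_blocks.ecdf p Sg Z {1..n} A' J m \<omega> ((t - f1 p Sg) / f2 p Sg)"
proof -
  define H where "H = vimage_algebra (space M) (\<lambda>\<omega>. \<lambda>j\<in>{1..J}. A j \<omega>) (PiM {1..J} (\<lambda>_. count_space UNIV :: nat set measure))"
  define g where "g b = (if b \<subseteq> {1..n} \<and> card b = m then b else {1..m})" for b :: "nat set"
  let ?B = "{b. b \<subseteq> {1..n} \<and> card b = m}"
  have A'_g: "A' j = (\<lambda>\<omega>. g (A j \<omega>))" for j by (simp add: A'_def g_def)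
  have g: "g b \<subseteq> {1..n} \<and> card (g b) = m" for b using m by (simp add: g_def)
  have fin: "finite ?B" by (rule finite_subset[of _ "Pow {1..n}"]) auto
  have "{1..m} \<in> ?B" using m by simp
  then have ne: "?B \<noteq> {}" by blast
  have gm: "g \<in> measurable (count_space UNIV) (count_space UNIV)" by simp
  have A'_measurable: "A' j \<in> measurable M (count_space UNIV)" for j
    unfolding A'_g by (rule measurable_compose[OF A_measurable gm])
  have A'_indep: "indep_vars (\<lambda>_. count_space UNIV) A' {1..J}"
    unfolding A'_g[abs_def] by (rule indep_vars_compose2[OF A_indep gm])
  have FH: "sets F \<subseteq> events" "sets H \<subseteq> events"
    "\<And>a b. a \<in> sets F \<Longrightarrow> b \<in> sets H \<Longrightarrow> prob (a \<inter> b) = prob a * prob b"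
    using XA unfolding indep_sets2_eq F_def[symmetric] H_def[symmetric] by blast+
  have spF: "space F = space M" and spH: "space H = space M" by (simp_all add: F_def H_def)
  have X_F: "X i \<in> measurable F (vec_space p)" if i: "i \<in> {1..n}" for i
  proof -
    have "(\<lambda>\<omega>. \<lambda>i\<in>{1..n}. X i \<omega>) \<in> measurable F (PiM {1..n} (\<lambda>_. vec_space p))"
      unfolding F_def by (rule measurable_vimage_algebra1)
        (auto intro!: measurable_space[OF measurable_restrict[OF X_measurable]])
    from measurable_compose[OF this measurable_component_singleton[OF i]] show ?thesis using i by simp
  qed
  have A'_H: "A' j \<in> measurable H (count_space UNIV)" if j: "j \<in> {1..J}" for j
  proof -
    have "(\<lambda>\<omega>. \<lambda>j\<in>{1..J}. A j \<omega>) \<in> measurable H (PiM {1..J} (\<lambda>_. count_space UNIV))"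
      unfolding H_def by (rule measurable_vimage_algebra1) (simp add: space_PiM)
    from measurable_compose[OF this measurable_component_singleton[OF j]]
    have "A j \<in> measurable H (count_space UNIV)" using j by simp
    from measurable_compose[OF this gm] show ?thesis unfolding A'_g .
  qed
  have A'_ev: "{\<omega> \<in> space M. A' j \<omega> \<in> C} \<in> events" for j C
    using measurable_sets[OF A'_measurable[of j], of C] by (simp add: vimage_def Int_def conj_commute)
  have prob_x: "prob {\<omega> \<in> space M. x \<in> A' j \<omega>} = real m / real n" if j: "j \<in> {1..J}" and x: "x \<in> {1..n}" for j x
  proof -
    have "prob {\<omega> \<in> space M. x \<in> A' j \<omega>} = measure (distr M (count_space UNIV) (A j)) {b. x \<in> g b}"
      using A_measurable[of j] by (subst measure_distr) (auto simp: A'_g vimage_def Int_def conj_commute)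
    also have "\<dots> = real (card (?B \<inter> {b. x \<in> g b})) / real (card ?B)"
      unfolding A_distr[OF j] by (rule measure_pmf_of_set[OF ne fin])
    also have "?B \<inter> {b. x \<in> g b} = {b. b \<subseteq> {1..n} \<and> card b = m \<and> x \<in> b}" by (auto simp: g_def)
    also have "real (card \<dots>) / real (card ?B) = real m / real n"
      using card_blocks_containing[OF x] m by simp
    finally show ?thesis .
  qed
  have prob_xx: "prob {\<omega> \<in> space M. x \<in> A' i \<omega> \<inter> A' j \<omega>} = (real m / real n)\<^sup>2"
    if ij: "i \<in> {1..J}" "j \<in> {1..J}" "i \<noteq> j" and x: "x \<in> {1..n}" for i j x
  proof -
    have "prob (\<Inter>l\<in>{i, j}. A' l -` {b. x \<in> b} \<inter> space M) = (\<Prod>l\<in>{i, j}. prob (A' l -` {b. x \<in> b} \<inter> space M))"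
      using ij by (intro indep_varsD[OF A'_indep]) auto
    moreover have "(\<Inter>l\<in>{i, j}. A' l -` {b. x \<in> b} \<inter> space M) = {\<omega> \<in> space M. x \<in> A' i \<omega> \<inter> A' j \<omega>}" by auto
    moreover have "A' l -` {b. x \<in> b} \<inter> space M = {\<omega> \<in> space M. x \<in> A' l \<omega>}" for l by auto
    ultimately show ?thesis using ij x by (simp add: prob_x power2_eq_square)
  qed
  have card_le: "card (A' i \<omega> \<inter> A' j \<omega>) \<le> m" for i j \<omega>
    using g[of "A i \<omega>"] card_mono[of "g (A i \<omega>)" "g (A i \<omega>) \<inter> g (A j \<omega>)"] finite_subset[of "g (A i \<omega>)" "{1..n}"]
    by (simp add: A'_g)
  have overlap: "(\<integral>\<omega>. sqrt (real (card (A' i \<omega> \<inter> A' j \<omega>)) / real m) \<partial>M) \<le> sqrt (real m / real n)"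
    if ij: "i \<in> {1..J}" "j \<in> {1..J}" "i \<noteq> j" for i j
  proof -
    let ?E = "\<lambda>x. {\<omega> \<in> space M. x \<in> A' i \<omega> \<inter> A' j \<omega>}" and ?Y = "\<lambda>\<omega>. sqrt (real (card (A' i \<omega> \<inter> A' j \<omega>)) / real m)"
    have E: "?E x \<in> events" for x
    proof -
      have e: "?E x = {\<omega> \<in> space M. A' i \<omega> \<in> {b. x \<in> b}} \<inter> {\<omega> \<in> space M. A' j \<omega> \<in> {b. x \<in> b}}" by auto
      show ?thesis unfolding e by (intro sets.Int A'_ev)
    qed
    have iE: "integrable M (indicator (?E x) :: 'a \<Rightarrow> real)" for x
      using E by (intro integrable_real_indicator) (simp_all add: less_top[symmetric])
    \<comment> \<open>The overlap is a sum of \<open>n\<close> indicators, each of probability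
      \<open>(m / n)^2\<close>; relative to \<open>m\<close> its mean is therefore
      \<open>m / n\<close>.\<close>
    have c: "real (card (A' i \<omega> \<inter> A' j \<omega>)) = (\<Sum>x\<in>{1..n}. indicator (?E x) \<omega>)" if "\<omega> \<in> space M" for \<omega>
    proof -
      have "(\<Sum>x\<in>{1..n}. indicator (?E x) \<omega>) = (\<Sum>x\<in>{1..n}. if x \<in> A' i \<omega> \<inter> A' j \<omega> then 1 else 0 :: real)"
        using that by (intro sum.cong) auto
      also have "\<dots> = real (card ({1..n} \<inter> (A' i \<omega> \<inter> A' j \<omega>)))" by (simp add: sum.If_cases Int_def)
      also have "{1..n} \<inter> (A' i \<omega> \<inter> A' j \<omega>) = A' i \<omega> \<inter> A' j \<omega>" using g[of "A i \<omega>"] by (auto simp: A'_g)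
      finally show ?thesis by simp
    qed
    have cm [measurable]: "(\<lambda>\<omega>. real (card (A' i \<omega> \<inter> A' j \<omega>))) \<in> borel_measurable M"
      by (subst measurable_cong[OF c]) (use E in \<open>auto intro: borel_measurable_sum\<close>)
    have i2: "integrable M (\<lambda>\<omega>. (?Y \<omega>)\<^sup>2)"
      by (rule integrable_const_bound[of _ 1]) (use card_le m in \<open>auto simp: divide_le_eq\<close>)
    have "(\<integral>\<omega>. (?Y \<omega>)\<^sup>2 \<partial>M) = (\<integral>\<omega>. real (card (A' i \<omega> \<inter> A' j \<omega>)) / real m \<partial>M)" by simp
    also have "\<dots> = (\<integral>\<omega>. (\<Sum>x\<in>{1..n}. indicator (?E x) \<omega>) / real m \<partial>M)"
      by (rule Bochner_Integration.integral_cong[OF refl]) (simp only: c)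
    also have "\<dots> = (\<Sum>x\<in>{1..n}. prob (?E x)) / real m"
      using E by (simp only: Bochner_Integration.integral_divide_zero Bochner_Integration.integral_sum[OF iE]
        Bochner_Integration.integral_indicator Int_absorb2[OF sets.sets_into_space] simp_thms)
    also have "\<dots> = real m / real n"
      using prob_xx[OF ij] m by (simp add: power2_eq_square)
    finally have "(\<integral>\<omega>. (?Y \<omega>)\<^sup>2 \<partial>M) = real m / real n" .
    \<comment> \<open>Only the mean of the square is known exactly; the mean of the root is below
      the root of the mean.\<close>
    moreover have "(\<integral>\<omega>. \<bar>?Y \<omega>\<bar> \<partial>M) \<le> sqrt (\<integral>\<omega>. (?Y \<omega>)\<^sup>2 \<partial>M)"
      by (rule expectation_abs_le_sqrt(2)[OF _ i2]) simp
    ultimately show ?thesis by simp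
  qed
  show rb: "random_blocks p Sg (2 + \<delta>) law factor M Z {1..n} F A' J m (sqrt (real m / real n))"
  proof
    show "Z i \<in> measurable F (vec_space p)" if "i \<in> {1..n}" for i
      using X_F[OF that] by (rule Z_measurable_of)
    show "{\<omega> \<in> space M. A' j \<omega> = b} \<in> events" for j b using A'_ev[of j "{b}"] by simp
    show "A' j \<omega> \<subseteq> {1..n} \<and> card (A' j \<omega>) = m" for j \<omega> using g by (simp add: A'_g)
    show "(\<integral>\<omega>. indicator {\<omega> \<in> space M. A' i \<omega> = b \<and> A' j \<omega> = c} \<omega> * Y \<omega> \<partial>M)
          = prob {\<omega> \<in> space M. A' i \<omega> = b \<and> A' j \<omega> = c} * expectation Y"
      if ij: "i \<in> {1..J}" "j \<in> {1..J}" and Y: "Y \<in> borel_measurable F" "integrable M Y" for i j b c Y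
    proof -
      let ?E = "{\<omega> \<in> space M. A' i \<omega> = b \<and> A' j \<omega> = c}"
      have "?E = (A' i -` {b} \<inter> space H) \<inter> (A' j -` {c} \<inter> space H)" by (auto simp: spH)
      then have EH: "?E \<in> sets H"
        using measurable_sets[OF A'_H[OF ij(1)], of "{b}"] measurable_sets[OF A'_H[OF ij(2)], of "{c}"] by simp
      then have E: "?E \<in> events" using FH by blast
      \<comment> \<open>\<open>Y\<close> is measurable for the sample and the event for the subsets,
        so the independence of the two generated sigma-algebras passes to them.\<close>
      have "indep_var borel Y borel (indicator ?E :: 'a \<Rightarrow> real)"
        unfolding indep_var_eq indep_sets2_eq
      proof (intro conjI ballI)
        show "random_variable borel Y" using Y(2) by simp
        show "random_variable borel (indicator ?E :: 'a \<Rightarrow> real)" using E by simp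
        have sub1: "sigma_sets (space M) {Y -` C \<inter> space M |C. C \<in> sets borel} \<subseteq> sets F"
          using sets.sigma_sets_subset[of "{Y -` C \<inter> space M |C. C \<in> sets borel}" F] measurable_sets[OF Y(1)] spF by auto
        have "(indicator ?E :: 'a \<Rightarrow> real) \<in> borel_measurable H" using EH by simp
        from measurable_sets[OF this]
        have sub2: "sigma_sets (space M) {(indicator ?E :: 'a \<Rightarrow> real) -` C \<inter> space M |C. C \<in> sets borel} \<subseteq> sets H"
          using sets.sigma_sets_subset[of "{(indicator ?E :: 'a \<Rightarrow> real) -` C \<inter> space M |C. C \<in> sets borel}" H] spH by auto
        show "sigma_sets (space M) {Y -` C \<inter> space M |C. C \<in> sets borel} \<subseteq> events"
          "sigma_sets (space M) {(indicator ?E :: 'a \<Rightarrow> real) -` C \<inter> space M |C. C \<in> sets borel} \<subseteq> events"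
          using sub1 sub2 FH by blast+
        fix a d assume "a \<in> sigma_sets (space M) {Y -` C \<inter> space M |C. C \<in> sets borel}"
          "d \<in> sigma_sets (space M) {(indicator ?E :: 'a \<Rightarrow> real) -` C \<inter> space M |C. C \<in> sets borel}"
        then show "prob (a \<inter> d) = prob a * prob d" using sub1 sub2 FH by blast
      qed
      moreover have "integrable M (indicator ?E :: 'a \<Rightarrow> real)"
        using E by (intro integrable_real_indicator) (simp_all add: less_top[symmetric])
      ultimately have "(\<integral>\<omega>. Y \<omega> * indicator ?E \<omega> \<partial>M) = expectation Y * expectation (indicator ?E)"
        using Y(2) by (intro indep_var_lebesgue_integral)
      then show ?thesis using E by (simp add: mult.commute)
    qed
    show "(\<integral>\<omega>. sqrt (real (card (A' i \<omega> \<inter> A' j \<omega>)) / real m) \<partial>M) \<le> sqrt (real m / real n)"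
      if "i \<in> {1..J}" "j \<in> {1..J}" "i \<noteq> j" for i j using that by (rule overlap)
  qed (use m J in auto)
  interpret rb: random_blocks p Sg "2 + \<delta>" law factor M Z "{1..n}" F A' J m "sqrt (real m / real n)" by (rule rb)
  \<comment> \<open>The uniform law is carried by the admissible subsets, so \<open>A\<close> and
    \<open>A'\<close> agree almost surely for the indices that are summed.\<close>
  have "AE \<omega> in M. A j \<omega> \<in> ?B" if "j \<in> {1..J}" for j
  proof -
    have "AE b in distr M (count_space UNIV) (A j). b \<in> ?B"
      unfolding A_distr[OF that] by (simp add: AE_measure_pmf_iff set_pmf_of_set[OF ne fin])
    then show ?thesis by (rule AE_distrD[OF A_measurable])
  qed
  then have "AE \<omega> in M. \<forall>j\<in>{1..J}. A j \<omega> \<in> ?B" by (intro AE_finite_allI) auto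
  then show "AE \<omega> in M. \<forall>t. Fcheck n p m J (\<lambda>j. A j \<omega>) (\<lambda>i. X i \<omega>) t = rb.ecdf \<omega> ((t - f1 p Sg) / f2 p Sg)"
  proof eventually_elim
    case (elim \<omega>)
    have "(real m * sqnorm p (\<lambda>k. set_mean (A j \<omega>) (\<lambda>i. X i \<omega>) k - set_mean {1..n} (\<lambda>i. X i \<omega>) k)
        \<le> t * (1 - real m / real n)) = (V.W m (A' j \<omega>) \<omega> \<le> (t - f1 p Sg) / f2 p Sg)"
      if "j \<in> {1..J}" for j t
      using elim that W_le_iff[OF _ _ m, of "A j \<omega>" \<omega> t] by (simp add: A'_def)
    then show ?case
      by (simp only: Fcheck_def rb.ecdf_def times_divide_eq_left mult_1_left simp_thms cong: sum.cong)
  qed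
qed

end

section \<open>Assembly of the limit theorem\<close>

lemma tendsto_zero_le:
  fixes f g :: "nat \<Rightarrow> real"
  assumes "g \<longlonglongrightarrow> 0" "\<forall>\<^sub>F n in sequentially. 0 \<le> f n \<and> f n \<le> g n"
  shows "f \<longlonglongrightarrow> 0"
  by (rule tendsto_sandwich[OF _ _ tendsto_const assms(1)]) (use assms(2) in \<open>auto elim: eventually_mono\<close>)

lemma moment_conditions_sample:
  fixes M :: "nat \<Rightarrow> 'a measure"
  assumes s: "\<And>n. 2 \<le> n \<Longrightarrow> iid_sample (M n) (p n) n (X n) \<delta>"
    and m: "filterlim m at_top sequentially" "(\<lambda>n. real (m n) / real n) \<longlonglongrightarrow> 0"
    and rate: "(\<lambda>n. iid_sample.rate (M n) (p n) (X n) \<delta> (m n)) \<longlonglongrightarrow> 0"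
  shows "moment_conditions p (\<lambda>n. cov_mat (M n) (X n 1)) (2 + \<delta>) (\<lambda>n. iid_sample.law (M n) (p n) (X n))
           (\<lambda>n. iid_sample.factor (M n) (p n) (X n)) m"
proof -
  have ev: "\<forall>\<^sub>F n in sequentially. iid_sample (M n) (p n) n (X n) \<delta>"
    using eventually_ge_at_top[of 2] by eventually_elim (rule s)
  have "0 < \<delta>" using iid_sample.delta(1)[OF s[of 2]] by simp
  show ?thesis
  proof
    show "\<forall>\<^sub>F n in sequentially. gauss_approx (p n) (cov_mat (M n) (X n 1)) (2 + \<delta>) (iid_sample.law (M n) (p n) (X n)) (iid_sample.factor (M n) (p n) (X n))"
      using ev by eventually_elim (rule iid_sample.gauss_approx_law)
    show "2 < 2 + \<delta>" using \<open>0 < \<delta>\<close> by simp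
    show "filterlim m at_top sequentially" "(\<lambda>n. real (m n) / real n) \<longlonglongrightarrow> 0" by (fact m)+
    show "(\<lambda>n. kap (p n) (cov_mat (M n) (X n 1)) (iid_sample.law (M n) (p n) (X n)) / real (m n)) \<longlonglongrightarrow> 0"
      by (rule tendsto_zero_le[OF rate]) (use ev iid_sample.moments_le_rate(1,2) in \<open>blast intro: eventually_mono\<close>)
    show "(\<lambda>n. real (m n) powr (1 - (2 + \<delta>) / 2) * qd (p n) (cov_mat (M n) (X n 1)) (2 + \<delta>) (iid_sample.law (M n) (p n) (X n))) \<longlonglongrightarrow> 0"
      by (rule tendsto_zero_le[OF rate]) (use ev iid_sample.moments_le_rate(3,4) in \<open>blast intro: eventually_mono\<close>)
    show "(\<lambda>n. real (m n) powr (2 - (2 + \<delta>)) * crs (p n) (cov_mat (M n) (X n 1)) (2 + \<delta>) (iid_sample.law (M n) (p n) (X n))) \<longlonglongrightarrow> 0"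
      by (rule tendsto_zero_le[OF rate]) (use ev iid_sample.moments_le_rate(5,6) in \<open>blast intro: eventually_mono\<close>)
  qed
qed

text \<open>The number of consecutive blocks grows without bound, which is the requirement on
  \<open>J\<close> in the first part.\<close>

lemma div_at_top:
  fixes m :: "nat \<Rightarrow> nat"
  assumes "\<forall>\<^sub>F n in sequentially. 0 < m n" "(\<lambda>n. real (m n) / real n) \<longlonglongrightarrow> 0"
  shows "filterlim (\<lambda>n. n div m n) at_top sequentially"
  unfolding filterlim_at_top
proof
  fix K :: nat
  have "\<forall>\<^sub>F n in sequentially. real (m n) / real n < 1 / (real K + 1)"
    by (rule order_tendstoD(2)[OF assms(2)]) simp
  then show "\<forall>\<^sub>F n in sequentially. K \<le> n div m n"
    using assms(1) eventually_gt_at_top[of 0]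
  proof eventually_elim
    case (elim n)
    then have "real (K * m n) \<le> real n" by (simp add: field_simps)
    then have "K * m n \<le> n" by (simp only: of_nat_le_iff)
    then show ?case using elim by (simp add: less_eq_div_iff_mult_less_eq)
  qed
qed

text \<open>Empirical function and target are both uniformly close to the same Gaussian distribution
  function, which drops out of the difference. The supremum over \<open>t\<close> is bounded through
  the normalised argument.\<close>

lemma (in moment_conditions) tendsto_in_prob_zero_ecdf:
  fixes M :: "nat \<Rightarrow> 'a measure"
  assumes pr: "\<And>n. prob_space (M n)"
    and rb: "\<forall>\<^sub>F n in sequentially. random_blocks (p n) (S n) q (P n) (a n) (M n) (Z n) {1..n} (F n) (A n) (J n) (m n) (\<eta> n)"
    and J: "filterlim J at_top sequentially" and \<eta>: "\<eta> \<longlonglongrightarrow> 0"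
    and E: "\<forall>\<^sub>F n in sequentially. AE \<omega> in M n. \<forall>t. E n \<omega> t =
       random_blocks.ecdf (p n) (S n) (Z n) {1..n} (A n) (J n) (m n) \<omega> ((t - f1 (p n) (S n)) / f2 (p n) (S n))"
    and T: "\<forall>\<^sub>F n in sequentially. \<forall>t. T n t =
       iid_vectors.total_cdf (p n) (S n) (M n) (Z n) {1..n} ((t - f1 (p n) (S n)) / f2 (p n) (S n))"
  shows "tendsto_in_prob_zero M (\<lambda>n \<omega>. SUP t. \<bar>E n \<omega> t - T n t\<bar>)"
proof (rule unif_small_imp_tendsto_in_prob_zero[OF pr])
  have iv: "\<forall>\<^sub>F n in sequentially. iid_vectors (p n) (S n) q (P n) (a n) (M n) (Z n) {1..n}"
    using rb by (auto simp: random_blocks_def elim: eventually_mono)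
  show "unif_small M (\<lambda>n \<omega> t. E n \<omega> t - T n t)"
  proof (rule unif_small_cong[OF unif_small_diff[OF pr unif_small_ecdf[OF pr rb J \<eta>] unif_small_total_cdf[OF pr iv]]])
    show "\<forall>\<^sub>F n in sequentially. AE \<omega> in M n. \<forall>t. \<exists>u. \<bar>E n \<omega> t - T n t\<bar> \<le>
      \<bar>random_blocks.ecdf (p n) (S n) (Z n) {1..n} (A n) (J n) (m n) \<omega> u - gc n u
        - (iid_vectors.total_cdf (p n) (S n) (M n) (Z n) {1..n} u - gc n u)\<bar>"
      using E T
    proof eventually_elim
      case (elim n)
      from elim(1) show ?case
      proof eventually_elim
        case e: (elim \<omega>)
        show ?case
        proof
          fix t
          show "\<exists>u. \<bar>E n \<omega> t - T n t\<bar> \<le>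
            \<bar>random_blocks.ecdf (p n) (S n) (Z n) {1..n} (A n) (J n) (m n) \<omega> u - gc n u
              - (iid_vectors.total_cdf (p n) (S n) (M n) (Z n) {1..n} u - gc n u)\<bar>"
            using e elim(2) by (intro exI[of _ "(t - f1 (p n) (S n)) / f2 (p n) (S n)"]) simp
        qed
      qed
    qed
  qed
qed

theorem mainTheorem8:
  fixes M :: "nat \<Rightarrow> 'a measure"
    and X :: "nat \<Rightarrow> nat \<Rightarrow> 'a \<Rightarrow> nat \<Rightarrow> real"
    and p m :: "nat \<Rightarrow> nat"
    and \<delta> :: real
  defines "\<mu> \<equiv> (\<lambda>n. mean_vec (M n) (X n 1))"
    and "\<Sigma> \<equiv> (\<lambda>n. cov_mat (M n) (X n 1))"
    and "q \<equiv> 2 + \<delta>"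
  assumes prob: "\<And>n. prob_space (M n)"
    and meas: "\<And>n i. X n i \<in> measurable (M n) (vec_space (p n))"
    and indep: "\<And>n. prob_space.indep_vars (M n) (\<lambda>_. vec_space (p n)) (X n) {1..n}"
    and ident: "\<And>n i. i \<in> {1..n} \<Longrightarrow>
        distr (M n) (vec_space (p n)) (X n i) = distr (M n) (vec_space (p n)) (X n 1)"
    and sq_int: "\<And>n k. 1 \<le> n \<Longrightarrow> k < p n \<Longrightarrow> integrable (M n) (\<lambda>\<omega>. (X n 1 \<omega> k)\<^sup>2)"
    and Sigma_nz: "\<And>n. 2 \<le> n \<Longrightarrow> \<exists>k<p n. \<exists>l<p n. \<Sigma> n k l \<noteq> 0"
    and delta: "0 < \<delta>" "\<delta> \<le> 1"
    and K_fin: "\<And>n. 2 \<le> n \<Longrightarrow> integrable (M n) (K_integrand (M n) (p n) (X n 1) \<delta>)"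
    and D_fin: "\<And>n. 2 \<le> n \<Longrightarrow> integrable (M n) (D_integrand (M n) (p n) (X n 1) (X n 2) \<delta>)"
    and m_inf: "filterlim m at_top sequentially"
    and m_small: "(\<lambda>n. real (m n) / real n) \<longlonglongrightarrow> 0"
    and rate: "(\<lambda>n. (Kt_delta (M n) (p n) (X n 1) 0)\<^sup>2 / real (m n)
                 + (Kt_delta (M n) (p n) (X n 1) \<delta>) powr q / real (m n) powr (q - 1)
                 + quad_moment (M n) (p n) (X n 1) q
                     / (real (m n) powr (\<delta> / 2) * f2 (p n) (\<Sigma> n) powr q)
                 + (Dt_delta (M n) (p n) (X n 1) (X n 2) \<delta>) powr q / real (m n) powr \<delta>)
              \<longlonglongrightarrow> 0"
  shows "tendsto_in_prob_zero M
           (\<lambda>n \<omega>. SUP t. \<bar>Fhat n (p n) (m n) (\<lambda>i. X n i \<omega>) t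
                          - target_cdf (M n) n (p n) (X n) (\<mu> n) t\<bar>)
       \<and> (\<forall>(A :: nat \<Rightarrow> nat \<Rightarrow> 'a \<Rightarrow> nat set) (J :: nat \<Rightarrow> nat).
            (\<forall>n j. A n j \<in> measurable (M n) (count_space UNIV))
          \<and> (\<forall>n. prob_space.indep_vars (M n) (\<lambda>_. count_space UNIV) (A n) {1..J n})
          \<and> (\<forall>n j. j \<in> {1..J n} \<longrightarrow> distr (M n) (count_space UNIV) (A n j)
                 = measure_pmf (pmf_of_set {B. B \<subseteq> {1..n} \<and> card B = m n}))
          \<and> (\<forall>n. prob_space.indep_set (M n)
                 (sets (vimage_algebra (space (M n)) (\<lambda>\<omega>. \<lambda>i\<in>{1..n}. X n i \<omega>)
                    (PiM {1..n} (\<lambda>_. vec_space (p n)))))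
                 (sets (vimage_algebra (space (M n)) (\<lambda>\<omega>. \<lambda>j\<in>{1..J n}. A n j \<omega>)
                    (PiM {1..J n} (\<lambda>_. count_space UNIV)))))
          \<and> filterlim J at_top sequentially
          \<longrightarrow> tendsto_in_prob_zero M
               (\<lambda>n \<omega>. SUP t. \<bar>Fcheck n (p n) (m n) (J n) (\<lambda>j. A n j \<omega>) (\<lambda>i. X n i \<omega>) t
                              - target_cdf (M n) n (p n) (X n) (\<mu> n) t\<bar>))"
proof -
  \<comment> \<open>From two observations on, every instance of the hypotheses is a sample in the
    sense of the locale.\<close>
  have s: "iid_sample (M n) (p n) n (X n) \<delta>" if n: "2 \<le> n" for n
  proof -
    show ?thesis
    proof (intro iid_sample.intro iid_sample_axioms.intro)
      show "integrable (M n) (\<lambda>\<omega>. (X n 1 \<omega> k)\<^sup>2)" if "k < p n" for k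
        by (rule sq_int) (use n that in auto)
      show "\<exists>k<p n. \<exists>l<p n. cov_mat (M n) (X n 1) k l \<noteq> 0"
        using Sigma_nz[OF n] unfolding \<Sigma>_def .
    qed (fact prob meas indep ident delta K_fin[OF n] D_fin[OF n] n)+
  qed
  let ?P = "\<lambda>n. iid_sample.law (M n) (p n) (X n)" and ?Z = "\<lambda>n. iid_sample.Z (M n) (p n) (X n)"
  let ?u = "\<lambda>n t. (t - f1 (p n) (\<Sigma> n)) / f2 (p n) (\<Sigma> n)"
  have ge2: "\<forall>\<^sub>F n in sequentially. 2 \<le> n" by (rule eventually_ge_at_top)
  have rate': "(\<lambda>n. iid_sample.rate (M n) (p n) (X n) \<delta> (m n)) \<longlonglongrightarrow> 0"
  proof (rule Lim_transform_eventually[OF rate])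
    show "\<forall>\<^sub>F n in sequentially.
        (Kt_delta (M n) (p n) (X n 1) 0)\<^sup>2 / real (m n)
          + (Kt_delta (M n) (p n) (X n 1) \<delta>) powr q / real (m n) powr (q - 1)
          + quad_moment (M n) (p n) (X n 1) q / (real (m n) powr (\<delta> / 2) * f2 (p n) (\<Sigma> n) powr q)
          + (Dt_delta (M n) (p n) (X n 1) (X n 2) \<delta>) powr q / real (m n) powr \<delta>
        = iid_sample.rate (M n) (p n) (X n) \<delta> (m n)"
      using ge2 by eventually_elim (simp only: iid_sample.rate_def[OF s] q_def \<Sigma>_def)
  qed
  interpret C: moment_conditions p \<Sigma> "2 + \<delta>" ?P "\<lambda>n. iid_sample.factor (M n) (p n) (X n)" m
    unfolding \<Sigma>_def by (rule moment_conditions_sample[OF s m_inf m_small rate'])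
  have T: "\<forall>\<^sub>F n in sequentially. \<forall>t. target_cdf (M n) n (p n) (X n) (\<mu> n) t
      = iid_vectors.total_cdf (p n) (\<Sigma> n) (M n) (?Z n) {1..n} (?u n t)"
    using ge2 by eventually_elim (simp only: iid_sample.target_cdf_eq[OF s] \<mu>_def \<Sigma>_def simp_thms)
  \<comment> \<open>The same family of blocks, with its default, as in
    \<open>consecutive_blocks\<close>.\<close>
  let ?blk = "\<lambda>n j (_::'a). if j \<in> {1..n div m n} then block (m n) j else block (m n) 1"
  have "tendsto_in_prob_zero M (\<lambda>n \<omega>. SUP t. \<bar>Fhat n (p n) (m n) (\<lambda>i. X n i \<omega>) t
                          - target_cdf (M n) n (p n) (X n) (\<mu> n) t\<bar>)"
  proof (rule C.tendsto_in_prob_zero_ecdf[OF prob _ div_at_top[OF C.m_pos m_small] tendsto_const _ T])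
    show "\<forall>\<^sub>F n in sequentially. random_blocks (p n) (\<Sigma> n) (2 + \<delta>) (?P n) (iid_sample.factor (M n) (p n) (X n)) (M n) (?Z n) {1..n}
        (M n) (?blk n) (n div m n) (m n) 0"
      using ge2 C.m_pos C.m_less
      by eventually_elim (simp only: \<Sigma>_def, rule iid_sample.consecutive_blocks(1)[OF s])
    show "\<forall>\<^sub>F n in sequentially. AE \<omega> in M n. \<forall>t. Fhat n (p n) (m n) (\<lambda>i. X n i \<omega>) t
        = random_blocks.ecdf (p n) (\<Sigma> n) (?Z n) {1..n} (?blk n) (n div m n) (m n) \<omega> (?u n t)"
      using ge2 C.m_pos C.m_less
      by eventually_elim (intro AE_I2 allI, simp only: \<Sigma>_def, rule iid_sample.consecutive_blocks(2)[OF s])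
  qed
  moreover have "tendsto_in_prob_zero M
               (\<lambda>n \<omega>. SUP t. \<bar>Fcheck n (p n) (m n) (J n) (\<lambda>j. A n j \<omega>) (\<lambda>i. X n i \<omega>) t
                              - target_cdf (M n) n (p n) (X n) (\<mu> n) t\<bar>)"
    if A: "\<And>n j. A n j \<in> measurable (M n) (count_space UNIV)"
      "\<And>n. prob_space.indep_vars (M n) (\<lambda>_. count_space UNIV) (A n) {1..J n}"
      "\<And>n j. j \<in> {1..J n} \<Longrightarrow> distr (M n) (count_space UNIV) (A n j)
                 = measure_pmf (pmf_of_set {B. B \<subseteq> {1..n} \<and> card B = m n})"
      "\<And>n. prob_space.indep_set (M n)
                 (sets (vimage_algebra (space (M n)) (\<lambda>\<omega>. \<lambda>i\<in>{1..n}. X n i \<omega>)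
                    (PiM {1..n} (\<lambda>_. vec_space (p n)))))
                 (sets (vimage_algebra (space (M n)) (\<lambda>\<omega>. \<lambda>j\<in>{1..J n}. A n j \<omega>)
                    (PiM {1..J n} (\<lambda>_. count_space UNIV))))"
      and J: "filterlim J at_top sequentially" for A :: "nat \<Rightarrow> nat \<Rightarrow> 'a \<Rightarrow> nat set" and J
  proof -
    \<comment> \<open>Subsets corrected to be admissible everywhere; the correction acts on a null
      set for the indices up to \<open>J n\<close>.\<close>
    let ?A = "\<lambda>n j \<omega>. if A n j \<omega> \<subseteq> {1..n} \<and> card (A n j \<omega>) = m n then A n j \<omega> else {1..m n}"
    let ?F = "\<lambda>n. vimage_algebra (space (M n)) (\<lambda>\<omega>. \<lambda>i\<in>{1..n}. X n i \<omega>) (PiM {1..n} (\<lambda>_. vec_space (p n)))"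
    have J0: "\<forall>\<^sub>F n in sequentially. 0 < J n"
      using J eventually_gt_at_top[of 0] by (rule filterlim_iff[THEN iffD1, rule_format])
    have \<eta>: "(\<lambda>n. sqrt (real (m n) / real n)) \<longlonglongrightarrow> 0" using tendsto_real_sqrt[OF m_small] by simp
    show ?thesis
    proof (rule C.tendsto_in_prob_zero_ecdf[OF prob _ J \<eta> _ T])
      show "\<forall>\<^sub>F n in sequentially. random_blocks (p n) (\<Sigma> n) (2 + \<delta>) (?P n) (iid_sample.factor (M n) (p n) (X n)) (M n) (?Z n) {1..n}
          (?F n) (?A n) (J n) (m n) (sqrt (real (m n) / real n))"
        using ge2 C.m_pos C.m_less J0
        by eventually_elim (simp only: \<Sigma>_def, rule iid_sample.random_subsets(1)[OF s _ _ _ A])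
      show "\<forall>\<^sub>F n in sequentially. AE \<omega> in M n. \<forall>t. Fcheck n (p n) (m n) (J n) (\<lambda>j. A n j \<omega>) (\<lambda>i. X n i \<omega>) t
          = random_blocks.ecdf (p n) (\<Sigma> n) (?Z n) {1..n} (?A n) (J n) (m n) \<omega> (?u n t)"
        using ge2 C.m_pos C.m_less J0
        by eventually_elim (simp only: \<Sigma>_def, rule iid_sample.random_subsets(2)[OF s _ _ _ A])
    qed
  qed
  ultimately show ?thesis by blast
qed

end
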